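(* Let $\mathfrak g$ be a complex simple Lie algebra with Cartan subalgebra $\mathfrak h$, and let $U\subset\mathfrak h^*$ be a connected open subset. There is a one-one correspondence among the following objects: (1) dynamical $r$-matrices $r$ on $U$ with zero gauge term; (2) pairs $(S,\lambda_0)$, where $S$ is a subset of the set of simple roots and $\lambda_0\in\mathfrak h^*$; (3) Lagrangian subalgebras $W_0\subset\mathfrak g\oplus\mathfrak g$ such that $W_0\cap\mathfrak g=\mathfrak h$. Under the correspondence, the pair $(S,\lambda_0)$ corresponds to the dynamical $r$-matrix $$r(\lambda)=\sum_{\alpha\in[S]}\coth\langle\alpha,\lambda+\lambda_0\rangle\,E_\alpha\wedge E_{-\alpha}+\sum_{\alpha\in\Delta_+\setminus[S]}E_\alpha\wedge E_{-\alpha},$$ and to the Lagrangian subalgebra $$W_0=\mathrm{span}_{\mathbb C}\{(h,h),\ (X,\mathrm{Ad}_{e^{\lambda_0}}X),\ (Y_-,Y_+)\;:\;h\in\mathfrak h,\ X\in\mathfrak n^\circ_+\cup\mathfrak n^\circ_-,\ Y_\pm\in\mathfrak k_\pm\}.$$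
   Context: $\Delta$ is the root system of $(\mathfrak g,\mathfrak h)$, $\Delta_+$ a choice of positive roots, $\alpha_1,\dots,\alpha_n$ the simple roots, and $\mathfrak g=\mathfrak n_+\oplus\mathfrak h\oplus\mathfrak n_-$ with $\mathfrak n_\pm=\sum_{\alpha\in\Delta_+}\mathfrak g_{\pm\alpha}$. $\langle\cdot,\cdot\rangle$ is the Killing form; it identifies $\mathfrak h$ with $\mathfrak h^*$, and $\langle\cdot,\cdot\rangle$ also denotes the induced form on $\mathfrak h^*$. Root vectors $E_\alpha\in\mathfrak g_\alpha$ are chosen with $\langle E_\alpha,E_{-\alpha}\rangle=1$. Put $h_\alpha=[E_\alpha,E_{-\alpha}]$, $h_i=h_{\alpha_i}$ (a basis of $\mathfrak h$), let $h_i^*$ be the dual basis of $\mathfrak h^*$ and $\lambda=\sum\lambda_ih_i^*$ the corresponding coordinates. Let $r_0=\sum_{\alpha\in\Delta_+}E_\alpha\wedge E_{-\alpha}$. Via $\mathfrak h^*\cong\mathfrak h$, $\lambda_0\in\mathfrak h^*$ is regarded as an element of $\mathfrak h$, and $\mathrm{Ad}_{e^{\lambda_0}}E_\alpha=e^{\langle\alpha,\lambda_0\rangle}E_\alpha$. A dynamical $r$-matrix on $U$ is a meromorphic function $r:U\to\wedge^2\mathfrak g$ with (i) $[h,r(\lambda)]=0$ for all $h\in\mathfrak h$, and (ii) $\mathrm{Alt}(dr)+\frac12[r,r]=[\Omega^{12},\Omega^{23}]$, where $\mathrm{Alt}(dr)=\sum_ih_i\wedge\frac{\partial r}{\partial\lambda_i}$,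 $[\cdot,\cdot]$ is the Schouten bracket on $\wedge^*\mathfrak g$ and $\Omega\in(S^2\mathfrak g)^{\mathfrak g}$ is the Casimir element of the Killing form (coupling constant $2$; with the normalization used, $[\Omega^{12},\Omega^{23}]=\frac12[r_0,r_0]$). By $\mathfrak h$-invariance $r=\omega+\sum_{\alpha\in\Delta_+}r_\alpha(\lambda)E_\alpha\wedge E_{-\alpha}$ with $\omega=\sum_{ij}\omega^{ij}(\lambda)h_i\wedge h_j$; $\omega$ is the gauge term, and "zero gauge term" means $\omega=0$. For a subset $S$ of simple roots, $[S]=\{\alpha\in\Delta_+:\alpha=\sum_{\alpha_i\in S}n_i\alpha_i,\ n_i\ge0\}$, $\mathfrak n^\circ_\pm=\mathrm{span}_{\mathbb C}\{E_{\pm\alpha}:\alpha\in[S]\}$, $\mathfrak k_\pm=\mathrm{span}_{\mathbb C}\{E_{\pm\alpha}:\alpha\in\Delta_+\setminus[S]\}$. $\mathfrak g\oplus\mathfrak g$ is the direct sum Lie algebra with the invariant form $((X_1,Y_1),(X_2,Y_2))=\frac12(\langle Y_1,Y_2\rangle-\langle X_1,X_2\rangle)$. A Lagrangian subalgebra is a Lie subalgebra that is maximal isotropic for this form. $\mathfrak g$ (and hence $\mathfrak h$) is identified with its image under the diagonal embedding in $\mathfrak g\oplus\mathfrak g$.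
   Formalization: The choice of simple roots may vary with the pair; for given simple roots λ0 counts only modulo stated periods (πi for r, 2πi for W0); W0∩g=h needs e^⟨α,λ0⟩≠1 on [S]; W0 for 2λ0 matches r for λ0, so (3) matches only the r with sinh⟨α,λ0⟩≠0 on [S]; U is nonempty. *)

theory Defs
  imports "HOL-Analysis.Analysis" "HOL-Library.Function_Algebras"
begin

subsection \<open>Finite-dimensional complex Lie algebras\<close>

class complex_lie_algebra = ab_group_add +
  fixes scaleC :: "complex \<Rightarrow> 'a \<Rightarrow> 'a" (infixr "*\<^sub>C" 75)
    and bracket :: "'a \<Rightarrow> 'a \<Rightarrow> 'a"
  assumes scaleC_add_right: "c *\<^sub>C (x + y) = c *\<^sub>C x + c *\<^sub>C y"
    and scaleC_add_left: "(c + d) *\<^sub>C x = c *\<^sub>C x + d *\<^sub>C x"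
    and scaleC_scaleC: "c *\<^sub>C (d *\<^sub>C x) = (c * d) *\<^sub>C x"
    and scaleC_one: "1 *\<^sub>C x = x"
    and finite_dim: "\<exists>B. finite B \<and> (\<forall>x. \<exists>c. x = (\<Sum>b\<in>B. c b *\<^sub>C b))"
    and bracket_add_left: "bracket (x + y) z = bracket x z + bracket y z"
    and bracket_add_right: "bracket x (y + z) = bracket x y + bracket x z"
    and bracket_scaleC_left: "bracket (c *\<^sub>C x) y = c *\<^sub>C bracket x y"
    and bracket_scaleC_right: "bracket x (c *\<^sub>C y) = c *\<^sub>C bracket x y"
    and bracket_self: "bracket x x = 0"
    and jacobi: "bracket x (bracket y z) + bracket y (bracket z x) + bracket z (bracket x y) = 0"

class simple_complex_lie_algebra = complex_lie_algebra +
  assumes nonabelian: "\<exists>x y. bracket x y \<noteq> 0"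
    and no_proper_ideal:
      "0 \<in> I \<Longrightarrow> (\<forall>x\<in>I. \<forall>y\<in>I. x + y \<in> I) \<Longrightarrow> (\<forall>c. \<forall>x\<in>I. c *\<^sub>C x \<in> I)
        \<Longrightarrow> (\<forall>x. \<forall>y\<in>I. bracket x y \<in> I) \<Longrightarrow> I = {0} \<or> I = UNIV"

interpretation cvs: vector_space "scaleC :: complex \<Rightarrow> 'a \<Rightarrow> 'a::complex_lie_algebra"
  by unfold_locales
    (simp_all add: scaleC_add_right scaleC_add_left scaleC_scaleC scaleC_one)

text \<open>The direct sum \<open>\<gg> \<oplus> \<gg>\<close> is the product type with componentwise operations.\<close>

instantiation prod :: (complex_lie_algebra, complex_lie_algebra) complex_lie_algebra
begin

definition scaleC_prod :: "complex \<Rightarrow> 'a \<times> 'b \<Rightarrow> 'a \<times> 'b"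
  where "scaleC_prod c p = (c *\<^sub>C fst p, c *\<^sub>C snd p)"

definition bracket_prod :: "'a \<times> 'b \<Rightarrow> 'a \<times> 'b \<Rightarrow> 'a \<times> 'b"
  where "bracket_prod p q = (bracket (fst p) (fst q), bracket (snd p) (snd q))"

instance
proof
  show "\<exists>B. finite B \<and> (\<forall>x::'a \<times> 'b. \<exists>c. x = (\<Sum>b\<in>B. c b *\<^sub>C b))"
  proof -
    obtain A :: "'a set" where A: "finite A" "\<And>x. \<exists>c. x = (\<Sum>b\<in>A. c b *\<^sub>C b)"
      using finite_dim[where 'a='a] by blast
    obtain B :: "'b set" where B: "finite B" "\<And>x. \<exists>c. x = (\<Sum>b\<in>B. c b *\<^sub>C b)"
      using finite_dim[where 'a='b] by blast
    define A' where "A' = (\<lambda>a. (a, 0::'b)) ` (A - {0})"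
    define B' where "B' = (\<lambda>b. (0::'a, b)) ` (B - {0})"
    have fin: "finite A'" "finite B'" and disj: "A' \<inter> B' = {}"
      using A(1) B(1) by (auto simp: A'_def B'_def)
    have "\<exists>c. x = (\<Sum>b\<in>A' \<union> B'. c b *\<^sub>C b)" for x :: "'a \<times> 'b"
    proof -
      obtain c where c: "fst x = (\<Sum>b\<in>A. c b *\<^sub>C b)" using A(2) by blast
      obtain d where d: "snd x = (\<Sum>b\<in>B. d b *\<^sub>C b)" using B(2) by blast
      let ?e = "\<lambda>p::'a \<times> 'b. if snd p = 0 then c (fst p) else d (snd p)"
      have "(\<Sum>p\<in>A'. ?e p *\<^sub>C p) = (\<Sum>a\<in>A - {0}. (c a *\<^sub>C a, 0))"
        unfolding A'_def by (subst sum.reindex) (auto simp: inj_on_def scaleC_prod_def)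
      also have "\<dots> = (\<Sum>a\<in>A - {0}. c a *\<^sub>C a, 0)"
        by (simp add: sum_prod)
      also have "(\<Sum>a\<in>A - {0}. c a *\<^sub>C a) = fst x"
        unfolding c by (rule sum.mono_neutral_left) (use A(1) in auto)
      finally have 1: "(\<Sum>p\<in>A'. ?e p *\<^sub>C p) = (fst x, 0)" .
      have "(\<Sum>p\<in>B'. ?e p *\<^sub>C p) = (\<Sum>a\<in>B - {0}. (0, d a *\<^sub>C a))"
        unfolding B'_def by (subst sum.reindex) (auto simp: inj_on_def scaleC_prod_def intro!: sum.cong)
      also have "\<dots> = (0, \<Sum>a\<in>B - {0}. d a *\<^sub>C a)"
        by (simp add: sum_prod)
      also have "(\<Sum>a\<in>B - {0}. d a *\<^sub>C a) = snd x"
        unfolding d by (rule sum.mono_neutral_left) (use B(1) in auto)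
      finally have 2: "(\<Sum>p\<in>B'. ?e p *\<^sub>C p) = (0, snd x)" .
      have "x = (\<Sum>b\<in>A' \<union> B'. ?e b *\<^sub>C b)"
        by (subst sum.union_disjoint[OF fin disj]) (simp only: 1 2, simp)
      then show ?thesis by (rule exI[of _ ?e])
    qed
    then show ?thesis using fin by blast
  qed
qed (auto simp: scaleC_prod_def bracket_prod_def scaleC_add_right scaleC_add_left scaleC_scaleC
      scaleC_one bracket_add_left bracket_add_right bracket_scaleC_left bracket_scaleC_right
      bracket_self jacobi prod_eq_iff)

end

definition lie_basis :: "'g::complex_lie_algebra set"
  where "lie_basis = (SOME B. cvs.independent B \<and> cvs.span B = UNIV)"

definition coord :: "'g::complex_lie_algebra \<Rightarrow> 'g \<Rightarrow> complex"
  where "coord a v = cvs.representation lie_basis v a"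

definition killing :: "'g::complex_lie_algebra \<Rightarrow> 'g \<Rightarrow> complex"
  where "killing x y = (\<Sum>a\<in>lie_basis. coord a (bracket x (bracket y a)))"

text \<open>\<open>Ad_exp x\<close> is \<open>Ad\<^bsub>e^x\<^esub> = exp (ad x)\<close>; the exponential series is summed
  coordinatewise, so that no norm on the Lie algebra has to be fixed.\<close>

definition Ad_exp :: "'g::complex_lie_algebra \<Rightarrow> 'g \<Rightarrow> 'g"
  where "Ad_exp x y =
    (THE z. \<forall>a\<in>lie_basis. (\<lambda>k. coord a ((bracket x ^^ k) y) / fact k) sums coord a z)"


subsection \<open>Cartan subalgebras and roots\<close>

text \<open>For a complex semisimple Lie algebra, a Cartan subalgebra is a toral subalgebra (abelian,
  with diagonalizable adjoint action) which coincides with its centralizer.\<close>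

definition cartan_subalgebra :: "'g::complex_lie_algebra set \<Rightarrow> bool"
  where "cartan_subalgebra h \<longleftrightarrow>
    cvs.subspace h \<and>
    (\<forall>x\<in>h. \<forall>y\<in>h. bracket x y = 0) \<and>
    (\<forall>x\<in>h. cvs.span {v. \<exists>c. bracket x v = c *\<^sub>C v} = UNIV) \<and>
    (\<forall>x. (\<forall>y\<in>h. bracket x y = 0) \<longrightarrow> x \<in> h)"

text \<open>Functionals on the subspace \<open>h\<close> are represented as functions on the whole Lie algebra
  vanishing off \<open>h\<close>. The topology on \<open>h\<^sup>*\<close> is that of pointwise convergence (from the
  function type), which on this finite-dimensional space is the usual one.\<close>

definition hdual :: "'g::complex_lie_algebra set \<Rightarrow> ('g \<Rightarrow> complex) set"
  where "hdual h = {l. (\<forall>x\<in>h. \<forall>y\<in>h. l (x + y) = l x + l y) \<and>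
    (\<forall>c. \<forall>x\<in>h. l (c *\<^sub>C x) = c * l x) \<and> (\<forall>x. x \<notin> h \<longrightarrow> l x = 0)}"

definition root_space :: "'g::complex_lie_algebra set \<Rightarrow> ('g \<Rightarrow> complex) \<Rightarrow> 'g set"
  where "root_space h \<alpha> = {x. \<forall>t\<in>h. bracket t x = \<alpha> t *\<^sub>C x}"

definition roots :: "'g::complex_lie_algebra set \<Rightarrow> ('g \<Rightarrow> complex) set"
  where "roots h = {\<alpha> \<in> hdual h. \<alpha> \<noteq> 0 \<and> root_space h \<alpha> \<noteq> {0}}"

text \<open>A base \<open>P\<close> (system of simple roots); choices of positive roots correspond to bases.\<close>

definition root_base :: "'g::complex_lie_algebra set \<Rightarrow> ('g \<Rightarrow> complex) set \<Rightarrow> bool"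
  where "root_base h P \<longleftrightarrow> finite P \<and> P \<subseteq> roots h \<and>
    (\<forall>l\<in>hdual h. \<exists>!c. (\<forall>\<alpha>. \<alpha> \<notin> P \<longrightarrow> c \<alpha> = 0) \<and> l = (\<lambda>x. \<Sum>\<alpha>\<in>P. c \<alpha> * \<alpha> x)) \<and>
    (\<forall>\<beta>\<in>roots h. \<exists>n :: ('g \<Rightarrow> complex) \<Rightarrow> nat.
        \<beta> = (\<lambda>x. \<Sum>\<alpha>\<in>P. of_nat (n \<alpha>) * \<alpha> x) \<or> \<beta> = (\<lambda>x. - (\<Sum>\<alpha>\<in>P. of_nat (n \<alpha>) * \<alpha> x)))"

text \<open>For a subset \<open>S\<close> of a base this is \<open>[S]\<close>; for the base itself it is the set of positive
  roots.\<close>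

definition gen_roots :: "'g::complex_lie_algebra set \<Rightarrow> ('g \<Rightarrow> complex) set \<Rightarrow> ('g \<Rightarrow> complex) set"
  where "gen_roots h S = {\<beta> \<in> roots h.
    \<exists>n :: ('g \<Rightarrow> complex) \<Rightarrow> nat. \<beta> = (\<lambda>x. \<Sum>\<alpha>\<in>S. of_nat (n \<alpha>) * \<alpha> x)}"

text \<open>The element of \<open>h\<close> identified with a functional by the Killing form, and the induced form
  on \<open>h\<^sup>*\<close>.\<close>

definition hvec :: "'g::complex_lie_algebra set \<Rightarrow> ('g \<Rightarrow> complex) \<Rightarrow> 'g"
  where "hvec h l = (THE t. t \<in> h \<and> (\<forall>x\<in>h. killing t x = l x))"

definition dform :: "'g::complex_lie_algebra set \<Rightarrow> ('g \<Rightarrow> complex) \<Rightarrow> ('g \<Rightarrow> complex) \<Rightarrow> complex"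
  where "dform h l m = killing (hvec h l) (hvec h m)"

text \<open>Throughout, \<open>E\<close> assigns to every root a root vector.\<close>

definition root_vectors :: "'g::complex_lie_algebra set \<Rightarrow> (('g \<Rightarrow> complex) \<Rightarrow> 'g) \<Rightarrow> bool"
  where "root_vectors h E \<longleftrightarrow>
    (\<forall>\<alpha>\<in>roots h. E \<alpha> \<in> root_space h \<alpha> \<and> killing (E \<alpha>) (E (- \<alpha>)) = 1)"

definition hcoroot :: "(('g::complex_lie_algebra \<Rightarrow> complex) \<Rightarrow> 'g) \<Rightarrow> ('g \<Rightarrow> complex) \<Rightarrow> 'g"
  where "hcoroot E \<alpha> = bracket (E \<alpha>) (E (- \<alpha>))"

text \<open>\<open>hstar h E P \<alpha>\<close> is the vector \<open>h\<^sub>i\<^sup>*\<close> of the basis of \<open>h\<^sup>*\<close> dual to the \<open>h\<^sub>i\<close>, for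
  \<open>\<alpha> = \<alpha>\<^sub>i\<close>.\<close>

definition hstar :: "'g::complex_lie_algebra set \<Rightarrow> (('g \<Rightarrow> complex) \<Rightarrow> 'g) \<Rightarrow>
    ('g \<Rightarrow> complex) set \<Rightarrow> ('g \<Rightarrow> complex) \<Rightarrow> ('g \<Rightarrow> complex)"
  where "hstar h E P \<alpha> =
    (THE l. l \<in> hdual h \<and> (\<forall>\<beta>\<in>P. l (hcoroot E \<beta>) = (if \<beta> = \<alpha> then 1 else 0)))"


subsection \<open>Tensors and multivectors\<close>

text \<open>Elements of \<open>\<gg>\<^sup>\<otimes>\<^sup>2\<close> and \<open>\<gg>\<^sup>\<otimes>\<^sup>3\<close> are given by their components with respect to
  \<open>lie_basis\<close>, and vanish off the basis. The exterior powers are the antisymmetric tensors, with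
  \<open>u \<and> v = u \<otimes> v - v \<otimes> u\<close>.\<close>

type_synonym 'g tensor2 = "'g \<Rightarrow> 'g \<Rightarrow> complex"
type_synonym 'g tensor3 = "'g \<Rightarrow> 'g \<Rightarrow> 'g \<Rightarrow> complex"

definition tens2 :: "'g::complex_lie_algebra \<Rightarrow> 'g \<Rightarrow> 'g tensor2"
  where "tens2 u v = (\<lambda>a b. coord a u * coord b v)"

definition tens3 :: "'g::complex_lie_algebra \<Rightarrow> 'g \<Rightarrow> 'g \<Rightarrow> 'g tensor3"
  where "tens3 u v w = (\<lambda>a b c. coord a u * coord b v * coord c w)"

definition wedge2 :: "'g::complex_lie_algebra \<Rightarrow> 'g \<Rightarrow> 'g tensor2"
  where "wedge2 u v = tens2 u v - tens2 v u"

definition wedge3 :: "'g::complex_lie_algebra \<Rightarrow> 'g \<Rightarrow> 'g \<Rightarrow> 'g tensor3"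
  where "wedge3 u v w = tens3 u v w + tens3 v w u + tens3 w u v
    - tens3 v u w - tens3 u w v - tens3 w v u"

definition bivectors :: "'g::complex_lie_algebra tensor2 set"
  where "bivectors = {r. (\<forall>a b. r b a = - r a b) \<and>
    (\<forall>a b. a \<notin> lie_basis \<or> b \<notin> lie_basis \<longrightarrow> r a b = 0)}"

text \<open>The action of \<open>x\<close> on \<open>r = \<Sum> r a b (a \<otimes> b)\<close>.\<close>

definition ad2 :: "'g::complex_lie_algebra \<Rightarrow> 'g tensor2 \<Rightarrow> 'g tensor2"
  where "ad2 x r = (\<lambda>i j. \<Sum>a\<in>lie_basis. \<Sum>b\<in>lie_basis.
    r a b * (tens2 (bracket x a) b i j + tens2 a (bracket x b) i j))"

text \<open>\<open>x \<and> r\<close> and the Schouten bracket \<open>[r, s]\<close> for bivectors: since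
  \<open>r = 1/2 \<Sum> r a b (a \<and> b)\<close>, these are the (bi)linear extensions of
  \<open>x \<and> (a \<and> b) = x \<and> a \<and> b\<close> and of the formula for decomposable bivectors.\<close>

definition wedge12 :: "'g::complex_lie_algebra \<Rightarrow> 'g tensor2 \<Rightarrow> 'g tensor3"
  where "wedge12 x r = (\<lambda>i j k. \<Sum>a\<in>lie_basis. \<Sum>b\<in>lie_basis. r a b / 2 * wedge3 x a b i j k)"

definition schouten_dec :: "'g::complex_lie_algebra \<Rightarrow> 'g \<Rightarrow> 'g \<Rightarrow> 'g \<Rightarrow> 'g tensor3"
  where "schouten_dec x1 x2 y1 y2 =
    wedge3 (bracket x1 y1) x2 y2 - wedge3 (bracket x1 y2) x2 y1
    - wedge3 (bracket x2 y1) x1 y2 + wedge3 (bracket x2 y2) x1 y1"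

definition schouten :: "'g::complex_lie_algebra tensor2 \<Rightarrow> 'g tensor2 \<Rightarrow> 'g tensor3"
  where "schouten r s = (\<lambda>i j k. \<Sum>a\<in>lie_basis. \<Sum>b\<in>lie_basis. \<Sum>c\<in>lie_basis. \<Sum>d\<in>lie_basis.
    (r a b / 2) * (s c d / 2) * schouten_dec a b c d i j k)"

definition casimir :: "'g::complex_lie_algebra tensor2"
  where "casimir = (\<Sum>a\<in>lie_basis.
    tens2 a (THE y. \<forall>b\<in>lie_basis. killing y b = (if b = a then 1 else 0)))"

text \<open>\<open>comm12_23 r s\<close> is \<open>[r\<^sup>1\<^sup>2, s\<^sup>2\<^sup>3]\<close>.\<close>

definition comm12_23 :: "'g::complex_lie_algebra tensor2 \<Rightarrow> 'g tensor2 \<Rightarrow> 'g tensor3"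
  where "comm12_23 r s = (\<lambda>i j k. \<Sum>a\<in>lie_basis. \<Sum>b\<in>lie_basis. \<Sum>c\<in>lie_basis. \<Sum>d\<in>lie_basis.
    r a b * s c d * tens3 a (bracket b c) d i j k)"


subsection \<open>Meromorphic functions on open subsets of \<open>h\<^sup>*\<close>\<close>

text \<open>A property holds generically on \<open>V\<close> if it holds on a dense open subset of \<open>V\<close>.\<close>

definition generically :: "'g::complex_lie_algebra set \<Rightarrow> ('g \<Rightarrow> complex) set \<Rightarrow>
    (('g \<Rightarrow> complex) \<Rightarrow> bool) \<Rightarrow> bool"
  where "generically h V Q \<longleftrightarrow>
    (\<exists>D. openin (top_of_set (hdual h)) D \<and> D \<subseteq> V \<and> V \<subseteq> closure D \<and> (\<forall>l\<in>D. Q l))"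

text \<open>Holomorphy in several variables: continuous, and holomorphic along every complex line.\<close>

definition hol_on :: "'g::complex_lie_algebra set \<Rightarrow> ('g \<Rightarrow> complex) set \<Rightarrow>
    (('g \<Rightarrow> complex) \<Rightarrow> complex) \<Rightarrow> bool"
  where "hol_on h V f \<longleftrightarrow> continuous_on V f \<and>
    (\<forall>l\<in>V. \<forall>m\<in>hdual h.
      (\<lambda>z. f (\<lambda>x. l x + z * m x)) holomorphic_on {z. (\<lambda>x. l x + z * m x) \<in> V})"

text \<open>A meromorphic function is locally a quotient \<open>p / q\<close> of holomorphic functions with \<open>q\<close>
  generically nonzero. Its values on a nowhere dense closed set are immaterial: functions are
  identified by \<open>gen_eq\<close>, so that the meromorphic functions are the \<open>gen_eq\<close>-classes.\<close>

definition meromorphic_tensor :: "'g::complex_lie_algebra set \<Rightarrow> ('g \<Rightarrow> complex) set \<Rightarrow>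
    (('g \<Rightarrow> complex) \<Rightarrow> 'g tensor2) \<Rightarrow> bool"
  where "meromorphic_tensor h U r \<longleftrightarrow>
    (\<forall>l\<in>U. \<exists>V p q. openin (top_of_set (hdual h)) V \<and> l \<in> V \<and> V \<subseteq> U \<and>
      hol_on h V q \<and> (\<forall>a b. hol_on h V (\<lambda>m. p m a b)) \<and>
      generically h V (\<lambda>m. q m \<noteq> 0 \<and> (\<forall>a b. r m a b = p m a b / q m)))"

definition gen_eq :: "'g::complex_lie_algebra set \<Rightarrow> ('g \<Rightarrow> complex) set \<Rightarrow>
    ((('g \<Rightarrow> complex) \<Rightarrow> 'g tensor2) \<times> (('g \<Rightarrow> complex) \<Rightarrow> 'g tensor2)) set"
  where "gen_eq h U = {(r, s). generically h U (\<lambda>l. r l = s l)}"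

definition dir_deriv :: "('g \<Rightarrow> complex) \<Rightarrow> (('g \<Rightarrow> complex) \<Rightarrow> 'g tensor2) \<Rightarrow>
    ('g \<Rightarrow> complex) \<Rightarrow> 'g tensor2"
  where "dir_deriv m r l = (\<lambda>a b. deriv (\<lambda>z. r (\<lambda>x. l x + z * m x) a b) 0)"


subsection \<open>Dynamical r-matrices\<close>

definition alt_d :: "'g::complex_lie_algebra set \<Rightarrow> (('g \<Rightarrow> complex) \<Rightarrow> 'g) \<Rightarrow>
    ('g \<Rightarrow> complex) set \<Rightarrow> (('g \<Rightarrow> complex) \<Rightarrow> 'g tensor2) \<Rightarrow> ('g \<Rightarrow> complex) \<Rightarrow> 'g tensor3"
  where "alt_d h E P r l = (\<Sum>\<alpha>\<in>P. wedge12 (hcoroot E \<alpha>) (dir_deriv (hstar h E P \<alpha>) r l))"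

definition dynamical_r_matrix :: "'g::complex_lie_algebra set \<Rightarrow> (('g \<Rightarrow> complex) \<Rightarrow> 'g) \<Rightarrow>
    ('g \<Rightarrow> complex) set \<Rightarrow> ('g \<Rightarrow> complex) set \<Rightarrow> (('g \<Rightarrow> complex) \<Rightarrow> 'g tensor2) \<Rightarrow> bool"
  where "dynamical_r_matrix h E P U r \<longleftrightarrow>
    meromorphic_tensor h U r \<and>
    generically h U (\<lambda>l. r l \<in> bivectors) \<and>
    generically h U (\<lambda>l. \<forall>x\<in>h. ad2 x (r l) = 0) \<and>
    generically h U (\<lambda>l. \<forall>i j k.
      alt_d h E P r l i j k + 1 / 2 * schouten (r l) (r l) i j k = comm12_23 casimir casimir i j k)"

definition zero_gauge :: "'g::complex_lie_algebra set \<Rightarrow> (('g \<Rightarrow> complex) \<Rightarrow> 'g) \<Rightarrow>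
    ('g \<Rightarrow> complex) set \<Rightarrow> ('g \<Rightarrow> complex) set \<Rightarrow> (('g \<Rightarrow> complex) \<Rightarrow> 'g tensor2) \<Rightarrow> bool"
  where "zero_gauge h E P U r \<longleftrightarrow> generically h U (\<lambda>l. \<exists>c. \<forall>a b.
    r l a b = (\<Sum>\<alpha>\<in>gen_roots h P. c \<alpha> * wedge2 (E \<alpha>) (E (- \<alpha>)) a b))"

text \<open>The set of dynamical r-matrices on \<open>U\<close> with zero gauge term, as meromorphic functions, i.e.
  as \<open>gen_eq\<close>-classes.\<close>

definition dyn_r_matrices :: "'g::complex_lie_algebra set \<Rightarrow> (('g \<Rightarrow> complex) \<Rightarrow> 'g) \<Rightarrow>
    ('g \<Rightarrow> complex) set \<Rightarrow> ('g \<Rightarrow> complex) set \<Rightarrow> (('g \<Rightarrow> complex) \<Rightarrow> 'g tensor2) set set"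
  where "dyn_r_matrices h E P U =
    {r. dynamical_r_matrix h E P U r \<and> zero_gauge h E P U r} // gen_eq h U"

definition coth :: "complex \<Rightarrow> complex"
  where "coth z = cosh z / sinh z"

definition coth_r_matrix :: "'g::complex_lie_algebra set \<Rightarrow> (('g \<Rightarrow> complex) \<Rightarrow> 'g) \<Rightarrow>
    ('g \<Rightarrow> complex) set \<Rightarrow> ('g \<Rightarrow> complex) set \<Rightarrow> ('g \<Rightarrow> complex) \<Rightarrow> ('g \<Rightarrow> complex) \<Rightarrow> 'g tensor2"
  where "coth_r_matrix h E P S l0 l = (\<lambda>a b.
    (\<Sum>\<alpha>\<in>gen_roots h S. coth (dform h \<alpha> (l + l0)) * wedge2 (E \<alpha>) (E (- \<alpha>)) a b) +
    (\<Sum>\<alpha>\<in>gen_roots h P - gen_roots h S. wedge2 (E \<alpha>) (E (- \<alpha>)) a b))"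

definition r_class :: "'g::complex_lie_algebra set \<Rightarrow> (('g \<Rightarrow> complex) \<Rightarrow> 'g) \<Rightarrow>
    ('g \<Rightarrow> complex) set \<Rightarrow> ('g \<Rightarrow> complex) set \<Rightarrow> ('g \<Rightarrow> complex) set \<Rightarrow> ('g \<Rightarrow> complex) \<Rightarrow>
    (('g \<Rightarrow> complex) \<Rightarrow> 'g tensor2) set"
  where "r_class h E U P S l0 = gen_eq h U `` {coth_r_matrix h E P S l0}"


subsection \<open>Lagrangian subalgebras of \<open>\<gg> \<oplus> \<gg>\<close>\<close>

definition dbl_form :: "'g::complex_lie_algebra \<times> 'g \<Rightarrow> 'g \<times> 'g \<Rightarrow> complex"
  where "dbl_form p q = 1 / 2 * (killing (snd p) (snd q) - killing (fst p) (fst q))"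

definition isotropic :: "('g::complex_lie_algebra \<times> 'g) set \<Rightarrow> bool"
  where "isotropic W \<longleftrightarrow> cvs.subspace W \<and> (\<forall>p\<in>W. \<forall>q\<in>W. dbl_form p q = 0)"

definition lagrangian_subalgebra :: "('g::complex_lie_algebra \<times> 'g) set \<Rightarrow> bool"
  where "lagrangian_subalgebra W \<longleftrightarrow>
    isotropic W \<and> (\<forall>W'. isotropic W' \<and> W \<subseteq> W' \<longrightarrow> W' = W) \<and>
    (\<forall>p\<in>W. \<forall>q\<in>W. bracket p q \<in> W)"

definition diag :: "'g set \<Rightarrow> ('g \<times> 'g) set"
  where "diag A = (\<lambda>x. (x, x)) ` A"

definition pair_subalgebra :: "'g::complex_lie_algebra set \<Rightarrow> (('g \<Rightarrow> complex) \<Rightarrow> 'g) \<Rightarrow>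
    ('g \<Rightarrow> complex) set \<Rightarrow> ('g \<Rightarrow> complex) set \<Rightarrow> ('g \<Rightarrow> complex) \<Rightarrow> ('g \<times> 'g) set"
  where "pair_subalgebra h E P S l0 =
    (let n_pos = cvs.span (E ` gen_roots h S);
         n_neg = cvs.span ((\<lambda>\<alpha>. E (- \<alpha>)) ` gen_roots h S);
         k_pos = cvs.span (E ` (gen_roots h P - gen_roots h S));
         k_neg = cvs.span ((\<lambda>\<alpha>. E (- \<alpha>)) ` (gen_roots h P - gen_roots h S))
     in cvs.span (diag h \<union> {(x, Ad_exp (hvec h l0) x) | x. x \<in> n_pos \<union> n_neg} \<union> k_neg \<times> k_pos))"


subsection \<open>Parameters\<close>

text \<open>A parameter is a choice of simple roots \<open>P\<close>, a subset \<open>S\<close> of \<open>P\<close>, and \<open>\<lambda>\<^sub>0 \<in> h\<^sup>*\<close>. The choice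
  of \<open>P\<close> is part of the parameter, because for a fixed \<open>P\<close> the pairs \<open>(S, \<lambda>\<^sub>0)\<close> do not exhaust
  the r-matrices or the Lagrangian subalgebras: for \<open>sl\<^sub>2\<close>, the r-matrix
  \<open>- E\<^sub>\<alpha> \<and> E\<^sub>-\<^sub>\<alpha>\<close> belongs to the pair with \<open>S\<close> empty and the opposite choice.

  The r-matrix depends on \<open>\<lambda>\<^sub>0\<close> through \<open>exp (2 \<langle>\<alpha>, \<lambda>\<^sub>0\<rangle>)\<close> for \<open>\<alpha> \<in> S\<close> (the period of \<open>coth\<close> is
  \<open>\<pi> \<i>\<close>), the Lagrangian subalgebra through \<open>exp \<langle>\<alpha>, \<lambda>\<^sub>0\<rangle>\<close>. Hence a correspondence between the two that is
  one-one must send the subalgebra with parameter \<open>2 \<lambda>\<^sub>0\<close> to the r-matrix with parameter \<open>\<lambda>\<^sub>0\<close>. The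
  subalgebra meets the diagonal in \<open>h\<close> only if \<open>exp \<langle>\<alpha>, \<lambda>\<^sub>0\<rangle> \<noteq> 1\<close> for all \<open>\<alpha> \<in> [S]\<close>; for
  \<open>\<lambda>\<^sub>0 = 0\<close> and \<open>S = P\<close> it is the diagonal itself.\<close>

definition params :: "'g::complex_lie_algebra set \<Rightarrow>
    (('g \<Rightarrow> complex) set \<times> ('g \<Rightarrow> complex) set \<times> ('g \<Rightarrow> complex)) set"
  where "params h = {(P, S, l0). root_base h P \<and> S \<subseteq> P \<and> l0 \<in> hdual h}"

end

theory Submission
  imports Defs "HOL-Complex_Analysis.Complex_Analysis"
begin

text \<open>Both kinds of objects are determined by a point \<open>(a\<^sub>\<alpha> : b\<^sub>\<alpha>)\<close> of the projective line for each root
  \<open>\<alpha>\<close>. A Lagrangian subalgebra \<open>W\<close> with \<open>W \<inter> \<gg> = \<hh>\<close> is stable under \<open>\<hh>\<close>, hence is the sum of \<open>\<hh>\<close> and of lines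
  spanned by \<open>(a\<^sub>\<alpha> E\<^sub>\<alpha>, b\<^sub>\<alpha> E\<^sub>\<alpha>)\<close>. An r-matrix is \<open>\<Sum> c\<^sub>\<alpha> E\<^sub>\<alpha> \<otimes> E\<^sub>-\<^sub>\<alpha>\<close> over all roots with \<open>c\<^sub>-\<^sub>\<alpha> = - c\<^sub>\<alpha>\<close>, and the
  dynamical Yang-Baxter equation splits into the Riccati equation \<open>dc\<^sub>\<alpha> = (1 - c\<^sub>\<alpha>\<^sup>2) d\<langle>\<alpha>, \<lambda>\<rangle>\<close>
  and the algebraic condition \<open>c\<^sub>\<alpha> c\<^sub>\<beta> + 1 = c\<^sub>\<alpha>\<^sub>+\<^sub>\<beta> (c\<^sub>\<alpha> + c\<^sub>\<beta>)\<close>. By the Riccati equation the Cayley transform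
  \<open>(c\<^sub>\<alpha> + 1) : (c\<^sub>\<alpha> - 1)\<close> is \<open>b\<^sub>\<alpha> exp (2 \<langle>\<alpha>, \<lambda>\<rangle>) : a\<^sub>\<alpha>\<close> with constants \<open>a\<^sub>\<alpha>, b\<^sub>\<alpha>\<close>, which do not
  depend on the point of \<open>U\<close>, since \<open>U\<close> is connected.

  Isotropy and closedness under the bracket on one side, oddness and the algebraic condition on the other, become
  the same conditions: \<open>\<alpha> \<mapsto> b\<^sub>\<alpha> / a\<^sub>\<alpha>\<close>, with values in the projective line, is inverted by
  \<open>\<alpha> \<mapsto> - \<alpha>\<close> and multiplicative on sums of roots. The roots with \<open>b\<^sub>\<alpha> / a\<^sub>\<alpha> \<noteq> 0\<close> form a parabolic set; it contains the
  positive roots of some base \<open>P\<close>, and \<open>S\<close> consists of the simple roots at which the value is finite. The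
  values at \<open>S\<close> are arbitrary nonzero numbers, and give \<open>\<lambda>\<^sub>0\<close> as a logarithm.

  The structure theory of \<open>\<gg>\<close> is available without Cartan's criterion, because root vectors with
  \<open>\<langle>E\<^sub>\<alpha>, E\<^sub>-\<^sub>\<alpha>\<rangle> = 1\<close> exist by assumption: the Killing form does not vanish, so that its radical, an ideal, is zero.\<close>

subsection \<open>Coordinates and the Killing form\<close>

text \<open>The points 0 and infinity cannot be avoided: the coefficients 1 and -1, which belong to
  the positive roots outside [S] and to their negatives, are the constant solutions of the Riccati
  equation. Hence all conditions are homogeneous, and division by a coordinate is replaced by case
  distinctions. Since coth z is the Cayley transform of exp (2 z), the pair (S, \<lambda>_0) gives
  the system exp (2 \<langle>\<alpha>, \<lambda>_0\<rangle>) for the r-matrix, but exp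
  \<langle>\<alpha>, \<lambda>_0\<rangle> for the subalgebra. The value 1 is the point at which the
  subalgebra would contain the diagonal vector of E_\<alpha>; excluding it is the condition on the
  intersection with the diagonal. The analytic obstacle is that r is known only up to nowhere dense
  sets, while derivatives need an open set on which r is a quotient of holomorphic functions. The
  Riccati equation is solved on a small polydisc of this kind. Multiplied by the denominator, the
  integrated relation is an equation between holomorphic functions, and the identity theorem carries
  it past the poles.\<close>

lemma finite_lie_basis: "finite (lie_basis :: 'g::complex_lie_algebra set)"
  and independent_lie_basis: "cvs.independent (lie_basis :: 'g set)"
  and span_lie_basis: "cvs.span (lie_basis :: 'g set) = UNIV"
proof -
  obtain B :: "'g set" where "finite B" and B: "\<And>x. \<exists>c. x = (\<Sum>b\<in>B. c b *\<^sub>C b)"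
    using finite_dim[where 'a='g] by blast
  have spanB: "cvs.span B = UNIV"
  proof -
    have "x \<in> cvs.span B" for x
    proof -
      obtain c where "x = (\<Sum>b\<in>B. c b *\<^sub>C b)" using B by blast
      then show ?thesis by (auto intro: cvs.span_sum cvs.span_scale cvs.span_base)
    qed
    then show ?thesis by blast
  qed
  have "\<exists>A::'g set. cvs.independent A \<and> cvs.span A = UNIV"
    using cvs.basis_exists[of "UNIV :: 'g set"] by (metis UNIV_eq_I cvs.span_UNIV subset_UNIV top.extremum_unique)
  then have *: "cvs.independent (lie_basis :: 'g set) \<and> cvs.span (lie_basis :: 'g set) = UNIV"
    unfolding lie_basis_def by (rule someI_ex)
  then show "cvs.independent (lie_basis :: 'g set)" "cvs.span (lie_basis :: 'g set) = UNIV" by auto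
  show "finite (lie_basis :: 'g set)"
    using cvs.independent_span_bound[OF \<open>finite B\<close>] * spanB by auto
qed

lemma bracket_zero_left [simp]: "bracket 0 (x::'g::complex_lie_algebra) = 0"
  using bracket_add_left[of 0 0 x] by simp
lemma bracket_zero_right [simp]: "bracket (x::'g::complex_lie_algebra) 0 = 0"
  using bracket_add_right[of x 0 0] by simp
lemma bracket_minus_left [simp]: "bracket (- x) (y::'g::complex_lie_algebra) = - bracket x y"
  using bracket_add_left[of x "- x" y] by (simp add: minus_unique)
lemma bracket_minus_right [simp]: "bracket x (- y::'g::complex_lie_algebra) = - bracket x y"
  using bracket_add_right[of x y "- y"] by (simp add: minus_unique)
lemma bracket_diff_right: "bracket x (y - z::'g::complex_lie_algebra) = bracket x y - bracket x z"
  using bracket_add_right[of x y "- z"] by simp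
lemma bracket_sum_left: "bracket (sum f A) (z::'g::complex_lie_algebra) = (\<Sum>a\<in>A. bracket (f a) z)"
  by (induction A rule: infinite_finite_induct) (auto simp: bracket_add_left)
lemma bracket_sum_right: "bracket z (sum f A ::'g::complex_lie_algebra) = (\<Sum>a\<in>A. bracket z (f a))"
  by (induction A rule: infinite_finite_induct) (auto simp: bracket_add_right)

lemma bracket_anticomm: "bracket y x = - bracket x (y::'g::complex_lie_algebra)"
proof -
  have "0 = bracket (x + y) (x + y)" by (simp only: bracket_self)
  also have "\<dots> = bracket x y + bracket y x"
    by (simp only: bracket_add_left, simp only: bracket_add_right) (simp add: bracket_self)
  finally show ?thesis by (metis add.commute eq_neg_iff_add_eq_0)
qed

lemma jacobi_left: "bracket (bracket x y) (z::'g::complex_lie_algebra)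
    = bracket x (bracket y z) - bracket y (bracket x z)"
proof -
  have "bracket x (bracket y z) + bracket y (bracket z x) + bracket z (bracket x y) = 0"
    by (rule jacobi)
  moreover have "bracket y (bracket z x) = - bracket y (bracket x z)"
    by (simp add: bracket_anticomm[of z x])
  moreover have "bracket z (bracket x y) = - bracket (bracket x y) z"
    by (rule bracket_anticomm)
  ultimately show ?thesis by (simp add: algebra_simps)
qed

lemma coord_add [simp]: "coord a (x + y :: 'g::complex_lie_algebra) = coord a x + coord a y"
  unfolding coord_def by (subst cvs.representation_add) (auto simp: independent_lie_basis span_lie_basis)
lemma coord_scaleC [simp]: "coord a (c *\<^sub>C x :: 'g::complex_lie_algebra) = c * coord a x"
  unfolding coord_def by (subst cvs.representation_scale) (auto simp: independent_lie_basis span_lie_basis)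
lemma coord_zero [simp]: "coord a (0 :: 'g::complex_lie_algebra) = 0"
  by (simp add: coord_def cvs.representation_zero)
lemma coord_minus [simp]: "coord a (- x :: 'g::complex_lie_algebra) = - coord a x"
  using coord_add[of a x "- x"] by (simp add: minus_unique)
lemma coord_diff [simp]: "coord a (x - y :: 'g::complex_lie_algebra) = coord a x - coord a y"
  using coord_add[of a x "- y"] by simp
lemma coord_sum: "coord a (sum f A :: 'g::complex_lie_algebra) = (\<Sum>i\<in>A. coord a (f i))"
  by (induction A rule: infinite_finite_induct) auto
lemma coord_basis: "b \<in> lie_basis \<Longrightarrow> coord a b = (if a = (b::'g::complex_lie_algebra) then 1 else 0)"
  by (simp add: coord_def cvs.representation_basis independent_lie_basis)
lemma coord_off_basis: "a \<notin> lie_basis \<Longrightarrow> coord a (x::'g::complex_lie_algebra) = 0"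
  unfolding coord_def using cvs.representation_ne_zero by blast

lemma coord_expansion: "(\<Sum>a\<in>lie_basis. coord a x *\<^sub>C a) = (x::'g::complex_lie_algebra)"
  unfolding coord_def
  by (rule cvs.sum_representation_eq) (auto simp: independent_lie_basis span_lie_basis finite_lie_basis)

section \<open>Bilinearity, symmetry and invariance of the Killing form\<close>

lemma killing_add_left: "killing (x + y) z = killing x z + killing y (z::'g::complex_lie_algebra)"
  by (simp add: killing_def bracket_add_left bracket_add_right sum.distrib)
lemma killing_add_right: "killing z (x + y) = killing z x + killing z (y::'g::complex_lie_algebra)"
  by (simp add: killing_def bracket_add_left bracket_add_right sum.distrib)
lemma killing_scaleC_left: "killing (c *\<^sub>C x) z = c * killing x (z::'g::complex_lie_algebra)"
  by (simp add: killing_def bracket_scaleC_left bracket_scaleC_right sum_distrib_left)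
lemma killing_scaleC_right: "killing z (c *\<^sub>C x) = c * killing z (x::'g::complex_lie_algebra)"
  by (simp add: killing_def bracket_scaleC_left bracket_scaleC_right sum_distrib_left)
lemma killing_zero_left [simp]: "killing 0 (z::'g::complex_lie_algebra) = 0"
  by (simp add: killing_def)
lemma killing_zero_right [simp]: "killing z (0::'g::complex_lie_algebra) = 0"
  by (simp add: killing_def)
lemma killing_minus_left [simp]: "killing (- x) (z::'g::complex_lie_algebra) = - killing x z"
  by (simp add: killing_def sum_negf)
lemma killing_minus_right [simp]: "killing z (- x::'g::complex_lie_algebra) = - killing z x"
  by (simp add: killing_def sum_negf)
lemma killing_diff_left: "killing (x - y) z = killing x z - killing y (z::'g::complex_lie_algebra)"
  using killing_add_left[of x "- y" z] by simp
lemma killing_diff_right: "killing z (x - y) = killing z x - killing z (y::'g::complex_lie_algebra)"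
  using killing_add_right[of z x "- y"] by simp
lemma killing_sum_left: "killing (sum f A) (z::'g::complex_lie_algebra) = (\<Sum>a\<in>A. killing (f a) z)"
  by (induction A rule: infinite_finite_induct) (auto simp: killing_add_left)

lemmas killing_linear = killing_add_left killing_add_right killing_scaleC_left killing_scaleC_right
  killing_diff_left killing_diff_right killing_sum_left

lemmas bracket_linear = bracket_add_left bracket_add_right bracket_scaleC_left bracket_scaleC_right
  bracket_diff_right bracket_sum_left bracket_sum_right

text \<open>Symmetry and invariance of the Killing form are both instances, the form being the trace
  of a composition of linear maps.\<close>

lemma trace_commute:
  fixes A B :: "'g::complex_lie_algebra \<Rightarrow> 'g"
  assumes A: "\<And>x y. A (x + y) = A x + A y" "\<And>c x. A (c *\<^sub>C x) = c *\<^sub>C A x"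
    and B: "\<And>x y. B (x + y) = B x + B y" "\<And>c x. B (c *\<^sub>C x) = c *\<^sub>C B x"
  shows "(\<Sum>a\<in>lie_basis. coord a (A (B a))) = (\<Sum>a\<in>lie_basis. coord a (B (A a)))"
proof -
  have sumexp: "C (sum f S) = (\<Sum>i\<in>S. C (f i))"
    if "\<And>x y. C (x + y) = C x + C y" "\<And>c x. C (c *\<^sub>C x) = c *\<^sub>C C x"
    for C :: "'g \<Rightarrow> 'g" and f :: "'g \<Rightarrow> 'g" and S :: "'g set"
  proof -
    have "C 0 = 0" using that(1)[of 0 0] by simp
    then show ?thesis by (induction S rule: infinite_finite_induct) (auto simp: that)
  qed
  have expand: "coord a (C (D a)) = (\<Sum>b\<in>lie_basis. coord b (D a) * coord a (C b))"
    if "\<And>x y. C (x + y) = C x + C y" "\<And>c x. C (c *\<^sub>C x) = c *\<^sub>C C x"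
    for C D :: "'g \<Rightarrow> 'g" and a
  proof -
    have "coord a (C (D a)) = coord a (C (\<Sum>b\<in>lie_basis. coord b (D a) *\<^sub>C b))"
      by (simp add: coord_expansion)
    also have "\<dots> = (\<Sum>b\<in>lie_basis. coord b (D a) * coord a (C b))"
      by (subst sumexp[OF that]) (auto simp: coord_sum that)
    finally show ?thesis .
  qed
  have "(\<Sum>a\<in>lie_basis. coord a (A (B a)))
      = (\<Sum>a\<in>lie_basis. \<Sum>b\<in>lie_basis. coord b (B a) * coord a (A b))"
    by (simp add: expand[OF A])
  also have "\<dots> = (\<Sum>b\<in>lie_basis. \<Sum>a\<in>lie_basis. coord b (B a) * coord a (A b))"
    by (rule sum.swap)
  also have "\<dots> = (\<Sum>b\<in>lie_basis. \<Sum>a\<in>lie_basis. coord a (A b) * coord b (B a))"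
    by (simp add: mult.commute)
  also have "\<dots> = (\<Sum>b\<in>lie_basis. coord b (B (A b)))"
    by (simp add: expand[OF B])
  finally show ?thesis .
qed

lemma killing_commute: "killing x y = killing y (x::'g::complex_lie_algebra)"
  unfolding killing_def
  by (rule trace_commute) (auto simp: bracket_linear)

lemma killing_invariant: "killing (bracket x y) z = killing x (bracket y (z::'g::complex_lie_algebra))"
proof -
  \<comment> \<open>Writing x, y, z for their adjoint maps, the two sides of the claim are tr(xyz) -
    tr(yxz) and tr(xyz) - tr(xzy); they differ by one cyclic rotation.\<close>
  have "(\<Sum>a\<in>lie_basis. coord a (bracket y (bracket x (bracket z a))))
     = (\<Sum>a\<in>lie_basis. coord a (bracket x (bracket z (bracket y a))))"
    using trace_commute[of "bracket y" "\<lambda>a. bracket x (bracket z a)"]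
    by (simp add: bracket_linear)
  then show ?thesis
    by (simp add: killing_def jacobi_left bracket_linear sum_subtractf)
qed

lemma killing_invariant_left: "killing (bracket y x) z = - killing x (bracket y (z::'g::complex_lie_algebra))"
  by (simp add: bracket_anticomm[of y x] killing_invariant)

subsection \<open>Weight components\<close>

text \<open>A subspace stable under commuting operators contains, with a sum of weight vectors of distinct
  weights, each of the summands: the others are killed one at a time.\<close>

lemma weight_component:
  fixes v :: "('t \<Rightarrow> complex) \<Rightarrow> 'v::complex_lie_algebra" and T :: "'t \<Rightarrow> 'v \<Rightarrow> 'v"
  assumes W: "cvs.subspace W" "\<And>t w. t \<in> H \<Longrightarrow> w \<in> W \<Longrightarrow> T t w \<in> W"
    and T: "\<And>t x y. t \<in> H \<Longrightarrow> T t (x + y) = T t x + T t y" "\<And>t. t \<in> H \<Longrightarrow> T t 0 = 0"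
    and "finite B"
    and "\<alpha> \<notin> B" "\<And>\<beta>. \<beta> \<in> B \<Longrightarrow> \<exists>t\<in>H. \<alpha> t \<noteq> \<beta> t"
    and "\<And>\<gamma> t. \<gamma> \<in> insert \<alpha> B \<Longrightarrow> t \<in> H \<Longrightarrow> T t (v \<gamma>) = \<gamma> t *\<^sub>C v \<gamma>"
    and "\<And>t \<gamma> c. t \<in> H \<Longrightarrow> T t (c *\<^sub>C v \<gamma>) = c *\<^sub>C T t (v \<gamma>)"
    and "(\<Sum>\<gamma>\<in>insert \<alpha> B. v \<gamma>) \<in> W"
  shows "v \<alpha> \<in> W"
  using assms(5-)
proof (induction B arbitrary: v rule: finite_induct)
  case empty
  then show ?case by simp
next
  case (insert \<beta> B)
  obtain t where t: "t \<in> H" "\<alpha> t \<noteq> \<beta> t" using insert.prems(2) by auto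
  \<comment> \<open>The operator \<open>T t\<close> minus the scalar \<open>\<beta> t\<close>
    annihilates the summand at \<beta> and multiplies the one at \<alpha> by a nonzero
    number.\<close>
  define v' where "v' \<gamma> = (\<gamma> t - \<beta> t) *\<^sub>C v \<gamma>" for \<gamma>
  have Tsum: "T s (sum f A) = (\<Sum>i\<in>A. T s (f i))" if "s \<in> H" for s A and f :: "('t \<Rightarrow> complex) \<Rightarrow> 'v"
    using T that by (induction A rule: infinite_finite_induct) auto
  let ?s = "\<Sum>\<gamma>\<in>insert \<alpha> (insert \<beta> B). v \<gamma>"
  have "T t ?s - \<beta> t *\<^sub>C ?s \<in> W"
    using insert.prems(5) W t by (simp only: cvs.subspace_diff cvs.subspace_scale)
  also have "T t ?s - \<beta> t *\<^sub>C ?s = (\<Sum>\<gamma>\<in>insert \<alpha> (insert \<beta> B). T t (v \<gamma>) - \<beta> t *\<^sub>C v \<gamma>)"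
    by (simp only: Tsum[OF t(1)] sum_subtractf cvs.scale_sum_right)
  also have "\<dots> = (\<Sum>\<gamma>\<in>insert \<alpha> (insert \<beta> B). v' \<gamma>)"
    unfolding v'_def using insert.prems(3) t(1)
    by (intro sum.cong refl) (simp add: cvs.scale_left_diff_distrib)
  also have "\<dots> = (\<Sum>\<gamma>\<in>insert \<alpha> B. v' \<gamma>)"
    using insert.hyps insert.prems(1) by (simp add: v'_def)
  finally have "(\<Sum>\<gamma>\<in>insert \<alpha> B. v' \<gamma>) \<in> W" .
  then have "v' \<alpha> \<in> W"
  proof (rule insert.IH[rotated -1])
    show "\<alpha> \<notin> B" using insert.prems(1) by simp
    show "\<exists>t\<in>H. \<alpha> t \<noteq> \<gamma> t" if "\<gamma> \<in> B" for \<gamma>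
      using insert.prems(2) that by simp
    show "T s (v' \<gamma>) = \<gamma> s *\<^sub>C v' \<gamma>" if "\<gamma> \<in> insert \<alpha> B" "s \<in> H" for \<gamma> s
      using insert.prems(3)[of \<gamma> s] that by (auto simp: v'_def insert.prems(4) scaleC_scaleC mult.commute)
    show "T s (c *\<^sub>C v' \<gamma>) = c *\<^sub>C T s (v' \<gamma>)" if "s \<in> H" for s \<gamma> c
      using that by (simp add: v'_def insert.prems(4) scaleC_scaleC)
  qed
  then have "inverse (\<alpha> t - \<beta> t) *\<^sub>C v' \<alpha> \<in> W"
    using W(1) cvs.subspace_scale by blast
  then show ?case using t by (simp add: v'_def scaleC_scaleC scaleC_one)
qed

subsection \<open>The root space decomposition\<close>

text \<open>Collecting the terms of a linear combination by index leaves one vector for each of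
  finitely many distinct indices, the form in which \<open>weight_component\<close> takes its
  input.\<close>

lemma span_UN_sum:
  fixes V :: "'i \<Rightarrow> 'g::complex_lie_algebra set"
  assumes V: "\<And>i. i \<in> I \<Longrightarrow> cvs.subspace (V i)" and x: "x \<in> cvs.span (\<Union>i\<in>I. V i)"
  shows "\<exists>A v. finite A \<and> A \<subseteq> I \<and> (\<forall>i\<in>A. v i \<in> V i) \<and> x = sum v A"
  using x
proof (induction rule: cvs.span_induct_alt)
  case base
  show ?case by (intro exI[of _ "{}"]) auto
next
  case (step c x y)
  then obtain A v i where A: "finite A" "A \<subseteq> I" "\<forall>i\<in>A. v i \<in> V i" "y = sum v A" and i: "i \<in> I" "x \<in> V i"
    by blast
  define v' where "v' = v(i := c *\<^sub>C x + (if i \<in> A then v i else 0))"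
  have "sum v' (insert i A) = v' i + sum v' (A - {i})"
    using A(1) by (simp add: sum.insert_remove)
  also have "sum v' (A - {i}) = sum v (A - {i})"
    by (rule sum.cong) (auto simp: v'_def)
  also have "v' i + \<dots> = c *\<^sub>C x + y"
    using A(1) by (auto simp: v'_def A(4) sum.remove)
  finally have "c *\<^sub>C x + y = sum v' (insert i A)" by simp
  moreover have "v' j \<in> V j" if "j \<in> insert i A" for j
    using that A i V[OF i(1)]
    by (auto simp: v'_def intro!: cvs.subspace_add cvs.subspace_scale cvs.subspace_0)
  ultimately show ?case using A(1,2) i(1) by (intro exI[of _ "insert i A"] exI[of _ v']) auto
qed

text \<open>\<open>P0\<close> fixes the coordinates on the dual of \<open>h\<close>, and with them
  the equation; the bases \<open>P\<close> occurring in parameters range over all bases.\<close>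

locale cartan =
  fixes h :: "'g::simple_complex_lie_algebra set"
    and E :: "('g \<Rightarrow> complex) \<Rightarrow> 'g"
    and P0 :: "('g \<Rightarrow> complex) set"
  assumes cartan: "cartan_subalgebra h"
    and root_vectors: "root_vectors h E"
    and root_base: "root_base h P0"
begin

abbreviation \<Delta> :: "('g \<Rightarrow> complex) set" where "\<Delta> \<equiv> roots h"
abbreviation T :: "('g \<Rightarrow> complex) \<Rightarrow> 'g" where "T \<equiv> hcoroot E"

lemma h_subspace: "cvs.subspace h"
  and h_abelian: "x \<in> h \<Longrightarrow> y \<in> h \<Longrightarrow> bracket x y = 0"
  and h_diagonalizable: "x \<in> h \<Longrightarrow> cvs.span {v. \<exists>c. bracket x v = c *\<^sub>C v} = UNIV"
  and h_self_centralizing: "(\<And>y. y \<in> h \<Longrightarrow> bracket x y = 0) \<Longrightarrow> x \<in> h"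
  using cartan unfolding cartan_subalgebra_def by blast+

lemmas h_add = cvs.subspace_add[OF h_subspace]
  and h_diff = cvs.subspace_diff[OF h_subspace]
  and h_scaleC = cvs.subspace_scale[OF h_subspace]
  and h_zero = cvs.subspace_0[OF h_subspace]
  and h_sum = cvs.subspace_sum[OF h_subspace]

lemma hdual_add_arg: "l \<in> hdual h \<Longrightarrow> x \<in> h \<Longrightarrow> y \<in> h \<Longrightarrow> l (x + y) = l x + l y"
  and hdual_scaleC_arg: "l \<in> hdual h \<Longrightarrow> x \<in> h \<Longrightarrow> l (c *\<^sub>C x) = c * l x"
  and hdual_outside: "l \<in> hdual h \<Longrightarrow> x \<notin> h \<Longrightarrow> l x = 0"
  unfolding hdual_def by blast+

lemma hdual_zero_arg: "l \<in> hdual h \<Longrightarrow> l 0 = 0"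
  using hdual_scaleC_arg[of l 0 0] h_zero by simp

lemma hdual_minus_arg: "l \<in> hdual h \<Longrightarrow> x \<in> h \<Longrightarrow> l (- x) = - l x"
  using hdual_scaleC_arg[of l x "-1"] by (simp add: scaleC_one)

lemma hdual_sum_arg:
  assumes "l \<in> hdual h" "\<And>i. i \<in> A \<Longrightarrow> f i \<in> h"
  shows "l (sum f A) = (\<Sum>i\<in>A. l (f i))"
  using assms(2)
  by (induction A rule: infinite_finite_induct)
     (auto simp: hdual_zero_arg assms(1) hdual_add_arg h_sum)

lemma hdual_zero [simp]: "0 \<in> hdual h"
  and hdual_add: "l \<in> hdual h \<Longrightarrow> m \<in> hdual h \<Longrightarrow> l + m \<in> hdual h"
  and hdual_diff: "l \<in> hdual h \<Longrightarrow> m \<in> hdual h \<Longrightarrow> l - m \<in> hdual h"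
  and hdual_minus: "l \<in> hdual h \<Longrightarrow> - l \<in> hdual h"
  and hdual_scale: "l \<in> hdual h \<Longrightarrow> (\<lambda>x. c * l x) \<in> hdual h"
  by (auto simp: hdual_def algebra_simps)

lemma hdual_line: "l \<in> hdual h \<Longrightarrow> m \<in> hdual h \<Longrightarrow> (\<lambda>x. l x + z * m x) \<in> hdual h"
  by (auto simp: hdual_def algebra_simps)

lemma hdual_sum: "(\<And>i. i \<in> A \<Longrightarrow> f i \<in> hdual h) \<Longrightarrow> (\<lambda>x. \<Sum>i\<in>A. c i * f i x) \<in> hdual h"
proof (induction A rule: infinite_finite_induct)
  case (insert a A)
  then show ?case by (auto simp: hdual_def algebra_simps)
qed (auto simp: hdual_def)

lemma hdual_neqE:
  assumes "l \<in> hdual h" "m \<in> hdual h" "l \<noteq> m"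
  obtains t where "t \<in> h" "l t \<noteq> m t"
  using assms hdual_outside by (metis ext)

lemma hdual_eqI:
  assumes "l \<in> hdual h" "m \<in> hdual h" "\<And>t. t \<in> h \<Longrightarrow> l t = m t"
  shows "l = m"
  using assms hdual_outside by (metis ext)

lemma root_hdual: "\<alpha> \<in> \<Delta> \<Longrightarrow> \<alpha> \<in> hdual h"
  and root_nonzero: "\<alpha> \<in> \<Delta> \<Longrightarrow> \<alpha> \<noteq> 0"
  by (auto simp: roots_def)

lemma root_spaceD: "x \<in> root_space h \<alpha> \<Longrightarrow> t \<in> h \<Longrightarrow> bracket t x = \<alpha> t *\<^sub>C x"
  by (simp add: root_space_def)

lemma root_space_subspace: "cvs.subspace (root_space h \<alpha>)"
  by (auto simp: cvs.subspace_def root_space_def bracket_linear scaleC_add_right scaleC_scaleC mult.commute)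

lemma root_space_zero: "root_space h 0 = h"
proof
  show "root_space h 0 \<subseteq> h"
  proof
    fix x assume x: "x \<in> root_space h 0"
    show "x \<in> h"
    proof (rule h_self_centralizing)
      fix y assume "y \<in> h"
      then show "bracket x y = 0"
        using root_spaceD[OF x, of y] bracket_anticomm[of x y] by simp
    qed
  qed
  show "h \<subseteq> root_space h 0" by (auto simp: root_space_def h_abelian)
qed

lemma bracket_root_space:
  assumes "x \<in> root_space h \<alpha>" "y \<in> root_space h \<beta>"
  shows "bracket x y \<in> root_space h (\<alpha> + \<beta>)"
proof -
  have "bracket t (bracket x y) = (\<alpha> + \<beta>) t *\<^sub>C bracket x y" if "t \<in> h" for t
  proof -
    have "bracket t (bracket x y) = bracket (bracket t x) y + bracket x (bracket t y)"
      by (simp add: jacobi_left)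
    then show ?thesis
      using assms that by (simp add: root_spaceD bracket_linear scaleC_add_left)
  qed
  then show ?thesis by (simp add: root_space_def)
qed

text \<open>Commuting diagonalizable operators are diagonalizable simultaneously: a joint eigenspace
  of \<open>F\<close> is stable under the next operator \<open>t\<close>, so it contains the
  \<open>t\<close>-eigencomponents of each of its vectors.\<close>

lemma joint_eigenvectors_span:
  assumes "finite F" "F \<subseteq> h"
  shows "cvs.span {v. \<forall>t\<in>F. \<exists>c. bracket t v = c *\<^sub>C v} = UNIV"
  using assms
proof (induction F rule: finite_induct)
  case empty
  show ?case by simp
next
  case (insert t F)
  let ?J = "\<lambda>F. {v. \<forall>t\<in>F. \<exists>c. bracket t v = c *\<^sub>C v}"
  have t: "t \<in> h" using insert.prems by simp
  have "?J F \<subseteq> cvs.span (?J (insert t F))"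
  proof
    fix v assume "v \<in> ?J F"
    then obtain d where d: "\<And>s. s \<in> F \<Longrightarrow> bracket s v = d s *\<^sub>C v" by (simp, metis)
    \<comment> \<open>The joint eigenspace of \<open>F\<close> that contains
      \<open>v\<close>.\<close>
    define W where "W = {w. \<forall>s\<in>F. bracket s w = d s *\<^sub>C w}"
    have W: "cvs.subspace W"
      by (auto simp: cvs.subspace_def W_def bracket_linear scaleC_add_right scaleC_scaleC mult.commute)
    have Wt: "bracket t w \<in> W" if "w \<in> W" for w
    proof -
      have "bracket s (bracket t w) = d s *\<^sub>C bracket t w" if s: "s \<in> F" for s
      proof -
        have "bracket s t = 0" using s t insert.prems h_abelian by blast
        then have "bracket s (bracket t w) = bracket t (bracket s w)"
          using jacobi_left[of s t w] by simp
        then show ?thesis using \<open>w \<in> W\<close> s by (simp add: W_def bracket_linear)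
      qed
      then show ?thesis by (simp add: W_def)
    qed
    \<comment> \<open>The weights in \<open>weight_component\<close> are functions, so the
      eigenvalues of the single operator \<open>t\<close> are disguised as constant
      functions.\<close>
    define I where "I = range (\<lambda>c (s::'g). c :: complex)"
    define V where "V \<gamma> = {w. bracket t w = \<gamma> t *\<^sub>C w}" for \<gamma> :: "'g \<Rightarrow> complex"
    have V: "cvs.subspace (V \<gamma>)" for \<gamma>
      by (auto simp: cvs.subspace_def V_def bracket_linear scaleC_add_right scaleC_scaleC mult.commute)
    have "(\<Union>\<gamma>\<in>I. V \<gamma>) = {v. \<exists>c. bracket t v = c *\<^sub>C v}"
      by (auto simp: I_def V_def)
    then have "v \<in> cvs.span (\<Union>\<gamma>\<in>I. V \<gamma>)" using h_diagonalizable[OF t] by simp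
    from span_UN_sum[OF V this] obtain A w
      where A: "finite A" "A \<subseteq> I" "\<And>\<gamma>. \<gamma> \<in> A \<Longrightarrow> w \<gamma> \<in> V \<gamma>" "v = sum w A" by blast
    have "w \<gamma> \<in> W" if g: "\<gamma> \<in> A" for \<gamma>
    proof (rule weight_component[where H = "{t}" and T = bracket and B = "A - {\<gamma>}" and W = W and v = w])
      show "sum w (insert \<gamma> (A - {\<gamma>})) \<in> W"
        using A(4) g d by (simp add: insert_absorb W_def)
      show "\<exists>s\<in>{t}. \<gamma> s \<noteq> \<beta> s" if "\<beta> \<in> A - {\<gamma>}" for \<beta>
        using that g A(2) by (auto simp: I_def)
      show "bracket s (w \<beta>) = \<beta> s *\<^sub>C w \<beta>" if "\<beta> \<in> insert \<gamma> (A - {\<gamma>})" "s \<in> {t}" for \<beta> s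
        using A(3)[of \<beta>] that g by (auto simp: V_def)
    qed (use W Wt A(1) in \<open>auto simp: bracket_linear\<close>)
    then have "w \<gamma> \<in> ?J (insert t F)" if "\<gamma> \<in> A" for \<gamma>
      using that A(3)[OF that] by (auto simp: W_def V_def)
    then show "v \<in> cvs.span (?J (insert t F))"
      unfolding A(4) by (intro cvs.span_sum cvs.span_base)
  qed
  then have "cvs.span (?J F) \<subseteq> cvs.span (?J (insert t F))"
    by (rule cvs.span_minimal) (rule cvs.subspace_span)
  then show ?case using insert.IH insert.prems by auto
qed

text \<open>A finite spanning set of \<open>h\<close> suffices: a joint eigenvector for it is one
  for all of \<open>h\<close>, and its eigenvalue depends linearly on the element of
  \<open>h\<close>.\<close>

lemma span_weight_spaces: "cvs.span (\<Union>\<gamma>\<in>hdual h. root_space h \<gamma>) = UNIV"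
proof -
  obtain B where B: "B \<subseteq> h" "cvs.independent B" "h \<subseteq> cvs.span B"
    using cvs.maximal_independent_subset[of h] by blast
  have "finite B"
    using cvs.independent_span_bound[OF finite_lie_basis B(2)] by (simp add: span_lie_basis)
  have "v \<in> (\<Union>\<gamma>\<in>hdual h. root_space h \<gamma>)" if v: "\<forall>t\<in>B. \<exists>c. bracket t v = c *\<^sub>C v" for v
  proof (cases "v = 0")
    case True
    then show ?thesis
      by (auto simp: root_space_zero h_zero intro!: bexI[of _ 0])
  next
    case False
    have "h \<subseteq> {t. \<exists>c. bracket t v = c *\<^sub>C v}"
    proof (rule subset_trans[OF B(3)], rule cvs.span_minimal)
      show "cvs.subspace {t. \<exists>c. bracket t v = c *\<^sub>C v}"
        unfolding cvs.subspace_def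
        by (auto simp: bracket_linear scaleC_scaleC scaleC_add_left[symmetric] intro: exI[of _ 0])
    qed (use v in auto)
    then obtain g where g: "\<And>t. t \<in> h \<Longrightarrow> bracket t v = g t *\<^sub>C v"
      unfolding subset_iff mem_Collect_eq by metis
    \<comment> \<open>Elements of \<open>hdual h\<close> vanish off \<open>h\<close>, hence the
      truncation. Linearity on \<open>h\<close> can be read off because \<open>v\<close> is
      nonzero.\<close>
    define \<gamma> where "\<gamma> t = (if t \<in> h then g t else 0)" for t
    have \<gamma>: "bracket t v = \<gamma> t *\<^sub>C v" if "t \<in> h" for t using g that by (simp add: \<gamma>_def)
    have "\<gamma> (x + y) = \<gamma> x + \<gamma> y" if "x \<in> h" "y \<in> h" for x y
      using \<gamma>[of "x + y"] \<gamma>[of x] \<gamma>[of y] that h_add[of x y] False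
      by (simp add: bracket_linear flip: scaleC_add_left)
    moreover have "\<gamma> (c *\<^sub>C x) = c * \<gamma> x" if "x \<in> h" for x c
      using \<gamma>[of "c *\<^sub>C x"] \<gamma>[of x] that h_scaleC[of x c] False
      by (simp add: bracket_linear scaleC_scaleC)
    ultimately have "\<gamma> \<in> hdual h" by (auto simp: hdual_def \<gamma>_def)
    moreover have "v \<in> root_space h \<gamma>" using \<gamma> by (simp add: root_space_def)
    ultimately show ?thesis by blast
  qed
  then have "{v. \<forall>t\<in>B. \<exists>c. bracket t v = c *\<^sub>C v} \<subseteq> (\<Union>\<gamma>\<in>hdual h. root_space h \<gamma>)" by blast
  from cvs.span_mono[OF this] show ?thesis
    using joint_eigenvectors_span[OF \<open>finite B\<close> B(1)] by auto
qed

lemma root_induct: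
  assumes "cvs.subspace {x. Q x}" "\<And>x. x \<in> h \<Longrightarrow> Q x"
    and "\<And>\<alpha> x. \<alpha> \<in> \<Delta> \<Longrightarrow> x \<in> root_space h \<alpha> \<Longrightarrow> Q x"
  shows "Q x"
proof -
  have "root_space h \<gamma> \<subseteq> {x. Q x}" if g: "\<gamma> \<in> hdual h" for \<gamma>
  proof -
    consider "\<gamma> = 0" | "root_space h \<gamma> = {0}" | "\<gamma> \<in> \<Delta>" using g unfolding roots_def by blast
    then show ?thesis
      using assms h_zero by cases (auto simp: root_space_zero)
  qed
  then have "cvs.span (\<Union>\<gamma>\<in>hdual h. root_space h \<gamma>) \<subseteq> {x. Q x}"
    by (intro cvs.span_minimal assms(1)) auto
  then show ?thesis unfolding span_weight_spaces by auto
qed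

text \<open>Each of the finitely many basis vectors involves finitely many weights. A root outside
  the resulting finite set \<open>C\<close> would have a root vector that is a sum of vectors of
  other weights.\<close>

lemma finite_roots: "finite \<Delta>"
proof -
  have "\<exists>A v. finite A \<and> A \<subseteq> hdual h \<and> (\<forall>\<gamma>\<in>A. v \<gamma> \<in> root_space h \<gamma>) \<and> x = sum v A" for x
    by (rule span_UN_sum) (auto simp: span_weight_spaces root_space_subspace)
  then obtain A v where Av: "\<And>x. finite (A x)" "\<And>x. A x \<subseteq> hdual h"
      "\<And>x \<gamma>. \<gamma> \<in> A x \<Longrightarrow> v x \<gamma> \<in> root_space h \<gamma>" "\<And>x. x = sum (v x) (A x)"
    by metis
  define C where "C = (\<Union>b\<in>lie_basis. A b)"
  have fC: "finite C" unfolding C_def using Av(1) finite_lie_basis by (intro finite_UN_I) auto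
  have "\<Delta> \<subseteq> C"
  proof
    fix \<alpha> assume \<alpha>: "\<alpha> \<in> \<Delta>"
    show "\<alpha> \<in> C"
    proof (rule ccontr)
      assume nC: "\<alpha> \<notin> C"
      obtain x where x: "x \<in> root_space h \<alpha>" "x \<noteq> 0"
        using \<alpha> root_space_subspace[of \<alpha>] cvs.subspace_0 by (auto simp: roots_def)
      have "x \<in> cvs.span (\<Union>\<gamma>\<in>C. root_space h \<gamma>)"
      proof -
        have "b \<in> cvs.span (\<Union>\<gamma>\<in>C. root_space h \<gamma>)" if "b \<in> lie_basis" for b
        proof -
          have "sum (v b) (A b) \<in> cvs.span (\<Union>\<gamma>\<in>C. root_space h \<gamma>)"
            using that Av(3) by (intro cvs.span_sum cvs.span_base) (auto simp: C_def)
          then show ?thesis using Av(4)[of b] by simp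
        qed
        then have "cvs.span lie_basis \<subseteq> cvs.span (\<Union>\<gamma>\<in>C. root_space h \<gamma>)"
          by (intro cvs.span_minimal) (auto simp: cvs.subspace_span)
        then show ?thesis by (auto simp: span_lie_basis)
      qed
      from span_UN_sum[OF root_space_subspace this] obtain B w where
        B: "finite B" "B \<subseteq> C" "\<forall>\<gamma>\<in>B. w \<gamma> \<in> root_space h \<gamma>" "x = sum w B" by blast
      \<comment> \<open>With the summand -x at \<alpha> the decomposition of \<open>x\<close>
        becomes a vanishing sum, and \<open>weight_component\<close> is applied to the zero
        subspace.\<close>
      have "(w(\<alpha> := - x)) \<alpha> \<in> {0}"
      proof (rule weight_component[where H = h and T = bracket and B = B and v = "w(\<alpha> := - x)" and \<alpha> = \<alpha>])
        have "sum (w(\<alpha> := - x)) B = sum w B"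
          using nC B(2) by (intro sum.cong) auto
        then show "sum (w(\<alpha> := - x)) (insert \<alpha> B) \<in> {0}"
          using nC B by (subst sum.insert) auto
        show "\<exists>t\<in>h. \<alpha> t \<noteq> \<beta> t" if "\<beta> \<in> B" for \<beta>
        proof -
          have "\<beta> \<in> hdual h" using that B(2) Av(2) by (auto simp: C_def)
          moreover have "\<alpha> \<noteq> \<beta>" using nC that B(2) by auto
          ultimately show ?thesis using hdual_neqE[of \<alpha> \<beta>] \<alpha> root_hdual by metis
        qed
        show "bracket t ((w(\<alpha> := - x)) \<gamma>) = \<gamma> t *\<^sub>C (w(\<alpha> := - x)) \<gamma>"
          if "\<gamma> \<in> insert \<alpha> B" "t \<in> h" for \<gamma> t
          using that x B(3) by (auto simp: root_spaceD)
      qed (use nC B in \<open>auto simp: bracket_linear\<close>)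
      then show False using x by simp
    qed
  qed
  then show ?thesis using fC finite_subset by blast
qed

lemma E_root_space: "\<alpha> \<in> \<Delta> \<Longrightarrow> E \<alpha> \<in> root_space h \<alpha>"
  and killing_E: "\<alpha> \<in> \<Delta> \<Longrightarrow> killing (E \<alpha>) (E (- \<alpha>)) = 1"
  using root_vectors by (auto simp: root_vectors_def)

lemma E_nonzero: "\<alpha> \<in> \<Delta> \<Longrightarrow> E \<alpha> \<noteq> 0"
  using killing_E by fastforce

lemma bracket_h_E: "\<alpha> \<in> \<Delta> \<Longrightarrow> t \<in> h \<Longrightarrow> bracket t (E \<alpha>) = \<alpha> t *\<^sub>C E \<alpha>"
  using E_root_space root_spaceD by blast

lemma roots_nonempty: "\<Delta> \<noteq> {}"
proof
  assume *: "\<Delta> = {}"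
  have "x \<in> h" for x
    by (rule root_induct[where Q = "\<lambda>x. x \<in> h"]) (use * h_subspace in auto)
  then have "bracket x y = 0" for x y :: 'g using h_abelian by blast
  then show False using nonabelian[where 'a='g] by blast
qed

subsection \<open>Nondegeneracy of the Killing form\<close>

lemma killing_root_spaces_orthogonal:
  assumes "x \<in> root_space h \<alpha>" "y \<in> root_space h \<beta>" "t \<in> h" "\<alpha> t + \<beta> t \<noteq> 0"
  shows "killing x y = 0"
proof -
  have "killing (bracket t x) y = - killing x (bracket t y)" by (rule killing_invariant_left)
  then have "(\<alpha> t + \<beta> t) * killing x y = 0"
    using assms by (simp add: root_spaceD killing_linear algebra_simps)
  then show ?thesis using assms(4) by simp
qed

lemma killing_root_spaces_zero:
  assumes "x \<in> root_space h \<alpha>" "y \<in> root_space h \<beta>" "\<alpha> \<in> hdual h" "\<beta> \<in> hdual h" "\<beta> \<noteq> - \<alpha>"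
  shows "killing x y = 0"
proof -
  obtain t where "t \<in> h" "\<beta> t \<noteq> (- \<alpha>) t"
    using hdual_neqE[of \<beta> "- \<alpha>"] assms hdual_minus by metis
  then show ?thesis
    using killing_root_spaces_orthogonal[OF assms(1,2), of t] by (metis add.commute add_eq_0_iff uminus_apply)
qed

lemma killing_h_root_space:
  assumes "x \<in> h" "y \<in> root_space h \<beta>" "\<beta> \<in> \<Delta>"
  shows "killing x y = 0" "killing y x = 0"
proof -
  show "killing x y = 0"
    by (rule killing_root_spaces_zero[of x 0 y \<beta>]) (use assms root_nonzero root_hdual in \<open>auto simp: root_space_zero\<close>)
  then show "killing y x = 0" by (simp add: killing_commute)
qed

lemma killing_nondegenerate:
  fixes x :: 'g
  assumes "\<And>y. killing x y = 0"
  shows "x = 0"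
proof -
  define I where "I = {x::'g. \<forall>y. killing x y = 0}"
  have "I = {0} \<or> I = UNIV"
    by (rule no_proper_ideal) (auto simp: I_def killing_linear killing_invariant_left)
  moreover have "I \<noteq> UNIV"
  proof
    assume "I = UNIV"
    moreover obtain \<alpha> where "\<alpha> \<in> \<Delta>" using roots_nonempty by blast
    ultimately have "killing (E \<alpha>) (E (- \<alpha>)) = 0" by (auto simp: I_def)
    then show False using killing_E \<open>\<alpha> \<in> \<Delta>\<close> by simp
  qed
  ultimately have "I = {0}" by blast
  moreover have "x \<in> I" using assms by (simp add: I_def)
  ultimately show ?thesis by simp
qed

text \<open>Otherwise \<open>E \<alpha>\<close> would be orthogonal to \<open>h\<close> and to every
  root space, yet it pairs to 1 with the vector \<open>E (- \<alpha>)\<close>, whose weight is not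
  known at this point.\<close>

lemma root_minus:
  assumes "\<alpha> \<in> \<Delta>"
  shows "- \<alpha> \<in> \<Delta>"
proof (rule ccontr)
  assume n: "- \<alpha> \<notin> \<Delta>"
  have "killing (E \<alpha>) y = 0" for y
  proof (rule root_induct[where Q = "\<lambda>y. killing (E \<alpha>) y = 0"])
    show "cvs.subspace {x. killing (E \<alpha>) x = 0}" by (auto simp: cvs.subspace_def killing_linear)
    show "killing (E \<alpha>) x = 0" if "x \<in> h" for x
      using killing_h_root_space that assms E_root_space by blast
    show "killing (E \<alpha>) x = 0" if "\<beta> \<in> \<Delta>" "x \<in> root_space h \<beta>" for \<beta> x
      by (rule killing_root_spaces_zero[OF E_root_space[OF assms] that(2)])
         (use that n assms root_hdual in auto)
  qed
  then show False using killing_E[OF assms] by simp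
qed

lemma root_minus_iff: "- \<alpha> \<in> \<Delta> \<longleftrightarrow> \<alpha> \<in> \<Delta>"
  by (metis minus_minus root_minus)

lemma killing_h_nondegenerate:
  assumes "x \<in> h" "\<And>y. y \<in> h \<Longrightarrow> killing x y = 0"
  shows "x = 0"
proof (rule killing_nondegenerate)
  fix y show "killing x y = 0"
    by (rule root_induct[where Q = "\<lambda>y. killing x y = 0"])
       (use assms killing_h_root_space in \<open>auto simp: cvs.subspace_def killing_linear\<close>)
qed

lemma bracket_opposite:
  assumes "\<alpha> \<in> \<Delta>" "x \<in> root_space h \<alpha>" "y \<in> root_space h (- \<alpha>)"
  shows "bracket x y \<in> h" "t \<in> h \<Longrightarrow> killing (bracket x y) t = killing x y * \<alpha> t"
proof -
  show "bracket x y \<in> h"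
    using bracket_root_space[OF assms(2,3)] by (simp add: root_space_zero)
  assume t: "t \<in> h"
  have "killing (bracket x y) t = killing x (bracket y t)" by (rule killing_invariant)
  also have "bracket y t = \<alpha> t *\<^sub>C y"
    using root_spaceD[OF assms(3) t] bracket_anticomm[of y t] by simp
  finally show "killing (bracket x y) t = killing x y * \<alpha> t" by (simp add: killing_linear)
qed

section \<open>The elements of the Cartan subalgebra identified with the roots\<close>

lemma T_h: "\<alpha> \<in> \<Delta> \<Longrightarrow> T \<alpha> \<in> h"
  unfolding hcoroot_def by (rule bracket_opposite) (auto simp: E_root_space root_minus)

text \<open>Thus \<open>T \<alpha>\<close> is the image of \<alpha> under the Killing form and not
  the normalized coroot: \<open>\<alpha> (T \<alpha>)\<close> is the squared length of
  \<alpha>.\<close>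

lemma killing_T: "\<alpha> \<in> \<Delta> \<Longrightarrow> t \<in> h \<Longrightarrow> killing (T \<alpha>) t = \<alpha> t"
  unfolding hcoroot_def
  by (subst bracket_opposite) (auto simp: E_root_space root_minus killing_E)

lemma bracket_opposite_T:
  assumes "\<alpha> \<in> \<Delta>" "x \<in> root_space h \<alpha>" "y \<in> root_space h (- \<alpha>)"
  shows "bracket x y = killing x y *\<^sub>C T \<alpha>"
proof -
  have "bracket x y - killing x y *\<^sub>C T \<alpha> = 0"
    by (rule killing_h_nondegenerate)
       (use assms bracket_opposite T_h in \<open>auto simp: h_diff h_scaleC killing_linear killing_T\<close>)
  then show ?thesis by simp
qed

lemma T_minus: "T (- \<alpha>) = - T \<alpha>"
  by (simp add: hcoroot_def bracket_anticomm[of "E (- \<alpha>)" "E \<alpha>"])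

lemma base_span:
  assumes "root_base h P" "l \<in> hdual h"
  obtains c where "l = (\<lambda>x. \<Sum>\<alpha>\<in>P. c \<alpha> * \<alpha> x)"
  using assms unfolding root_base_def by blast

text \<open>No dimension count is made for existence: a functional is a combination of simple roots,
  and each of these is represented by its \<open>T\<close>.\<close>

lemma hvec_ex1:
  assumes "l \<in> hdual h"
  shows "\<exists>!t. t \<in> h \<and> (\<forall>x\<in>h. killing t x = l x)"
proof -
  obtain c where c: "l = (\<lambda>x. \<Sum>\<alpha>\<in>P0. c \<alpha> * \<alpha> x)" using base_span[OF root_base assms] by blast
  have P0: "P0 \<subseteq> \<Delta>" using root_base by (auto simp: root_base_def)
  define t where "t = (\<Sum>\<alpha>\<in>P0. c \<alpha> *\<^sub>C T \<alpha>)"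
  have t: "t \<in> h" "\<forall>x\<in>h. killing t x = l x"
    using P0 by (auto simp: t_def h_sum h_scaleC T_h killing_linear killing_T c subset_iff intro!: sum.cong)
  show ?thesis
  proof (intro ex1I[of _ t] conjI)
    fix s assume s: "s \<in> h \<and> (\<forall>x\<in>h. killing s x = l x)"
    have "s - t = 0"
      by (rule killing_h_nondegenerate) (use s t in \<open>auto simp: h_diff killing_linear\<close>)
    then show "s = t" by simp
  qed (use t in auto)
qed

lemma hvec_h: "l \<in> hdual h \<Longrightarrow> hvec h l \<in> h"
  and killing_hvec: "l \<in> hdual h \<Longrightarrow> t \<in> h \<Longrightarrow> killing (hvec h l) t = l t"
proof -
  assume l: "l \<in> hdual h"
  have *: "hvec h l \<in> h \<and> (\<forall>x\<in>h. killing (hvec h l) x = l x)"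
    unfolding hvec_def by (rule theI'[OF hvec_ex1[OF l]])
  then show "hvec h l \<in> h" by blast
  show "t \<in> h \<Longrightarrow> killing (hvec h l) t = l t" using * by blast
qed

lemma hvec_unique: "l \<in> hdual h \<Longrightarrow> t \<in> h \<Longrightarrow> (\<And>x. x \<in> h \<Longrightarrow> killing t x = l x) \<Longrightarrow> hvec h l = t"
  unfolding hvec_def by (rule the1_equality[OF hvec_ex1]) auto

lemma hvec_root: "\<alpha> \<in> \<Delta> \<Longrightarrow> hvec h \<alpha> = T \<alpha>"
  by (rule hvec_unique) (auto simp: root_hdual T_h killing_T)

lemma dform_root: "\<alpha> \<in> \<Delta> \<Longrightarrow> l \<in> hdual h \<Longrightarrow> dform h \<alpha> l = l (T \<alpha>)"
  by (simp add: dform_def hvec_root killing_commute[of "T \<alpha>"] killing_hvec T_h)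

lemma root_hvec: "\<alpha> \<in> \<Delta> \<Longrightarrow> l \<in> hdual h \<Longrightarrow> \<alpha> (hvec h l) = l (T \<alpha>)"
  using killing_T[of \<alpha> "hvec h l"] killing_hvec[of l "T \<alpha>"]
  by (simp add: hvec_h T_h killing_commute)

subsection \<open>Root strings\<close>

lemma funpow_bracket_root_space:
  assumes "x \<in> root_space h \<alpha>" "v \<in> root_space h \<beta>"
  shows "(bracket x ^^ k) v \<in> root_space h (\<lambda>t. \<beta> t + of_nat k * \<alpha> t)"
proof (induction k)
  case 0
  show ?case using assms(2) by (simp add: eta_contract_eq)
next
  case (Suc k)
  have "(\<lambda>t. \<beta> t + of_nat (Suc k) * \<alpha> t) = \<alpha> + (\<lambda>t. \<beta> t + of_nat k * \<alpha> t)"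
    by (auto simp: algebra_simps)
  then show ?case using bracket_root_space[OF assms(1) Suc] by simp
qed

lemma root_string_hdual:
  assumes "\<alpha> \<in> \<Delta>" "\<beta> \<in> hdual h"
  shows "(\<lambda>t. \<beta> t + c * \<alpha> t) \<in> hdual h"
  using hdual_line[OF assms(2) root_hdual[OF assms(1)]] .

lemma root_string_inj:
  assumes "\<alpha> \<in> \<Delta>"
  shows "inj (\<lambda>k::nat. (\<lambda>t. \<beta> t + of_nat k * \<alpha> t))"
proof (rule injI)
  fix i j :: nat
  assume *: "(\<lambda>t. \<beta> t + of_nat i * \<alpha> t) = (\<lambda>t. \<beta> t + of_nat j * \<alpha> t)"
  obtain t where "\<alpha> t \<noteq> 0" using root_nonzero[OF assms] by (auto simp: fun_eq_iff)
  then show "i = j" using fun_cong[OF *, of t] by simp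
qed

text \<open>Nonzero powers would have pairwise distinct weights \<beta> + k \<alpha>, all of them
  roots or 0.\<close>

lemma funpow_bracket_eventually_zero:
  assumes \<alpha>: "\<alpha> \<in> \<Delta>" and x: "x \<in> root_space h \<alpha>" and v: "v \<in> root_space h \<beta>" and \<beta>: "\<beta> \<in> hdual h"
  shows "\<exists>k. (bracket x ^^ k) v = 0"
proof (rule ccontr)
  assume n: "\<nexists>k. (bracket x ^^ k) v = 0"
  let ?g = "\<lambda>k::nat. (\<lambda>t. \<beta> t + of_nat k * \<alpha> t)"
  have "?g k \<in> insert 0 \<Delta>" for k
  proof -
    have "root_space h (?g k) \<noteq> {0}"
      using n funpow_bracket_root_space[OF x v, of k] by auto
    then show ?thesis
      using root_string_hdual[OF \<alpha> \<beta>] by (simp add: roots_def)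
  qed
  then have "finite (range ?g)"
    using finite_subset[of "range ?g" "insert 0 \<Delta>"] finite_roots by auto
  then show False
    using finite_imageD[OF _ root_string_inj[OF \<alpha>]] by simp
qed

lemma string_top:
  assumes "\<alpha> \<in> \<Delta>" "w \<in> root_space h \<beta>" "\<beta> \<in> hdual h" "w \<noteq> 0"
  obtains k where "(bracket (E \<alpha>) ^^ k) w \<noteq> 0" "bracket (E \<alpha>) ((bracket (E \<alpha>) ^^ k) w) = 0"
proof -
  let ?P = "\<lambda>k. (bracket (E \<alpha>) ^^ k) w = 0"
  have ex: "\<exists>k. ?P k" by (rule funpow_bracket_eventually_zero) (use assms E_root_space in auto)
  define m where "m = (LEAST k. ?P k)"
  have m: "?P m" unfolding m_def by (rule LeastI_ex[OF ex])
  have "m \<noteq> 0" using m assms(4) by (intro notI) simp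
  then obtain k where k: "m = Suc k" using not0_implies_Suc by blast
  have "\<not> ?P k" using not_less_Least[of k ?P] k m_def by simp
  then show thesis using that[of k] m k by simp
qed

text \<open>The usual computation in sl_2, for the unnormalized triple \<open>E \<alpha>\<close>,
  \<open>E (- \<alpha>)\<close>, \<open>T \<alpha>\<close>. As \<open>T \<alpha>\<close> acts on
  \<open>E \<alpha>\<close> by \<open>\<alpha> (T \<alpha>)\<close> instead of 2, half this number
  multiplies j.\<close>

lemma highest_weight_step:
  assumes \<alpha>: "\<alpha> \<in> \<Delta>" and v: "v \<in> root_space h \<beta>" and e: "bracket (E \<alpha>) v = 0"
  shows "bracket (E \<alpha>) ((bracket (E (- \<alpha>)) ^^ Suc j) v)
    = (of_nat (Suc j) * (\<beta> (T \<alpha>) - of_nat j / 2 * \<alpha> (T \<alpha>))) *\<^sub>C (bracket (E (- \<alpha>)) ^^ j) v"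
proof (induction j)
  let ?e = "E \<alpha>" and ?f = "E (- \<alpha>)"
  have step: "bracket ?e (bracket ?f x) = bracket (T \<alpha>) x + bracket ?f (bracket ?e x)" for x
    using jacobi_left[of ?e ?f x] by (simp add: hcoroot_def)
  {
    case 0
    show ?case
      using step[of v] root_spaceD[OF v T_h[OF \<alpha>]] unfolding e bracket_zero_right
      by (simp only: funpow.simps o_apply id_apply) simp
  next
    case (Suc j)
    let ?w = "(bracket ?f ^^ Suc j) v"
    have w: "?w \<in> root_space h (\<lambda>t. \<beta> t + of_nat (Suc j) * (- \<alpha>) t)"
      by (rule funpow_bracket_root_space[OF E_root_space[OF root_minus[OF \<alpha>]] v])
    have "bracket ?e ((bracket ?f ^^ Suc (Suc j)) v) = bracket (T \<alpha>) ?w + bracket ?f (bracket ?e ?w)"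
      using step[of ?w] by simp
    also have "bracket (T \<alpha>) ?w = (\<beta> (T \<alpha>) - of_nat (Suc j) * \<alpha> (T \<alpha>)) *\<^sub>C ?w"
      using root_spaceD[OF w T_h[OF \<alpha>]] by simp
    also have "bracket ?f (bracket ?e ?w)
        = (of_nat (Suc j) * (\<beta> (T \<alpha>) - of_nat j / 2 * \<alpha> (T \<alpha>))) *\<^sub>C ?w"
      unfolding Suc bracket_scaleC_right by simp
    finally have "bracket ?e ((bracket ?f ^^ Suc (Suc j)) v)
      = (\<beta> (T \<alpha>) - of_nat (Suc j) * \<alpha> (T \<alpha>) +
         of_nat (Suc j) * (\<beta> (T \<alpha>) - of_nat j / 2 * \<alpha> (T \<alpha>))) *\<^sub>C ?w"
      by (simp only: scaleC_add_left)
    also have "\<beta> (T \<alpha>) - of_nat (Suc j) * \<alpha> (T \<alpha>) +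
         of_nat (Suc j) * (\<beta> (T \<alpha>) - of_nat j / 2 * \<alpha> (T \<alpha>))
       = of_nat (Suc (Suc j)) * (\<beta> (T \<alpha>) - of_nat (Suc j) / 2 * \<alpha> (T \<alpha>))"
      by (simp add: field_simps)
    finally show ?case .
  }
qed

text \<open>At the first vanishing power the scalar in \<open>highest_weight_step\<close> must be
  zero. The conclusion is not divided by \<open>\<alpha> (T \<alpha>)\<close>, because that this
  number is nonzero is itself derived from here.\<close>

lemma highest_weight:
  assumes \<alpha>: "\<alpha> \<in> \<Delta>" and v: "v \<in> root_space h \<beta>" and e: "bracket (E \<alpha>) v = 0"
    and \<beta>: "\<beta> \<in> hdual h" and v0: "v \<noteq> 0"
  obtains q :: nat where "\<beta> (T \<alpha>) = of_nat q / 2 * \<alpha> (T \<alpha>)"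
    "\<And>j. j \<le> q \<Longrightarrow> (bracket (E (- \<alpha>)) ^^ j) v \<noteq> 0"
proof -
  let ?P = "\<lambda>k. (bracket (E (- \<alpha>)) ^^ k) v = 0"
  have ex: "\<exists>k. ?P k"
    by (rule funpow_bracket_eventually_zero[of "- \<alpha>"]) (use assms E_root_space root_minus in auto)
  define m where "m = (LEAST k. ?P k)"
  have m: "?P m" unfolding m_def by (rule LeastI_ex[OF ex])
  have "m \<noteq> 0" using m v0 by (intro notI) simp
  then obtain q where q: "m = Suc q" using not0_implies_Suc by blast
  have nz: "\<not> ?P j" if "j \<le> q" for j
    using not_less_Least[of j ?P] q m_def that by simp
  have "(of_nat (Suc q) * (\<beta> (T \<alpha>) - of_nat q / 2 * \<alpha> (T \<alpha>))) *\<^sub>C (bracket (E (- \<alpha>)) ^^ q) v = 0"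
    using highest_weight_step[OF \<alpha> v e, of q] m q by simp
  then have "of_nat (Suc q) * (\<beta> (T \<alpha>) - of_nat q / 2 * \<alpha> (T \<alpha>)) = 0"
    using nz[of q] by (simp only: cvs.scale_eq_0_iff) simp
  then have "\<beta> (T \<alpha>) = of_nat q / 2 * \<alpha> (T \<alpha>)"
    by (simp only: mult_eq_0_iff of_nat_eq_0_iff) simp
  then show thesis using that nz by blast
qed

lemma string_highest_weight:
  assumes \<alpha>: "\<alpha> \<in> \<Delta>" and w: "w \<in> root_space h \<beta>" "\<beta> \<in> hdual h" "w \<noteq> 0"
  obtains k q :: nat and u where "\<beta> (T \<alpha>) + of_nat k * \<alpha> (T \<alpha>) = of_nat q / 2 * \<alpha> (T \<alpha>)"
    "u \<in> root_space h (\<lambda>t. \<beta> t + of_nat k * \<alpha> t)" "bracket (E \<alpha>) u = 0"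
    "\<And>j. j \<le> q \<Longrightarrow> (bracket (E (- \<alpha>)) ^^ j) u \<noteq> 0"
proof -
  obtain k where k: "(bracket (E \<alpha>) ^^ k) w \<noteq> 0" "bracket (E \<alpha>) ((bracket (E \<alpha>) ^^ k) w) = 0"
    using string_top[OF \<alpha> w] by blast
  have u: "(bracket (E \<alpha>) ^^ k) w \<in> root_space h (\<lambda>t. \<beta> t + of_nat k * \<alpha> t)"
    by (rule funpow_bracket_root_space[OF E_root_space[OF \<alpha>] w(1)])
  show thesis
    by (rule highest_weight[OF \<alpha> u k(2) root_string_hdual[OF \<alpha> w(2)] k(1)]) (use that u k in blast)
qed

text \<open>If \<alpha> had length zero, integrality along strings would make every root vanish at
  \<open>T \<alpha>\<close>. As the roots span the dual, \<open>T \<alpha>\<close> would then be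
  orthogonal to \<open>h\<close>.\<close>

lemma root_T_nonzero:
  assumes \<alpha>: "\<alpha> \<in> \<Delta>"
  shows "\<alpha> (T \<alpha>) \<noteq> 0"
proof
  assume 0: "\<alpha> (T \<alpha>) = 0"
  have b0: "\<beta> (T \<alpha>) = 0" if "\<beta> \<in> \<Delta>" for \<beta>
    by (rule string_highest_weight[OF \<alpha> E_root_space[OF that] root_hdual[OF that] E_nonzero[OF that]])
       (use 0 in simp)
  have "\<alpha> t = 0" if t: "t \<in> h" for t
  proof -
    \<comment> \<open>Pairing with \<open>t\<close> is a combination of simple roots, and all of
      these vanish at \<open>T \<alpha>\<close>.\<close>
    define l where "l x = (if x \<in> h then killing t x else 0)" for x
    have "l \<in> hdual h" by (auto simp: l_def hdual_def h_add h_scaleC killing_linear)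
    then obtain c where c: "l = (\<lambda>x. \<Sum>\<alpha>\<in>P0. c \<alpha> * \<alpha> x)" using base_span[OF root_base] by blast
    have "P0 \<subseteq> \<Delta>" using root_base by (auto simp: root_base_def)
    then have "l (T \<alpha>) = 0" using b0 by (auto simp: c intro!: sum.neutral)
    then show ?thesis using T_h[OF \<alpha>] killing_T[OF \<alpha> t] killing_commute[of t "T \<alpha>"] by (simp add: l_def)
  qed
  then have "\<alpha> = 0" using hdual_eqI[OF root_hdual[OF \<alpha>] hdual_zero] by simp
  then show False using root_nonzero[OF \<alpha>] by simp
qed

text \<open>Root spaces are one-dimensional. The part \<open>v\<close> of \<open>y\<close>
  orthogonal to \<open>E \<alpha>\<close> is killed by \<open>E \<alpha>\<close>, so it would be a
  highest weight vector of the negative weight -\<alpha>; but a highest weight is a nonnegative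
  multiple of half the length.\<close>

lemma root_space_minus_span:
  assumes \<alpha>: "\<alpha> \<in> \<Delta>" and y: "y \<in> root_space h (- \<alpha>)"
  shows "y = killing (E \<alpha>) y *\<^sub>C E (- \<alpha>)"
proof (rule ccontr)
  define v where "v = y - killing (E \<alpha>) y *\<^sub>C E (- \<alpha>)"
  assume "y \<noteq> killing (E \<alpha>) y *\<^sub>C E (- \<alpha>)"
  then have v0: "v \<noteq> 0" by (simp add: v_def)
  have m: "- \<alpha> \<in> \<Delta>" by (rule root_minus[OF \<alpha>])
  have v: "v \<in> root_space h (- \<alpha>)"
    unfolding v_def
    by (intro cvs.subspace_diff cvs.subspace_scale root_space_subspace y E_root_space m)
  have "bracket (E \<alpha>) v = killing (E \<alpha>) v *\<^sub>C T \<alpha>"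
    by (rule bracket_opposite_T[OF \<alpha> E_root_space[OF \<alpha>] v])
  also have "killing (E \<alpha>) v = 0" by (simp add: v_def killing_linear killing_E[OF \<alpha>])
  finally have e: "bracket (E \<alpha>) v = 0" by simp
  obtain q :: nat where "(- \<alpha>) (T \<alpha>) = of_nat q / 2 * \<alpha> (T \<alpha>)"
    using highest_weight[OF \<alpha> v e root_hdual[OF m] v0] by blast
  then have "- \<alpha> (T \<alpha>) = of_nat q / 2 * \<alpha> (T \<alpha>)" by simp
  then have "(of_nat q / 2 + 1) * \<alpha> (T \<alpha>) = 0" by (simp only: ring_distribs) (metis add.commute mult_1 neg_eq_iff_add_eq_0)
  then have "of_nat q / 2 + 1 = (0::complex)" using root_T_nonzero[OF \<alpha>] by simp
  then have "of_nat (q + 2) = (0::complex)" by (simp add: field_simps)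
  then show False by (simp only: of_nat_eq_0_iff)
qed

lemma root_space_span:
  assumes \<alpha>: "\<alpha> \<in> \<Delta>" and y: "y \<in> root_space h \<alpha>"
  shows "y = killing y (E (- \<alpha>)) *\<^sub>C E \<alpha>"
  using root_space_minus_span[OF root_minus[OF \<alpha>]] y by (simp add: killing_commute)

section \<open>Pairings of root vectors and brackets of root vectors\<close>

lemma killing_E_E:
  assumes "\<alpha> \<in> \<Delta>" "\<beta> \<in> \<Delta>"
  shows "killing (E \<alpha>) (E \<beta>) = (if \<beta> = - \<alpha> then 1 else 0)"
  using assms killing_E killing_root_spaces_zero[OF E_root_space[OF assms(1)] E_root_space[OF assms(2)]]
  by (auto simp: root_hdual)

lemma killing_h_E: "\<alpha> \<in> \<Delta> \<Longrightarrow> t \<in> h \<Longrightarrow> killing t (E \<alpha>) = 0"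
  and killing_E_h: "\<alpha> \<in> \<Delta> \<Longrightarrow> t \<in> h \<Longrightarrow> killing (E \<alpha>) t = 0"
  using killing_h_root_space E_root_space by blast+

text \<open>The projection to \<open>h\<close> along the root spaces.\<close>

definition hpart :: "'g \<Rightarrow> 'g"
  where "hpart x = x - (\<Sum>\<beta>\<in>\<Delta>. killing x (E (- \<beta>)) *\<^sub>C E \<beta>)"

lemma hpart_linear:
  "hpart (x + y) = hpart x + hpart y" "hpart (c *\<^sub>C x) = c *\<^sub>C hpart x" "hpart 0 = 0"
  by (simp_all add: hpart_def killing_linear scaleC_add_left sum.distrib cvs.scale_sum_right
      cvs.scale_right_diff_distrib scaleC_scaleC)

lemma hpart_of_h: "t \<in> h \<Longrightarrow> hpart t = t"
  by (simp add: hpart_def killing_h_E root_minus)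

lemma hpart_h: "hpart x \<in> h"
proof (rule root_induct[where Q = "\<lambda>x. hpart x \<in> h"])
  show "cvs.subspace {x. hpart x \<in> h}"
    by (auto simp: cvs.subspace_def hpart_linear h_add h_scaleC h_zero)
  show "hpart x \<in> h" if "x \<in> h" for x
    using that by (simp add: hpart_of_h)
  show "hpart x \<in> h" if \<alpha>: "\<alpha> \<in> \<Delta>" and x: "x \<in> root_space h \<alpha>" for \<alpha> x
  proof -
    have *: "killing x (E (- \<beta>)) = 0" if "\<beta> \<in> \<Delta> - {\<alpha>}" for \<beta>
      by (rule killing_root_spaces_zero[OF x E_root_space])
         (use that \<alpha> in \<open>auto simp: root_minus root_hdual\<close>)
    have "(\<Sum>\<beta>\<in>\<Delta>. killing x (E (- \<beta>)) *\<^sub>C E \<beta>) = killing x (E (- \<alpha>)) *\<^sub>C E \<alpha>"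
      by (subst sum.remove[OF finite_roots \<alpha>]) (simp add: *)
    then show ?thesis using root_space_span[OF \<alpha> x] h_zero by (simp add: hpart_def)
  qed
qed

lemma root_expansion: "hpart x + (\<Sum>\<beta>\<in>\<Delta>. killing x (E (- \<beta>)) *\<^sub>C E \<beta>) = x"
  by (simp add: hpart_def)

lemma killing_h_hpart: "t \<in> h \<Longrightarrow> killing x t = killing (hpart x) t"
  by (subst (1) root_expansion[of x, symmetric]) (simp add: killing_linear killing_E_h)

lemma E_induct:
  assumes "cvs.subspace {x. Q x}" "\<And>x. x \<in> h \<Longrightarrow> Q x" "\<And>\<alpha>. \<alpha> \<in> \<Delta> \<Longrightarrow> Q (E \<alpha>)"
  shows "Q x"
proof (rule root_induct[where Q = Q, OF assms(1,2)])
  fix \<alpha> x assume "\<alpha> \<in> \<Delta>" "x \<in> root_space h \<alpha>"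
  then show "Q x"
    using root_space_span[of \<alpha> x] cvs.subspace_scale[OF assms(1)] assms(3) by (metis mem_Collect_eq)
qed

text \<open>Suppose the bracket vanishes. Then \<open>E \<beta>\<close> is a highest weight vector.
  Descending from the top \<open>u\<close> of the string through \<alpha> + \<beta> gives another
  vector of weight \<beta>, hence a multiple of \<open>E \<beta>\<close>, so it is also killed by
  \<open>E \<alpha>\<close>. By \<open>highest_weight_step\<close> this fixes the length of the
  longer string too small.\<close>

lemma bracket_E_nonzero:
  assumes \<alpha>: "\<alpha> \<in> \<Delta>" and \<beta>: "\<beta> \<in> \<Delta>" and ab: "\<alpha> + \<beta> \<in> \<Delta>"
  shows "bracket (E \<alpha>) (E \<beta>) \<noteq> 0"
proof
  assume e: "bracket (E \<alpha>) (E \<beta>) = 0"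
  let ?f = "E (- \<alpha>)" and ?c = "\<alpha> (T \<alpha>)"
  have c: "?c \<noteq> 0" by (rule root_T_nonzero[OF \<alpha>])
  obtain q :: nat where q: "\<beta> (T \<alpha>) = of_nat q / 2 * ?c"
    using highest_weight[OF \<alpha> E_root_space[OF \<beta>] e root_hdual[OF \<beta>] E_nonzero[OF \<beta>]] by blast
  obtain k p :: nat and u where u: "(\<alpha> + \<beta>) (T \<alpha>) + of_nat k * ?c = of_nat p / 2 * ?c"
    "u \<in> root_space h (\<lambda>t. (\<alpha> + \<beta>) t + of_nat k * \<alpha> t)" "bracket (E \<alpha>) u = 0"
    "\<And>j. j \<le> p \<Longrightarrow> (bracket ?f ^^ j) u \<noteq> 0"
    using string_highest_weight[OF \<alpha> E_root_space[OF ab] root_hdual[OF ab] E_nonzero[OF ab]] by blast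
  \<comment> \<open>The weight of \<open>u\<close> is \<beta> + (k + 1) \<alpha>. Its value at
    \<open>T \<alpha>\<close> is computed from \<open>q\<close> and from \<open>p\<close>.\<close>
  have "of_nat (q + 2 * Suc k) / 2 * ?c = of_nat p / 2 * ?c"
    using u(1) q by (simp add: algebra_simps)
  then have "of_nat (q + 2 * Suc k) = (of_nat p :: complex)" using c by simp
  then have p: "p = q + 2 * Suc k" by (simp only: of_nat_eq_iff)
  let ?w = "(bracket ?f ^^ Suc k) u"
  have "(\<lambda>t. (\<lambda>t. (\<alpha> + \<beta>) t + of_nat k * \<alpha> t) t + of_nat (Suc k) * (- \<alpha>) t) = \<beta>"
    by (auto simp: algebra_simps)
  then have w: "?w \<in> root_space h \<beta>"
    using funpow_bracket_root_space[OF E_root_space[OF root_minus[OF \<alpha>]] u(2), of "Suc k"] by simp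
  have "bracket (E \<alpha>) ?w = killing ?w (E (- \<beta>)) *\<^sub>C bracket (E \<alpha>) (E \<beta>)"
    by (subst root_space_span[OF \<beta> w]) (simp only: bracket_scaleC_right)
  then have "bracket (E \<alpha>) ?w = 0" using e by simp
  then have "of_nat (Suc k) * ((\<alpha> + \<beta>) (T \<alpha>) + of_nat k * ?c - of_nat k / 2 * ?c) = 0"
    using highest_weight_step[OF \<alpha> u(2,3), of k] u(4)[of k] p
    by (simp only: cvs.scale_eq_0_iff) simp
  then have "of_nat p / 2 * ?c - of_nat k / 2 * ?c = 0"
    using u(1) by (simp only: mult_eq_0_iff of_nat_eq_0_iff) simp
  then have "of_nat p = (of_nat k :: complex)" using c by simp
  then have "p = k" by (simp only: of_nat_eq_iff)
  then show False using p by simp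
qed

lemma bracket_E_E:
  assumes "\<alpha> \<in> \<Delta>" "\<beta> \<in> \<Delta>" "\<alpha> + \<beta> \<in> \<Delta>"
  obtains c where "c \<noteq> 0" "bracket (E \<alpha>) (E \<beta>) = c *\<^sub>C E (\<alpha> + \<beta>)"
  using root_space_span[OF assms(3) bracket_root_space[OF E_root_space E_root_space]] assms
    bracket_E_nonzero[OF assms] by (metis cvs.scale_zero_left)

lemma bracket_E_E_zero:
  assumes "\<alpha> \<in> \<Delta>" "\<beta> \<in> \<Delta>" "\<alpha> + \<beta> \<notin> \<Delta>" "\<alpha> + \<beta> \<noteq> 0"
  shows "bracket (E \<alpha>) (E \<beta>) = 0"
  using bracket_root_space[OF E_root_space[OF assms(1)] E_root_space[OF assms(2)]]
    assms hdual_add[OF root_hdual root_hdual] by (auto simp: roots_def)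

section \<open>Integrality, reflections and positivity of lengths\<close>

lemma root_string_integer:
  assumes \<alpha>: "\<alpha> \<in> \<Delta>" and \<beta>: "\<beta> \<in> \<Delta>"
  obtains n :: int where "\<beta> (T \<alpha>) = of_int n / 2 * \<alpha> (T \<alpha>)"
proof -
  obtain k q :: nat where "\<beta> (T \<alpha>) + of_nat k * \<alpha> (T \<alpha>) = of_nat q / 2 * \<alpha> (T \<alpha>)"
    using string_highest_weight[OF \<alpha> E_root_space[OF \<beta>] root_hdual[OF \<beta>] E_nonzero[OF \<beta>]] by metis
  then have "\<beta> (T \<alpha>) = of_int (int q - 2 * int k) / 2 * \<alpha> (T \<alpha>)"
    by (simp add: algebra_simps diff_divide_distrib)
  then show thesis by (rule that)
qed

text \<open>The lowering operator stays nonzero all the way down from the top of the string. The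
  conclusion speaks of the weight space, because \<beta> - j \<alpha> may be 0, which is not a
  root.\<close>

lemma root_string_member:
  assumes \<alpha>: "\<alpha> \<in> \<Delta>" and \<beta>: "\<beta> \<in> \<Delta>" and n: "\<beta> (T \<alpha>) = of_nat n / 2 * \<alpha> (T \<alpha>)"
    and j: "j \<le> n"
  shows "root_space h (\<lambda>t. \<beta> t - of_nat j * \<alpha> t) \<noteq> {0}"
proof -
  obtain k q :: nat and u where u: "\<beta> (T \<alpha>) + of_nat k * \<alpha> (T \<alpha>) = of_nat q / 2 * \<alpha> (T \<alpha>)"
    "u \<in> root_space h (\<lambda>t. \<beta> t + of_nat k * \<alpha> t)" "bracket (E \<alpha>) u = 0"
    "\<And>j. j \<le> q \<Longrightarrow> (bracket (E (- \<alpha>)) ^^ j) u \<noteq> 0"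
    using string_highest_weight[OF \<alpha> E_root_space[OF \<beta>] root_hdual[OF \<beta>] E_nonzero[OF \<beta>]] by blast
  have "of_nat (n + 2 * k) / 2 * \<alpha> (T \<alpha>) = of_nat q / 2 * \<alpha> (T \<alpha>)"
    using u(1) n by (simp add: algebra_simps)
  then have "of_nat (n + 2 * k) = (of_nat q :: complex)" using root_T_nonzero[OF \<alpha>] by simp
  then have q: "q = n + 2 * k" by (simp only: of_nat_eq_iff)
  have "(bracket (E (- \<alpha>)) ^^ (j + k)) u \<noteq> 0" using u(4) q j by simp
  moreover have "(\<lambda>t. (\<lambda>t. \<beta> t + of_nat k * \<alpha> t) t + of_nat (j + k) * (- \<alpha>) t) = (\<lambda>t. \<beta> t - of_nat j * \<alpha> t)"
    by (auto simp: algebra_simps)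
  ultimately show ?thesis
    using funpow_bracket_root_space[OF E_root_space[OF root_minus[OF \<alpha>]] u(2), of "j + k"] by auto
qed

lemma root_reflection:
  assumes \<alpha>: "\<alpha> \<in> \<Delta>" and \<beta>: "\<beta> \<in> \<Delta>"
  shows "(\<lambda>t. \<beta> t - (2 * \<beta> (T \<alpha>) / \<alpha> (T \<alpha>)) * \<alpha> t) \<in> \<Delta>"
proof -
  have main: "(\<lambda>t. \<beta> t - (2 * \<beta> (T \<alpha>) / \<alpha> (T \<alpha>)) * \<alpha> t) \<in> \<Delta>"
    if n: "\<beta> (T \<alpha>) = of_nat n / 2 * \<alpha> (T \<alpha>)" and \<alpha>: "\<alpha> \<in> \<Delta>" for n :: nat and \<alpha>
  proof -
    let ?s = "\<lambda>t. \<beta> t - of_nat n * \<alpha> t"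
    have c: "\<alpha> (T \<alpha>) \<noteq> 0" by (rule root_T_nonzero[OF \<alpha>])
    have "root_space h ?s \<noteq> {0}" by (rule root_string_member[OF \<alpha> \<beta> n]) simp
    moreover have "?s \<in> hdual h"
      using root_string_hdual[OF \<alpha> root_hdual[OF \<beta>], of "- of_nat n"] by simp
    \<comment> \<open>Otherwise \<beta> = n \<alpha>, and evaluation at \<open>T \<alpha>\<close>
      gives n / 2 = n.\<close>
    moreover have "?s \<noteq> 0"
    proof
      assume *: "?s = 0"
      have "of_nat n / 2 * \<alpha> (T \<alpha>) = of_nat n * \<alpha> (T \<alpha>)"
        using fun_cong[OF *, of "T \<alpha>"] n by simp
      then have "of_nat n = (0::complex)" using c by simp
      then show False using * root_nonzero[OF \<beta>] by (auto simp: fun_eq_iff)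
    qed
    moreover have "2 * \<beta> (T \<alpha>) / \<alpha> (T \<alpha>) = of_nat n" using n c by (simp add: field_simps)
    ultimately show ?thesis by (simp only: roots_def mem_Collect_eq) simp
  qed
  obtain n :: int where n: "\<beta> (T \<alpha>) = of_int n / 2 * \<alpha> (T \<alpha>)"
    using root_string_integer[OF \<alpha> \<beta>] .
  show ?thesis
  proof (cases "n \<ge> 0")
    case True
    then have "of_int n = (of_nat (nat n) :: complex)" by simp
    then have "\<beta> (T \<alpha>) = of_nat (nat n) / 2 * \<alpha> (T \<alpha>)" using n by (simp only:)
    from main[OF this \<alpha>] show ?thesis .
  next
    case False
    \<comment> \<open>\<alpha> and -\<alpha> define the same reflection, and passing to -\<alpha>
      changes the sign of \<open>n\<close>.\<close>
    then have "of_int n = - (of_nat (nat (- n)) :: complex)" by simp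
    then have "\<beta> (T (- \<alpha>)) = of_nat (nat (- n)) / 2 * (- \<alpha>) (T (- \<alpha>))"
      using n T_h[OF \<alpha>] root_hdual[OF \<alpha>] root_hdual[OF \<beta>]
      by (simp add: T_minus hdual_minus_arg)
    from main[OF this root_minus[OF \<alpha>]] show ?thesis
      using T_h[OF \<alpha>] root_hdual[OF \<alpha>] root_hdual[OF \<beta>] by (simp add: T_minus hdual_minus_arg)
  qed
qed

text \<open>The double 2 \<alpha> is not a root, since \<open>E \<alpha>\<close> commutes with
  itself, against \<open>bracket_E_nonzero\<close>. For n \<ge> 2 the string downwards from n
  \<alpha> has 2 n steps and would pass through 2 \<alpha>.\<close>

lemma root_multiple:
  assumes \<alpha>: "\<alpha> \<in> \<Delta>" and \<beta>: "(\<lambda>t. of_nat n * \<alpha> t) \<in> \<Delta>"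
  shows "n = 1"
proof -
  have two: "\<alpha> + \<alpha> \<notin> \<Delta>"
    using bracket_E_nonzero[OF \<alpha> \<alpha>] bracket_self by blast
  have "n \<noteq> 0"
  proof
    assume "n = 0"
    then have "(\<lambda>t. of_nat n * \<alpha> t) = 0" by auto
    then show False using root_nonzero[OF \<beta>] by blast
  qed
  moreover have False if "n \<ge> 2"
  proof -
    have "root_space h (\<lambda>t. of_nat n * \<alpha> t - of_nat (n - 2) * \<alpha> t) \<noteq> {0}"
      by (rule root_string_member[OF \<alpha> \<beta>, of "2 * n"]) auto
    also have "(\<lambda>t. of_nat n * \<alpha> t - of_nat (n - 2) * \<alpha> t) = \<alpha> + \<alpha>"
      using that by (auto simp: of_nat_diff algebra_simps)
    finally have "root_space h (\<alpha> + \<alpha>) \<noteq> {0}" .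
    moreover have "\<alpha> + \<alpha> \<noteq> 0"
      using root_nonzero[OF \<alpha>] by (auto simp: fun_eq_iff)
    ultimately have "\<alpha> + \<alpha> \<in> \<Delta>" using hdual_add[OF root_hdual[OF \<alpha>] root_hdual[OF \<alpha>]] unfolding roots_def by blast
    then show False using two by blast
  qed
  ultimately show ?thesis by (cases "n \<ge> 2") auto
qed

text \<open>Two elements of \<open>h\<close> act diagonally on the root vectors, and each root has
  multiplicity one. The trace is still the one in \<open>lie_basis\<close>, hence the conversion by
  \<open>root_expansion\<close>.\<close>

lemma killing_h_trace:
  assumes "t \<in> h" "s \<in> h"
  shows "killing t s = (\<Sum>\<beta>\<in>\<Delta>. \<beta> t * \<beta> s)"
proof -
  have "bracket t (bracket s a) = (\<Sum>\<beta>\<in>\<Delta>. (\<beta> t * \<beta> s * killing a (E (- \<beta>))) *\<^sub>C E \<beta>)" for a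
    using assms
    by (subst (1) root_expansion[of a, symmetric])
       (auto simp: bracket_linear bracket_h_E h_abelian hpart_h scaleC_scaleC mult_ac intro!: sum.cong)
  then have "killing t s = (\<Sum>a\<in>lie_basis. \<Sum>\<beta>\<in>\<Delta>. (\<beta> t * \<beta> s) * (killing a (E (- \<beta>)) * coord a (E \<beta>)))"
    by (simp add: killing_def[of t] coord_sum mult.assoc)
  also have "\<dots> = (\<Sum>\<beta>\<in>\<Delta>. \<beta> t * \<beta> s * (\<Sum>a\<in>lie_basis. killing a (E (- \<beta>)) * coord a (E \<beta>)))"
    by (subst sum.swap) (simp add: sum_distrib_left)
  also have "\<dots> = (\<Sum>\<beta>\<in>\<Delta>. \<beta> t * \<beta> s)"
  proof (rule sum.cong[OF refl])
    fix \<beta> assume \<beta>: "\<beta> \<in> \<Delta>"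
    \<comment> \<open>The trace of the rank one projection to the line of
      \<open>E \<beta>\<close>.\<close>
    have "(\<Sum>a\<in>lie_basis. killing a (E (- \<beta>)) * coord a (E \<beta>))
        = killing (\<Sum>a\<in>lie_basis. coord a (E \<beta>) *\<^sub>C a) (E (- \<beta>))"
      by (simp add: killing_linear mult.commute)
    also have "\<dots> = 1" by (simp add: coord_expansion killing_E \<beta>)
    finally show "\<beta> t * \<beta> s * (\<Sum>a\<in>lie_basis. killing a (E (- \<beta>)) * coord a (E \<beta>)) = \<beta> t * \<beta> s" by simp
  qed
  finally show ?thesis .
qed

text \<open>By the trace formula \<langle>\<alpha>, \<alpha>\<rangle> is the sum of the squares of
  all \<langle>\<beta>, \<alpha>\<rangle>, and each of these is a half-integral multiple of
  \<langle>\<alpha>, \<alpha>\<rangle>. So \<langle>\<alpha>, \<alpha>\<rangle> = S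
  \<langle>\<alpha>, \<alpha>\<rangle>^2 with \<open>S\<close> a sum of real squares, that is,
  \<langle>\<alpha>, \<alpha>\<rangle> = 1 / S.\<close>

lemma root_T_positive:
  assumes \<alpha>: "\<alpha> \<in> \<Delta>"
  obtains a :: real where "a > 0" "\<alpha> (T \<alpha>) = of_real a"
proof -
  have "\<forall>\<beta>\<in>\<Delta>. \<exists>n::int. \<beta> (T \<alpha>) = of_int n / 2 * \<alpha> (T \<alpha>)"
    using root_string_integer[OF \<alpha>] by metis
  then obtain n :: "('g \<Rightarrow> complex) \<Rightarrow> int" where n: "\<And>\<beta>. \<beta> \<in> \<Delta> \<Longrightarrow> \<beta> (T \<alpha>) = of_int (n \<beta>) / 2 * \<alpha> (T \<alpha>)"
    by metis
  define S where "S = (\<Sum>\<beta>\<in>\<Delta>. (real_of_int (n \<beta>) / 2)\<^sup>2)"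
  have "S \<ge> 0" by (simp add: S_def sum_nonneg)
  have "\<alpha> (T \<alpha>) = killing (T \<alpha>) (T \<alpha>)" by (simp add: killing_T T_h \<alpha>)
  also have "\<dots> = (\<Sum>\<beta>\<in>\<Delta>. (of_int (n \<beta>) / 2)\<^sup>2 * (\<alpha> (T \<alpha>))\<^sup>2)"
    unfolding killing_h_trace[OF T_h[OF \<alpha>] T_h[OF \<alpha>]]
    by (rule sum.cong) (auto simp: n power2_eq_square)
  also have "\<dots> = of_real S * (\<alpha> (T \<alpha>))\<^sup>2" by (simp add: S_def sum_distrib_right)
  finally have *: "of_real S * \<alpha> (T \<alpha>) = 1"
    using root_T_nonzero[OF \<alpha>] by (simp add: power2_eq_square)
  then have "S \<noteq> 0" by auto
  then have "\<alpha> (T \<alpha>) = of_real (1 / S)" using * by (simp add: field_simps)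
  then show thesis using that[of "1 / S"] \<open>S \<ge> 0\<close> \<open>S \<noteq> 0\<close> by simp
qed

subsection \<open>Bases and positive roots\<close>

lemma ex1_eq: "\<exists>!x. Q x \<Longrightarrow> Q a \<Longrightarrow> Q b \<Longrightarrow> a = b"
  by blast

lemma base_finite: "root_base h P \<Longrightarrow> finite P"
  and base_roots: "root_base h P \<Longrightarrow> P \<subseteq> \<Delta>"
  by (auto simp: root_base_def)

lemma base_unique:
  assumes P: "root_base h P" and eq: "(\<lambda>x. \<Sum>\<alpha>\<in>P. c \<alpha> * \<alpha> x) = (\<lambda>x. \<Sum>\<alpha>\<in>P. d \<alpha> * \<alpha> x)" and "\<alpha> \<in> P"
  shows "c \<alpha> = d \<alpha>"
proof -
  let ?l = "\<lambda>x. \<Sum>\<alpha>\<in>P. c \<alpha> * \<alpha> x"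
  have "?l \<in> hdual h" using base_roots[OF P] root_hdual by (intro hdual_sum) auto
  then have ex1: "\<exists>!c. (\<forall>\<alpha>. \<alpha> \<notin> P \<longrightarrow> c \<alpha> = 0) \<and> ?l = (\<lambda>x. \<Sum>\<alpha>\<in>P. c \<alpha> * \<alpha> x)"
    using P unfolding root_base_def by blast
  let ?Q = "\<lambda>c. (\<forall>\<alpha>. \<alpha> \<notin> P \<longrightarrow> c \<alpha> = 0) \<and> ?l = (\<lambda>x. \<Sum>\<alpha>\<in>P. c \<alpha> * \<alpha> x)"
  \<comment> \<open>Uniqueness in \<open>root_base\<close> concerns coefficient functions that
    vanish off \<open>P\<close>, so both are truncated.\<close>
  have "?Q (\<lambda>\<alpha>. if \<alpha> \<in> P then c \<alpha> else 0)" by (auto intro!: sum.cong)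
  moreover have "?Q (\<lambda>\<alpha>. if \<alpha> \<in> P then d \<alpha> else 0)"
    unfolding eq by (auto intro!: sum.cong)
  ultimately have "(\<lambda>\<alpha>. if \<alpha> \<in> P then c \<alpha> else 0) = (\<lambda>\<alpha>. if \<alpha> \<in> P then d \<alpha> else 0)"
    by (rule ex1_eq[OF ex1])
  from fun_cong[OF this, of \<alpha>] show ?thesis using \<open>\<alpha> \<in> P\<close> by simp
qed

lemma gen_roots_root: "\<beta> \<in> gen_roots h S \<Longrightarrow> \<beta> \<in> \<Delta>"
  by (simp add: gen_roots_def)

lemma gen_roots_mono:
  assumes "S \<subseteq> P" "finite P"
  shows "gen_roots h S \<subseteq> gen_roots h P"
proof
  fix \<beta> assume "\<beta> \<in> gen_roots h S"
  then obtain n :: "('g \<Rightarrow> complex) \<Rightarrow> nat" where \<beta>: "\<beta> \<in> \<Delta>" "\<beta> = (\<lambda>x. \<Sum>\<alpha>\<in>S. of_nat (n \<alpha>) * \<alpha> x)"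
    by (auto simp: gen_roots_def)
  have "(\<Sum>\<alpha>\<in>S. of_nat (n \<alpha>) * \<alpha> x) = (\<Sum>\<alpha>\<in>P. of_nat (if \<alpha> \<in> S then n \<alpha> else 0) * \<alpha> x)" for x
    by (rule sum.mono_neutral_cong_left) (use assms in auto)
  then have "\<beta> = (\<lambda>x. \<Sum>\<alpha>\<in>P. of_nat (if \<alpha> \<in> S then n \<alpha> else 0) * \<alpha> x)" using \<beta>(2) by simp
  then show "\<beta> \<in> gen_roots h P"
    using \<beta>(1) unfolding gen_roots_def by (intro CollectI conjI exI[of _ "\<lambda>\<alpha>. if \<alpha> \<in> S then n \<alpha> else 0"])
qed

lemma gen_roots_simple:
  assumes "finite S" "S \<subseteq> \<Delta>" "\<alpha> \<in> S"
  shows "\<alpha> \<in> gen_roots h S"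
proof -
  have "(\<Sum>\<beta>\<in>S. of_nat (if \<beta> = \<alpha> then 1 else 0) * \<beta> x) = \<alpha> x" for x
  proof -
    have "(\<Sum>\<beta>\<in>S. of_nat (if \<beta> = \<alpha> then 1 else 0) * \<beta> x) = (\<Sum>\<beta>\<in>S. if \<beta> = \<alpha> then \<alpha> x else 0)"
      by (rule sum.cong) auto
    then show ?thesis using assms by (simp add: sum.delta)
  qed
  then show ?thesis using assms unfolding gen_roots_def
    by (intro CollectI conjI exI[of _ "\<lambda>\<beta>. if \<beta> = \<alpha> then 1 else 0"]) auto
qed

lemma gen_roots_add:
  assumes "\<alpha> \<in> gen_roots h S" "\<beta> \<in> gen_roots h S" "\<alpha> + \<beta> \<in> \<Delta>"
  shows "\<alpha> + \<beta> \<in> gen_roots h S"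
proof -
  obtain n m :: "('g \<Rightarrow> complex) \<Rightarrow> nat" where
    n: "\<alpha> = (\<lambda>x. \<Sum>\<alpha>\<in>S. of_nat (n \<alpha>) * \<alpha> x)" and m: "\<beta> = (\<lambda>x. \<Sum>\<alpha>\<in>S. of_nat (m \<alpha>) * \<alpha> x)"
    using assms(1,2) unfolding gen_roots_def by blast
  have "(\<alpha> + \<beta>) x = (\<Sum>\<gamma>\<in>S. of_nat (n \<gamma> + m \<gamma>) * \<gamma> x)" for x
    using fun_cong[OF n, of x] fun_cong[OF m, of x] by (simp add: algebra_simps sum.distrib)
  then have "\<alpha> + \<beta> = (\<lambda>x. \<Sum>\<gamma>\<in>S. of_nat (n \<gamma> + m \<gamma>) * \<gamma> x)" by blast
  then show ?thesis using assms(3) unfolding gen_roots_def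
    by (intro CollectI conjI exI[of _ "\<lambda>\<gamma>. n \<gamma> + m \<gamma>"])
qed

lemma T_symmetric: "\<alpha> \<in> \<Delta> \<Longrightarrow> \<beta> \<in> \<Delta> \<Longrightarrow> \<alpha> (T \<beta>) = \<beta> (T \<alpha>)"
  using killing_T[of \<alpha> "T \<beta>"] killing_T[of \<beta> "T \<alpha>"] T_h by (simp add: killing_commute)

text \<open>Since \<open>\<langle>\<beta>, \<beta>\<rangle> > 0\<close>, some simple root \<open>\<alpha>\<close> that occurs in \<open>\<beta>\<close> satisfies \<open>\<langle>\<beta>, \<alpha>\<rangle> > 0\<close>, and then
  \<open>\<beta> - \<alpha>\<close> is on the root string.\<close>

lemma gen_roots_step:
  assumes S: "finite S" "S \<subseteq> \<Delta>" and \<beta>: "\<beta> \<in> \<Delta>" "\<beta> = (\<lambda>x. \<Sum>\<alpha>\<in>S. of_nat (n \<alpha> :: nat) * \<alpha> x)" "\<beta> \<notin> S"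
  obtains \<alpha> where "\<alpha> \<in> S" "n \<alpha> > 0" "\<beta> - \<alpha> \<in> \<Delta>"
    "\<beta> - \<alpha> = (\<lambda>x. \<Sum>\<gamma>\<in>S. of_nat ((n(\<alpha> := n \<alpha> - 1)) \<gamma>) * \<gamma> x)"
proof -
  have "\<exists>\<alpha>\<in>S. n \<alpha> > 0 \<and> Re (\<beta> (T \<alpha>)) > 0"
  proof (rule ccontr)
    assume *: "\<not> ?thesis"
    obtain b where b: "b > 0" "\<beta> (T \<beta>) = of_real b" using root_T_positive[OF \<beta>(1)] by blast
    have "\<beta> (T \<beta>) = (\<Sum>\<alpha>\<in>S. of_nat (n \<alpha>) * \<beta> (T \<alpha>))"
      using fun_cong[OF \<beta>(2), of "T \<beta>"] S(2) \<beta>(1) by (auto simp: T_symmetric subset_iff intro!: sum.cong)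
    then have "b = (\<Sum>\<alpha>\<in>S. of_nat (n \<alpha>) * Re (\<beta> (T \<alpha>)))"
      using arg_cong[OF b(2), of Re] by simp
    also have "\<dots> \<le> 0"
    proof (rule sum_nonpos)
      fix \<alpha> assume "\<alpha> \<in> S"
      then show "of_nat (n \<alpha>) * Re (\<beta> (T \<alpha>)) \<le> 0"
        using * by (cases "n \<alpha> = 0") (auto simp: mult_le_0_iff not_less)
    qed
    finally show False using b(1) by simp
  qed
  then obtain \<alpha> where \<alpha>: "\<alpha> \<in> S" "n \<alpha> > 0" "Re (\<beta> (T \<alpha>)) > 0" by blast
  then have \<alpha>r: "\<alpha> \<in> \<Delta>" using S(2) by blast
  obtain a where a: "a > 0" "\<alpha> (T \<alpha>) = of_real a" using root_T_positive[OF \<alpha>r] by blast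
  obtain k :: int where k: "\<beta> (T \<alpha>) = of_int k / 2 * \<alpha> (T \<alpha>)" using root_string_integer[OF \<alpha>r \<beta>(1)] .
  have "Re (\<beta> (T \<alpha>)) = of_int k / 2 * a" unfolding k a(2) by simp
  then have "real_of_int k * a > 0" using \<alpha>(3) by simp
  then have k0: "k > 0" using a(1) by (simp add: zero_less_mult_iff)
  have "root_space h (\<lambda>t. \<beta> t - of_nat 1 * \<alpha> t) \<noteq> {0}"
  proof (rule root_string_member[OF \<alpha>r \<beta>(1), of "nat k"])
    show "\<beta> (T \<alpha>) = of_nat (nat k) / 2 * \<alpha> (T \<alpha>)" using k k0 by simp
  qed (use k0 in simp)
  moreover have "(\<lambda>t. \<beta> t - of_nat 1 * \<alpha> t) = \<beta> - \<alpha>" by auto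
  moreover have "\<beta> - \<alpha> \<noteq> 0" using \<beta>(3) \<alpha>(1) by auto
  ultimately have r: "\<beta> - \<alpha> \<in> \<Delta>"
    using hdual_diff[OF root_hdual[OF \<beta>(1)] root_hdual[OF \<alpha>r]] by (simp add: roots_def)
  have "(\<beta> - \<alpha>) x = (\<Sum>\<gamma>\<in>S. of_nat ((n(\<alpha> := n \<alpha> - 1)) \<gamma>) * \<gamma> x)" for x
  proof -
    have "(\<Sum>\<gamma>\<in>S. of_nat ((n(\<alpha> := n \<alpha> - 1)) \<gamma>) * \<gamma> x)
      = (of_nat (n \<alpha>) - 1) * \<alpha> x + (\<Sum>\<gamma>\<in>S - {\<alpha>}. of_nat (n \<gamma>) * \<gamma> x)"
      using \<alpha> S(1) by (subst sum.remove[of S \<alpha>]) (auto simp: of_nat_diff intro!: sum.cong)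
    also have "\<dots> = (\<Sum>\<gamma>\<in>S. of_nat (n \<gamma>) * \<gamma> x) - \<alpha> x"
      by (simp add: sum.remove[OF S(1) \<alpha>(1)] algebra_simps)
    finally show ?thesis using fun_cong[OF \<beta>(2), of x] by simp
  qed
  then have "\<beta> - \<alpha> = (\<lambda>x. \<Sum>\<gamma>\<in>S. of_nat ((n(\<alpha> := n \<alpha> - 1)) \<gamma>) * \<gamma> x)" by blast
  with \<alpha> r that show thesis by blast
qed

text \<open>A root of [S] is reached from a simple root by adding elements of \<open>S\<close> one
  at a time without leaving the roots. This is induction on the height, with
  \<open>gen_roots_step\<close> going down.\<close>

lemma gen_roots_induct [consumes 3, case_names simple add]:
  assumes S: "finite S" "S \<subseteq> \<Delta>" and \<beta>: "\<beta> \<in> gen_roots h S"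
    and simple: "\<And>\<alpha>. \<alpha> \<in> S \<Longrightarrow> Q \<alpha>"
    and add: "\<And>\<beta> \<alpha>. \<beta> \<in> gen_roots h S \<Longrightarrow> \<alpha> \<in> S \<Longrightarrow> \<beta> + \<alpha> \<in> \<Delta> \<Longrightarrow> Q \<beta> \<Longrightarrow> Q (\<beta> + \<alpha>)"
  shows "Q \<beta>"
proof -
  have "\<beta> \<in> \<Delta> \<Longrightarrow> \<beta> = (\<lambda>x. \<Sum>\<alpha>\<in>S. of_nat (n \<alpha> :: nat) * \<alpha> x) \<Longrightarrow> Q \<beta>" for n
  proof (induction "\<Sum>\<alpha>\<in>S. n \<alpha>" arbitrary: \<beta> n rule: less_induct)
    case less
    show ?case
    proof (cases "\<beta> \<in> S")
      case False
      obtain \<alpha> where \<alpha>: "\<alpha> \<in> S" "n \<alpha> > 0" "\<beta> - \<alpha> \<in> \<Delta>"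
        "\<beta> - \<alpha> = (\<lambda>x. \<Sum>\<gamma>\<in>S. of_nat ((n(\<alpha> := n \<alpha> - 1)) \<gamma>) * \<gamma> x)"
        using gen_roots_step[OF S less.prems False] by blast
      have "sum (n(\<alpha> := n \<alpha> - 1)) S < sum n S"
        by (rule sum_strict_mono_ex1) (use S(1) \<alpha>(1,2) in auto)
      from less.hyps[OF this \<alpha>(3,4)] have "Q (\<beta> - \<alpha>)" .
      moreover have "\<beta> - \<alpha> \<in> gen_roots h S" unfolding gen_roots_def using \<alpha>(3,4) by blast
      ultimately show ?thesis using add[of "\<beta> - \<alpha>" \<alpha>] \<alpha>(1) less.prems(1) by simp
    qed (rule simple)
  qed
  moreover obtain n :: "('g \<Rightarrow> complex) \<Rightarrow> nat" where "\<beta> \<in> \<Delta>" "\<beta> = (\<lambda>x. \<Sum>\<alpha>\<in>S. of_nat (n \<alpha>) * \<alpha> x)"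
    using \<beta> unfolding gen_roots_def by blast
  ultimately show ?thesis by blast
qed

lemma pos_or_neg:
  assumes P: "root_base h P" and \<beta>: "\<beta> \<in> \<Delta>"
  shows "\<beta> \<in> gen_roots h P \<or> - \<beta> \<in> gen_roots h P"
proof -
  obtain n :: "('g \<Rightarrow> complex) \<Rightarrow> nat" where
    "\<beta> = (\<lambda>x. \<Sum>\<alpha>\<in>P. of_nat (n \<alpha>) * \<alpha> x) \<or> \<beta> = (\<lambda>x. - (\<Sum>\<alpha>\<in>P. of_nat (n \<alpha>) * \<alpha> x))"
    using P \<beta> unfolding root_base_def by blast
  then show ?thesis
  proof
    assume "\<beta> = (\<lambda>x. \<Sum>\<alpha>\<in>P. of_nat (n \<alpha>) * \<alpha> x)"
    then show ?thesis using \<beta> unfolding gen_roots_def by blast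
  next
    assume "\<beta> = (\<lambda>x. - (\<Sum>\<alpha>\<in>P. of_nat (n \<alpha>) * \<alpha> x))"
    then have "- \<beta> = (\<lambda>x. \<Sum>\<alpha>\<in>P. of_nat (n \<alpha>) * \<alpha> x)" by (simp add: fun_eq_iff)
    then show ?thesis using root_minus[OF \<beta>] unfolding gen_roots_def by blast
  qed
qed

text \<open>The Killing form carries the base to the vectors \<open>T \<alpha>\<close>, which
  therefore form a basis of \<open>h\<close>; \<open>D\<close> is its dual basis. For
  \<open>P0\<close> these are the functionals \<open>hstar\<close>.\<close>

lemma base_dual:
  assumes P: "root_base h P"
  obtains D where "\<And>\<alpha>. \<alpha> \<in> P \<Longrightarrow> D \<alpha> \<in> hdual h"
    "\<And>\<alpha> \<beta>. \<alpha> \<in> P \<Longrightarrow> \<beta> \<in> P \<Longrightarrow> D \<alpha> (T \<beta>) = (if \<beta> = \<alpha> then 1 else 0)"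
    "\<And>t. t \<in> h \<Longrightarrow> (\<Sum>\<alpha>\<in>P. D \<alpha> t *\<^sub>C T \<alpha>) = t"
proof -
  have Pr: "\<And>\<alpha>. \<alpha> \<in> P \<Longrightarrow> \<alpha> \<in> \<Delta>" using base_roots[OF P] by blast
  have "\<exists>c. t = (\<Sum>\<alpha>\<in>P. c \<alpha> *\<^sub>C T \<alpha>)" if t: "t \<in> h" for t
  proof -
    define l where "l x = (if x \<in> h then killing t x else 0)" for x
    have "l \<in> hdual h" by (auto simp: l_def hdual_def h_add h_scaleC killing_linear)
    then obtain c where c: "l = (\<lambda>x. \<Sum>\<alpha>\<in>P. c \<alpha> * \<alpha> x)" using base_span[OF P] by blast
    have "t - (\<Sum>\<alpha>\<in>P. c \<alpha> *\<^sub>C T \<alpha>) = 0"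
    proof (rule killing_h_nondegenerate)
      show "t - (\<Sum>\<alpha>\<in>P. c \<alpha> *\<^sub>C T \<alpha>) \<in> h" using t Pr T_h by (intro h_diff h_sum h_scaleC) auto
      show "killing (t - (\<Sum>\<alpha>\<in>P. c \<alpha> *\<^sub>C T \<alpha>)) y = 0" if y: "y \<in> h" for y
        using fun_cong[OF c, of y] y Pr by (simp add: l_def killing_linear killing_T)
    qed
    then show ?thesis by (intro exI[of _ c]) simp
  qed
  then obtain c where c: "\<And>t. t \<in> h \<Longrightarrow> t = (\<Sum>\<alpha>\<in>P. c t \<alpha> *\<^sub>C T \<alpha>)" by metis
  have unique: "d \<alpha> = c t \<alpha>" if "t \<in> h" "t = (\<Sum>\<alpha>\<in>P. d \<alpha> *\<^sub>C T \<alpha>)" "\<alpha> \<in> P" for d t \<alpha>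
  proof -
    \<comment> \<open>Pairing a combination of the \<open>T \<alpha>\<close> with \<open>x\<close>
      turns it into the same combination of roots, where coefficients are unique.\<close>
    have "(\<Sum>\<alpha>\<in>P. d \<alpha> * \<alpha> x) = (\<Sum>\<alpha>\<in>P. c t \<alpha> * \<alpha> x)" for x
    proof (cases "x \<in> h")
      case True
      have "killing (\<Sum>\<alpha>\<in>P. d \<alpha> *\<^sub>C T \<alpha>) x = killing (\<Sum>\<alpha>\<in>P. c t \<alpha> *\<^sub>C T \<alpha>) x"
        using that(2) c[OF that(1)] by simp
      then show ?thesis using True Pr by (simp add: killing_linear killing_T)
    next
      case False
      then show ?thesis using Pr root_hdual hdual_outside by (auto intro!: sum.cong)
    qed
    then show ?thesis using base_unique[OF P _ that(3), of d "c t"] by blast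
  qed
  define D where "D \<alpha> t = (if t \<in> h then c t \<alpha> else 0)" for \<alpha> t
  show thesis
  proof
    fix \<alpha> assume \<alpha>: "\<alpha> \<in> P"
    have "c (x + y) \<alpha> = c x \<alpha> + c y \<alpha>" if "x \<in> h" "y \<in> h" for x y
      by (rule sym, rule unique[of "x + y" "\<lambda>\<alpha>. c x \<alpha> + c y \<alpha>" \<alpha>])
         (use that \<alpha> c[of x] c[of y] h_add in \<open>simp_all add: scaleC_add_left sum.distrib\<close>)
    moreover have "c (k *\<^sub>C x) \<alpha> = k * c x \<alpha>" if "x \<in> h" for x k
    proof (rule sym, rule unique[of "k *\<^sub>C x" "\<lambda>\<alpha>. k * c x \<alpha>" \<alpha>])
      show "k *\<^sub>C x = (\<Sum>\<alpha>\<in>P. (k * c x \<alpha>) *\<^sub>C T \<alpha>)"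
        using arg_cong[OF c[OF that], of "\<lambda>y. k *\<^sub>C y"] by (simp add: cvs.scale_sum_right scaleC_scaleC)
    qed (use that \<alpha> h_scaleC in auto)
    ultimately show "D \<alpha> \<in> hdual h" by (auto simp: D_def hdual_def h_add h_scaleC)
    fix \<beta> assume \<beta>: "\<beta> \<in> P"
    have "(if \<alpha> = \<beta> then 1 else 0) = c (T \<beta>) \<alpha>"
    proof (rule unique)
      have "(\<Sum>\<alpha>\<in>P. (if \<alpha> = \<beta> then 1 else 0) *\<^sub>C T \<alpha>) = (\<Sum>\<alpha>\<in>P. if \<alpha> = \<beta> then T \<beta> else 0)"
        by (rule sum.cong) (auto simp: scaleC_one)
      also have "\<dots> = T \<beta>" using \<beta> base_finite[OF P] by simp
      finally show "T \<beta> = (\<Sum>\<alpha>\<in>P. (if \<alpha> = \<beta> then 1 else 0) *\<^sub>C T \<alpha>)" by simp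
    qed (use \<alpha> \<beta> Pr T_h in auto)
    then show "D \<alpha> (T \<beta>) = (if \<beta> = \<alpha> then 1 else 0)" using Pr[OF \<beta>] T_h by (auto simp: D_def)
  next
    fix t assume t: "t \<in> h"
    then have "(\<Sum>\<alpha>\<in>P. D \<alpha> t *\<^sub>C T \<alpha>) = (\<Sum>\<alpha>\<in>P. c t \<alpha> *\<^sub>C T \<alpha>)"
      by (simp add: D_def)
    also have "\<dots> = t" by (rule c[OF t, symmetric])
    finally show "(\<Sum>\<alpha>\<in>P. D \<alpha> t *\<^sub>C T \<alpha>) = t" .
  qed
qed

lemma hdual_interpolation:
  assumes P: "root_base h P"
  obtains l where "l \<in> hdual h" "\<And>\<alpha>. \<alpha> \<in> P \<Longrightarrow> l (T \<alpha>) = v \<alpha>"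
proof -
  obtain D where D: "\<And>\<alpha>. \<alpha> \<in> P \<Longrightarrow> D \<alpha> \<in> hdual h"
    "\<And>\<alpha> \<beta>. \<alpha> \<in> P \<Longrightarrow> \<beta> \<in> P \<Longrightarrow> D \<alpha> (T \<beta>) = (if \<beta> = \<alpha> then 1 else 0)"
    by (rule base_dual[OF P]) (rule that)
  show thesis
  proof
    show "(\<lambda>x. \<Sum>\<alpha>\<in>P. v \<alpha> * D \<alpha> x) \<in> hdual h" by (rule hdual_sum[OF D(1)])
    fix \<beta> assume \<beta>: "\<beta> \<in> P"
    have "(\<Sum>\<alpha>\<in>P. v \<alpha> * D \<alpha> (T \<beta>)) = (\<Sum>\<alpha>\<in>P. if \<beta> = \<alpha> then v \<beta> else 0)"
      by (rule sum.cong) (use D(2) \<beta> in auto)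
    then show "(\<Sum>\<alpha>\<in>P. v \<alpha> * D \<alpha> (T \<beta>)) = v \<beta>" using \<beta> base_finite[OF P] by simp
  qed
qed

lemma T_add:
  assumes "\<alpha> \<in> \<Delta>" "\<beta> \<in> \<Delta>" "\<alpha> + \<beta> \<in> \<Delta>"
  shows "T (\<alpha> + \<beta>) = T \<alpha> + T \<beta>"
proof -
  have "T (\<alpha> + \<beta>) - (T \<alpha> + T \<beta>) = 0"
    by (rule killing_h_nondegenerate)
       (use assms in \<open>auto simp: killing_linear killing_T intro!: h_diff h_add T_h\<close>)
  then show ?thesis by simp
qed

lemma T_combination:
  assumes "S \<subseteq> \<Delta>" "\<beta> \<in> \<Delta>" "\<beta> = (\<lambda>x. \<Sum>\<alpha>\<in>S. n \<alpha> * \<alpha> x)"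
  shows "T \<beta> = (\<Sum>\<alpha>\<in>S. n \<alpha> *\<^sub>C T \<alpha>)"
proof -
  have "T \<beta> - (\<Sum>\<alpha>\<in>S. n \<alpha> *\<^sub>C T \<alpha>) = 0"
  proof (rule killing_h_nondegenerate)
    show "T \<beta> - (\<Sum>\<alpha>\<in>S. n \<alpha> *\<^sub>C T \<alpha>) \<in> h"
      using assms by (intro h_diff h_sum h_scaleC T_h) auto
    fix y assume y: "y \<in> h"
    have "(\<Sum>\<alpha>\<in>S. n \<alpha> * killing (T \<alpha>) y) = (\<Sum>\<alpha>\<in>S. n \<alpha> * \<alpha> y)"
      by (rule sum.cong) (use y assms(1) in \<open>auto simp: killing_T\<close>)
    then show "killing (T \<beta> - (\<Sum>\<alpha>\<in>S. n \<alpha> *\<^sub>C T \<alpha>)) y = 0"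
      using fun_cong[OF assms(3), of y] y assms(2) by (simp add: killing_linear killing_T)
  qed
  then show ?thesis by simp
qed

subsection \<open>Reflected bases\<close>

definition reflect :: "('g \<Rightarrow> complex) \<Rightarrow> ('g \<Rightarrow> complex) \<Rightarrow> ('g \<Rightarrow> complex)"
  where "reflect \<alpha> l = (\<lambda>t. l t - (2 * l (T \<alpha>) / \<alpha> (T \<alpha>)) * \<alpha> t)"

lemma reflect_root: "\<alpha> \<in> \<Delta> \<Longrightarrow> \<beta> \<in> \<Delta> \<Longrightarrow> reflect \<alpha> \<beta> \<in> \<Delta>"
  unfolding reflect_def by (rule root_reflection)

lemma reflect_reflect: "\<alpha> \<in> \<Delta> \<Longrightarrow> reflect \<alpha> (reflect \<alpha> l) = l"
  using root_T_nonzero[of \<alpha>] by (simp add: reflect_def fun_eq_iff)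

lemma reflect_self: "\<alpha> \<in> \<Delta> \<Longrightarrow> reflect \<alpha> \<alpha> = - \<alpha>"
  using root_T_nonzero[of \<alpha>] by (simp add: reflect_def fun_eq_iff)

lemma reflect_sum: "reflect \<alpha> (\<lambda>x. \<Sum>\<beta>\<in>P. c \<beta> * \<beta> x) = (\<lambda>x. \<Sum>\<beta>\<in>P. c \<beta> * reflect \<alpha> \<beta> x)"
  by (simp add: reflect_def fun_eq_iff sum_subtractf right_diff_distrib sum_distrib_left sum_distrib_right
      sum_divide_distrib mult_ac)

lemma reflect_minus: "reflect \<alpha> (\<lambda>x. - l x) = (\<lambda>x. - reflect \<alpha> l x)"
  by (simp add: reflect_def fun_eq_iff)

lemma reflect_hdual: "\<alpha> \<in> \<Delta> \<Longrightarrow> l \<in> hdual h \<Longrightarrow> reflect \<alpha> l \<in> hdual h"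
  unfolding reflect_def using root_string_hdual[of \<alpha> l "- (2 * l (T \<alpha>) / \<alpha> (T \<alpha>))"] by simp

lemma reflect_inj_on: "\<alpha> \<in> \<Delta> \<Longrightarrow> inj_on (reflect \<alpha>) A"
  by (metis inj_on_inverseI reflect_reflect)

lemma reflect_image_sum:
  assumes "\<alpha> \<in> \<Delta>"
  shows "(\<lambda>x. \<Sum>\<gamma>\<in>reflect \<alpha> ` P. c \<gamma> * \<gamma> x) = reflect \<alpha> (\<lambda>x. \<Sum>\<beta>\<in>P. c (reflect \<alpha> \<beta>) * \<beta> x)"
  unfolding reflect_sum by (rule ext) (simp add: sum.reindex reflect_inj_on assms)

text \<open>The reflection is a linear involution permuting the roots, so expansions are transported
  by composing the coefficients with it.\<close>

lemma reflect_base: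
  assumes P: "root_base h P" and \<alpha>: "\<alpha> \<in> \<Delta>"
  shows "root_base h (reflect \<alpha> ` P)"
  unfolding root_base_def
proof (intro conjI ballI)
  let ?s = "reflect \<alpha>"
  show "finite (?s ` P)" using base_finite[OF P] by simp
  show "?s ` P \<subseteq> \<Delta>" using base_roots[OF P] reflect_root[OF \<alpha>] by blast
  have mem: "\<gamma> \<in> ?s ` P \<longleftrightarrow> ?s \<gamma> \<in> P" for \<gamma> using reflect_reflect[OF \<alpha>] by (metis image_iff)
  show "\<exists>!c. (\<forall>\<beta>. \<beta> \<notin> ?s ` P \<longrightarrow> c \<beta> = 0) \<and> l = (\<lambda>x. \<Sum>\<beta>\<in>?s ` P. c \<beta> * \<beta> x)"
    if l: "l \<in> hdual h" for l
  proof -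
    have "\<exists>!c. (\<forall>\<beta>. \<beta> \<notin> P \<longrightarrow> c \<beta> = 0) \<and> ?s l = (\<lambda>x. \<Sum>\<beta>\<in>P. c \<beta> * \<beta> x)"
      using P reflect_hdual[OF \<alpha> l] unfolding root_base_def by blast
    then obtain c where c: "\<forall>\<beta>. \<beta> \<notin> P \<longrightarrow> c \<beta> = 0" "?s l = (\<lambda>x. \<Sum>\<beta>\<in>P. c \<beta> * \<beta> x)"
      and cu: "\<And>d. (\<forall>\<beta>. \<beta> \<notin> P \<longrightarrow> d \<beta> = 0) \<Longrightarrow> ?s l = (\<lambda>x. \<Sum>\<beta>\<in>P. d \<beta> * \<beta> x) \<Longrightarrow> d = c"
      by blast
    show ?thesis
    proof (intro ex1I[of _ "\<lambda>\<gamma>. c (?s \<gamma>)"] conjI)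
      show "\<forall>\<beta>. \<beta> \<notin> ?s ` P \<longrightarrow> c (?s \<beta>) = 0" using c(1) mem by blast
      show "l = (\<lambda>x. \<Sum>\<beta>\<in>?s ` P. c (?s \<beta>) * \<beta> x)"
        unfolding reflect_image_sum[OF \<alpha>] reflect_reflect[OF \<alpha>] c(2)[symmetric] ..
      fix d assume d: "(\<forall>\<beta>. \<beta> \<notin> ?s ` P \<longrightarrow> d \<beta> = 0) \<and> l = (\<lambda>x. \<Sum>\<beta>\<in>?s ` P. d \<beta> * \<beta> x)"
      have "(\<lambda>\<beta>. d (?s \<beta>)) = c"
      proof (rule cu)
        show "\<forall>\<beta>. \<beta> \<notin> P \<longrightarrow> d (?s \<beta>) = 0" using d mem reflect_reflect[OF \<alpha>] by metis
        have "l = ?s (\<lambda>x. \<Sum>\<beta>\<in>P. d (?s \<beta>) * \<beta> x)"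
          unfolding reflect_image_sum[OF \<alpha>, symmetric] using d by blast
        from arg_cong[OF this, of ?s] show "?s l = (\<lambda>x. \<Sum>\<beta>\<in>P. d (?s \<beta>) * \<beta> x)"
          by (simp only: reflect_reflect[OF \<alpha>])
      qed
      then have "c (?s \<gamma>) = d (?s (?s \<gamma>))" for \<gamma> by blast
      then show "d = (\<lambda>\<gamma>. c (?s \<gamma>))" by (simp add: reflect_reflect[OF \<alpha>])
    qed
  qed
  show "\<exists>n::('g \<Rightarrow> complex) \<Rightarrow> nat. \<beta> = (\<lambda>x. \<Sum>\<gamma>\<in>?s ` P. of_nat (n \<gamma>) * \<gamma> x) \<or>
      \<beta> = (\<lambda>x. - (\<Sum>\<gamma>\<in>?s ` P. of_nat (n \<gamma>) * \<gamma> x))" if \<beta>: "\<beta> \<in> \<Delta>" for \<beta>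
  proof -
    obtain n :: "('g \<Rightarrow> complex) \<Rightarrow> nat" where
      n: "?s \<beta> = (\<lambda>x. \<Sum>\<gamma>\<in>P. of_nat (n \<gamma>) * \<gamma> x) \<or> ?s \<beta> = (\<lambda>x. - (\<Sum>\<gamma>\<in>P. of_nat (n \<gamma>) * \<gamma> x))"
      using P reflect_root[OF \<alpha> \<beta>] unfolding root_base_def by blast
    have im: "(\<lambda>x. \<Sum>\<gamma>\<in>?s ` P. of_nat (n (?s \<gamma>)) * \<gamma> x) = ?s (\<lambda>x. \<Sum>\<gamma>\<in>P. of_nat (n \<gamma>) * \<gamma> x)"
      using reflect_image_sum[OF \<alpha>, of "\<lambda>\<gamma>. of_nat (n (?s \<gamma>))" P] reflect_reflect[OF \<alpha>] by simp
    from n show ?thesis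
    proof
      assume *: "?s \<beta> = (\<lambda>x. \<Sum>\<gamma>\<in>P. of_nat (n \<gamma>) * \<gamma> x)"
      then have "\<beta> = (\<lambda>x. \<Sum>\<gamma>\<in>?s ` P. of_nat (n (?s \<gamma>)) * \<gamma> x)"
        using im reflect_reflect[OF \<alpha>, of \<beta>] by simp
      then show ?thesis by (intro exI[of _ "\<lambda>\<gamma>. n (?s \<gamma>)"] disjI1)
    next
      assume *: "?s \<beta> = (\<lambda>x. - (\<Sum>\<gamma>\<in>P. of_nat (n \<gamma>) * \<gamma> x))"
      have "\<beta> = ?s (?s \<beta>)" by (rule reflect_reflect[OF \<alpha>, symmetric])
      also have "\<dots> = (\<lambda>x. - (\<Sum>\<gamma>\<in>?s ` P. of_nat (n (?s \<gamma>)) * \<gamma> x))"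
        unfolding * reflect_minus using fun_cong[OF im] by simp
      finally show ?thesis by (intro exI[of _ "\<lambda>\<gamma>. n (?s \<gamma>)"] disjI2)
    qed
  qed
qed

lemma not_pos_and_neg:
  assumes P: "root_base h P" and \<beta>: "\<beta> \<in> gen_roots h P"
  shows "- \<beta> \<notin> gen_roots h P"
proof
  assume "- \<beta> \<in> gen_roots h P"
  then obtain m :: "('g \<Rightarrow> complex) \<Rightarrow> nat" where m: "- \<beta> = (\<lambda>x. \<Sum>\<alpha>\<in>P. of_nat (m \<alpha>) * \<alpha> x)"
    unfolding gen_roots_def by blast
  obtain n :: "('g \<Rightarrow> complex) \<Rightarrow> nat" where n: "\<beta> = (\<lambda>x. \<Sum>\<alpha>\<in>P. of_nat (n \<alpha>) * \<alpha> x)"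
    using \<beta> unfolding gen_roots_def by blast
  have "(\<Sum>\<alpha>\<in>P. of_nat (n \<alpha> + m \<alpha>) * \<alpha> x) = (\<Sum>\<alpha>\<in>P. 0 * \<alpha> x)" for x
  proof -
    have "(\<Sum>\<alpha>\<in>P. of_nat (n \<alpha> + m \<alpha>) * \<alpha> x) = \<beta> x + (- \<beta>) x"
      unfolding fun_cong[OF n, of x] fun_cong[OF m, of x] by (simp add: ring_distribs sum.distrib)
    then show ?thesis by simp
  qed
  then have "of_nat (n \<alpha> + m \<alpha>) = (0::complex)" if "\<alpha> \<in> P" for \<alpha>
    by (rule base_unique[OF P ext that, of "\<lambda>\<alpha>. of_nat (n \<alpha> + m \<alpha>)" "\<lambda>_. 0"])
  then have "n \<alpha> + m \<alpha> = 0" if "\<alpha> \<in> P" for \<alpha> using of_nat_eq_0_iff[THEN iffD1] that by blast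
  then have "(\<Sum>\<alpha>\<in>P. of_nat (n \<alpha>) * \<alpha> x) = 0" for x by (intro sum.neutral) simp
  then have "\<beta> x = 0" for x using fun_cong[OF n, of x] by (simp only:)
  then have "\<beta> = 0" by (simp add: fun_eq_iff)
  then show False using root_nonzero[OF gen_roots_root[OF \<beta>]] by simp
qed

text \<open>The difference of \<beta> and its reflection is a multiple of \<alpha>. If the
  reflection were negative, this difference would have nonnegative coefficients that add without
  cancellation, so \<beta> would be a multiple of \<alpha>, hence \<alpha> itself by
  \<open>root_multiple\<close>.\<close>

lemma reflect_pos:
  assumes P: "root_base h P" and \<alpha>: "\<alpha> \<in> P" and \<beta>: "\<beta> \<in> gen_roots h P" "\<beta> \<noteq> \<alpha>"
  shows "reflect \<alpha> \<beta> \<in> gen_roots h P"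
proof (rule ccontr)
  assume "reflect \<alpha> \<beta> \<notin> gen_roots h P"
  have \<alpha>r: "\<alpha> \<in> \<Delta>" and \<beta>r: "\<beta> \<in> \<Delta>" using \<alpha> base_roots[OF P] gen_roots_root[OF \<beta>(1)] by auto
  have "- reflect \<alpha> \<beta> \<in> gen_roots h P"
    using \<open>reflect \<alpha> \<beta> \<notin> gen_roots h P\<close> pos_or_neg[OF P reflect_root[OF \<alpha>r \<beta>r]] by blast
  then obtain m :: "('g \<Rightarrow> complex) \<Rightarrow> nat" where m: "- reflect \<alpha> \<beta> = (\<lambda>x. \<Sum>\<alpha>\<in>P. of_nat (m \<alpha>) * \<alpha> x)"
    unfolding gen_roots_def by blast
  obtain n :: "('g \<Rightarrow> complex) \<Rightarrow> nat" where n: "\<beta> = (\<lambda>x. \<Sum>\<alpha>\<in>P. of_nat (n \<alpha>) * \<alpha> x)"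
    using \<beta>(1) unfolding gen_roots_def by blast
  define k where "k = 2 * \<beta> (T \<alpha>) / \<alpha> (T \<alpha>)"
  have "(\<Sum>\<gamma>\<in>P. (of_nat (n \<gamma>) + of_nat (m \<gamma>)) * \<gamma> x) = (\<Sum>\<gamma>\<in>P. (if \<gamma> = \<alpha> then k else 0) * \<gamma> x)" for x
  proof -
    have "(\<Sum>\<gamma>\<in>P. (if \<gamma> = \<alpha> then k else 0) * \<gamma> x) = (\<Sum>\<gamma>\<in>P. if \<gamma> = \<alpha> then k * \<alpha> x else 0)"
      by (rule sum.cong) auto
    also have "\<dots> = k * \<alpha> x" using \<alpha> base_finite[OF P] by simp
    also have "\<dots> = \<beta> x + (- reflect \<alpha> \<beta>) x" by (simp add: reflect_def k_def)
    also have "\<dots> = (\<Sum>\<gamma>\<in>P. of_nat (n \<gamma>) * \<gamma> x) + (\<Sum>\<gamma>\<in>P. of_nat (m \<gamma>) * \<gamma> x)"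
      using fun_cong[OF n, of x] fun_cong[OF m, of x] by simp
    finally show ?thesis by (simp add: algebra_simps sum.distrib)
  qed
  then have *: "of_nat (n \<gamma>) + of_nat (m \<gamma>) = (if \<gamma> = \<alpha> then k else 0)" if "\<gamma> \<in> P" for \<gamma>
    by (rule base_unique[OF P ext that, of "\<lambda>\<gamma>. of_nat (n \<gamma>) + of_nat (m \<gamma>)" "\<lambda>\<gamma>. if \<gamma> = \<alpha> then k else 0"])
  have "n \<gamma> = 0" if "\<gamma> \<in> P" "\<gamma> \<noteq> \<alpha>" for \<gamma>
    using *[OF that(1)] that(2) by (simp flip: of_nat_add)
  then have "(\<Sum>\<gamma>\<in>P. of_nat (n \<gamma>) * \<gamma> x) = of_nat (n \<alpha>) * \<alpha> x" for x
    by (subst sum.remove[OF base_finite[OF P] \<alpha>]) simp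
  then have \<beta>e: "\<beta> = (\<lambda>x. of_nat (n \<alpha>) * \<alpha> x)" using n by simp
  then have "n \<alpha> = 1" using root_multiple[OF \<alpha>r] \<beta>r by blast
  then show False using \<beta>e \<beta>(2) by simp
qed

lemma gen_roots_reflect:
  assumes P: "root_base h P" and \<alpha>: "\<alpha> \<in> \<Delta>"
  shows "gen_roots h (reflect \<alpha> ` P) = reflect \<alpha> ` gen_roots h P"
proof -
  have sub: "reflect \<alpha> \<beta> \<in> gen_roots h (reflect \<alpha> ` Q)" if "\<beta> \<in> gen_roots h Q" for Q \<beta>
  proof -
    obtain n :: "('g \<Rightarrow> complex) \<Rightarrow> nat" where n: "\<beta> \<in> \<Delta>" "\<beta> = (\<lambda>x. \<Sum>\<alpha>\<in>Q. of_nat (n \<alpha>) * \<alpha> x)"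
      using \<open>\<beta> \<in> gen_roots h Q\<close> unfolding gen_roots_def by blast
    have "(\<lambda>x. \<Sum>\<gamma>\<in>reflect \<alpha> ` Q. of_nat (n (reflect \<alpha> \<gamma>)) * \<gamma> x) = reflect \<alpha> (\<lambda>x. \<Sum>\<gamma>\<in>Q. of_nat (n \<gamma>) * \<gamma> x)"
      using reflect_image_sum[OF \<alpha>, of "\<lambda>\<gamma>. of_nat (n (reflect \<alpha> \<gamma>))" Q] reflect_reflect[OF \<alpha>] by simp
    then have "reflect \<alpha> \<beta> = (\<lambda>x. \<Sum>\<gamma>\<in>reflect \<alpha> ` Q. of_nat (n (reflect \<alpha> \<gamma>)) * \<gamma> x)" using n(2) by simp
    then show ?thesis using reflect_root[OF \<alpha> n(1)] unfolding gen_roots_def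
      by (intro CollectI conjI exI[of _ "\<lambda>\<gamma>. n (reflect \<alpha> \<gamma>)"])
  qed
  have "reflect \<alpha> ` reflect \<alpha> ` P = P" by (simp add: image_image reflect_reflect[OF \<alpha>])
  then have back_mem: "reflect \<alpha> \<beta> \<in> gen_roots h P" if "\<beta> \<in> gen_roots h (reflect \<alpha> ` P)" for \<beta>
    using sub[OF that] by simp
  show ?thesis
  proof (intro equalityI subsetI)
    fix \<beta> assume "\<beta> \<in> gen_roots h (reflect \<alpha> ` P)"
    then show "\<beta> \<in> reflect \<alpha> ` gen_roots h P"
      using imageI[OF back_mem, of \<beta> "reflect \<alpha>"] by (simp add: reflect_reflect[OF \<alpha>])
  qed (use sub in blast)
qed

subsection \<open>Parabolic sets of roots\<close>

text \<open>Among all bases take one with as many positive roots in \<open>Q\<close> as possible. If a simple root \<open>\<alpha>\<close> were not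
  in \<open>Q\<close>, then the reflection at \<open>\<alpha>\<close>, which only exchanges \<open>\<alpha>\<close> and \<open>-\<alpha>\<close> in the positive system, would
  give a better base.\<close>

lemma parabolic_base:
  assumes Q: "Q \<subseteq> \<Delta>" "\<And>\<alpha> \<beta>. \<alpha> \<in> Q \<Longrightarrow> \<beta> \<in> Q \<Longrightarrow> \<alpha> + \<beta> \<in> \<Delta> \<Longrightarrow> \<alpha> + \<beta> \<in> Q"
    "\<And>\<alpha>. \<alpha> \<in> \<Delta> \<Longrightarrow> \<alpha> \<in> Q \<or> - \<alpha> \<in> Q"
  obtains P where "root_base h P" "gen_roots h P \<subseteq> Q"
proof -
  have fin: "finite Q" using Q(1) finite_roots finite_subset by blast
  let ?c = "\<lambda>P. card (Q \<inter> gen_roots h P)"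
  \<comment> \<open>The counts are bounded by the cardinality of \<open>Q\<close>, so a maximum
    exists; the rule asks for a strict bound, hence the 1.\<close>
  have "\<exists>P. root_base h P \<and> (\<forall>P'. root_base h P' \<longrightarrow> ?c P' \<le> ?c P)"
    by (rule ex_has_greatest_nat[of "root_base h" P0 _ "card Q + 1"])
       (auto simp: root_base less_Suc_eq_le intro: card_mono fin)
  then obtain P where P: "root_base h P" and max: "\<And>P'. root_base h P' \<Longrightarrow> ?c P' \<le> ?c P" by blast
  have PQ: "P \<subseteq> Q"
  proof
    fix \<alpha> assume \<alpha>: "\<alpha> \<in> P"
    show "\<alpha> \<in> Q"
    proof (rule ccontr)
      assume nQ: "\<alpha> \<notin> Q"
      have \<alpha>r: "\<alpha> \<in> \<Delta>" using \<alpha> base_roots[OF P] by blast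
      have \<alpha>p: "\<alpha> \<in> gen_roots h P" using gen_roots_simple[OF base_finite[OF P] base_roots[OF P] \<alpha>] .
      have mQ: "- \<alpha> \<in> Q" using Q(3)[OF \<alpha>r] nQ by blast
      have "insert (- \<alpha>) (Q \<inter> gen_roots h P) \<subseteq> Q \<inter> gen_roots h (reflect \<alpha> ` P)"
      proof -
        have "\<beta> \<in> gen_roots h (reflect \<alpha> ` P)" if "\<beta> \<in> gen_roots h P" "\<beta> \<noteq> \<alpha>" for \<beta>
          unfolding gen_roots_reflect[OF P \<alpha>r]
          using reflect_pos[OF P \<alpha> that] reflect_reflect[OF \<alpha>r] by (metis imageI)
        moreover have "- \<alpha> \<in> gen_roots h (reflect \<alpha> ` P)"
          unfolding gen_roots_reflect[OF P \<alpha>r] using reflect_self[OF \<alpha>r] \<alpha>p by (metis imageI)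
        ultimately show ?thesis using mQ nQ by blast
      qed
      moreover have "- \<alpha> \<notin> Q \<inter> gen_roots h P" using not_pos_and_neg[OF P \<alpha>p] by blast
      ultimately have "?c P < ?c (reflect \<alpha> ` P)"
        using card_mono[of "Q \<inter> gen_roots h (reflect \<alpha> ` P)" "insert (- \<alpha>) (Q \<inter> gen_roots h P)"] fin by simp
      then show False using max[OF reflect_base[OF P \<alpha>r]] by simp
    qed
  qed
  have "\<beta> \<in> Q" if "\<beta> \<in> gen_roots h P" for \<beta>
    using base_finite[OF P] base_roots[OF P] that
    by (induction rule: gen_roots_induct) (use PQ Q(2) in blast)+
  then show thesis using that P by blast
qed

text \<open>The intersection of \<open>Q\<close> and -\<open>Q\<close> is generated by simple roots.
  If -(\<beta> + \<alpha>) is in \<open>Q\<close>, adding the positive root \<alpha> or \<beta>,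
  which is in \<open>Q\<close>, shows that -\<beta> and -\<alpha> are in \<open>Q\<close>, so the
  induction splits off one simple root at a time.\<close>

lemma parabolic_levi:
  assumes Q: "\<And>\<alpha> \<beta>. \<alpha> \<in> Q \<Longrightarrow> \<beta> \<in> Q \<Longrightarrow> \<alpha> + \<beta> \<in> \<Delta> \<Longrightarrow> \<alpha> + \<beta> \<in> Q"
    and P: "root_base h P" "gen_roots h P \<subseteq> Q" and \<beta>: "\<beta> \<in> gen_roots h P"
  shows "- \<beta> \<in> Q \<longleftrightarrow> \<beta> \<in> gen_roots h {\<alpha> \<in> P. - \<alpha> \<in> Q}"
proof
  let ?S = "{\<alpha> \<in> P. - \<alpha> \<in> Q}"
  have Pf: "finite P" and Pr: "P \<subseteq> \<Delta>" using base_finite[OF P(1)] base_roots[OF P(1)] .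
  have S: "finite ?S" "?S \<subseteq> \<Delta>" using Pf Pr by auto
  have PQ: "P \<subseteq> Q" using gen_roots_simple[OF Pf Pr] P(2) by blast
  {
    assume "\<beta> \<in> gen_roots h ?S"
    with S show "- \<beta> \<in> Q"
    proof (induction rule: gen_roots_induct)
      case (simple \<alpha>)
      then show ?case by blast
    next
      case (add \<beta> \<alpha>)
      have "- \<beta> + - \<alpha> = - (\<beta> + \<alpha>)" by simp
      then show ?case using Q[of "- \<beta>" "- \<alpha>"] root_minus[OF add(3)] add(2,4) by (metis (no_types, lifting) mem_Collect_eq)
    qed
  }
  have "- \<beta> \<in> Q \<longrightarrow> \<beta> \<in> gen_roots h ?S"
    using Pf Pr \<beta>
  proof (induction rule: gen_roots_induct)
    case (simple \<alpha>)
    then show ?case using gen_roots_simple[OF S] by blast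
  next
    case (add \<beta> \<alpha>)
    show ?case
    proof
      assume m: "- (\<beta> + \<alpha>) \<in> Q"
      have \<beta>r: "\<beta> \<in> \<Delta>" using add(1) gen_roots_root by blast
      have \<alpha>r: "\<alpha> \<in> \<Delta>" using add(2) Pr by blast
      have "- \<beta> \<in> Q" using Q[OF m, of \<alpha>] add(2) PQ root_minus[OF \<beta>r] by auto
      moreover have "- \<alpha> \<in> Q" using Q[OF m, of \<beta>] add(1) P(2) root_minus[OF \<alpha>r] by auto
      ultimately show "\<beta> + \<alpha> \<in> gen_roots h ?S"
        using add gen_roots_add[OF _ gen_roots_simple[OF S]] by blast
    qed
  qed
  then show "- \<beta> \<in> Q \<Longrightarrow> \<beta> \<in> gen_roots h ?S" by blast
qed

end

subsection \<open>Admissible systems of points of the projective line\<close>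

text \<open>A point \<open>(a : b)\<close> of the projective line is encoded as \<open>Some (b / a)\<close>, or \<open>None\<close> if \<open>a = 0\<close>.\<close>

definition coordA :: "complex option \<Rightarrow> complex"
  where "coordA p = (case p of None \<Rightarrow> 0 | Some c \<Rightarrow> 1)"

definition coordB :: "complex option \<Rightarrow> complex"
  where "coordB p = (case p of None \<Rightarrow> 1 | Some c \<Rightarrow> c)"

lemma coord_simps [simp]:
  "coordA None = 0" "coordA (Some c) = 1" "coordB None = 1" "coordB (Some c) = c"
  by (simp_all add: coordA_def coordB_def)

lemma coordA_eq_0: "coordA p = 0 \<longleftrightarrow> p = None" and coordB_eq_0: "coordB p = 0 \<longleftrightarrow> p = Some 0"
  by (cases p; simp)+

lemma coord_proportional: "coordA p * coordB q = coordA q * coordB p \<longleftrightarrow> p = q"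
  by (cases p; cases q) auto

context cartan
begin

text \<open>For the ratios b / a this is multiplicativity on sums of roots and inversion at
  negatives. In homogeneous form it leaves the value at \<alpha> + \<beta> free when the two values
  are 0 and infinity.\<close>

definition admissible :: "(('g \<Rightarrow> complex) \<Rightarrow> complex option) \<Rightarrow> bool"
  where "admissible \<phi> \<longleftrightarrow>
    (\<forall>\<alpha>\<in>\<Delta>. coordA (\<phi> \<alpha>) * coordA (\<phi> (- \<alpha>)) = coordB (\<phi> \<alpha>) * coordB (\<phi> (- \<alpha>))) \<and>
    (\<forall>\<alpha>\<in>\<Delta>. \<forall>\<beta>\<in>\<Delta>. \<alpha> + \<beta> \<in> \<Delta> \<longrightarrow>
      coordA (\<phi> \<alpha>) * coordA (\<phi> \<beta>) * coordB (\<phi> (\<alpha> + \<beta>)) = coordB (\<phi> \<alpha>) * coordB (\<phi> \<beta>) * coordA (\<phi> (\<alpha> + \<beta>)))"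

text \<open>A positive root outside [S] contributes (0, E_\<alpha>) to the subalgebra, which is the
  point \<open>None\<close>; its negative contributes (E_-\<alpha>, 0), which is
  \<open>Some 0\<close>.\<close>

definition param_system :: "('g \<Rightarrow> complex) set \<Rightarrow> ('g \<Rightarrow> complex) set \<Rightarrow> ('g \<Rightarrow> complex) \<Rightarrow>
    ('g \<Rightarrow> complex) \<Rightarrow> complex option"
  where "param_system P S l \<alpha> =
    (if \<alpha> \<in> gen_roots h S \<or> - \<alpha> \<in> gen_roots h S then Some (exp (l (T \<alpha>)))
     else if \<alpha> \<in> gen_roots h P then None else Some 0)"

text \<open>\<sigma> is the height counted only in the simple roots outside \<open>S\<close>. It is
  additive, and its sign separates the three cases of \<open>param_system\<close>. The functional
  \<open>l\<close> behind it, with \<open>S\<close> empty, also supplies a direction in which no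
  root vanishes.\<close>

lemma sign_functional:
  assumes P: "root_base h P" and S: "S \<subseteq> P"
  obtains \<sigma> :: "('g \<Rightarrow> complex) \<Rightarrow> real" and l where
    "l \<in> hdual h" "\<And>\<alpha>. \<alpha> \<in> \<Delta> \<Longrightarrow> l (T \<alpha>) = of_real (\<sigma> \<alpha>)"
    "\<And>\<alpha>. \<alpha> \<in> \<Delta> \<Longrightarrow> \<sigma> (- \<alpha>) = - \<sigma> \<alpha>"
    "\<And>\<alpha> \<beta>. \<alpha> \<in> \<Delta> \<Longrightarrow> \<beta> \<in> \<Delta> \<Longrightarrow> \<alpha> + \<beta> \<in> \<Delta> \<Longrightarrow> \<sigma> (\<alpha> + \<beta>) = \<sigma> \<alpha> + \<sigma> \<beta>"
    "\<And>\<alpha>. \<alpha> \<in> \<Delta> \<Longrightarrow> \<sigma> \<alpha> = 0 \<longleftrightarrow> \<alpha> \<in> gen_roots h S \<or> - \<alpha> \<in> gen_roots h S"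
    "\<And>\<alpha>. \<alpha> \<in> \<Delta> \<Longrightarrow> \<sigma> \<alpha> > 0 \<longleftrightarrow> \<alpha> \<in> gen_roots h P - gen_roots h S"
proof -
  have Pf: "finite P" and Pr: "P \<subseteq> \<Delta>" using base_finite[OF P] base_roots[OF P] .
  obtain l where l: "l \<in> hdual h" "\<And>\<gamma>. \<gamma> \<in> P \<Longrightarrow> l (T \<gamma>) = (if \<gamma> \<in> S then 0 else 1)"
    by (rule hdual_interpolation[OF P, of "\<lambda>\<gamma>. if \<gamma> \<in> S then 0 else 1"]) (rule that)
  define \<sigma> where "\<sigma> \<alpha> = Re (l (T \<alpha>))" for \<alpha>
  have minus: "l (T (- \<alpha>)) = - l (T \<alpha>)" if "\<alpha> \<in> \<Delta>" for \<alpha>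
    using that l(1) T_h by (simp add: T_minus hdual_minus_arg)
  have val: "l (T \<beta>) = of_nat (\<Sum>\<gamma>\<in>P - S. n \<gamma>)"
    if \<beta>: "\<beta> \<in> \<Delta>" "\<beta> = (\<lambda>x. \<Sum>\<gamma>\<in>P. of_nat (n \<gamma>) * \<gamma> x)" for \<beta> and n :: "('g \<Rightarrow> complex) \<Rightarrow> nat"
  proof -
    have "l (T \<beta>) = (\<Sum>\<gamma>\<in>P. of_nat (n \<gamma>) * l (T \<gamma>))"
      unfolding T_combination[OF Pr \<beta>]
      by (subst hdual_sum_arg[OF l(1)])
         (use Pr T_h h_scaleC l(1) in \<open>auto simp: hdual_scaleC_arg subset_iff intro!: sum.cong\<close>)
    also have "\<dots> = (\<Sum>\<gamma>\<in>P. if \<gamma> \<in> S then 0 else of_nat (n \<gamma>))"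
      by (rule sum.cong) (auto simp: l(2))
    also have "\<dots> = (\<Sum>\<gamma>\<in>P - S. of_nat (n \<gamma>))"
      by (rule sum.mono_neutral_cong_right) (use Pf in auto)
    finally show ?thesis by simp
  qed
  have pos: "l (T \<beta>) = of_real (\<sigma> \<beta>) \<and> \<sigma> \<beta> \<ge> 0 \<and> (\<sigma> \<beta> = 0 \<longleftrightarrow> \<beta> \<in> gen_roots h S)"
    if "\<beta> \<in> gen_roots h P" for \<beta>
  proof -
    obtain n :: "('g \<Rightarrow> complex) \<Rightarrow> nat" where n: "\<beta> \<in> \<Delta>" "\<beta> = (\<lambda>x. \<Sum>\<gamma>\<in>P. of_nat (n \<gamma>) * \<gamma> x)"
      using \<open>\<beta> \<in> gen_roots h P\<close> unfolding gen_roots_def by blast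
    have v: "\<sigma> \<beta> = of_nat (\<Sum>\<gamma>\<in>P - S. n \<gamma>)" unfolding \<sigma>_def val[OF n] by simp
    have "\<beta> \<in> gen_roots h S" if "\<sigma> \<beta> = 0"
    proof -
      have "(\<Sum>\<gamma>\<in>P - S. n \<gamma>) = 0" using that v by (simp only: of_nat_eq_0_iff)
      then have n0: "n \<gamma> = 0" if "\<gamma> \<in> P - S" for \<gamma> using that Pf by simp
      have "(\<Sum>\<gamma>\<in>P. of_nat (n \<gamma>) * \<gamma> x) = (\<Sum>\<gamma>\<in>S. of_nat (n \<gamma>) * \<gamma> x)" for x
        by (rule sum.mono_neutral_right) (use Pf S n0 in auto)
      then have "\<beta> = (\<lambda>x. \<Sum>\<gamma>\<in>S. of_nat (n \<gamma>) * \<gamma> x)" using n(2) by simp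
      then show ?thesis using n(1) unfolding gen_roots_def by blast
    qed
    moreover have "\<sigma> \<beta> = 0" if "\<beta> \<in> gen_roots h S"
    proof -
      obtain m :: "('g \<Rightarrow> complex) \<Rightarrow> nat" where m: "\<beta> = (\<lambda>x. \<Sum>\<gamma>\<in>S. of_nat (m \<gamma>) * \<gamma> x)"
        using \<open>\<beta> \<in> gen_roots h S\<close> unfolding gen_roots_def by blast
      have "(\<Sum>\<gamma>\<in>S. of_nat (m \<gamma>) * \<gamma> x) = (\<Sum>\<gamma>\<in>P. of_nat (if \<gamma> \<in> S then m \<gamma> else 0) * \<gamma> x)" for x
        by (rule sum.mono_neutral_cong_left) (use Pf S in auto)
      then have "\<beta> = (\<lambda>x. \<Sum>\<gamma>\<in>P. of_nat (if \<gamma> \<in> S then m \<gamma> else 0) * \<gamma> x)" using m by simp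
      from val[OF n(1) this] show ?thesis by (simp add: \<sigma>_def)
    qed
    moreover have "\<sigma> \<beta> \<ge> 0" unfolding v by (rule of_nat_0_le_iff)
    moreover have "l (T \<beta>) = of_real (\<sigma> \<beta>)" unfolding v val[OF n] by simp
    ultimately show ?thesis by blast
  qed
  have gS: "gen_roots h S \<subseteq> gen_roots h P" by (rule gen_roots_mono[OF S Pf])
  have \<sigma>minus: "\<sigma> (- \<alpha>) = - \<sigma> \<alpha>" if "\<alpha> \<in> \<Delta>" for \<alpha> using minus[OF that] by (simp add: \<sigma>_def)
  show thesis
  proof (rule that[OF l(1), of \<sigma>])
    fix \<alpha> assume \<alpha>: "\<alpha> \<in> \<Delta>"
    show "\<sigma> (- \<alpha>) = - \<sigma> \<alpha>" by (rule \<sigma>minus[OF \<alpha>])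
    have "\<alpha> \<in> gen_roots h P \<or> - \<alpha> \<in> gen_roots h P" by (rule pos_or_neg[OF P \<alpha>])
    then show "l (T \<alpha>) = of_real (\<sigma> \<alpha>)"
    proof
      assume "- \<alpha> \<in> gen_roots h P"
      then have "l (T (- \<alpha>)) = of_real (\<sigma> (- \<alpha>))" using pos by blast
      then show ?thesis by (simp add: minus[OF \<alpha>] \<sigma>minus[OF \<alpha>])
    qed (use pos in blast)
    consider "\<alpha> \<in> gen_roots h P" "- \<alpha> \<notin> gen_roots h P" | "\<alpha> \<notin> gen_roots h P" "- \<alpha> \<in> gen_roots h P"
      using pos_or_neg[OF P \<alpha>] not_pos_and_neg[OF P] by blast
    then have "(\<sigma> \<alpha> = 0 \<longleftrightarrow> \<alpha> \<in> gen_roots h S \<or> - \<alpha> \<in> gen_roots h S) \<and>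
        (\<sigma> \<alpha> > 0 \<longleftrightarrow> \<alpha> \<in> gen_roots h P - gen_roots h S)"
    proof cases
      case 1
      then have "- \<alpha> \<notin> gen_roots h S" using gS by blast
      then show ?thesis using pos[OF 1(1)] 1 by auto
    next
      case 2
      then have "\<alpha> \<notin> gen_roots h S" using gS by blast
      then show ?thesis using pos[OF 2(2)] 2 \<sigma>minus[OF \<alpha>] by auto
    qed
    then show "\<sigma> \<alpha> = 0 \<longleftrightarrow> \<alpha> \<in> gen_roots h S \<or> - \<alpha> \<in> gen_roots h S"
      "\<sigma> \<alpha> > 0 \<longleftrightarrow> \<alpha> \<in> gen_roots h P - gen_roots h S" by blast+
  next
    fix \<alpha> \<beta> assume "\<alpha> \<in> \<Delta>" "\<beta> \<in> \<Delta>" "\<alpha> + \<beta> \<in> \<Delta>"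
    then show "\<sigma> (\<alpha> + \<beta>) = \<sigma> \<alpha> + \<sigma> \<beta>"
      using T_h l(1) by (simp add: \<sigma>_def T_add hdual_add_arg)
  qed
qed

text \<open>Once the cases are expressed by the sign of the additive function \<sigma>, both
  conditions follow by comparing the signs of the summands and of the sum.\<close>

lemma param_system_admissible:
  assumes P: "root_base h P" and S: "S \<subseteq> P" and l: "l \<in> hdual h"
  shows "admissible (param_system P S l)"
proof -
  obtain \<sigma> :: "('g \<Rightarrow> complex) \<Rightarrow> real" where
    minus: "\<And>\<alpha>. \<alpha> \<in> \<Delta> \<Longrightarrow> \<sigma> (- \<alpha>) = - \<sigma> \<alpha>" and
    add: "\<And>\<alpha> \<beta>. \<alpha> \<in> \<Delta> \<Longrightarrow> \<beta> \<in> \<Delta> \<Longrightarrow> \<alpha> + \<beta> \<in> \<Delta> \<Longrightarrow> \<sigma> (\<alpha> + \<beta>) = \<sigma> \<alpha> + \<sigma> \<beta>" and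
    zero: "\<And>\<alpha>. \<alpha> \<in> \<Delta> \<Longrightarrow> \<sigma> \<alpha> = 0 \<longleftrightarrow> \<alpha> \<in> gen_roots h S \<or> - \<alpha> \<in> gen_roots h S" and
    pos: "\<And>\<alpha>. \<alpha> \<in> \<Delta> \<Longrightarrow> \<sigma> \<alpha> > 0 \<longleftrightarrow> \<alpha> \<in> gen_roots h P - gen_roots h S"
    by (rule sign_functional[OF P S]) (rule that)
  have ps: "param_system P S l \<alpha> = (if \<sigma> \<alpha> = 0 then Some (exp (l (T \<alpha>)))
      else if \<sigma> \<alpha> > 0 then None else Some 0)" if "\<alpha> \<in> \<Delta>" for \<alpha>
    unfolding param_system_def zero[OF that] pos[OF that] by auto
  have lm: "l (T (- \<alpha>)) = - l (T \<alpha>)" if "\<alpha> \<in> \<Delta>" for \<alpha>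
    using that l T_h by (simp add: T_minus hdual_minus_arg)
  have la: "l (T (\<alpha> + \<beta>)) = l (T \<alpha>) + l (T \<beta>)" if "\<alpha> \<in> \<Delta>" "\<beta> \<in> \<Delta>" "\<alpha> + \<beta> \<in> \<Delta>" for \<alpha> \<beta>
    using that l T_h by (simp add: T_add hdual_add_arg)
  show ?thesis
    unfolding admissible_def
  proof (intro conjI ballI impI)
    fix \<alpha> assume \<alpha>: "\<alpha> \<in> \<Delta>"
    show "coordA (param_system P S l \<alpha>) * coordA (param_system P S l (- \<alpha>)) =
        coordB (param_system P S l \<alpha>) * coordB (param_system P S l (- \<alpha>))"
      by (simp add: ps[OF \<alpha>] ps[OF root_minus[OF \<alpha>]] minus[OF \<alpha>] lm[OF \<alpha>] flip: exp_add)
    fix \<beta> assume \<beta>: "\<beta> \<in> \<Delta>" and ab: "\<alpha> + \<beta> \<in> \<Delta>"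
    show "coordA (param_system P S l \<alpha>) * coordA (param_system P S l \<beta>) * coordB (param_system P S l (\<alpha> + \<beta>)) =
        coordB (param_system P S l \<alpha>) * coordB (param_system P S l \<beta>) * coordA (param_system P S l (\<alpha> + \<beta>))"
      unfolding ps[OF \<alpha>] ps[OF \<beta>] ps[OF ab] add[OF \<alpha> \<beta> ab] la[OF \<alpha> \<beta> ab]
      by (auto simp: exp_add)
  qed
qed

lemma admissible_param_system:
  assumes adm: "admissible \<phi>"
  obtains P S l where "root_base h P" "S \<subseteq> P" "l \<in> hdual h"
    "\<And>\<alpha>. \<alpha> \<in> \<Delta> \<Longrightarrow> \<phi> \<alpha> = param_system P S l \<alpha>"
proof -
  have neg: "coordA (\<phi> \<alpha>) * coordA (\<phi> (- \<alpha>)) = coordB (\<phi> \<alpha>) * coordB (\<phi> (- \<alpha>))" if "\<alpha> \<in> \<Delta>" for \<alpha>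
    using adm that unfolding admissible_def by blast
  have add: "coordA (\<phi> \<alpha>) * coordA (\<phi> \<beta>) * coordB (\<phi> (\<alpha> + \<beta>)) = coordB (\<phi> \<alpha>) * coordB (\<phi> \<beta>) * coordA (\<phi> (\<alpha> + \<beta>))"
    if "\<alpha> \<in> \<Delta>" "\<beta> \<in> \<Delta>" "\<alpha> + \<beta> \<in> \<Delta>" for \<alpha> \<beta>
    using adm that unfolding admissible_def by blast
  define Q where "Q = {\<alpha>\<in>\<Delta>. \<phi> \<alpha> \<noteq> Some 0}"
  have negN: "\<phi> \<alpha> = None \<longleftrightarrow> \<phi> (- \<alpha>) = Some 0" if "\<alpha> \<in> \<Delta>" for \<alpha>
    using neg[OF that] by (cases "\<phi> \<alpha>"; cases "\<phi> (- \<alpha>)") auto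
  have Q1: "Q \<subseteq> \<Delta>" by (auto simp: Q_def)
  have Q2: "\<alpha> + \<beta> \<in> Q" if "\<alpha> \<in> Q" "\<beta> \<in> Q" "\<alpha> + \<beta> \<in> \<Delta>" for \<alpha> \<beta>
    using add[of \<alpha> \<beta>] that by (auto simp: Q_def coordB_eq_0)
  have Q3: "\<alpha> \<in> Q \<or> - \<alpha> \<in> Q" if "\<alpha> \<in> \<Delta>" for \<alpha>
    using negN[OF that] root_minus[OF that] that by (auto simp: Q_def)
  obtain P where P: "root_base h P" "gen_roots h P \<subseteq> Q"
    using parabolic_base[OF Q1 Q2 Q3] by metis
  define S where "S = {\<alpha>\<in>P. - \<alpha> \<in> Q}"
  have levi: "- \<beta> \<in> Q \<longleftrightarrow> \<beta> \<in> gen_roots h S" if "\<beta> \<in> gen_roots h P" for \<beta>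
    unfolding S_def by (rule parabolic_levi[OF Q2 P that])
  have SP: "S \<subseteq> P" by (auto simp: S_def)
  have Pf: "finite P" and Pr: "P \<subseteq> \<Delta>" using base_finite[OF P(1)] base_roots[OF P(1)] .
  have Sf: "finite S" "S \<subseteq> \<Delta>" using SP Pf Pr finite_subset by auto
  have gSP: "gen_roots h S \<subseteq> gen_roots h P" by (rule gen_roots_mono[OF SP Pf])
  have fin: "\<phi> \<beta> = Some (coordB (\<phi> \<beta>)) \<and> coordB (\<phi> \<beta>) \<noteq> 0" if "\<beta> \<in> gen_roots h S" for \<beta>
  proof -
    have \<beta>: "\<beta> \<in> gen_roots h P" "\<beta> \<in> \<Delta>" using that gSP gen_roots_root by auto
    have "\<phi> \<beta> \<noteq> Some 0" "\<phi> (- \<beta>) \<noteq> Some 0" using levi[OF \<beta>(1)] that \<beta> P(2) by (auto simp: Q_def)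
    then show ?thesis using negN[OF \<beta>(2)] by (cases "\<phi> \<beta>") auto
  qed
  \<comment> \<open>On \<open>S\<close> the values are finite and nonzero, so the logarithm inverts
    \<open>exp\<close>. At the other simple roots the system is \<open>None\<close>, whose
    coordinate 1 has logarithm 0.\<close>
  obtain l where l: "l \<in> hdual h" "\<And>\<gamma>. \<gamma> \<in> P \<Longrightarrow> l (T \<gamma>) = Ln (coordB (\<phi> \<gamma>))"
    by (rule hdual_interpolation[OF P(1), of "\<lambda>\<gamma>. Ln (coordB (\<phi> \<gamma>))"]) (rule that)
  have expS: "coordB (\<phi> \<beta>) = exp (l (T \<beta>))" if "\<beta> \<in> gen_roots h S" for \<beta>
    using Sf that
  proof (induction rule: gen_roots_induct)
    case (simple \<alpha>)
    then have "coordB (\<phi> \<alpha>) \<noteq> 0" using fin gen_roots_simple[OF Sf] by blast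
    then show ?case using l(2)[of \<alpha>] simple SP by (simp add: exp_Ln subset_iff)
  next
    case (add \<beta> \<alpha>)
    have \<alpha>: "\<alpha> \<in> gen_roots h S" using gen_roots_simple[OF Sf add(2)] .
    have ba: "\<beta> + \<alpha> \<in> gen_roots h S" by (rule gen_roots_add[OF add(1) \<alpha> add(3)])
    have r: "\<beta> \<in> \<Delta>" "\<alpha> \<in> \<Delta>" using add(1) \<alpha> gen_roots_root by auto
    have A: "coordA (\<phi> \<gamma>) = 1" if "\<gamma> \<in> gen_roots h S" for \<gamma> using fin[OF that] coord_simps(2) by metis
    have "coordB (\<phi> \<alpha>) \<noteq> 0" using fin \<alpha> by blast
    then have "coordB (\<phi> \<alpha>) = exp (l (T \<alpha>))" using l(2)[of \<alpha>] add(2) SP by (simp add: exp_Ln subset_iff)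
    moreover have "coordB (\<phi> (\<beta> + \<alpha>)) = coordB (\<phi> \<beta>) * coordB (\<phi> \<alpha>)"
      using \<open>\<And>\<alpha> \<beta>. \<alpha> \<in> \<Delta> \<Longrightarrow> \<beta> \<in> \<Delta> \<Longrightarrow> \<alpha> + \<beta> \<in> \<Delta> \<Longrightarrow> _\<close>[OF r add(3)] A[OF add(1)] A[OF \<alpha>] A[OF ba] by simp
    moreover have "l (T (\<beta> + \<alpha>)) = l (T \<beta>) + l (T \<alpha>)"
      unfolding T_add[OF r add(3)] by (rule hdual_add_arg[OF l(1) T_h[OF r(1)] T_h[OF r(2)]])
    ultimately have "coordB (\<phi> (\<beta> + \<alpha>)) = exp (l (T (\<beta> + \<alpha>)))" using add(4) by (simp only: exp_add)
    then show ?case .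
  qed
  show thesis
  proof (rule that[OF P(1) SP l(1)])
    fix \<alpha> assume \<alpha>: "\<alpha> \<in> \<Delta>"
    have np: "- \<alpha> \<notin> gen_roots h P" if "\<alpha> \<in> gen_roots h P" by (rule not_pos_and_neg[OF P(1) that])
    have Tm: "l (T (- \<alpha>)) = - l (T \<alpha>)"
      using \<alpha> l(1) T_h by (simp add: T_minus hdual_minus_arg)
    consider "\<alpha> \<in> gen_roots h S" | "- \<alpha> \<in> gen_roots h S" | "\<alpha> \<in> gen_roots h P - gen_roots h S" "- \<alpha> \<notin> gen_roots h S"
      | "- \<alpha> \<in> gen_roots h P" "- \<alpha> \<notin> gen_roots h S" "\<alpha> \<notin> gen_roots h P" "\<alpha> \<notin> gen_roots h S"
      using pos_or_neg[OF P(1) \<alpha>] np gSP by blast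
    then show "\<phi> \<alpha> = param_system P S l \<alpha>"
    proof cases
      case 1
      then show ?thesis using fin[OF 1] expS[OF 1] by (simp add: param_system_def)
    next
      case 2
      have m: "\<phi> (- \<alpha>) = Some (exp (l (T (- \<alpha>))))" using fin[OF 2] expS[OF 2] by simp
      have "exp (- l (T \<alpha>)) * coordB (\<phi> \<alpha>) = coordA (\<phi> \<alpha>)"
        using neg[OF \<alpha>] unfolding m Tm by (simp add: mult.commute)
      moreover have "exp (- l (T \<alpha>)) * exp (l (T \<alpha>)) = 1" by (simp flip: exp_add)
      ultimately have "\<phi> \<alpha> = Some (exp (l (T \<alpha>)))"
        by (cases "\<phi> \<alpha>") (auto, metis mult_cancel_left exp_not_eq_zero)
      then show ?thesis using 2 by (simp add: param_system_def)
    next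
      case 3
      then have "- \<alpha> \<notin> Q" using levi by blast
      then have "\<phi> (- \<alpha>) = Some 0" using root_minus[OF \<alpha>] by (simp add: Q_def)
      then have "\<phi> \<alpha> = None" using negN[OF \<alpha>] by blast
      then show ?thesis using 3 by (simp add: param_system_def)
    next
      case 4
      then have "\<alpha> \<notin> Q" using levi[OF 4(1)] by simp
      then have "\<phi> \<alpha> = Some 0" using \<alpha> by (simp add: Q_def)
      then show ?thesis using 4 by (simp add: param_system_def)
    qed
  qed
qed

end

subsection \<open>Lagrangian subalgebras\<close>

lemma scaleC_pair [simp]: "c *\<^sub>C (x, y) = (c *\<^sub>C x, c *\<^sub>C y)"
  by (simp add: scaleC_prod_def)

lemma bracket_pair [simp]: "bracket (x, y) (x', y') = (bracket x x', bracket y y')"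
  by (simp add: bracket_prod_def)

lemma dbl_form_pair [simp]: "dbl_form (x, y) (x', y') = (killing y y' - killing x x') / 2"
  by (simp add: dbl_form_def)

lemma dbl_form_linear:
  "dbl_form (p + q) r = dbl_form p r + dbl_form q r" "dbl_form r (p + q) = dbl_form r p + dbl_form r q"
  "dbl_form (c *\<^sub>C p) r = c * dbl_form p r" "dbl_form r (c *\<^sub>C p) = c * dbl_form r p"
  by (simp_all add: dbl_form_def killing_linear scaleC_prod_def algebra_simps add_divide_distrib diff_divide_distrib)

lemma dbl_form_commute: "dbl_form p q = dbl_form q p"
  by (simp add: dbl_form_def killing_commute)

text \<open>An isotropic vector orthogonal to \<open>W\<close> can be adjoined to it without losing
  isotropy, so maximality puts it into \<open>W\<close>.\<close>

lemma lagrangian_member: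
  assumes W: "lagrangian_subalgebra W" and p: "\<And>q. q \<in> W \<Longrightarrow> dbl_form p q = 0" "dbl_form p p = 0"
  shows "p \<in> W"
proof -
  have iso: "cvs.subspace W" "\<And>q r. q \<in> W \<Longrightarrow> r \<in> W \<Longrightarrow> dbl_form q r = 0"
    and max: "\<And>W'. isotropic W' \<Longrightarrow> W \<subseteq> W' \<Longrightarrow> W' = W"
    using W unfolding lagrangian_subalgebra_def isotropic_def by blast+
  define W' where "W' = cvs.span (insert p W)"
  have "isotropic W'"
    unfolding isotropic_def
  proof (intro conjI ballI)
    show "cvs.subspace W'" unfolding W'_def by (rule cvs.subspace_span)
    fix q r assume q: "q \<in> W'" and r: "r \<in> W'"
    have gen: "dbl_form a b = 0" if "a \<in> insert p W" "b \<in> insert p W" for a b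
      using that p(1)[of a] p(1)[of b] p(2) iso(2)[of a b] dbl_form_commute[of a b] by (elim insertE) simp_all
    have sub1: "cvs.subspace {b. dbl_form a b = 0}" for a :: "'a \<times> 'a"
    proof -
      have "dbl_form a 0 = 0" by (simp add: dbl_form_def)
      then show ?thesis by (auto simp: cvs.subspace_def dbl_form_linear)
    qed
    have 1: "dbl_form a r = 0" if "a \<in> insert p W" for a
    proof -
      have "W' \<subseteq> {b. dbl_form a b = 0}"
        unfolding W'_def by (rule cvs.span_minimal[OF _ sub1]) (use gen that in blast)
      then show ?thesis using r by blast
    qed
    have "W' \<subseteq> {b. dbl_form r b = 0}"
      unfolding W'_def by (rule cvs.span_minimal[OF _ sub1]) (use 1 dbl_form_commute in \<open>metis (mono_tags) mem_Collect_eq subsetI\<close>)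
    then show "dbl_form q r = 0" using q dbl_form_commute[of q r] by auto
  qed
  moreover have "insert p W \<subseteq> W'" unfolding W'_def by (rule cvs.span_superset)
  ultimately show ?thesis using max[of W'] by blast
qed

context cartan
begin

text \<open>The sum of the diagonal \<open>h\<close> and of the lines of (a_\<alpha> E_\<alpha>,
  b_\<alpha> E_\<alpha>), given by equations on the coefficients: the first says that the components
  in \<open>h\<close> agree. The generators are recovered in \<open>lag_span\<close>.\<close>

definition lag :: "(('g \<Rightarrow> complex) \<Rightarrow> complex option) \<Rightarrow> ('g \<times> 'g) set"
  where "lag \<phi> = {(u, v). (\<forall>t\<in>h. killing u t = killing v t) \<and>
    (\<forall>\<alpha>\<in>\<Delta>. coordB (\<phi> \<alpha>) * killing u (E (- \<alpha>)) = coordA (\<phi> \<alpha>) * killing v (E (- \<alpha>)))}"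

definition lagE :: "(('g \<Rightarrow> complex) \<Rightarrow> complex option) \<Rightarrow> ('g \<Rightarrow> complex) \<Rightarrow> 'g \<times> 'g"
  where "lagE \<phi> \<alpha> = (coordA (\<phi> \<alpha>) *\<^sub>C E \<alpha>, coordB (\<phi> \<alpha>) *\<^sub>C E \<alpha>)"

lemma lag_subspace: "cvs.subspace (lag \<phi>)"
  by (auto simp: cvs.subspace_def lag_def killing_linear zero_prod_def ring_distribs)

lemma lag_h: "t \<in> h \<Longrightarrow> (t, t) \<in> lag \<phi>"
  by (simp add: lag_def killing_h_E root_minus)

lemma killing_E_minus: "\<alpha> \<in> \<Delta> \<Longrightarrow> \<beta> \<in> \<Delta> \<Longrightarrow> killing (E \<alpha>) (E (- \<beta>)) = (if \<beta> = \<alpha> then 1 else 0)"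
  by (auto simp: killing_E_E root_minus killing_E)

lemma lag_E_pair:
  assumes "\<gamma> \<in> \<Delta>"
  shows "(a *\<^sub>C E \<gamma>, b *\<^sub>C E \<gamma>) \<in> lag \<phi> \<longleftrightarrow> coordB (\<phi> \<gamma>) * a = coordA (\<phi> \<gamma>) * b"
  using assms by (auto simp: lag_def killing_linear killing_E_h killing_E_minus)

lemma lagE_lag: "\<alpha> \<in> \<Delta> \<Longrightarrow> lagE \<phi> \<alpha> \<in> lag \<phi>"
  unfolding lagE_def by (simp add: lag_E_pair mult.commute)

lemma hpart_eqI:
  assumes "\<And>t. t \<in> h \<Longrightarrow> killing u t = killing v t"
  shows "hpart u = hpart v"
proof -
  have "hpart u - hpart v = 0"
    by (rule killing_h_nondegenerate)
       (use assms in \<open>auto simp: killing_linear hpart_h h_diff simp flip: killing_h_hpart\<close>)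
  then show ?thesis by simp
qed

lemma root_expansion_pair:
  "(u, v) = (hpart u, hpart v) + (\<Sum>\<alpha>\<in>\<Delta>. (killing u (E (- \<alpha>)) *\<^sub>C E \<alpha>, killing v (E (- \<alpha>)) *\<^sub>C E \<alpha>))"
  by (simp add: sum_prod root_expansion)

lemma lag_span: "lag \<phi> = cvs.span (diag h \<union> lagE \<phi> ` \<Delta>)"
proof
  show "cvs.span (diag h \<union> lagE \<phi> ` \<Delta>) \<subseteq> lag \<phi>"
    by (rule cvs.span_minimal[OF _ lag_subspace]) (auto simp: diag_def lag_h lagE_lag)
  show "lag \<phi> \<subseteq> cvs.span (diag h \<union> lagE \<phi> ` \<Delta>)"
  proof
    fix p assume "p \<in> lag \<phi>"
    then obtain u v where p: "p = (u, v)" and uv: "\<And>t. t \<in> h \<Longrightarrow> killing u t = killing v t"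
      "\<And>\<alpha>. \<alpha> \<in> \<Delta> \<Longrightarrow> coordB (\<phi> \<alpha>) * killing u (E (- \<alpha>)) = coordA (\<phi> \<alpha>) * killing v (E (- \<alpha>))"
      by (auto simp: lag_def)
    have "(killing u (E (- \<alpha>)) *\<^sub>C E \<alpha>, killing v (E (- \<alpha>)) *\<^sub>C E \<alpha>) \<in> cvs.span (diag h \<union> lagE \<phi> ` \<Delta>)"
      if \<alpha>: "\<alpha> \<in> \<Delta>" for \<alpha>
    proof -
      \<comment> \<open>The coefficient is read in the entry in which \<open>lagE\<close> is
        normalized to 1: the second for \<open>None\<close>, the first otherwise.\<close>
      let ?c = "if \<phi> \<alpha> = None then killing v (E (- \<alpha>)) else killing u (E (- \<alpha>))"
      have "(killing u (E (- \<alpha>)) *\<^sub>C E \<alpha>, killing v (E (- \<alpha>)) *\<^sub>C E \<alpha>) = ?c *\<^sub>C lagE \<phi> \<alpha>"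
        using uv(2)[OF \<alpha>] by (cases "\<phi> \<alpha>") (auto simp: lagE_def scaleC_one scaleC_scaleC mult.commute)
      moreover have "lagE \<phi> \<alpha> \<in> cvs.span (diag h \<union> lagE \<phi> ` \<Delta>)" using \<alpha> by (intro cvs.span_base) simp
      ultimately show ?thesis by (simp only: cvs.span_scale)
    qed
    moreover have "(hpart u, hpart v) \<in> cvs.span (diag h \<union> lagE \<phi> ` \<Delta>)"
      using hpart_eqI[OF uv(1)] hpart_h by (auto simp: diag_def intro!: cvs.span_base)
    ultimately show "p \<in> cvs.span (diag h \<union> lagE \<phi> ` \<Delta>)"
      unfolding p by (subst root_expansion_pair) (intro cvs.span_add cvs.span_sum)
  qed
qed

lemma killing_expansion:
  "killing u v = killing (hpart u) (hpart v) + (\<Sum>\<beta>\<in>\<Delta>. killing u (E (- \<beta>)) * killing v (E \<beta>))"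
proof -
  have "killing u v = killing (hpart u) v + (\<Sum>\<beta>\<in>\<Delta>. killing u (E (- \<beta>)) * killing v (E \<beta>))"
    by (subst (1) root_expansion[of u, symmetric]) (simp add: killing_linear killing_commute[of v])
  then show ?thesis
    using killing_h_hpart[OF hpart_h[of u], of v] by (simp add: killing_commute)
qed

lemma admissible_minus:
  "admissible \<phi> \<Longrightarrow> \<alpha> \<in> \<Delta> \<Longrightarrow> coordA (\<phi> \<alpha>) * coordA (\<phi> (- \<alpha>)) = coordB (\<phi> \<alpha>) * coordB (\<phi> (- \<alpha>))"
  and admissible_add: "admissible \<phi> \<Longrightarrow> \<alpha> \<in> \<Delta> \<Longrightarrow> \<beta> \<in> \<Delta> \<Longrightarrow> \<alpha> + \<beta> \<in> \<Delta> \<Longrightarrow>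
    coordA (\<phi> \<alpha>) * coordA (\<phi> \<beta>) * coordB (\<phi> (\<alpha> + \<beta>)) = coordB (\<phi> \<alpha>) * coordB (\<phi> \<beta>) * coordA (\<phi> (\<alpha> + \<beta>))"
  by (simp_all add: admissible_def)

text \<open>For the form on the double, the line orthogonal to (a, b) in the opposite root space is
  that of (b, a), so inverse points of the projective line are orthogonal. The cases cover 0 and
  infinity, where one cannot divide.\<close>

lemma coord_isotropic:
  assumes "coordA p * coordA q = coordB p * coordB q" "coordB p * u = coordA p * v" "coordB q * u' = coordA q * v'"
  shows "u * u' = v * v'"
proof (cases p)
  case None
  then show ?thesis using assms by (cases q) auto
next
  case (Some c)
  show ?thesis
  proof (cases q)
    case None
    then show ?thesis using assms Some by auto
  next
    case q: (Some d)
    then have "c * d = 1" "v = c * u" "v' = d * u'" using assms Some by simp_all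
    moreover have "c * u * (d * u') = (c * d) * (u * u')" by (simp only: mult_ac)
    ultimately show ?thesis by simp
  qed
qed

lemma coord_perp:
  assumes "coordB q * v = coordA q * u" "coordA p * coordA q = coordB p * coordB q"
  shows "coordB p * u = coordA p * v"
proof (cases p)
  case None
  then show ?thesis using assms by (cases q) auto
next
  case (Some c)
  show ?thesis
  proof (cases q)
    case None
    then show ?thesis using assms Some by auto
  next
    case q: (Some d)
    then have "c * d = 1" "u = d * v" using assms Some by simp_all
    then show ?thesis using Some by (simp flip: mult.assoc)
  qed
qed

lemma lag_isotropic:
  assumes "admissible \<phi>"
  shows "isotropic (lag \<phi>)"
  unfolding isotropic_def
proof (intro conjI ballI lag_subspace)
  fix p q assume "p \<in> lag \<phi>" "q \<in> lag \<phi>"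
  then obtain u v u' v' where p: "p = (u, v)" and q: "q = (u', v')" and
    uv: "\<And>t. t \<in> h \<Longrightarrow> killing u t = killing v t"
      "\<And>\<alpha>. \<alpha> \<in> \<Delta> \<Longrightarrow> coordB (\<phi> \<alpha>) * killing u (E (- \<alpha>)) = coordA (\<phi> \<alpha>) * killing v (E (- \<alpha>))" and
    uv': "\<And>t. t \<in> h \<Longrightarrow> killing u' t = killing v' t"
      "\<And>\<alpha>. \<alpha> \<in> \<Delta> \<Longrightarrow> coordB (\<phi> \<alpha>) * killing u' (E (- \<alpha>)) = coordA (\<phi> \<alpha>) * killing v' (E (- \<alpha>))"
    by (auto simp: lag_def)
  have "killing u (E (- \<beta>)) * killing u' (E \<beta>) = killing v (E (- \<beta>)) * killing v' (E \<beta>)" if \<beta>: "\<beta> \<in> \<Delta>" for \<beta>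
    by (rule coord_isotropic[OF admissible_minus[OF assms \<beta>] uv(2)[OF \<beta>]])
       (use uv'(2)[OF root_minus[OF \<beta>]] in simp)
  then have "killing u u' = killing v v'"
    using killing_expansion[of u u'] killing_expansion[of v v'] hpart_eqI[OF uv(1)] hpart_eqI[OF uv'(1)]
    by simp
  then show "dbl_form p q = 0" by (simp add: p q)
qed

text \<open>Together with isotropy this makes \<open>lag \<phi>\<close> its own orthogonal
  complement, which yields maximality.\<close>

lemma lag_perp:
  assumes adm: "admissible \<phi>" and p: "\<And>q. q \<in> lag \<phi> \<Longrightarrow> dbl_form p q = 0"
  shows "p \<in> lag \<phi>"
proof -
  obtain u v where uv: "p = (u, v)" by (cases p)
  have "killing u t = killing v t" if "t \<in> h" for t
    using p[OF lag_h[OF that]] by (simp add: uv)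
  moreover have "coordB (\<phi> \<alpha>) * killing u (E (- \<alpha>)) = coordA (\<phi> \<alpha>) * killing v (E (- \<alpha>))" if \<alpha>: "\<alpha> \<in> \<Delta>" for \<alpha>
  proof -
    have "coordB (\<phi> (- \<alpha>)) * killing v (E (- \<alpha>)) = coordA (\<phi> (- \<alpha>)) * killing u (E (- \<alpha>))"
      using p[OF lagE_lag[OF root_minus[OF \<alpha>]]] by (simp add: uv lagE_def killing_linear)
    from coord_perp[OF this admissible_minus[OF adm \<alpha>]]
    show ?thesis .
  qed
  ultimately show ?thesis by (simp add: uv lag_def)
qed

text \<open>The two conditions of \<open>admissible\<close> answer the two ways in which the bracket
  can be nonzero: for opposite roots the result must lie in the diagonal \<open>h\<close>, and for a
  sum that is a root it must lie on the line at that sum.\<close>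

lemma bracket_lagE:
  assumes \<alpha>: "\<alpha> \<in> \<Delta>" and \<beta>: "\<beta> \<in> \<Delta>" and adm: "admissible \<phi>"
  shows "bracket (lagE \<phi> \<alpha>) (lagE \<phi> \<beta>) \<in> lag \<phi>"
proof -
  have br: "bracket (lagE \<phi> \<alpha>) (lagE \<phi> \<beta>) = ((coordA (\<phi> \<alpha>) * coordA (\<phi> \<beta>)) *\<^sub>C bracket (E \<alpha>) (E \<beta>),
      (coordB (\<phi> \<alpha>) * coordB (\<phi> \<beta>)) *\<^sub>C bracket (E \<alpha>) (E \<beta>))"
    by (simp add: lagE_def bracket_linear scaleC_scaleC mult.commute)
  consider "\<alpha> + \<beta> = 0" | "\<alpha> + \<beta> \<in> \<Delta>" | "\<alpha> + \<beta> \<noteq> 0" "\<alpha> + \<beta> \<notin> \<Delta>" by blast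
  then show ?thesis
  proof cases
    case 1
    then have "\<beta> = - \<alpha>" by (simp add: add_eq_0_iff)
    then show ?thesis
      using T_h[OF \<alpha>] admissible_minus[OF adm \<alpha>] unfolding br by (simp add: lag_h h_scaleC flip: hcoroot_def)
  next
    case 2
    obtain c where "bracket (E \<alpha>) (E \<beta>) = c *\<^sub>C E (\<alpha> + \<beta>)" using bracket_E_E[OF \<alpha> \<beta> 2] .
    then show ?thesis
      unfolding br using lag_E_pair[OF 2] admissible_add[OF adm \<alpha> \<beta> 2] by (simp add: scaleC_scaleC mult_ac)
  next
    case 3
    then have "bracket (E \<alpha>) (E \<beta>) = 0" using bracket_E_E_zero[OF \<alpha> \<beta>] by blast
    then show ?thesis unfolding br using lag_h[OF h_zero] by simp
  qed
qed

lemma lag_bracket: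
  assumes adm: "admissible \<phi>" and "p \<in> lag \<phi>" "q \<in> lag \<phi>"
  shows "bracket p q \<in> lag \<phi>"
proof -
  let ?G = "diag h \<union> lagE \<phi> ` \<Delta>"
  have hE: "bracket (t, t) (lagE \<phi> \<alpha>) \<in> lag \<phi>" if "t \<in> h" "\<alpha> \<in> \<Delta>" for t \<alpha>
  proof -
    have "bracket (t, t) (lagE \<phi> \<alpha>) = \<alpha> t *\<^sub>C lagE \<phi> \<alpha>"
      using that by (simp add: lagE_def bracket_linear bracket_h_E scaleC_scaleC mult.commute)
    then show ?thesis using lagE_lag[OF that(2)] cvs.subspace_scale[OF lag_subspace] by metis
  qed
  have gen: "bracket a b \<in> lag \<phi>" if "a \<in> ?G" "b \<in> ?G" for a b
  proof -
    have "bracket (lagE \<phi> \<alpha>) (t, t) \<in> lag \<phi>" if "t \<in> h" "\<alpha> \<in> \<Delta>" for t \<alpha>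
      using cvs.subspace_neg[OF lag_subspace hE[OF that]]
      by (subst bracket_anticomm)
    moreover have "bracket (t, t) (s, s) \<in> lag \<phi>" if "t \<in> h" "s \<in> h" for t s
      using that lag_h[OF h_zero] by (simp add: h_abelian)
    ultimately show ?thesis using that hE bracket_lagE[OF _ _ adm] by (auto simp: diag_def)
  qed
  have 1: "bracket a q \<in> lag \<phi>" if "a \<in> ?G" for a
  proof -
    have "cvs.span ?G \<subseteq> {b. bracket a b \<in> lag \<phi>}"
    proof (rule cvs.span_minimal)
      show "cvs.subspace {b. bracket a b \<in> lag \<phi>}"
        using lag_subspace[of \<phi>] by (auto simp: cvs.subspace_def bracket_linear)
    qed (use gen that in blast)
    then show ?thesis using assms(3) lag_span[of \<phi>] by blast
  qed
  have "cvs.span ?G \<subseteq> {a. bracket a q \<in> lag \<phi>}"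
  proof (rule cvs.span_minimal)
    show "cvs.subspace {a. bracket a q \<in> lag \<phi>}"
      using lag_subspace[of \<phi>] by (auto simp: cvs.subspace_def bracket_linear)
  qed (use 1 in blast)
  then show ?thesis using assms(2) lag_span[of \<phi>] by blast
qed

lemma lag_lagrangian:
  assumes "admissible \<phi>"
  shows "lagrangian_subalgebra (lag \<phi>)"
  unfolding lagrangian_subalgebra_def
proof (intro conjI allI impI ballI)
  show "isotropic (lag \<phi>)" by (rule lag_isotropic[OF assms])
  fix W assume W: "isotropic W \<and> lag \<phi> \<subseteq> W"
  have "p \<in> lag \<phi>" if "p \<in> W" for p
    by (rule lag_perp[OF assms]) (use W that in \<open>auto simp: isotropic_def\<close>)
  then show "W = lag \<phi>" using W by blast
qed (rule lag_bracket[OF assms])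

lemma lag_inj:
  assumes "lag \<phi> = lag \<psi>" "\<alpha> \<in> \<Delta>"
  shows "\<phi> \<alpha> = \<psi> \<alpha>"
proof -
  have "lagE \<phi> \<alpha> \<in> lag \<psi>" using lagE_lag[OF assms(2), of \<phi>] assms(1) by simp
  then have "coordB (\<psi> \<alpha>) * coordA (\<phi> \<alpha>) = coordA (\<psi> \<alpha>) * coordB (\<phi> \<alpha>)"
    unfolding lagE_def by (simp add: lag_E_pair[OF assms(2)])
  then show ?thesis using coord_proportional[of "\<phi> \<alpha>" "\<psi> \<alpha>"] by (simp add: mult.commute)
qed

lemma lag_cong: "(\<And>\<alpha>. \<alpha> \<in> \<Delta> \<Longrightarrow> \<phi> \<alpha> = \<psi> \<alpha>) \<Longrightarrow> lag \<phi> = lag \<psi>"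
  by (auto simp: lag_def)

text \<open>At the value \<open>Some 1\<close>, and only there, the line at \<alpha> is
  diagonal.\<close>

lemma lag_diag: "lag \<phi> \<inter> diag UNIV = diag h \<longleftrightarrow> (\<forall>\<alpha>\<in>\<Delta>. \<phi> \<alpha> \<noteq> Some 1)"
proof
  assume *: "lag \<phi> \<inter> diag UNIV = diag h"
  show "\<forall>\<alpha>\<in>\<Delta>. \<phi> \<alpha> \<noteq> Some 1"
  proof (intro ballI notI)
    fix \<alpha> assume \<alpha>: "\<alpha> \<in> \<Delta>" and "\<phi> \<alpha> = Some 1"
    then have "(E \<alpha>, E \<alpha>) \<in> lag \<phi> \<inter> diag UNIV"
      using lagE_lag[OF \<alpha>, of \<phi>] by (auto simp: lagE_def scaleC_one diag_def)
    then have "E \<alpha> \<in> h" unfolding * by (auto simp: diag_def)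
    then show False using killing_h_E[OF root_minus[OF \<alpha>]] killing_E[OF \<alpha>] by simp
  qed
next
  assume *: "\<forall>\<alpha>\<in>\<Delta>. \<phi> \<alpha> \<noteq> Some 1"
  have "u \<in> h" if u: "(u, u) \<in> lag \<phi>" for u
  proof -
    have "killing u (E (- \<alpha>)) = 0" if "\<alpha> \<in> \<Delta>" for \<alpha>
      using u that * by (cases "\<phi> \<alpha>") (auto simp: lag_def)
    then have "hpart u = u" by (simp add: hpart_def)
    then show ?thesis using hpart_h[of u] by simp
  qed
  then show "lag \<phi> \<inter> diag UNIV = diag h" using lag_h by (auto simp: diag_def)
qed

text \<open>\<open>V \<alpha>\<close> holds the coordinates of the elements of \<open>W\<close> in
  the two copies of the root space. Stability under the diagonal \<open>h\<close> puts the root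
  components of \<open>W\<close> into \<open>W\<close>. If \<open>V \<alpha>\<close> were a plane it
  would contain (1, 1), against the assumption on the diagonal. It is not zero, since by maximality
  it contains everything orthogonal to \<open>V (- \<alpha>)\<close>. So it is a line.\<close>

lemma lagrangian_is_lag:
  assumes W: "lagrangian_subalgebra W" and Wd: "W \<inter> diag UNIV = diag h"
  obtains \<phi> where "admissible \<phi>" "W = lag \<phi>"
proof -
  have sub: "cvs.subspace W" and iso: "\<And>p q. p \<in> W \<Longrightarrow> q \<in> W \<Longrightarrow> dbl_form p q = 0"
    and br: "\<And>p q. p \<in> W \<Longrightarrow> q \<in> W \<Longrightarrow> bracket p q \<in> W"
    using W unfolding lagrangian_subalgebra_def isotropic_def by blast+
  have hW: "(t, t) \<in> W" if "t \<in> h" for t using Wd that by (auto simp: diag_def)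
  have no_diag: "(E \<alpha>, E \<alpha>) \<notin> W" if \<alpha>: "\<alpha> \<in> \<Delta>" for \<alpha>
  proof
    assume "(E \<alpha>, E \<alpha>) \<in> W"
    then have "(E \<alpha>, E \<alpha>) \<in> diag h" using Wd by (auto simp: diag_def)
    then have "E \<alpha> \<in> h" by (auto simp: diag_def)
    then show False using killing_h_E[OF root_minus[OF \<alpha>]] killing_E[OF \<alpha>] by simp
  qed
  define V where "V \<alpha> = {(a, b). (a *\<^sub>C E \<alpha>, b *\<^sub>C E \<alpha>) \<in> W}" for \<alpha>
  have Vcomb: "(x * a + y * a', x * b + y * b') \<in> V \<alpha>" if "(a, b) \<in> V \<alpha>" "(a', b') \<in> V \<alpha>" for x y a b a' b' \<alpha>
  proof -
    have "x *\<^sub>C (a *\<^sub>C E \<alpha>, b *\<^sub>C E \<alpha>) + y *\<^sub>C (a' *\<^sub>C E \<alpha>, b' *\<^sub>C E \<alpha>) \<in> W"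
      using that by (intro cvs.subspace_add[OF sub] cvs.subspace_scale[OF sub]) (auto simp: V_def)
    then show ?thesis by (simp add: V_def scaleC_scaleC scaleC_add_left)
  qed
  have comp: "(killing u (E (- \<alpha>)), killing v (E (- \<alpha>))) \<in> V \<alpha>" if uv: "(u, v) \<in> W" and \<alpha>: "\<alpha> \<in> \<Delta>" for u v \<alpha>
  proof -
    \<comment> \<open>The component in the double of \<open>h\<close> occupies the weight 0, so that
      a single family carries the whole decomposition.\<close>
    define w where "w \<gamma> = (if \<gamma> = 0 then (hpart u, hpart v)
      else (killing u (E (- \<gamma>)) *\<^sub>C E \<gamma>, killing v (E (- \<gamma>)) *\<^sub>C E \<gamma>))" for \<gamma>
    have z: "0 \<notin> \<Delta>" using root_nonzero by blast
    have "sum w \<Delta> = (\<Sum>\<alpha>\<in>\<Delta>. (killing u (E (- \<alpha>)) *\<^sub>C E \<alpha>, killing v (E (- \<alpha>)) *\<^sub>C E \<alpha>))"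
      by (rule sum.cong) (auto simp: w_def dest: root_nonzero)
    then have sumw: "(u, v) = sum w (insert 0 \<Delta>)"
      using z finite_roots root_expansion_pair[of u v] by (simp add: w_def)
    have "w \<alpha> \<in> W"
    proof (rule weight_component[where H = h and T = "\<lambda>t. bracket (t, t)" and B = "insert 0 \<Delta> - {\<alpha>}" and v = w and \<alpha> = \<alpha>])
      show "sum w (insert \<alpha> (insert 0 \<Delta> - {\<alpha>})) \<in> W"
        using \<alpha> uv sumw by (simp add: insert_absorb)
      show "\<exists>t\<in>h. \<alpha> t \<noteq> \<beta> t" if "\<beta> \<in> insert 0 \<Delta> - {\<alpha>}" for \<beta>
        using hdual_neqE[of \<alpha> \<beta>] that \<alpha> root_hdual hdual_zero by (metis Diff_iff insert_iff)
      show "bracket (t, t) (w \<gamma>) = \<gamma> t *\<^sub>C w \<gamma>" if "\<gamma> \<in> insert \<alpha> (insert 0 \<Delta> - {\<alpha>})" "t \<in> h" for \<gamma> t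
        using that \<alpha> by (auto simp: w_def bracket_linear bracket_h_E scaleC_scaleC h_abelian hpart_h mult.commute)
    qed (use sub br hW finite_roots in \<open>auto simp: bracket_add_right bracket_scaleC_right\<close>)
    then show ?thesis using root_nonzero[OF \<alpha>] by (simp add: w_def V_def)
  qed
  have hcomp: "killing u t = killing v t" if "(u, v) \<in> W" "t \<in> h" for u v t
    using iso[OF that(1) hW[OF that(2)]] by simp
  have proportional: "a * b' = a' * b" if \<alpha>: "\<alpha> \<in> \<Delta>" and ab: "(a, b) \<in> V \<alpha>" "(a', b') \<in> V \<alpha>" for a b a' b' \<alpha>
  proof (rule ccontr)
    assume ne: "a * b' \<noteq> a' * b"
    define d where "d = a * b' - a' * b"
    have d: "d \<noteq> 0" using ne by (simp add: d_def)
    \<comment> \<open>Cramer's rule for writing (1, 1) in terms of (a, b) and (a', b').\<close>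
    have "((b' - a') / d * a + (a - b) / d * a', (b' - a') / d * b + (a - b) / d * b') \<in> V \<alpha>"
      by (rule Vcomb[OF ab])
    moreover have "(b' - a') / d * a + (a - b) / d * a' = 1" "(b' - a') / d * b + (a - b) / d * b' = 1"
      using d by (simp_all add: divide_simps) (simp_all add: d_def algebra_simps)
    ultimately show False using no_diag[OF \<alpha>] by (simp add: V_def scaleC_one)
  qed
  have perp: "(a, b) \<in> V \<alpha>" if \<alpha>: "\<alpha> \<in> \<Delta>" and ab: "\<And>a' b'. (a', b') \<in> V (- \<alpha>) \<Longrightarrow> a * a' = b * b'" for a b \<alpha>
  proof -
    have "(a *\<^sub>C E \<alpha>, b *\<^sub>C E \<alpha>) \<in> W"
    proof (rule lagrangian_member[OF W])
      fix q assume q: "q \<in> W"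
      obtain u v where uv: "q = (u, v)" by (cases q)
      have "a * killing u (E \<alpha>) = b * killing v (E \<alpha>)"
        using ab comp[of u v "- \<alpha>"] q uv root_minus[OF \<alpha>] by simp
      then show "dbl_form (a *\<^sub>C E \<alpha>, b *\<^sub>C E \<alpha>) q = 0"
        by (simp add: uv killing_linear killing_commute[of "E \<alpha>"])
    next
      have "\<alpha> \<noteq> - \<alpha>"
      proof
        assume "\<alpha> = - \<alpha>"
        then have "\<alpha> x = - \<alpha> x" for x by (metis uminus_apply)
        then show False using root_nonzero[OF \<alpha>] by (simp add: fun_eq_iff)
      qed
      then show "dbl_form (a *\<^sub>C E \<alpha>, b *\<^sub>C E \<alpha>) (a *\<^sub>C E \<alpha>, b *\<^sub>C E \<alpha>) = 0"
        using \<alpha> by (simp add: killing_linear killing_E_E)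
    qed
    then show ?thesis by (simp add: V_def)
  qed
  have ex: "\<exists>a b. (a, b) \<in> V \<alpha> \<and> (a \<noteq> 0 \<or> b \<noteq> 0)" if \<alpha>: "\<alpha> \<in> \<Delta>" for \<alpha>
  proof (cases "\<exists>a b. (a, b) \<in> V (- \<alpha>) \<and> (a \<noteq> 0 \<or> b \<noteq> 0)")
    case True
    then obtain a b where ab: "(a, b) \<in> V (- \<alpha>)" "a \<noteq> 0 \<or> b \<noteq> 0" by blast
    \<comment> \<open>Exchanging the entries gives the orthogonal line, because the two copies of
      the Killing form enter with opposite signs.\<close>
    have "(b, a) \<in> V \<alpha>"
    proof (rule perp[OF \<alpha>])
      fix a' b' assume "(a', b') \<in> V (- \<alpha>)"
      then show "b * a' = a * b'" using proportional[OF root_minus[OF \<alpha>] ab(1), of a' b'] by (simp add: mult.commute)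
    qed
    then show ?thesis using ab(2) by blast
  next
    case False
    \<comment> \<open>If \<open>V (- \<alpha>)\<close> is zero, every pair satisfies the
      orthogonality condition.\<close>
    have "(1, 1) \<in> V \<alpha>" by (rule perp[OF \<alpha>]) (use False in auto)
    then show ?thesis by (intro exI[of _ 1]) simp
  qed
  have "\<exists>p. \<forall>a b. (a, b) \<in> V \<alpha> \<longleftrightarrow> coordB p * a = coordA p * b" if \<alpha>: "\<alpha> \<in> \<Delta>" for \<alpha>
  proof -
    obtain a b where ab: "(a, b) \<in> V \<alpha>" "a \<noteq> 0 \<or> b \<noteq> 0" using ex[OF \<alpha>] by blast
    have mult: "(a' , b') \<in> V \<alpha> \<longleftrightarrow> a * b' = a' * b" for a' b'
    proof
      assume e: "a * b' = a' * b"
      show "(a', b') \<in> V \<alpha>"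
      proof (cases "a = 0")
        case True
        then have "a' = 0" "b \<noteq> 0" using e ab(2) by auto
        then show ?thesis using Vcomb[OF ab(1) ab(1), of "b' / b" 0] True by simp
      next
        case False
        then have "b' = a' / a * b" using e by (simp add: field_simps)
        then show ?thesis using Vcomb[OF ab(1) ab(1), of "a' / a" 0] False by simp
      qed
    qed (rule proportional[OF \<alpha> ab(1)])
    show ?thesis
    proof (intro exI[of _ "if a = 0 then None else Some (b / a)"] allI)
      fix a' b'
      show "(a', b') \<in> V \<alpha> \<longleftrightarrow> coordB (if a = 0 then None else Some (b / a)) * a' =
          coordA (if a = 0 then None else Some (b / a)) * b'"
        unfolding mult using ab(2) by (auto simp: field_simps)
    qed
  qed
  then obtain \<phi> where \<phi>: "\<And>\<alpha> a b. \<alpha> \<in> \<Delta> \<Longrightarrow> (a, b) \<in> V \<alpha> \<longleftrightarrow> coordB (\<phi> \<alpha>) * a = coordA (\<phi> \<alpha>) * b"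
    by metis
  have Wlag: "W = lag \<phi>"
  proof
    show "W \<subseteq> lag \<phi>"
    proof
      fix p assume p: "p \<in> W"
      then show "p \<in> lag \<phi>" using hcomp comp \<phi> by (cases p) (auto simp: lag_def)
    qed
    have "lagE \<phi> \<alpha> \<in> W" if "\<alpha> \<in> \<Delta>" for \<alpha>
      using \<phi>[OF that, of "coordA (\<phi> \<alpha>)" "coordB (\<phi> \<alpha>)"] by (simp add: lagE_def V_def mult.commute)
    then show "lag \<phi> \<subseteq> W"
      unfolding lag_span by (intro cvs.span_minimal[OF _ sub]) (auto simp: diag_def hW)
  qed
  have "admissible \<phi>"
    unfolding admissible_def
  proof (intro conjI ballI impI)
    fix \<alpha> assume \<alpha>: "\<alpha> \<in> \<Delta>"
    show "coordA (\<phi> \<alpha>) * coordA (\<phi> (- \<alpha>)) = coordB (\<phi> \<alpha>) * coordB (\<phi> (- \<alpha>))"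
      using iso[of "lagE \<phi> \<alpha>" "lagE \<phi> (- \<alpha>)"] lagE_lag[of _ \<phi>] \<alpha> root_minus[OF \<alpha>] Wlag
      by (simp add: lagE_def killing_linear killing_E) (simp add: mult.commute)
    fix \<beta> assume \<beta>: "\<beta> \<in> \<Delta>" and ab: "\<alpha> + \<beta> \<in> \<Delta>"
    obtain c where c: "c \<noteq> 0" "bracket (E \<alpha>) (E \<beta>) = c *\<^sub>C E (\<alpha> + \<beta>)" using bracket_E_E[OF \<alpha> \<beta> ab] .
    have "bracket (lagE \<phi> \<alpha>) (lagE \<phi> \<beta>) \<in> lag \<phi>"
      using br lagE_lag[OF \<alpha>, of \<phi>] lagE_lag[OF \<beta>, of \<phi>] Wlag by blast
    then have "((coordA (\<phi> \<alpha>) * coordA (\<phi> \<beta>) * c) *\<^sub>C E (\<alpha> + \<beta>), (coordB (\<phi> \<alpha>) * coordB (\<phi> \<beta>) * c) *\<^sub>C E (\<alpha> + \<beta>)) \<in> lag \<phi>"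
      by (simp add: lagE_def bracket_linear c(2) scaleC_scaleC mult_ac)
    then have "c * (coordA (\<phi> \<alpha>) * coordA (\<phi> \<beta>) * coordB (\<phi> (\<alpha> + \<beta>))) = c * (coordB (\<phi> \<alpha>) * coordB (\<phi> \<beta>) * coordA (\<phi> (\<alpha> + \<beta>)))"
      unfolding lag_E_pair[OF ab] by (simp only: mult_ac)
    then show "coordA (\<phi> \<alpha>) * coordA (\<phi> \<beta>) * coordB (\<phi> (\<alpha> + \<beta>)) = coordB (\<phi> \<alpha>) * coordB (\<phi> \<beta>) * coordA (\<phi> (\<alpha> + \<beta>))"
      using c(1) by simp
  qed
  then show thesis using that Wlag by blast
qed

subsection \<open>The subalgebra of a parameter\<close>

lemma Ad_exp_eqI:
  assumes "\<And>a. a \<in> lie_basis \<Longrightarrow> (\<lambda>k. coord a ((bracket x ^^ k) y) / fact k) sums coord a (z::'g)"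
  shows "Ad_exp x y = z"
  unfolding Ad_exp_def
proof (rule the_equality)
  fix z' assume z': "\<forall>a\<in>lie_basis. (\<lambda>k. coord a ((bracket x ^^ k) y) / fact k) sums coord a z'"
  then have "coord a z' = coord a z" if "a \<in> lie_basis" for a
    using assms[OF that] that sums_unique2 by blast
  then have "(\<Sum>a\<in>lie_basis. coord a z' *\<^sub>C a) = (\<Sum>a\<in>lie_basis. coord a z *\<^sub>C a)" by simp
  then show "z' = z" by (simp only: coord_expansion)
qed (use assms in blast)

lemma Ad_exp_h:
  assumes t: "t \<in> h"
  shows "Ad_exp t x = hpart x + (\<Sum>\<beta>\<in>\<Delta>. (exp (\<beta> t) * killing x (E (- \<beta>))) *\<^sub>C E \<beta>)"
proof (rule Ad_exp_eqI)
  fix a :: 'g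
  \<comment> \<open>The component in \<open>h\<close> survives only in the term k = 0, because
    \<open>t\<close> commutes with \<open>h\<close>.\<close>
  have pow: "(bracket t ^^ k) x = (if k = 0 then hpart x else 0) + (\<Sum>\<beta>\<in>\<Delta>. (\<beta> t ^ k * killing x (E (- \<beta>))) *\<^sub>C E \<beta>)" for k
  proof (induction k)
    case 0
    show ?case using root_expansion[of x] by (simp only: funpow.simps id_apply power_0 mult_1 if_True) simp
  next
    case (Suc k)
    have "bracket t (if k = 0 then hpart x else 0) = 0" using h_abelian[OF t hpart_h] by simp
    then show ?case
      using t by (simp add: Suc bracket_linear bracket_h_E scaleC_scaleC mult_ac)
  qed
  have 1: "(\<lambda>k. if k = 0 then coord a (hpart x) else 0) sums coord a (hpart x)"
    using sums_single[of 0 "\<lambda>_. coord a (hpart x)"] by simp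
  have 2: "(\<lambda>k. (\<beta> t ^ k / fact k) * (killing x (E (- \<beta>)) * coord a (E \<beta>))) sums
      (exp (\<beta> t) * (killing x (E (- \<beta>)) * coord a (E \<beta>)))" for \<beta>
    by (rule sums_mult2) (use exp_converges[of "\<beta> t"] in \<open>simp add: scaleR_conv_of_real divide_inverse mult.commute\<close>)
  have "(\<lambda>k. (if k = 0 then coord a (hpart x) else 0) +
      (\<Sum>\<beta>\<in>\<Delta>. (\<beta> t ^ k / fact k) * (killing x (E (- \<beta>)) * coord a (E \<beta>)))) sums
     (coord a (hpart x) + (\<Sum>\<beta>\<in>\<Delta>. exp (\<beta> t) * (killing x (E (- \<beta>)) * coord a (E \<beta>))))"
    by (intro sums_add 1 sums_sum 2)
  moreover have "coord a ((bracket t ^^ k) x) / fact k = (if k = 0 then coord a (hpart x) else 0) +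
      (\<Sum>\<beta>\<in>\<Delta>. (\<beta> t ^ k / fact k) * (killing x (E (- \<beta>)) * coord a (E \<beta>)))" for k
    unfolding pow by (auto simp: coord_sum add_divide_distrib sum_divide_distrib mult_ac)
  ultimately show "(\<lambda>k. coord a ((bracket t ^^ k) x) / fact k) sums
     coord a (hpart x + (\<Sum>\<beta>\<in>\<Delta>. (exp (\<beta> t) * killing x (E (- \<beta>))) *\<^sub>C E \<beta>))"
    by (simp add: coord_sum mult_ac)
qed

lemma span_E_coefficient:
  assumes X: "X \<subseteq> \<Delta>" and x: "x \<in> cvs.span (E ` X)"
  shows "t \<in> h \<Longrightarrow> killing x t = 0" "\<alpha> \<in> \<Delta> - X \<Longrightarrow> killing x (E (- \<alpha>)) = 0"
proof -
  have sub: "cvs.subspace {x. killing x y = 0}" for y :: 'g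
    by (auto simp: cvs.subspace_def killing_linear)
  show "killing x t = 0" if t: "t \<in> h"
  proof -
    have "cvs.span (E ` X) \<subseteq> {x. killing x t = 0}"
      by (rule cvs.span_minimal[OF _ sub]) (use X t killing_E_h in auto)
    then show ?thesis using x by blast
  qed
  show "killing x (E (- \<alpha>)) = 0" if \<alpha>: "\<alpha> \<in> \<Delta> - X"
  proof -
    have "cvs.span (E ` X) \<subseteq> {x. killing x (E (- \<alpha>)) = 0}"
      by (rule cvs.span_minimal[OF _ sub]) (use X \<alpha> killing_E_minus in auto)
    then show ?thesis using x by blast
  qed
qed

text \<open>One inclusion checks the equations of \<open>lag\<close> on generators; the other finds
  each \<open>lagE\<close> among the generators. As \<open>kn\<close> and \<open>kp\<close> enter as
  a product and both contain 0, the vectors (0, E_\<alpha>) and (E_-\<alpha>, 0) are available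
  separately.\<close>

lemma pair_subalgebra_lag:
  assumes P: "root_base h P" and S: "S \<subseteq> P" and l: "l \<in> hdual h"
  shows "pair_subalgebra h E P S l = lag (param_system P S l)"
proof -
  let ?\<phi> = "param_system P S l"
  let ?gS = "gen_roots h S" and ?gK = "gen_roots h P - gen_roots h S"
  let ?m = "(\<lambda>\<alpha>. - \<alpha>) :: ('g \<Rightarrow> complex) \<Rightarrow> ('g \<Rightarrow> complex)"
  define np nn kp kn where "np = cvs.span (E ` ?gS)" and "nn = cvs.span (E ` ?m ` ?gS)"
    and "kp = cvs.span (E ` ?gK)" and "kn = cvs.span (E ` ?m ` ?gK)"
  let ?G = "diag h \<union> {(x, Ad_exp (hvec h l) x) | x. x \<in> np \<union> nn} \<union> kn \<times> kp"
  have W: "pair_subalgebra h E P S l = cvs.span ?G"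
    unfolding pair_subalgebra_def Let_def np_def nn_def kp_def kn_def image_image ..
  have t: "hvec h l \<in> h" by (rule hvec_h[OF l])
  have gSP: "gen_roots h S \<subseteq> gen_roots h P" by (rule gen_roots_mono[OF S base_finite[OF P]])
  have np: "\<alpha> \<notin> gen_roots h P \<or> - \<alpha> \<notin> gen_roots h P" for \<alpha> using not_pos_and_neg[OF P] by blast
  have roots: "?gS \<subseteq> \<Delta>" "?m ` ?gS \<subseteq> \<Delta>" "?gK \<subseteq> \<Delta>" "?m ` ?gK \<subseteq> \<Delta>"
    using gen_roots_root root_minus by blast+
  have mem: "\<alpha> \<in> ?m ` X \<longleftrightarrow> - \<alpha> \<in> X" for \<alpha> X by force
  have Ad: "(x, Ad_exp (hvec h l) x) \<in> lag ?\<phi>"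
    if x: "x \<in> cvs.span (E ` X)" and X: "X \<subseteq> \<Delta>" "\<And>\<alpha>. \<alpha> \<in> X \<Longrightarrow> \<alpha> \<in> ?gS \<or> - \<alpha> \<in> ?gS" for x X
  proof -
    have "killing x s = killing (Ad_exp (hvec h l) x) s" if "s \<in> h" for s
      using that killing_h_hpart[OF that, of x] unfolding Ad_exp_h[OF t] by (simp add: killing_linear killing_E_h)
    moreover have "coordB (?\<phi> \<alpha>) * killing x (E (- \<alpha>)) = coordA (?\<phi> \<alpha>) * killing (Ad_exp (hvec h l) x) (E (- \<alpha>))"
      if \<alpha>: "\<alpha> \<in> \<Delta>" for \<alpha>
    proof (cases "\<alpha> \<in> X")
      case True
      have "killing (Ad_exp (hvec h l) x) (E (- \<alpha>)) = exp (\<alpha> (hvec h l)) * killing x (E (- \<alpha>))"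
      proof -
        have "(\<Sum>\<beta>\<in>\<Delta>. exp (\<beta> (hvec h l)) * killing x (E (- \<beta>)) * killing (E \<beta>) (E (- \<alpha>)))
           = (\<Sum>\<beta>\<in>\<Delta>. if \<beta> = \<alpha> then exp (\<alpha> (hvec h l)) * killing x (E (- \<alpha>)) else 0)"
          by (rule sum.cong) (auto simp: killing_E_minus \<alpha>)
        also have "\<dots> = exp (\<alpha> (hvec h l)) * killing x (E (- \<alpha>))" using finite_roots \<alpha> by simp
        finally show ?thesis
          unfolding Ad_exp_h[OF t] using killing_h_E[OF root_minus[OF \<alpha>] hpart_h] by (simp add: killing_linear)
      qed
      then show ?thesis using X(2)[OF True] root_hvec[OF \<alpha> l] by (simp add: param_system_def)
    next
      case False
      then have "killing x (E (- \<beta>)) = 0" if "\<beta> = \<alpha>" for \<beta> using span_E_coefficient(2)[OF X(1) x] \<alpha> that by blast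
      moreover have "killing (Ad_exp (hvec h l) x) (E (- \<alpha>)) = 0"
      proof -
        have "(\<Sum>\<beta>\<in>\<Delta>. exp (\<beta> (hvec h l)) * killing x (E (- \<beta>)) * killing (E \<beta>) (E (- \<alpha>))) = 0"
          by (rule sum.neutral) (use calculation in \<open>auto simp: killing_E_minus \<alpha>\<close>)
        then show ?thesis
          unfolding Ad_exp_h[OF t] using killing_h_E[OF root_minus[OF \<alpha>] hpart_h] by (simp add: killing_linear)
      qed
      ultimately show ?thesis by simp
    qed
    ultimately show ?thesis by (simp add: lag_def)
  qed
  have "?G \<subseteq> lag ?\<phi>"
  proof (intro Un_least)
    show "diag h \<subseteq> lag ?\<phi>" by (auto simp: diag_def lag_h)
    show "{(x, Ad_exp (hvec h l) x) | x. x \<in> np \<union> nn} \<subseteq> lag ?\<phi>"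
      using Ad[OF _ roots(1)] Ad[OF _ roots(2)] unfolding np_def nn_def mem by blast
    show "kn \<times> kp \<subseteq> lag ?\<phi>"
    proof
      fix p assume "p \<in> kn \<times> kp"
      then obtain y z where p: "p = (y, z)" and y: "y \<in> cvs.span (E ` ?m ` ?gK)" and z: "z \<in> cvs.span (E ` ?gK)"
        unfolding kn_def kp_def by blast
      have "coordB (?\<phi> \<alpha>) * killing y (E (- \<alpha>)) = coordA (?\<phi> \<alpha>) * killing z (E (- \<alpha>))" if \<alpha>: "\<alpha> \<in> \<Delta>" for \<alpha>
      proof -
        have y0: "killing y (E (- \<alpha>)) = 0" if "- \<alpha> \<notin> ?gK"
          by (rule span_E_coefficient(2)[OF roots(4) y]) (use that \<alpha> mem[of \<alpha> ?gK] in simp)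
        have z0: "killing z (E (- \<alpha>)) = 0" if "\<alpha> \<notin> ?gK"
          by (rule span_E_coefficient(2)[OF roots(3) z]) (use that \<alpha> in simp)
        show ?thesis
          using y0 z0 np[of \<alpha>] gSP pos_or_neg[OF P \<alpha>] by (auto simp: param_system_def)
      qed
      then show "p \<in> lag ?\<phi>"
        using span_E_coefficient(1)[OF roots(4) y] span_E_coefficient(1)[OF roots(3) z] by (simp add: p lag_def)
    qed
  qed
  then have "cvs.span ?G \<subseteq> lag ?\<phi>" by (rule cvs.span_minimal[OF _ lag_subspace])
  moreover have "lag ?\<phi> \<subseteq> cvs.span ?G"
    unfolding lag_span
  proof (rule cvs.span_minimal[OF _ cvs.subspace_span])
    have "lagE ?\<phi> \<alpha> \<in> ?G" if \<alpha>: "\<alpha> \<in> \<Delta>" for \<alpha>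
    proof -
      consider "\<alpha> \<in> ?gS \<or> - \<alpha> \<in> ?gS" | "\<alpha> \<in> ?gK" "- \<alpha> \<notin> ?gS" | "- \<alpha> \<in> ?gK" "\<alpha> \<notin> gen_roots h P" "\<alpha> \<notin> ?gS"
        using pos_or_neg[OF P \<alpha>] np[of \<alpha>] gSP by blast
      then show ?thesis
      proof cases
        case 1
        have "E \<alpha> \<in> np \<union> nn"
          using 1 mem[of \<alpha> ?gS] unfolding np_def nn_def by (auto intro: cvs.span_base)
        moreover have "Ad_exp (hvec h l) (E \<alpha>) = exp (l (T \<alpha>)) *\<^sub>C E \<alpha>"
        proof -
          have s: "(\<Sum>\<beta>\<in>\<Delta>. (c \<beta> * killing (E \<alpha>) (E (- \<beta>))) *\<^sub>C E \<beta>) = c \<alpha> *\<^sub>C E \<alpha>" for c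
          proof -
            have "(\<Sum>\<beta>\<in>\<Delta>. (c \<beta> * killing (E \<alpha>) (E (- \<beta>))) *\<^sub>C E \<beta>) = (\<Sum>\<beta>\<in>\<Delta>. if \<beta> = \<alpha> then c \<alpha> *\<^sub>C E \<alpha> else 0)"
              by (rule sum.cong) (auto simp: killing_E_minus \<alpha>)
            then show ?thesis using finite_roots \<alpha> by simp
          qed
          have "hpart (E \<alpha>) = 0" unfolding hpart_def using s[of "\<lambda>_. 1"] by (simp add: scaleC_one)
          then show ?thesis unfolding Ad_exp_h[OF t] s by (simp add: root_hvec[OF \<alpha> l])
        qed
        moreover have "lagE ?\<phi> \<alpha> = (E \<alpha>, exp (l (T \<alpha>)) *\<^sub>C E \<alpha>)"
          using 1 by (simp add: lagE_def param_system_def scaleC_one)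
        ultimately show ?thesis by auto
      next
        case 2
        have "lagE ?\<phi> \<alpha> = (0, E \<alpha>)" using 2 by (simp add: lagE_def param_system_def scaleC_one)
        moreover have "E \<alpha> \<in> kp" "0 \<in> kn" using 2 unfolding kp_def kn_def
          by (auto intro: cvs.span_base cvs.span_zero)
        ultimately show ?thesis by simp
      next
        case 3
        then have "- \<alpha> \<notin> ?gS" by simp
        then have "lagE ?\<phi> \<alpha> = (E \<alpha>, 0)" using 3 by (simp add: lagE_def param_system_def scaleC_one)
        moreover have "E \<alpha> \<in> kn" "0 \<in> kp" using 3 mem[of \<alpha> ?gK] unfolding kp_def kn_def
          by (auto intro: cvs.span_base cvs.span_zero)
        ultimately show ?thesis by simp
      qed
    qed
    then show "diag h \<union> lagE ?\<phi> ` \<Delta> \<subseteq> cvs.span ?G"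
      using cvs.span_superset[of ?G] by blast
  qed
  ultimately show ?thesis unfolding W by blast
qed

text \<open>Independence of the simple roots allows \<open>S\<close> to be recovered from
  [S].\<close>

lemma simple_in_gen_roots:
  assumes P: "root_base h P" and S: "S \<subseteq> P" and \<alpha>: "\<alpha> \<in> P" "\<alpha> \<in> gen_roots h S"
  shows "\<alpha> \<in> S"
proof -
  obtain n :: "('g \<Rightarrow> complex) \<Rightarrow> nat" where n: "\<alpha> = (\<lambda>x. \<Sum>\<gamma>\<in>S. of_nat (n \<gamma>) * \<gamma> x)"
    using \<alpha>(2) unfolding gen_roots_def by blast
  have "(\<Sum>\<gamma>\<in>P. (if \<gamma> = \<alpha> then 1 else 0) * \<gamma> x) = (\<Sum>\<gamma>\<in>P. (if \<gamma> \<in> S then of_nat (n \<gamma>) else 0) * \<gamma> x)" for x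
  proof -
    have "(\<Sum>\<gamma>\<in>P. (if \<gamma> = \<alpha> then 1 else 0) * \<gamma> x) = (\<Sum>\<gamma>\<in>P. if \<gamma> = \<alpha> then \<alpha> x else 0)"
      by (rule sum.cong) auto
    also have "\<dots> = \<alpha> x" using base_finite[OF P] \<alpha>(1) by simp
    also have "\<alpha> x = (\<Sum>\<gamma>\<in>S. of_nat (n \<gamma>) * \<gamma> x)" by (rule fun_cong[OF n])
    also have "\<dots> = (\<Sum>\<gamma>\<in>P. (if \<gamma> \<in> S then of_nat (n \<gamma>) else 0) * \<gamma> x)"
      by (rule sum.mono_neutral_cong_left) (use base_finite[OF P] S in auto)
    finally show ?thesis .
  qed
  then have "(if \<alpha> = \<alpha> then 1 else 0) = (if \<alpha> \<in> S then of_nat (n \<alpha>) else (0::complex))"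
    by (rule base_unique[OF P ext \<alpha>(1), of "\<lambda>\<gamma>. if \<gamma> = \<alpha> then 1 else 0" "\<lambda>\<gamma>. if \<gamma> \<in> S then of_nat (n \<gamma>) else 0"])
  then show ?thesis by (auto split: if_splits)
qed

text \<open>The base is the same on both sides, because different bases can give the same system.
  For a fixed one, \<open>S\<close> consists of the simple roots with finite value, and the values
  on [S] follow from those on \<open>S\<close> by additivity in the exponent.\<close>

lemma param_system_eq_iff:
  assumes P: "root_base h P" and S: "S \<subseteq> P" "S' \<subseteq> P" and l: "l \<in> hdual h" "l' \<in> hdual h"
  shows "(\<forall>\<alpha>\<in>\<Delta>. param_system P S l \<alpha> = param_system P S' l' \<alpha>) \<longleftrightarrow>
    S = S' \<and> (\<forall>\<alpha>\<in>S. exp (l (T \<alpha>)) = exp (l' (T \<alpha>)))"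
proof
  have sub: "M \<subseteq> M' \<and> (\<forall>\<alpha>\<in>M. exp (m (T \<alpha>)) = exp (m' (T \<alpha>)))"
    if M: "M \<subseteq> P" "M' \<subseteq> P" and eq: "\<And>\<alpha>. \<alpha> \<in> \<Delta> \<Longrightarrow> param_system P M m \<alpha> = param_system P M' m' \<alpha>" for M M' m m'
  proof -
    have "\<alpha> \<in> M' \<and> exp (m (T \<alpha>)) = exp (m' (T \<alpha>))" if "\<alpha> \<in> M" for \<alpha>
    proof -
      have \<alpha>P: "\<alpha> \<in> P" "\<alpha> \<in> \<Delta>" using that M base_roots[OF P] by auto
      have \<alpha>p: "\<alpha> \<in> gen_roots h P" by (rule gen_roots_simple[OF base_finite[OF P] base_roots[OF P] \<alpha>P(1)])
      have "\<alpha> \<in> gen_roots h M"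
        using gen_roots_simple[OF _ _ that] M(1) base_finite[OF P] base_roots[OF P] finite_subset by blast
      then have "param_system P M' m' \<alpha> = Some (exp (m (T \<alpha>)))" using eq[OF \<alpha>P(2)] by (simp add: param_system_def)
      moreover have "- \<alpha> \<notin> gen_roots h M'"
        using not_pos_and_neg[OF P \<alpha>p] gen_roots_mono[OF M(2) base_finite[OF P]] by blast
      ultimately have "\<alpha> \<in> gen_roots h M'" "exp (m (T \<alpha>)) = exp (m' (T \<alpha>))"
        using \<alpha>p by (auto simp: param_system_def split: if_splits)
      then show ?thesis using simple_in_gen_roots[OF P M(2) \<alpha>P(1)] by blast
    qed
    then show ?thesis by blast
  qed
  assume *: "\<forall>\<alpha>\<in>\<Delta>. param_system P S l \<alpha> = param_system P S' l' \<alpha>"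
  have "S \<subseteq> S' \<and> (\<forall>\<alpha>\<in>S. exp (l (T \<alpha>)) = exp (l' (T \<alpha>)))" by (rule sub[OF S]) (use * in blast)
  moreover have "S' \<subseteq> S \<and> (\<forall>\<alpha>\<in>S'. exp (l' (T \<alpha>)) = exp (l (T \<alpha>)))"
    by (rule sub[OF S(2,1)]) (simp add: *)
  ultimately show "S = S' \<and> (\<forall>\<alpha>\<in>S. exp (l (T \<alpha>)) = exp (l' (T \<alpha>)))" by blast
next
  assume *: "S = S' \<and> (\<forall>\<alpha>\<in>S. exp (l (T \<alpha>)) = exp (l' (T \<alpha>)))"
  have Sf: "finite S" "S \<subseteq> \<Delta>" using S(1) base_finite[OF P] base_roots[OF P] finite_subset by auto
  have e: "exp (l (T \<beta>)) = exp (l' (T \<beta>))" if "\<beta> \<in> gen_roots h S" for \<beta>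
    using Sf that
  proof (induction rule: gen_roots_induct)
    case (simple \<alpha>)
    then show ?case using * by blast
  next
    case (add \<beta> \<alpha>)
    have r: "\<beta> \<in> \<Delta>" "\<alpha> \<in> \<Delta>" using add(1,2) gen_roots_root Sf by auto
    have m: "m (T (\<beta> + \<alpha>)) = m (T \<beta>) + m (T \<alpha>)" if "m \<in> hdual h" for m
      unfolding T_add[OF r add(3)] by (rule hdual_add_arg[OF that T_h[OF r(1)] T_h[OF r(2)]])
    have "exp (l (T (\<beta> + \<alpha>))) = exp (l' (T (\<beta> + \<alpha>)))"
      unfolding m[OF l(1)] m[OF l(2)] exp_add add(4) bspec[OF conjunct2[OF *] add(2)] by (rule refl)
    then show ?case .
  qed
  have "exp (l (T \<beta>)) = exp (l' (T \<beta>))" if "- \<beta> \<in> gen_roots h S" for \<beta>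
  proof -
    have \<beta>: "\<beta> \<in> \<Delta>" using gen_roots_root[OF that] root_minus[of "- \<beta>"] by simp
    have m: "m (T (- \<beta>)) = - m (T \<beta>)" if "m \<in> hdual h" for m
      unfolding T_minus by (rule hdual_minus_arg[OF that T_h[OF \<beta>]])
    show ?thesis using e[OF that] unfolding m[OF l(1)] m[OF l(2)] exp_minus by simp
  qed
  then show "\<forall>\<alpha>\<in>\<Delta>. param_system P S l \<alpha> = param_system P S' l' \<alpha>"
    using e * by (auto simp: param_system_def)
qed

end

subsection \<open>Tensors in coordinates\<close>

text \<open>Sums over \<open>lie_basis\<close> against components of a vector are evaluated by
  linearity, so the definitions in components become basis-free.\<close>

lemma sum_coord_linear:
  fixes f :: "'g::complex_lie_algebra \<Rightarrow> complex"
  assumes "\<And>x y. f (x + y) = f x + f y" "\<And>c x. f (c *\<^sub>C x) = c * f x"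
  shows "(\<Sum>a\<in>lie_basis. coord a u * f a) = f u"
proof -
  have "f 0 = 0" using assms(1)[of 0 0] by simp
  then have "f (\<Sum>a\<in>A. g a) = (\<Sum>a\<in>A. f (g a))" for A and g :: "'g \<Rightarrow> 'g"
    by (induction A rule: infinite_finite_induct) (auto simp: assms(1))
  then have "(\<Sum>a\<in>lie_basis. coord a u * f a) = f (\<Sum>a\<in>lie_basis. coord a u *\<^sub>C a)"
    by (simp add: assms(2))
  then show ?thesis by (simp add: coord_expansion)
qed

lemma sum_coord_bilinear:
  fixes f :: "'g::complex_lie_algebra \<Rightarrow> 'g \<Rightarrow> complex"
  assumes "\<And>x y z. f (x + y) z = f x z + f y z" "\<And>c x z. f (c *\<^sub>C x) z = c * f x z"
    and "\<And>x y z. f z (x + y) = f z x + f z y" "\<And>c x z. f z (c *\<^sub>C x) = c * f z x"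
  shows "(\<Sum>a\<in>lie_basis. \<Sum>b\<in>lie_basis. tens2 u v a b * f a b) = f u v"
proof -
  have "(\<Sum>a\<in>lie_basis. \<Sum>b\<in>lie_basis. tens2 u v a b * f a b)
      = (\<Sum>a\<in>lie_basis. coord a u * (\<Sum>b\<in>lie_basis. coord b v * f a b))"
    by (simp add: tens2_def sum_distrib_left mult.assoc)
  also have "\<dots> = f u v"
    by (simp add: sum_coord_linear assms)
  finally show ?thesis .
qed

lemma tens3_linear:
  "tens3 (x + y) v w i j k = tens3 x v w i j k + tens3 y v w i j k"
  "tens3 u (x + y) w i j k = tens3 u x w i j k + tens3 u y w i j k"
  "tens3 u v (x + y) i j k = tens3 u v x i j k + tens3 u v y i j k"
  "tens3 (c *\<^sub>C x) v w i j k = c * tens3 x v w i j k"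
  "tens3 u (c *\<^sub>C x) w i j k = c * tens3 u x w i j k"
  "tens3 u v (c *\<^sub>C x) i j k = c * tens3 u v x i j k"
  by (simp_all add: tens3_def algebra_simps)

lemma wedge3_linear:
  "wedge3 (x + y) v w i j k = wedge3 x v w i j k + wedge3 y v w i j k"
  "wedge3 u (x + y) w i j k = wedge3 u x w i j k + wedge3 u y w i j k"
  "wedge3 u v (x + y) i j k = wedge3 u v x i j k + wedge3 u v y i j k"
  "wedge3 (c *\<^sub>C x) v w i j k = c * wedge3 x v w i j k"
  "wedge3 u (c *\<^sub>C x) w i j k = c * wedge3 u x w i j k"
  "wedge3 u v (c *\<^sub>C x) i j k = c * wedge3 u v x i j k"
  by (simp_all add: wedge3_def tens3_linear algebra_simps)

lemma schouten_dec_linear: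
  "schouten_dec (x + y) b c d i j k = schouten_dec x b c d i j k + schouten_dec y b c d i j k"
  "schouten_dec a (x + y) c d i j k = schouten_dec a x c d i j k + schouten_dec a y c d i j k"
  "schouten_dec a b (x + y) d i j k = schouten_dec a b x d i j k + schouten_dec a b y d i j k"
  "schouten_dec a b c (x + y) i j k = schouten_dec a b c x i j k + schouten_dec a b c y i j k"
  "schouten_dec (s *\<^sub>C x) b c d i j k = s * schouten_dec x b c d i j k"
  "schouten_dec a (s *\<^sub>C x) c d i j k = s * schouten_dec a x c d i j k"
  "schouten_dec a b (s *\<^sub>C x) d i j k = s * schouten_dec a b x d i j k"
  "schouten_dec a b c (s *\<^sub>C x) i j k = s * schouten_dec a b c x i j k"
  by (simp_all add: schouten_dec_def wedge3_linear bracket_add_left bracket_add_right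
      bracket_scaleC_left bracket_scaleC_right algebra_simps)

lemma sum_fun_apply2: "(\<Sum>a\<in>A. f a) x y = (\<Sum>a\<in>A. f a x y :: complex)"
  by (induction A rule: infinite_finite_induct) auto

lemma sum_fun_apply3: "(\<Sum>a\<in>A. f a) x y z = (\<Sum>a\<in>A. f a x y z :: complex)"
  by (induction A rule: infinite_finite_induct) auto

section \<open>The Killing-dual basis and the Casimir element\<close>

context cartan
begin

text \<open>The representing vector is assembled from \<open>hvec\<close> on \<open>h\<close> and
  from the opposite root vectors on the root spaces.\<close>

lemma killing_represents:
  fixes f :: "'g \<Rightarrow> complex"
  assumes f: "\<And>x y. f (x + y) = f x + f y" "\<And>c x. f (c *\<^sub>C x) = c * f x"
  shows "\<exists>y. \<forall>x. killing y x = f x"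
proof -
  define l where "l x = (if x \<in> h then f x else 0)" for x
  have l: "l \<in> hdual h" by (auto simp: l_def hdual_def h_add h_scaleC f)
  have f0: "f 0 = 0" using f(1)[of 0 0] by simp
  define y where "y = hvec h l + (\<Sum>\<beta>\<in>\<Delta>. f (E \<beta>) *\<^sub>C E (- \<beta>))"
  have "killing y x = f x" for x
  proof (rule E_induct[where Q = "\<lambda>x. killing y x = f x"])
    show "cvs.subspace {x. killing y x = f x}"
      by (auto simp: cvs.subspace_def killing_linear f f0)
    show "killing y x = f x" if x: "x \<in> h" for x
      using x l by (simp add: y_def killing_linear killing_hvec killing_E_h root_minus l_def)
    show "killing y (E \<alpha>) = f (E \<alpha>)" if \<alpha>: "\<alpha> \<in> \<Delta>" for \<alpha>
    proof -
      have "(\<Sum>\<beta>\<in>\<Delta>. f (E \<beta>) * killing (E (- \<beta>)) (E \<alpha>)) = (\<Sum>\<beta>\<in>\<Delta>. if \<beta> = \<alpha> then f (E \<alpha>) else 0)"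
        by (rule sum.cong) (auto simp: killing_commute[of "E (- _)"] killing_E_minus \<alpha>)
      then show ?thesis
        using finite_roots \<alpha> hvec_h[OF l] by (simp add: y_def killing_linear killing_h_E)
    qed
  qed
  then show ?thesis by blast
qed

text \<open>The basis dual to \<open>lie_basis\<close> under the Killing form, and 0 at indices off
  the basis. A tensor component at index \<open>a\<close> is a pairing with \<open>dualv a\<close>,
  so equations between components become identities of multilinear forms on the Lie algebra.\<close>

definition dualv :: "'g \<Rightarrow> 'g"
  where "dualv a = (SOME y. \<forall>x. killing y x = coord a x)"

lemma killing_dualv: "killing (dualv a) x = coord a x"
proof -
  have "\<exists>y. \<forall>x. killing y x = coord a x" by (rule killing_represents) auto
  then show ?thesis unfolding dualv_def by (rule someI2_ex) blast
qed

lemma killing_dualv_right: "killing x (dualv a) = coord a x"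
  by (simp add: killing_commute[of x] killing_dualv)

lemma coord_dualv_commute: "coord a (dualv b) = coord b (dualv a)"
  by (metis killing_dualv killing_dualv_right)

lemma dualv_expansion: "x = (\<Sum>a\<in>lie_basis. killing x a *\<^sub>C dualv a)"
proof -
  have "killing (x - (\<Sum>a\<in>lie_basis. killing x a *\<^sub>C dualv a)) y = 0" for y
  proof -
    have "(\<Sum>a\<in>lie_basis. killing x a * coord a y) = killing x y"
      using sum_coord_linear[of "killing x" y] by (simp add: killing_linear mult.commute)
    then show ?thesis by (simp add: killing_linear killing_dualv)
  qed
  then show ?thesis using killing_nondegenerate by (metis eq_iff_diff_eq_0)
qed

lemma casimir_component: "a \<in> lie_basis \<Longrightarrow> casimir a b = coord b (dualv a)"
proof -
  assume a: "a \<in> lie_basis"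
  have the: "(THE y. \<forall>b\<in>lie_basis. killing y b = (if b = e then 1 else 0)) = dualv e" if e: "e \<in> lie_basis" for e :: 'g
  proof (rule the_equality)
    show "\<forall>b\<in>lie_basis. killing (dualv e) b = (if b = e then 1 else 0)"
      by (auto simp: killing_dualv coord_basis)
    fix y assume y: "\<forall>b\<in>lie_basis. killing y b = (if b = e then 1 else 0)"
    have "y = (\<Sum>b\<in>lie_basis. (if b = e then 1 else 0) *\<^sub>C dualv b)"
      by (subst dualv_expansion) (use y in \<open>auto intro!: sum.cong\<close>)
    also have "\<dots> = (\<Sum>b\<in>lie_basis. if b = e then dualv e else 0)"
      by (rule sum.cong) (auto simp: scaleC_one)
    also have "\<dots> = dualv e" using e by (simp add: finite_lie_basis)
    finally show "y = dualv e" .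
  qed
  have "casimir a b = (\<Sum>e\<in>lie_basis. coord a e * coord b (dualv e))"
    unfolding casimir_def sum_fun_apply2 by (rule sum.cong) (simp_all add: the tens2_def)
  also have "\<dots> = (\<Sum>e\<in>lie_basis. if e = a then coord b (dualv a) else 0)"
    by (rule sum.cong) (auto simp: coord_basis)
  also have "\<dots> = coord b (dualv a)" using a by (simp add: finite_lie_basis)
  finally show ?thesis .
qed

lemma coord_dualv_sum:
  assumes "\<And>x y. f (x + y) = f x + f y" "\<And>c x. f (c *\<^sub>C x) = c * f x"
  shows "(\<Sum>a\<in>lie_basis. coord i a * f (dualv a)) = f (dualv i :: 'g)"
proof (cases "i \<in> lie_basis")
  case True
  have "(\<Sum>a\<in>lie_basis. coord i a * f (dualv a)) = (\<Sum>a\<in>lie_basis. if a = i then f (dualv i) else 0)"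
    by (rule sum.cong) (auto simp: coord_basis)
  then show ?thesis using True by (simp add: finite_lie_basis)
next
  case False
  then have "dualv i = 0" by (intro killing_nondegenerate) (simp add: killing_dualv coord_off_basis)
  moreover have "f 0 = 0" using assms(1)[of 0 0] by simp
  ultimately show ?thesis using False by (simp add: coord_off_basis)
qed

text \<open>The Casimir tensor inverts the Killing form, so each contraction with it substitutes a
  dual vector. What is left is the invariant three-form.\<close>

lemma comm_casimir: "comm12_23 casimir casimir i j k = - killing (bracket (dualv i) (dualv j)) (dualv k)"
proof -
  have k: "(\<Sum>d\<in>lie_basis. coord k d * coord j (bracket b (dualv d))) = coord j (bracket b (dualv k))" for b
    by (rule coord_dualv_sum) (simp_all add: bracket_add_right bracket_scaleC_right)
  have i: "(\<Sum>a\<in>lie_basis. coord i a * coord j (bracket (dualv a) (dualv k))) = coord j (bracket (dualv i) (dualv k))"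
    by (rule coord_dualv_sum) (simp_all add: bracket_add_left bracket_scaleC_left)
  have "comm12_23 casimir casimir i j k = (\<Sum>a\<in>lie_basis. \<Sum>b\<in>lie_basis. \<Sum>c\<in>lie_basis. \<Sum>d\<in>lie_basis.
      coord b (dualv a) * coord c (dualv d) * (coord i a * coord j (bracket b c) * coord k d))"
    unfolding comm12_23_def tens3_def
    by (intro sum.cong refl) (simp add: casimir_component coord_dualv_commute)
  also have "\<dots> = (\<Sum>a\<in>lie_basis. coord i a * (\<Sum>b\<in>lie_basis. coord b (dualv a) *
      (\<Sum>c\<in>lie_basis. \<Sum>d\<in>lie_basis. coord c (dualv d) * coord j (bracket b c) * coord k d)))"
    by (simp add: sum_distrib_left mult_ac)
  also have "\<dots> = (\<Sum>a\<in>lie_basis. coord i a * (\<Sum>b\<in>lie_basis. coord b (dualv a) *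
      (\<Sum>d\<in>lie_basis. coord k d * (\<Sum>c\<in>lie_basis. coord c (dualv d) * coord j (bracket b c)))))"
    by (subst sum.swap) (simp add: sum_distrib_left mult_ac)
  also have "\<dots> = (\<Sum>a\<in>lie_basis. coord i a * (\<Sum>b\<in>lie_basis. coord b (dualv a) * coord j (bracket b (dualv k))))"
    by (simp add: sum_coord_linear k bracket_add_right bracket_scaleC_right)
  also have "\<dots> = coord j (bracket (dualv i) (dualv k))"
    by (simp add: sum_coord_linear i bracket_add_left bracket_scaleC_left)
  also have "\<dots> = killing (dualv j) (bracket (dualv i) (dualv k))" by (simp add: killing_dualv)
  also have "\<dots> = killing (bracket (dualv j) (dualv i)) (dualv k)" by (simp add: killing_invariant)
  finally show ?thesis by (simp add: bracket_anticomm[of "dualv j" "dualv i"])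
qed

subsection \<open>Weight zero bivectors\<close>

text \<open>Summing over all roots makes no reference to positive roots. For odd coefficients this
  is the wedge sum over the positive roots of any base (\<open>rmat_wedge\<close>), so parameters
  with different bases can be compared.\<close>

definition rmat :: "(('g \<Rightarrow> complex) \<Rightarrow> complex) \<Rightarrow> 'g tensor2"
  where "rmat \<rho> = (\<lambda>a b. \<Sum>\<alpha>\<in>\<Delta>. \<rho> \<alpha> * tens2 (E \<alpha>) (E (- \<alpha>)) a b)"

definition odd_on_roots :: "(('g \<Rightarrow> complex) \<Rightarrow> complex) \<Rightarrow> bool"
  where "odd_on_roots \<rho> \<longleftrightarrow> (\<forall>\<alpha>\<in>\<Delta>. \<rho> (- \<alpha>) = - \<rho> \<alpha>)"

lemma sum_roots_minus: "(\<Sum>\<alpha>\<in>\<Delta>. f (- \<alpha>)) = (\<Sum>\<alpha>\<in>\<Delta>. f \<alpha>)"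
  by (rule sum.reindex_bij_witness[of _ uminus uminus]) (auto simp: root_minus)

lemma rmat_contract:
  fixes f :: "'g \<Rightarrow> 'g \<Rightarrow> complex"
  assumes "\<And>x y z. f (x + y) z = f x z + f y z" "\<And>c x z. f (c *\<^sub>C x) z = c * f x z"
    and "\<And>x y z. f z (x + y) = f z x + f z y" "\<And>c x z. f z (c *\<^sub>C x) = c * f z x"
  shows "(\<Sum>a\<in>lie_basis. \<Sum>b\<in>lie_basis. rmat \<rho> a b * f a b) = (\<Sum>\<alpha>\<in>\<Delta>. \<rho> \<alpha> * f (E \<alpha>) (E (- \<alpha>)))"
proof -
  have "(\<Sum>a\<in>lie_basis. \<Sum>b\<in>lie_basis. rmat \<rho> a b * f a b)
      = (\<Sum>a\<in>lie_basis. \<Sum>b\<in>lie_basis. \<Sum>\<alpha>\<in>\<Delta>. \<rho> \<alpha> * (tens2 (E \<alpha>) (E (- \<alpha>)) a b * f a b))"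
    by (simp add: rmat_def sum_distrib_right mult.assoc)
  also have "\<dots> = (\<Sum>a\<in>lie_basis. \<Sum>\<alpha>\<in>\<Delta>. \<Sum>b\<in>lie_basis. \<rho> \<alpha> * (tens2 (E \<alpha>) (E (- \<alpha>)) a b * f a b))"
    by (rule sum.cong[OF refl], rule sum.swap)
  also have "\<dots> = (\<Sum>\<alpha>\<in>\<Delta>. \<Sum>a\<in>lie_basis. \<Sum>b\<in>lie_basis. \<rho> \<alpha> * (tens2 (E \<alpha>) (E (- \<alpha>)) a b * f a b))"
    by (rule sum.swap)
  also have "\<dots> = (\<Sum>\<alpha>\<in>\<Delta>. \<rho> \<alpha> * (\<Sum>a\<in>lie_basis. \<Sum>b\<in>lie_basis. tens2 (E \<alpha>) (E (- \<alpha>)) a b * f a b))"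
    by (simp add: sum_distrib_left)
  also have "\<dots> = (\<Sum>\<alpha>\<in>\<Delta>. \<rho> \<alpha> * f (E \<alpha>) (E (- \<alpha>)))"
    by (simp add: sum_coord_bilinear[OF assms])
  finally show ?thesis .
qed

text \<open>A linear functional on all tensors, so that it commutes with differentiation and with
  division by a denominator even before the tensor is known to have the form
  \<open>rmat\<close>.\<close>

definition rcoeff :: "'g tensor2 \<Rightarrow> ('g \<Rightarrow> complex) \<Rightarrow> complex"
  where "rcoeff r \<alpha> = (\<Sum>a\<in>lie_basis. \<Sum>b\<in>lie_basis. r a b * (killing a (E (- \<alpha>)) * killing b (E \<alpha>)))"

lemma rcoeff_rmat:
  assumes "\<alpha> \<in> \<Delta>"
  shows "rcoeff (rmat \<rho>) \<alpha> = \<rho> \<alpha>"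
proof -
  have "rcoeff (rmat \<rho>) \<alpha> = (\<Sum>\<beta>\<in>\<Delta>. \<rho> \<beta> * (killing (E \<beta>) (E (- \<alpha>)) * killing (E (- \<beta>)) (E \<alpha>)))"
    unfolding rcoeff_def by (rule rmat_contract) (simp_all add: killing_linear algebra_simps)
  also have "\<dots> = (\<Sum>\<beta>\<in>\<Delta>. if \<beta> = \<alpha> then \<rho> \<alpha> else 0)"
    by (rule sum.cong) (auto simp: killing_E_minus killing_commute[of "E (- _)"] assms)
  finally show ?thesis using finite_roots assms by simp
qed

lemma rmat_bivector:
  assumes "odd_on_roots \<rho>"
  shows "rmat \<rho> \<in> bivectors"
proof -
  have "rmat \<rho> b a = - rmat \<rho> a b" for a b
  proof -
    have "rmat \<rho> b a = (\<Sum>\<alpha>\<in>\<Delta>. \<rho> (- \<alpha>) * tens2 (E (- \<alpha>)) (E (- (- \<alpha>))) b a)"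
      unfolding rmat_def by (rule sum_roots_minus[symmetric])
    also have "\<dots> = - rmat \<rho> a b"
      using assms by (simp add: rmat_def odd_on_roots_def tens2_def mult.commute flip: sum_negf)
    finally show ?thesis .
  qed
  moreover have "rmat \<rho> a b = 0" if "a \<notin> lie_basis \<or> b \<notin> lie_basis" for a b
    using that by (auto simp: rmat_def tens2_def coord_off_basis intro!: sum.neutral)
  ultimately show ?thesis unfolding bivectors_def by blast
qed

lemma ad2_rmat:
  assumes "x \<in> h"
  shows "ad2 x (rmat \<rho>) = 0"
proof -
  have "ad2 x (rmat \<rho>) i j = 0" for i j
  proof -
    have "ad2 x (rmat \<rho>) i j = (\<Sum>\<alpha>\<in>\<Delta>. \<rho> \<alpha> * (tens2 (bracket x (E \<alpha>)) (E (- \<alpha>)) i j + tens2 (E \<alpha>) (bracket x (E (- \<alpha>))) i j))"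
      unfolding ad2_def
      by (rule rmat_contract) (simp_all add: tens2_def bracket_linear algebra_simps)
    also have "\<dots> = 0"
      by (rule sum.neutral) (use assms in \<open>auto simp: bracket_h_E root_minus tens2_def\<close>)
    finally show ?thesis .
  qed
  then show ?thesis by (simp add: fun_eq_iff)
qed

lemma rmat_wedge:
  assumes P: "root_base h P" and odd: "odd_on_roots \<rho>"
  shows "rmat \<rho> a b = (\<Sum>\<alpha>\<in>gen_roots h P. \<rho> \<alpha> * wedge2 (E \<alpha>) (E (- \<alpha>)) a b)"
proof -
  let ?m = "(\<lambda>\<alpha>. - \<alpha>) :: ('g \<Rightarrow> complex) \<Rightarrow> ('g \<Rightarrow> complex)"
  let ?p = "gen_roots h P"
  have pr: "?p \<subseteq> \<Delta>" using gen_roots_root by blast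
  have fp: "finite ?p" using pr finite_roots finite_subset by blast
  have mem: "\<alpha> \<in> ?m ` X \<longleftrightarrow> - \<alpha> \<in> X" for \<alpha> X by force
  have D: "\<Delta> = ?p \<union> ?m ` ?p"
    using pr pos_or_neg[OF P] root_minus mem by blast
  have "?p \<inter> ?m ` ?p = {}" using not_pos_and_neg[OF P] by blast
  then have "rmat \<rho> a b = (\<Sum>\<alpha>\<in>?p. \<rho> \<alpha> * tens2 (E \<alpha>) (E (- \<alpha>)) a b) +
      (\<Sum>\<alpha>\<in>?m ` ?p. \<rho> \<alpha> * tens2 (E \<alpha>) (E (- \<alpha>)) a b)"
    unfolding rmat_def by (subst D) (rule sum.union_disjoint, use fp in auto)
  also have "(\<Sum>\<alpha>\<in>?m ` ?p. \<rho> \<alpha> * tens2 (E \<alpha>) (E (- \<alpha>)) a b)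
      = (\<Sum>\<alpha>\<in>?p. \<rho> (- \<alpha>) * tens2 (E (- \<alpha>)) (E (- (- \<alpha>))) a b)"
    by (subst sum.reindex) (auto simp: inj_on_def)
  also have "\<dots> = (\<Sum>\<alpha>\<in>?p. - \<rho> \<alpha> * tens2 (E (- \<alpha>)) (E \<alpha>) a b)"
    by (rule sum.cong) (use odd pr in \<open>auto simp: odd_on_roots_def\<close>)
  finally have "rmat \<rho> a b = (\<Sum>\<alpha>\<in>?p. \<rho> \<alpha> * tens2 (E \<alpha>) (E (- \<alpha>)) a b + - \<rho> \<alpha> * tens2 (E (- \<alpha>)) (E \<alpha>) a b)"
    by (simp only: sum.distrib)
  also have "\<dots> = (\<Sum>\<alpha>\<in>?p. \<rho> \<alpha> * wedge2 (E \<alpha>) (E (- \<alpha>)) a b)"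
    by (rule sum.cong[OF refl]) (simp add: wedge2_def algebra_simps)
  finally show ?thesis .
qed

subsection \<open>The classical dynamical Yang-Baxter equation on weight zero bivectors\<close>

definition rform :: "(('g \<Rightarrow> complex) \<Rightarrow> complex) \<Rightarrow> 'g \<Rightarrow> 'g \<Rightarrow> complex"
  where "rform \<rho> x y = (\<Sum>\<alpha>\<in>\<Delta>. \<rho> \<alpha> * (killing (E \<alpha>) x * killing (E (- \<alpha>)) y))"

text \<open>The same tensor read as an operator through the Killing form. It kills \<open>h\<close>
  and multiplies each root vector by its coefficient.\<close>

definition rop :: "(('g \<Rightarrow> complex) \<Rightarrow> complex) \<Rightarrow> 'g \<Rightarrow> 'g"
  where "rop \<rho> y = (\<Sum>\<alpha>\<in>\<Delta>. (\<rho> \<alpha> * killing (E (- \<alpha>)) y) *\<^sub>C E \<alpha>)"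

lemma rform_linear:
  "rform \<rho> (x + y) z = rform \<rho> x z + rform \<rho> y z" "rform \<rho> z (x + y) = rform \<rho> z x + rform \<rho> z y"
  "rform \<rho> (c *\<^sub>C x) z = c * rform \<rho> x z" "rform \<rho> z (c *\<^sub>C x) = c * rform \<rho> z x"
  by (simp_all add: rform_def killing_linear algebra_simps sum.distrib sum_distrib_left)

lemma rop_linear: "rop \<rho> (x + y) = rop \<rho> x + rop \<rho> y" "rop \<rho> (c *\<^sub>C x) = c *\<^sub>C rop \<rho> x"
  by (simp_all add: rop_def killing_linear algebra_simps sum.distrib scaleC_add_left cvs.scale_sum_right scaleC_scaleC)

lemma rform_odd: "odd_on_roots \<rho> \<Longrightarrow> rform \<rho> y x = - rform \<rho> x y"
proof -
  assume odd: "odd_on_roots \<rho>"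
  have "rform \<rho> y x = (\<Sum>\<alpha>\<in>\<Delta>. \<rho> (- \<alpha>) * (killing (E (- \<alpha>)) y * killing (E (- (- \<alpha>))) x))"
    unfolding rform_def by (rule sum_roots_minus[symmetric])
  also have "\<dots> = - rform \<rho> x y"
    using odd by (simp add: rform_def odd_on_roots_def mult_ac flip: sum_negf)
  finally show ?thesis .
qed

lemma rform_h: "t \<in> h \<Longrightarrow> rform \<rho> t x = 0" "t \<in> h \<Longrightarrow> rform \<rho> x t = 0"
  by (simp_all add: rform_def killing_E_h root_minus)

lemma rop_h: "t \<in> h \<Longrightarrow> rop \<rho> t = 0"
  by (simp add: rop_def killing_E_h root_minus)

lemma rform_E:
  assumes "\<alpha> \<in> \<Delta>" "\<beta> \<in> \<Delta>"
  shows "rform \<rho> (E \<alpha>) (E \<beta>) = (if \<beta> = - \<alpha> then \<rho> \<beta> else 0)"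
proof -
  have "rform \<rho> (E \<alpha>) (E \<beta>) = (\<Sum>\<gamma>\<in>\<Delta>. if \<gamma> = \<beta> then (if \<beta> = - \<alpha> then \<rho> \<beta> else 0) else 0)"
    unfolding rform_def
    by (rule sum.cong) (auto simp: killing_E_E killing_commute[of "E (- _)"] killing_E_minus assms)
  then show ?thesis using finite_roots assms by simp
qed

lemma rop_E:
  assumes "\<alpha> \<in> \<Delta>"
  shows "rop \<rho> (E \<alpha>) = \<rho> \<alpha> *\<^sub>C E \<alpha>"
proof -
  have "rop \<rho> (E \<alpha>) = (\<Sum>\<gamma>\<in>\<Delta>. if \<gamma> = \<alpha> then \<rho> \<alpha> *\<^sub>C E \<alpha> else 0)"
    unfolding rop_def
    by (rule sum.cong) (auto simp: killing_commute[of "E (- _)"] killing_E_minus assms)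
  then show ?thesis using finite_roots assms by simp
qed

lemma wedge3_killing:
  "wedge3 u v w i j k =
    killing u (dualv i) * killing v (dualv j) * killing w (dualv k)
    + killing v (dualv i) * killing w (dualv j) * killing u (dualv k)
    + killing w (dualv i) * killing u (dualv j) * killing v (dualv k)
    - killing v (dualv i) * killing u (dualv j) * killing w (dualv k)
    - killing u (dualv i) * killing w (dualv j) * killing v (dualv k)
    - killing w (dualv i) * killing v (dualv j) * killing u (dualv k)"
  by (simp add: wedge3_def tens3_def killing_dualv_right)

lemma wedge12_rmat:
  assumes odd: "odd_on_roots \<rho>"
  shows "wedge12 t (rmat \<rho>) i j k =
    killing t (dualv i) * rform \<rho> (dualv j) (dualv k) +
    killing t (dualv j) * rform \<rho> (dualv k) (dualv i) +
    killing t (dualv k) * rform \<rho> (dualv i) (dualv j)"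
proof -
  have "wedge12 t (rmat \<rho>) i j k = (\<Sum>a\<in>lie_basis. \<Sum>b\<in>lie_basis. rmat \<rho> a b * (wedge3 t a b i j k / 2))"
    by (simp add: wedge12_def)
  also have "\<dots> = (\<Sum>\<alpha>\<in>\<Delta>. \<rho> \<alpha> * (wedge3 t (E \<alpha>) (E (- \<alpha>)) i j k / 2))"
    by (rule rmat_contract) (simp_all add: wedge3_linear add_divide_distrib)
  also have "\<dots> = (killing t (dualv i) * rform \<rho> (dualv j) (dualv k)
    + killing t (dualv k) * rform \<rho> (dualv i) (dualv j)
    + killing t (dualv j) * rform \<rho> (dualv k) (dualv i)
    - killing t (dualv j) * rform \<rho> (dualv i) (dualv k)
    - killing t (dualv i) * rform \<rho> (dualv k) (dualv j)
    - killing t (dualv k) * rform \<rho> (dualv j) (dualv i)) / 2"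
    unfolding wedge3_killing rform_def
    by (simp add: sum_distrib_left sum.distrib sum_subtractf algebra_simps sum_divide_distrib
        add_divide_distrib diff_divide_distrib)
  also have "\<dots> = killing t (dualv i) * rform \<rho> (dualv j) (dualv k) +
    killing t (dualv j) * rform \<rho> (dualv k) (dualv i) + killing t (dualv k) * rform \<rho> (dualv i) (dualv j)"
    unfolding rform_odd[OF odd, of "dualv i" "dualv k"] rform_odd[OF odd, of "dualv k" "dualv j"]
      rform_odd[OF odd, of "dualv j" "dualv i"] by (simp add: field_simps)
  finally show ?thesis .
qed

lemma killing_rop_bracket:
  "killing (bracket (rop \<rho> y) (rop \<rho> z)) x =
    (\<Sum>\<alpha>\<in>\<Delta>. \<Sum>\<beta>\<in>\<Delta>. \<rho> \<alpha> * \<rho> \<beta> * (killing (bracket (E \<alpha>) (E \<beta>)) x * killing (E (- \<alpha>)) y * killing (E (- \<beta>)) z))"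
  by (simp only: rop_def bracket_sum_left)
     (simp add: bracket_linear killing_linear sum_distrib_left sum_distrib_right mult_ac)

text \<open>Replacing \<alpha> by -\<alpha> shows that the four terms of \<open>schouten_dec\<close>
  contribute equally, which absorbs the two factors 1/2 in \<open>schouten\<close>. The six terms of
  \<open>wedge3\<close> then agree in pairs by antisymmetry of the bracket, which absorbs the
  remaining 1/2.\<close>

lemma schouten_rmat:
  assumes odd: "odd_on_roots \<rho>"
  shows "1 / 2 * schouten (rmat \<rho>) (rmat \<rho>) i j k =
    killing (bracket (rop \<rho> (dualv j)) (rop \<rho> (dualv k))) (dualv i) +
    killing (bracket (rop \<rho> (dualv k)) (rop \<rho> (dualv i))) (dualv j) +
    killing (bracket (rop \<rho> (dualv i)) (rop \<rho> (dualv j))) (dualv k)"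
proof -
  define M where "M a b c d = wedge3 (bracket a c) b d i j k" for a b c d :: 'g
  have M: "schouten_dec a b c d i j k = M a b c d - M a b d c - M b a c d + M b a d c" for a b c d
    by (simp add: schouten_dec_def M_def)
  have flip2: "(\<Sum>\<alpha>\<in>\<Delta>. \<Sum>\<beta>\<in>\<Delta>. \<rho> \<alpha> * \<rho> \<beta> * M (x \<alpha>) (y \<alpha>) (E (- \<beta>)) (E \<beta>))
      = - (\<Sum>\<alpha>\<in>\<Delta>. \<Sum>\<beta>\<in>\<Delta>. \<rho> \<alpha> * \<rho> \<beta> * M (x \<alpha>) (y \<alpha>) (E \<beta>) (E (- \<beta>)))" for x y
  proof -
    have "(\<Sum>\<beta>\<in>\<Delta>. \<rho> \<alpha> * \<rho> \<beta> * M (x \<alpha>) (y \<alpha>) (E (- \<beta>)) (E \<beta>))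
        = - (\<Sum>\<beta>\<in>\<Delta>. \<rho> \<alpha> * \<rho> \<beta> * M (x \<alpha>) (y \<alpha>) (E \<beta>) (E (- \<beta>)))" for \<alpha>
      using sum_roots_minus[of "\<lambda>\<beta>. \<rho> \<alpha> * \<rho> \<beta> * M (x \<alpha>) (y \<alpha>) (E (- \<beta>)) (E \<beta>)"] odd
      by (simp add: odd_on_roots_def sum_negf)
    then show ?thesis by (simp add: sum_negf)
  qed
  have flip1: "(\<Sum>\<alpha>\<in>\<Delta>. \<Sum>\<beta>\<in>\<Delta>. \<rho> \<alpha> * \<rho> \<beta> * M (E (- \<alpha>)) (E \<alpha>) (E \<beta>) (E (- \<beta>)))
      = - (\<Sum>\<alpha>\<in>\<Delta>. \<Sum>\<beta>\<in>\<Delta>. \<rho> \<alpha> * \<rho> \<beta> * M (E \<alpha>) (E (- \<alpha>)) (E \<beta>) (E (- \<beta>)))"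
    using sum_roots_minus[of "\<lambda>\<alpha>. \<Sum>\<beta>\<in>\<Delta>. \<rho> \<alpha> * \<rho> \<beta> * M (E (- \<alpha>)) (E \<alpha>) (E \<beta>) (E (- \<beta>))"] odd
    by (simp add: odd_on_roots_def sum_negf)
  have "schouten (rmat \<rho>) (rmat \<rho>) i j k = (\<Sum>a\<in>lie_basis. \<Sum>b\<in>lie_basis. rmat \<rho> a b *
      (\<Sum>c\<in>lie_basis. \<Sum>d\<in>lie_basis. rmat \<rho> c d * (schouten_dec a b c d i j k / 4)))"
    by (simp add: schouten_def sum_distrib_left mult_ac)
  also have "\<dots> = (\<Sum>a\<in>lie_basis. \<Sum>b\<in>lie_basis. rmat \<rho> a b *
      (\<Sum>\<beta>\<in>\<Delta>. \<rho> \<beta> * (schouten_dec a b (E \<beta>) (E (- \<beta>)) i j k / 4)))"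
    by (subst rmat_contract) (simp_all add: schouten_dec_linear add_divide_distrib)
  also have "\<dots> = (\<Sum>\<alpha>\<in>\<Delta>. \<rho> \<alpha> * (\<Sum>\<beta>\<in>\<Delta>. \<rho> \<beta> * (schouten_dec (E \<alpha>) (E (- \<alpha>)) (E \<beta>) (E (- \<beta>)) i j k / 4)))"
    by (rule rmat_contract)
       (simp_all add: schouten_dec_linear add_divide_distrib sum.distrib sum_distrib_left distrib_left mult_ac)
  also have "\<dots> = ((\<Sum>\<alpha>\<in>\<Delta>. \<Sum>\<beta>\<in>\<Delta>. \<rho> \<alpha> * \<rho> \<beta> * M (E \<alpha>) (E (- \<alpha>)) (E \<beta>) (E (- \<beta>)))
     - (\<Sum>\<alpha>\<in>\<Delta>. \<Sum>\<beta>\<in>\<Delta>. \<rho> \<alpha> * \<rho> \<beta> * M (E \<alpha>) (E (- \<alpha>)) (E (- \<beta>)) (E \<beta>))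
     - (\<Sum>\<alpha>\<in>\<Delta>. \<Sum>\<beta>\<in>\<Delta>. \<rho> \<alpha> * \<rho> \<beta> * M (E (- \<alpha>)) (E \<alpha>) (E \<beta>) (E (- \<beta>)))
     + (\<Sum>\<alpha>\<in>\<Delta>. \<Sum>\<beta>\<in>\<Delta>. \<rho> \<alpha> * \<rho> \<beta> * M (E (- \<alpha>)) (E \<alpha>) (E (- \<beta>)) (E \<beta>))) / 4"
    unfolding M
    by (simp add: sum_distrib_left sum.distrib sum_subtractf algebra_simps sum_divide_distrib
        add_divide_distrib diff_divide_distrib)
  also have "\<dots> = (\<Sum>\<alpha>\<in>\<Delta>. \<Sum>\<beta>\<in>\<Delta>. \<rho> \<alpha> * \<rho> \<beta> * M (E \<alpha>) (E (- \<alpha>)) (E \<beta>) (E (- \<beta>)))"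
    unfolding flip2 flip1 by simp
  also have "\<dots> =
      killing (bracket (rop \<rho> (dualv j)) (rop \<rho> (dualv k))) (dualv i)
    + killing (bracket (rop \<rho> (dualv i)) (rop \<rho> (dualv j))) (dualv k)
    + killing (bracket (rop \<rho> (dualv k)) (rop \<rho> (dualv i))) (dualv j)
    - killing (bracket (rop \<rho> (dualv i)) (rop \<rho> (dualv k))) (dualv j)
    - killing (bracket (rop \<rho> (dualv k)) (rop \<rho> (dualv j))) (dualv i)
    - killing (bracket (rop \<rho> (dualv j)) (rop \<rho> (dualv i))) (dualv k)"
    unfolding M_def wedge3_killing killing_rop_bracket
    by (simp add: algebra_simps sum.distrib sum_subtractf)
  finally show ?thesis
    using bracket_anticomm[of "rop \<rho> (dualv i)" "rop \<rho> (dualv k)"]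
      bracket_anticomm[of "rop \<rho> (dualv k)" "rop \<rho> (dualv j)"] bracket_anticomm[of "rop \<rho> (dualv j)" "rop \<rho> (dualv i)"]
    by simp
qed

text \<open>Up to rotation, three arguments taken from \<open>h\<close> and from the root vectors
  either begin with two elements of \<open>h\<close>, or are one element of \<open>h\<close>
  followed by two root vectors, or are three root vectors.\<close>

lemma cyclic_trilinear_zero:
  fixes F :: "'g \<Rightarrow> 'g \<Rightarrow> 'g \<Rightarrow> complex"
  assumes add: "\<And>x y z w. F (x + y) z w = F x z w + F y z w" and scale: "\<And>c x z w. F (c *\<^sub>C x) z w = c * F x z w"
    and cyc: "\<And>x y z. F y z x = F x y z"
    and hh: "\<And>s t z. s \<in> h \<Longrightarrow> t \<in> h \<Longrightarrow> F s t z = 0"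
    and hE: "\<And>t \<alpha> \<beta>. t \<in> h \<Longrightarrow> \<alpha> \<in> \<Delta> \<Longrightarrow> \<beta> \<in> \<Delta> \<Longrightarrow> F t (E \<alpha>) (E \<beta>) = 0"
    and EE: "\<And>\<alpha> \<beta> \<gamma>. \<alpha> \<in> \<Delta> \<Longrightarrow> \<beta> \<in> \<Delta> \<Longrightarrow> \<gamma> \<in> \<Delta> \<Longrightarrow> F (E \<alpha>) (E \<beta>) (E \<gamma>) = 0"
  shows "F x y z = 0"
proof -
  have F0: "F 0 z w = 0" for z w using scale[of 0 0] by simp
  have sub1: "cvs.subspace {x. F x y z = 0}" for y z
    by (auto simp: cvs.subspace_def add scale F0)
  have sub2: "cvs.subspace {y. F x y z = 0}" for x z
    using sub1[of z x] unfolding cyc[of _ z x] .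
  have sub3: "cvs.subspace {z. F x y z = 0}" for x y
    using sub1[of x y] unfolding cyc[of x y _, symmetric] .
  have 1: "F (E \<alpha>) (E \<beta>) z = 0" if "\<alpha> \<in> \<Delta>" "\<beta> \<in> \<Delta>" for \<alpha> \<beta> z
  proof (rule E_induct[where Q = "\<lambda>z. F (E \<alpha>) (E \<beta>) z = 0", OF sub3])
    show "F (E \<alpha>) (E \<beta>) t = 0" if "t \<in> h" for t
      unfolding cyc[of "E \<alpha>" "E \<beta>" t] by (rule hE[OF that \<open>\<alpha> \<in> \<Delta>\<close> \<open>\<beta> \<in> \<Delta>\<close>])
  qed (use EE that in blast)
  have 2: "F t (E \<alpha>) z = 0" if "t \<in> h" "\<alpha> \<in> \<Delta>" for t \<alpha> z
  proof (rule E_induct[where Q = "\<lambda>z. F t (E \<alpha>) z = 0", OF sub3])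
    show "F t (E \<alpha>) s = 0" if "s \<in> h" for s
      unfolding cyc[of t "E \<alpha>" s] by (rule hh[OF that \<open>t \<in> h\<close>])
  qed (use hE that in blast)
  have 3: "F (E \<alpha>) y z = 0" if "\<alpha> \<in> \<Delta>" for \<alpha> y z
  proof (rule E_induct[where Q = "\<lambda>y. F (E \<alpha>) y z = 0", OF sub2])
    show "F (E \<alpha>) t z = 0" if "t \<in> h" for t
    proof (rule E_induct[where Q = "\<lambda>z. F (E \<alpha>) t z = 0", OF sub3])
      show "F (E \<alpha>) t s = 0" if "s \<in> h" for s
        unfolding cyc[of "E \<alpha>" t s] cyc[of s "E \<alpha>" t] by (rule hh[OF \<open>t \<in> h\<close> that])
      show "F (E \<alpha>) t (E \<beta>) = 0" if "\<beta> \<in> \<Delta>" for \<beta>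
        using 2[OF \<open>t \<in> h\<close> that, of "E \<alpha>"] unfolding cyc[of t "E \<beta>" "E \<alpha>"] .
    qed
  qed (use 1 that in blast)
  have 4: "F t y z = 0" if "t \<in> h" for t y z
    by (rule E_induct[where Q = "\<lambda>y. F t y z = 0", OF sub2]) (use 2 hh that in blast)+
  show ?thesis
    by (rule E_induct[where Q = "\<lambda>x. F x y z = 0", OF sub1]) (use 3 4 in blast)+
qed

lemma killing_bracket_cyclic: "killing (bracket x y) z = killing (bracket y z) (x::'g)"
  by (simp add: killing_invariant killing_commute[of x])

lemma killing_bracket_EEE:
  assumes "\<alpha> \<in> \<Delta>" "\<beta> \<in> \<Delta>" "\<gamma> \<in> \<Delta>" "killing (bracket (E \<alpha>) (E \<beta>)) (E \<gamma>) \<noteq> 0"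
  shows "\<gamma> = - (\<alpha> + \<beta>)"
  using killing_root_spaces_zero[OF bracket_root_space[OF E_root_space E_root_space] E_root_space, of \<alpha> \<beta> \<gamma>]
    assms root_hdual hdual_add by blast

text \<open>The equation says that a cyclic trilinear form \<open>F\<close> vanishes. Its value at
  (t, E_\<alpha>, E_-\<alpha>) is the Riccati equation in the direction \<open>t\<close>. Its value
  at three root vectors with sum of roots 0 is the algebraic condition times a nonzero structure
  constant, and all other values vanish by weight. Here \<open>\<delta> \<gamma>\<close> stands for
  the derivative along \<open>hs \<gamma>\<close>; keeping it abstract makes the statement pointwise
  and usable in both directions.\<close>

lemma cdybe_rmat:
  assumes odd: "odd_on_roots \<rho>" and oddD: "\<And>\<gamma>. \<gamma> \<in> P \<Longrightarrow> odd_on_roots (\<delta> \<gamma>)" and P: "P \<subseteq> \<Delta>"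
  shows "(\<forall>i j k. (\<Sum>\<gamma>\<in>P. wedge12 (T \<gamma>) (rmat (\<delta> \<gamma>)) i j k) + 1 / 2 * schouten (rmat \<rho>) (rmat \<rho>) i j k
        = comm12_23 casimir casimir i j k) \<longleftrightarrow>
    (\<forall>\<alpha>\<in>\<Delta>. \<forall>t\<in>h. (\<Sum>\<gamma>\<in>P. \<gamma> t * \<delta> \<gamma> \<alpha>) = (1 - (\<rho> \<alpha>)\<^sup>2) * \<alpha> t) \<and>
    (\<forall>\<alpha>\<in>\<Delta>. \<forall>\<beta>\<in>\<Delta>. \<alpha> + \<beta> \<in> \<Delta> \<longrightarrow> \<rho> \<alpha> * \<rho> \<beta> + 1 = \<rho> (\<alpha> + \<beta>) * (\<rho> \<alpha> + \<rho> \<beta>))"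
    (is "?cybe \<longleftrightarrow> ?ode \<and> ?alg")
proof -
  define F where "F x y z = (\<Sum>\<gamma>\<in>P. killing (T \<gamma>) x * rform (\<delta> \<gamma>) y z + killing (T \<gamma>) y * rform (\<delta> \<gamma>) z x +
      killing (T \<gamma>) z * rform (\<delta> \<gamma>) x y) +
      (killing (bracket (rop \<rho> y) (rop \<rho> z)) x + killing (bracket (rop \<rho> z) (rop \<rho> x)) y +
       killing (bracket (rop \<rho> x) (rop \<rho> y)) z) + killing (bracket x y) z" for x y z
  have "?cybe \<longleftrightarrow> (\<forall>i j k. F (dualv i) (dualv j) (dualv k) = 0)"
  proof -
    have "(\<Sum>\<gamma>\<in>P. wedge12 (T \<gamma>) (rmat (\<delta> \<gamma>)) i j k) = (\<Sum>\<gamma>\<in>P. killing (T \<gamma>) (dualv i) * rform (\<delta> \<gamma>) (dualv j) (dualv k) +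
      killing (T \<gamma>) (dualv j) * rform (\<delta> \<gamma>) (dualv k) (dualv i) + killing (T \<gamma>) (dualv k) * rform (\<delta> \<gamma>) (dualv i) (dualv j))" for i j k
      by (rule sum.cong) (simp_all add: wedge12_rmat oddD)
    then have "(\<Sum>\<gamma>\<in>P. wedge12 (T \<gamma>) (rmat (\<delta> \<gamma>)) i j k) + 1 / 2 * schouten (rmat \<rho>) (rmat \<rho>) i j k -
        comm12_23 casimir casimir i j k = F (dualv i) (dualv j) (dualv k)" for i j k
      by (simp only: schouten_rmat[OF odd] comm_casimir F_def) simp
    then show ?thesis by (metis (no_types, lifting) eq_iff_diff_eq_0)
  qed
  also have "\<dots> \<longleftrightarrow> (\<forall>x y z. F x y z = 0)"
  proof
    assume *: "\<forall>i j k. F (dualv i) (dualv j) (dualv k) = 0"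
    have add: "F (x + y) z w = F x z w + F y z w" "F z (x + y) w = F z x w + F z y w" "F z w (x + y) = F z w x + F z w y" for x y z w
      by (simp_all add: F_def killing_linear bracket_linear rform_linear rop_linear algebra_simps sum.distrib)
    have scale: "F (c *\<^sub>C x) z w = c * F x z w" "F z (c *\<^sub>C x) w = c * F z x w" "F z w (c *\<^sub>C x) = c * F z w x" for c x z w
      by (simp_all add: F_def killing_linear bracket_linear rform_linear rop_linear algebra_simps sum.distrib sum_distrib_left)
    have F0: "F 0 z w = 0" "F z 0 w = 0" "F z w 0 = 0" for z w
      using scale(1)[of 0 0 z w] scale(2)[of z 0 0 w] scale(3)[of z w 0 0] by simp_all
    \<comment> \<open>The vectors \<open>dualv i\<close> span, so vanishing passes from the indices
      to all vectors, one argument at a time.\<close>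
    have lin: "f x = 0" if "cvs.subspace {x. f x = 0}" "\<And>i. f (dualv i) = 0" for f :: "'g \<Rightarrow> complex" and x
    proof -
      have "(\<Sum>a\<in>lie_basis. killing x a *\<^sub>C dualv a) \<in> {x. f x = 0}"
        using that by (intro cvs.subspace_sum cvs.subspace_scale) auto
      then show ?thesis using dualv_expansion[of x] by simp
    qed
    have 1: "F (dualv i) (dualv j) z = 0" for i j z
      by (rule lin) (use * in \<open>auto simp: cvs.subspace_def add scale F0\<close>)
    have 2: "F (dualv i) y z = 0" for i y z
      by (rule lin[of "\<lambda>y. F (dualv i) y z"]) (use 1 in \<open>auto simp: cvs.subspace_def add scale F0\<close>)
    show "\<forall>x y z. F x y z = 0"
      by (intro allI, rule lin[of "\<lambda>x. F x _ _"]) (use 2 in \<open>auto simp: cvs.subspace_def add scale F0\<close>)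
  qed blast
  also have "\<dots> \<longleftrightarrow> ?ode \<and> ?alg"
  proof
    \<comment> \<open>Each derivative term contains a pairing of \<open>h\<close> with a root vector
      and vanishes. The other four terms are multiples of one structure constant by
      cyclicity.\<close>
    have E3: "F (E \<alpha>) (E \<beta>) (E \<gamma>) = killing (bracket (E \<alpha>) (E \<beta>)) (E \<gamma>) * (\<rho> \<beta> * \<rho> \<gamma> + \<rho> \<gamma> * \<rho> \<alpha> + \<rho> \<alpha> * \<rho> \<beta> + 1)"
      if "\<alpha> \<in> \<Delta>" "\<beta> \<in> \<Delta>" "\<gamma> \<in> \<Delta>" for \<alpha> \<beta> \<gamma>
    proof -
      have "killing (T \<mu>) (E \<nu>) = 0" if "\<mu> \<in> P" "\<nu> \<in> \<Delta>" for \<mu> \<nu>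
        using that P T_h killing_h_E by blast
      then show ?thesis
        using that killing_bracket_cyclic[of "E \<alpha>" "E \<beta>" "E \<gamma>"] killing_bracket_cyclic[of "E \<beta>" "E \<gamma>" "E \<alpha>"]
        by (simp add: F_def rop_E bracket_linear killing_linear algebra_simps)
    qed
    have hE: "F t (E \<alpha>) (E \<beta>) = (if \<beta> = - \<alpha> then (1 - (\<rho> \<alpha>)\<^sup>2) * \<alpha> t - (\<Sum>\<gamma>\<in>P. \<gamma> t * \<delta> \<gamma> \<alpha>) else 0)"
      if t: "t \<in> h" and \<alpha>: "\<alpha> \<in> \<Delta>" and \<beta>: "\<beta> \<in> \<Delta>" for t \<alpha> \<beta>
    proof -
      have "(\<Sum>\<gamma>\<in>P. killing (T \<gamma>) t * rform (\<delta> \<gamma>) (E \<alpha>) (E \<beta>) + killing (T \<gamma>) (E \<alpha>) * rform (\<delta> \<gamma>) (E \<beta>) t +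
        killing (T \<gamma>) (E \<beta>) * rform (\<delta> \<gamma>) t (E \<alpha>)) = (\<Sum>\<gamma>\<in>P. \<gamma> t * rform (\<delta> \<gamma>) (E \<alpha>) (E \<beta>))"
        by (rule sum.cong) (use P t in \<open>auto simp: rform_h killing_T subset_iff\<close>)
      also have "\<dots> = (if \<beta> = - \<alpha> then - (\<Sum>\<gamma>\<in>P. \<gamma> t * \<delta> \<gamma> \<alpha>) else 0)"
        using oddD \<alpha> \<beta> by (auto simp: rform_E odd_on_roots_def sum_negf intro!: sum.cong simp flip: sum_negf)
      finally have 1: "(\<Sum>\<gamma>\<in>P. killing (T \<gamma>) t * rform (\<delta> \<gamma>) (E \<alpha>) (E \<beta>) + killing (T \<gamma>) (E \<alpha>) * rform (\<delta> \<gamma>) (E \<beta>) t +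
        killing (T \<gamma>) (E \<beta>) * rform (\<delta> \<gamma>) t (E \<alpha>)) = (if \<beta> = - \<alpha> then - (\<Sum>\<gamma>\<in>P. \<gamma> t * \<delta> \<gamma> \<alpha>) else 0)" .
      have 2: "killing (bracket t (E \<alpha>)) (E \<beta>) = (if \<beta> = - \<alpha> then \<alpha> t else 0)"
        using t \<alpha> \<beta> by (simp add: bracket_h_E killing_linear killing_E_E)
      have "killing (bracket (rop \<rho> (E \<alpha>)) (rop \<rho> (E \<beta>))) t = \<rho> \<alpha> * \<rho> \<beta> * killing (bracket (E \<alpha>) (E \<beta>)) t"
        using \<alpha> \<beta> by (simp add: rop_E bracket_linear killing_linear)
      also have "killing (bracket (E \<alpha>) (E \<beta>)) t = killing (bracket t (E \<alpha>)) (E \<beta>)"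
        using killing_bracket_cyclic[of t "E \<alpha>" "E \<beta>"] by simp
      also have "\<rho> \<alpha> * \<rho> \<beta> * killing (bracket t (E \<alpha>)) (E \<beta>) = (if \<beta> = - \<alpha> then - (\<rho> \<alpha>)\<^sup>2 * \<alpha> t else 0)"
        using odd \<alpha> unfolding 2 by (simp add: odd_on_roots_def power2_eq_square)
      finally show ?thesis
        unfolding F_def 1 2 using t by (simp add: rop_h algebra_simps)
    qed
    {
      assume F: "\<forall>x y z. F x y z = 0"
      show "?ode \<and> ?alg"
      proof (intro conjI ballI impI)
        fix \<alpha> t assume "\<alpha> \<in> \<Delta>" "t \<in> h"
        then show "(\<Sum>\<gamma>\<in>P. \<gamma> t * \<delta> \<gamma> \<alpha>) = (1 - (\<rho> \<alpha>)\<^sup>2) * \<alpha> t"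
          using hE[of t \<alpha> "- \<alpha>"] F root_minus by simp
      next
        fix \<alpha> \<beta> assume ab: "\<alpha> \<in> \<Delta>" "\<beta> \<in> \<Delta>" "\<alpha> + \<beta> \<in> \<Delta>"
        let ?\<gamma> = "- (\<alpha> + \<beta>)"
        have \<gamma>: "?\<gamma> \<in> \<Delta>" by (rule root_minus[OF ab(3)])
        obtain c where c: "c \<noteq> 0" "bracket (E \<alpha>) (E \<beta>) = c *\<^sub>C E (\<alpha> + \<beta>)" using bracket_E_E[OF ab] .
        have "killing (bracket (E \<alpha>) (E \<beta>)) (E ?\<gamma>) = c"
          unfolding c(2) killing_scaleC_left killing_E[OF ab(3)] by simp
        then have "\<rho> \<beta> * \<rho> ?\<gamma> + \<rho> ?\<gamma> * \<rho> \<alpha> + \<rho> \<alpha> * \<rho> \<beta> + 1 = 0"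
          using E3[OF ab(1,2) \<gamma>] F c(1) by simp
        moreover have "\<rho> ?\<gamma> = - \<rho> (\<alpha> + \<beta>)" using odd ab(3) unfolding odd_on_roots_def by blast
        ultimately show "\<rho> \<alpha> * \<rho> \<beta> + 1 = \<rho> (\<alpha> + \<beta>) * (\<rho> \<alpha> + \<rho> \<beta>)" by (simp add: algebra_simps)
      qed
    }
    assume *: "?ode \<and> ?alg"
    show "\<forall>x y z. F x y z = 0"
    proof (intro allI, rule cyclic_trilinear_zero[where F = F])
      show "F (x + y) z w = F x z w + F y z w" for x y z w
        by (simp_all add: F_def killing_linear bracket_linear rform_linear rop_linear algebra_simps sum.distrib)
      show "F (c *\<^sub>C x) z w = c * F x z w" for c x z w
        by (simp_all add: F_def killing_linear bracket_linear rform_linear rop_linear algebra_simps sum.distrib sum_distrib_left)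
      show "F y z x = F x y z" for x y z
        using killing_bracket_cyclic[of x y z] by (simp add: F_def algebra_simps sum.distrib)
      show "F s t z = 0" if "s \<in> h" "t \<in> h" for s t z
      proof -
        have "killing (bracket s t) z = 0" using that by (simp add: h_abelian)
        then show ?thesis using that by (simp add: F_def rform_h rop_h)
      qed
      show "F t (E \<alpha>) (E \<beta>) = 0" if "t \<in> h" "\<alpha> \<in> \<Delta>" "\<beta> \<in> \<Delta>" for t \<alpha> \<beta>
        using hE[OF that] * that by simp
      show "F (E \<alpha>) (E \<beta>) (E \<gamma>) = 0" if abc: "\<alpha> \<in> \<Delta>" "\<beta> \<in> \<Delta>" "\<gamma> \<in> \<Delta>" for \<alpha> \<beta> \<gamma>
      proof (cases "killing (bracket (E \<alpha>) (E \<beta>)) (E \<gamma>) = 0")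
        case True
        then show ?thesis by (simp add: E3[OF abc])
      next
        case False
        then have \<gamma>: "\<gamma> = - (\<alpha> + \<beta>)" by (rule killing_bracket_EEE[OF abc])
        then have ab: "\<alpha> + \<beta> \<in> \<Delta>" using abc(3) root_minus_iff by metis
        then have "\<rho> \<alpha> * \<rho> \<beta> + 1 = \<rho> (\<alpha> + \<beta>) * (\<rho> \<alpha> + \<rho> \<beta>)" using * abc(1,2) by blast
        moreover have "\<rho> \<gamma> = - \<rho> (\<alpha> + \<beta>)" unfolding \<gamma> using odd ab unfolding odd_on_roots_def by blast
        ultimately show ?thesis unfolding E3[OF abc] by (simp add: algebra_simps)
      qed
    qed
  qed
  finally show ?thesis .
qed

subsection \<open>Neighbourhoods in the dual of the Cartan subalgebra\<close>

abbreviation hs :: "('g \<Rightarrow> complex) \<Rightarrow> ('g \<Rightarrow> complex)" where "hs \<equiv> hstar h E P0"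

abbreviation line :: "('g \<Rightarrow> complex) \<Rightarrow> ('g \<Rightarrow> complex) \<Rightarrow> complex \<Rightarrow> ('g \<Rightarrow> complex)"
  where "line l m z \<equiv> (\<lambda>x. l x + z * m x)"

lemma P0_root: "\<gamma> \<in> P0 \<Longrightarrow> \<gamma> \<in> \<Delta>" and P0_T_h: "\<gamma> \<in> P0 \<Longrightarrow> T \<gamma> \<in> h" and finite_P0: "finite P0"
  using base_roots[OF root_base] base_finite[OF root_base] T_h by blast+

lemma
  shows hs_hdual: "\<gamma> \<in> P0 \<Longrightarrow> hs \<gamma> \<in> hdual h"
    and hs_T: "\<gamma> \<in> P0 \<Longrightarrow> \<beta> \<in> P0 \<Longrightarrow> hs \<gamma> (T \<beta>) = (if \<beta> = \<gamma> then 1 else 0)"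
    and hs_expansion: "t \<in> h \<Longrightarrow> (\<Sum>\<gamma>\<in>P0. hs \<gamma> t *\<^sub>C T \<gamma>) = t"
proof -
  obtain D where D: "\<And>\<alpha>. \<alpha> \<in> P0 \<Longrightarrow> D \<alpha> \<in> hdual h"
    "\<And>\<alpha> \<beta>. \<alpha> \<in> P0 \<Longrightarrow> \<beta> \<in> P0 \<Longrightarrow> D \<alpha> (T \<beta>) = (if \<beta> = \<alpha> then 1 else 0)"
    "\<And>t. t \<in> h \<Longrightarrow> (\<Sum>\<alpha>\<in>P0. D \<alpha> t *\<^sub>C T \<alpha>) = t"
    by (rule base_dual[OF root_base]) (rule that)
  have ext: "l = m" if l: "l \<in> hdual h" and m: "m \<in> hdual h" and eq: "\<And>\<beta>. \<beta> \<in> P0 \<Longrightarrow> l (T \<beta>) = m (T \<beta>)" for l m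
  proof (rule hdual_eqI[OF l m])
    fix t assume t: "t \<in> h"
    have "k (\<Sum>\<alpha>\<in>P0. D \<alpha> t *\<^sub>C T \<alpha>) = (\<Sum>\<alpha>\<in>P0. D \<alpha> t * k (T \<alpha>))" if "k \<in> hdual h" for k
      by (subst hdual_sum_arg[OF that]) (use P0_T_h h_scaleC that in \<open>auto simp: hdual_scaleC_arg intro!: sum.cong\<close>)
    then show "l t = m t" using l m eq D(3)[OF t] by (metis (no_types, lifting) sum.cong)
  qed
  have eq: "hs \<gamma> = D \<gamma>" if "\<gamma> \<in> P0" for \<gamma>
    unfolding hstar_def
  proof (rule the_equality)
    show "D \<gamma> \<in> hdual h \<and> (\<forall>\<beta>\<in>P0. D \<gamma> (T \<beta>) = (if \<beta> = \<gamma> then 1 else 0))" using D that by blast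
    show "l = D \<gamma>" if "l \<in> hdual h \<and> (\<forall>\<beta>\<in>P0. l (T \<beta>) = (if \<beta> = \<gamma> then 1 else 0))" for l
      by (rule ext) (use that D \<open>\<gamma> \<in> P0\<close> in auto)
  qed
  show "\<gamma> \<in> P0 \<Longrightarrow> hs \<gamma> \<in> hdual h" using eq D by simp
  show "\<gamma> \<in> P0 \<Longrightarrow> \<beta> \<in> P0 \<Longrightarrow> hs \<gamma> (T \<beta>) = (if \<beta> = \<gamma> then 1 else 0)" using eq D by simp
  show "t \<in> h \<Longrightarrow> (\<Sum>\<gamma>\<in>P0. hs \<gamma> t *\<^sub>C T \<gamma>) = t" using eq D(3)[of t] by simp
qed

lemma hdual_hs_expansion:
  assumes l: "l \<in> hdual h" and t: "t \<in> h"
  shows "l t = (\<Sum>\<gamma>\<in>P0. l (T \<gamma>) * hs \<gamma> t)"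
proof -
  have "l (\<Sum>\<gamma>\<in>P0. hs \<gamma> t *\<^sub>C T \<gamma>) = (\<Sum>\<gamma>\<in>P0. hs \<gamma> t * l (T \<gamma>))"
    by (subst hdual_sum_arg[OF l]) (use P0_T_h h_scaleC l in \<open>auto simp: hdual_scaleC_arg intro!: sum.cong\<close>)
  then show ?thesis by (simp add: hs_expansion[OF t] mult.commute)
qed

text \<open>Polydiscs in the coordinates \<open>\<lambda>\<^sub>i\<close>. They are convex, and a path from the centre to any point can be chosen along the
  coordinate directions.\<close>

definition polydisc :: "('g \<Rightarrow> complex) \<Rightarrow> real \<Rightarrow> ('g \<Rightarrow> complex) set"
  where "polydisc l e = {m \<in> hdual h. \<forall>\<gamma>\<in>P0. norm (m (T \<gamma>) - l (T \<gamma>)) < e}"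

abbreviation hopen :: "('g \<Rightarrow> complex) set \<Rightarrow> bool"
  where "hopen V \<equiv> openin (top_of_set (hdual h)) V"

lemma hopen_hdual: "hopen V \<Longrightarrow> l \<in> V \<Longrightarrow> l \<in> hdual h"
  using openin_imp_subset by blast

lemma polydisc_center: "l \<in> hdual h \<Longrightarrow> e > 0 \<Longrightarrow> l \<in> polydisc l e"
  by (simp add: polydisc_def)

lemma polydisc_mono: "d \<le> e \<Longrightarrow> polydisc l d \<subseteq> polydisc l e"
  by (force simp: polydisc_def)

lemma open_polydisc: "hopen (polydisc l e)"
proof -
  have "open {m::'g \<Rightarrow> complex. norm (m (T \<gamma>) - l (T \<gamma>)) < e}" for \<gamma>
    by (intro open_Collect_less continuous_intros continuous_on_product_coordinates)
  then have "open (\<Inter>\<gamma>\<in>P0. {m::'g \<Rightarrow> complex. norm (m (T \<gamma>) - l (T \<gamma>)) < e})"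
    using finite_P0 by (intro open_INT) auto
  moreover have "polydisc l e = hdual h \<inter> (\<Inter>\<gamma>\<in>P0. {m::'g \<Rightarrow> complex. norm (m (T \<gamma>) - l (T \<gamma>)) < e})"
    by (auto simp: polydisc_def)
  ultimately show ?thesis by (simp add: openin_open_Int)
qed

text \<open>Pointwise convergence constrains finitely many arguments \<open>i\<close> at a time. Off
  \<open>h\<close> all functionals vanish, so there is nothing to control; for \<open>i\<close> in
  \<open>h\<close> the value is a fixed linear combination of the finitely many coordinates.\<close>

lemma polydisc_nhd:
  assumes V: "hopen V" and l: "l \<in> V"
  obtains e where "e > 0" "polydisc l e \<subseteq> V"
proof -
  have lh: "l \<in> hdual h" by (rule hopen_hdual[OF V l])
  obtain O' where O': "open O'" "V = hdual h \<inter> O'" using V by (auto simp: openin_open)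
  have "openin (product_topology (\<lambda>i. euclidean) UNIV) O'" using O'(1) by (simp add: open_fun_def)
  from product_topology_open_contains_basis[OF this, of l] obtain X where
    X: "l \<in> (\<Pi>\<^sub>E i\<in>UNIV. X i)" "\<And>i. open (X i)" "finite {i. X i \<noteq> UNIV}" "(\<Pi>\<^sub>E i\<in>UNIV. X i) \<subseteq> O'"
    using l O'(2) by (auto simp: )
  have "\<exists>e>0. \<forall>m\<in>polydisc l e. m i \<in> X i" for i
  proof (cases "i \<in> h")
    case False
    have "m i = l i" if "m \<in> polydisc l 1" for m
      using that lh False hdual_outside[of m i] hdual_outside[of l i] by (simp add: polydisc_def)
    moreover have "l i \<in> X i" using X(1) by (auto simp: PiE_def)
    ultimately have "\<forall>m\<in>polydisc l 1. m i \<in> X i" by metis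
    then show ?thesis using zero_less_one by blast
  next
    case True
    obtain \<delta> where \<delta>: "\<delta> > 0" "ball (l i) \<delta> \<subseteq> X i"
      using X(1,2) open_contains_ball by (metis PiE_UNIV_domain Pi_iff UNIV_I)
    \<comment> \<open>The summand 1 makes \<open>C\<close> positive and the final estimate
      strict.\<close>
    define C where "C = 1 + (\<Sum>\<gamma>\<in>P0. norm (hs \<gamma> i))"
    have C: "C > 0" unfolding C_def by (smt (verit) norm_ge_zero sum_nonneg)
    have "m i \<in> X i" if m: "m \<in> polydisc l (\<delta> / C)" for m
    proof -
      have mh: "m \<in> hdual h" using m by (simp add: polydisc_def)
      have "m i - l i = (\<Sum>\<gamma>\<in>P0. (m (T \<gamma>) - l (T \<gamma>)) * hs \<gamma> i)"
        unfolding hdual_hs_expansion[OF mh True] hdual_hs_expansion[OF lh True]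
        by (simp add: left_diff_distrib sum_subtractf)
      also have "norm \<dots> \<le> (\<Sum>\<gamma>\<in>P0. \<delta> / C * norm (hs \<gamma> i))"
      proof (rule sum_norm_le)
        fix \<gamma> assume "\<gamma> \<in> P0"
        then have "norm (m (T \<gamma>) - l (T \<gamma>)) \<le> \<delta> / C" using m by (simp add: polydisc_def less_imp_le)
        then show "norm ((m (T \<gamma>) - l (T \<gamma>)) * hs \<gamma> i) \<le> \<delta> / C * norm (hs \<gamma> i)"
          unfolding norm_mult by (rule mult_right_mono) simp
      qed
      also have "\<dots> = \<delta> / C * (C - 1)" by (simp add: C_def sum_distrib_left)
      also have "\<dots> < \<delta>" using C \<delta>(1) by (simp add: field_simps)
      finally show ?thesis using \<delta>(2) by (auto simp: dist_norm norm_minus_commute)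
    qed
    then show ?thesis using \<delta>(1) C by (intro exI[of _ "\<delta> / C"]) auto
  qed
  then obtain e where e: "\<And>i. e i > 0" "\<And>i m. m \<in> polydisc l (e i) \<Longrightarrow> m i \<in> X i" by metis
  \<comment> \<open>The 1 covers the case that no argument is constrained.\<close>
  define d where "d = Min (insert 1 (e ` {i. X i \<noteq> UNIV}))"
  have d: "d > 0" unfolding d_def using X(3) e(1) by (subst Min_gr_iff) auto
  have "polydisc l d \<subseteq> V"
  proof
    fix m assume m: "m \<in> polydisc l d"
    have "m i \<in> X i" for i
    proof (cases "X i = UNIV")
      case False
      then have "d \<le> e i" unfolding d_def using X(3) by (intro Min_le) auto
      then show ?thesis using m polydisc_mono e(2) by blast
    qed simp
    then have "m \<in> O'" using X(4) by (auto simp: PiE_def)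
    then show "m \<in> V" using m O'(2) by (simp add: polydisc_def)
  qed
  then show thesis using that d by blast
qed

text \<open>Density and openness restated: arbitrarily close to every point there is a whole
  polydisc on which the property holds. Restriction, conjunction and localization are all derived in
  this form.\<close>

lemma generically_iff:
  assumes V: "hopen V"
  shows "generically h V Q \<longleftrightarrow>
    (\<forall>l\<in>V. \<forall>e>0. \<exists>m\<in>V. m \<in> polydisc l e \<and> (\<exists>d>0. polydisc m d \<subseteq> V \<and> (\<forall>x\<in>polydisc m d. Q x)))"
proof
  assume "generically h V Q"
  then obtain D where D: "hopen D" "D \<subseteq> V" "V \<subseteq> closure D" "\<forall>l\<in>D. Q l"
    unfolding generically_def by blast
  show "\<forall>l\<in>V. \<forall>e>0. \<exists>m\<in>V. m \<in> polydisc l e \<and> (\<exists>d>0. polydisc m d \<subseteq> V \<and> (\<forall>x\<in>polydisc m d. Q x))"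
  proof (intro ballI allI impI)
    fix l and e :: real assume l: "l \<in> V" and e: "e > 0"
    obtain O' where O': "open O'" "polydisc l e = hdual h \<inter> O'" using open_polydisc by (metis openin_open)
    have "l \<in> O'" using polydisc_center[OF hopen_hdual[OF V l] e] O'(2) by blast
    then obtain m where m: "m \<in> D" "m \<in> O'"
      using D(3) l O'(1) by (metis Int_emptyI closure_iff_nhds_not_empty inf_commute subsetD subset_refl)
    have "m \<in> polydisc l e" using m O'(2) hopen_hdual[OF D(1)] by blast
    moreover obtain d where "d > 0" "polydisc m d \<subseteq> D" using polydisc_nhd[OF D(1) m(1)] .
    ultimately show "\<exists>m\<in>V. m \<in> polydisc l e \<and> (\<exists>d>0. polydisc m d \<subseteq> V \<and> (\<forall>x\<in>polydisc m d. Q x))"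
      using m(1) D by blast
  qed
next
  assume *: "\<forall>l\<in>V. \<forall>e>0. \<exists>m\<in>V. m \<in> polydisc l e \<and> (\<exists>d>0. polydisc m d \<subseteq> V \<and> (\<forall>x\<in>polydisc m d. Q x))"
  define D where "D = \<Union>{polydisc m d | m d. polydisc m d \<subseteq> V \<and> (\<forall>x\<in>polydisc m d. Q x)}"
  have "hopen D" unfolding D_def using open_polydisc by (intro openin_Union) blast
  moreover have "D \<subseteq> V" "\<forall>x\<in>D. Q x" unfolding D_def by blast+
  moreover have "V \<subseteq> closure D"
  proof
    fix l assume l: "l \<in> V"
    have "O' \<inter> D \<noteq> {}" if O': "open O'" "l \<in> O'" for O'
    proof -
      have "hopen (hdual h \<inter> O')" using O'(1) by (rule openin_open_Int)
      then obtain e where e: "e > 0" "polydisc l e \<subseteq> hdual h \<inter> O'"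
        using polydisc_nhd[of "hdual h \<inter> O'" l] hopen_hdual[OF V l] O'(2) by blast
      then obtain m d where m: "m \<in> V" "m \<in> polydisc l e" "d > 0" "polydisc m d \<subseteq> V" "\<forall>x\<in>polydisc m d. Q x"
        using * l by blast
      have "m \<in> polydisc m d" by (rule polydisc_center[OF hopen_hdual[OF V m(1)] m(3)])
      then have "m \<in> D" unfolding D_def using m by blast
      then show ?thesis using m(2) e(2) by blast
    qed
    then show "l \<in> closure D" unfolding closure_iff_nhds_not_empty by blast
  qed
  ultimately show "generically h V Q" unfolding generically_def by blast
qed

lemma generically_mono:
  "generically h V Q \<Longrightarrow> (\<And>l. l \<in> V \<Longrightarrow> Q l \<Longrightarrow> R l) \<Longrightarrow> generically h V R"
  unfolding generically_def by blast

lemma generically_all: "hopen V \<Longrightarrow> (\<And>l. l \<in> V \<Longrightarrow> Q l) \<Longrightarrow> generically h V Q"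
  unfolding generically_def using closure_subset by blast

lemma generically_subset:
  assumes V: "hopen V" "hopen V'" "V' \<subseteq> V" and Q: "generically h V Q"
  shows "generically h V' Q"
  unfolding generically_iff[OF V(2)]
proof (intro ballI allI impI)
  fix l and e :: real assume l: "l \<in> V'" and e: "e > 0"
  obtain e' where e': "e' > 0" "polydisc l e' \<subseteq> V'" using polydisc_nhd[OF V(2) l] .
  then have "min e e' > 0" using e by simp
  then obtain m d where m: "m \<in> V" "m \<in> polydisc l (min e e')" "d > 0" "polydisc m d \<subseteq> V" "\<forall>x\<in>polydisc m d. Q x"
    using Q[unfolded generically_iff[OF V(1)]] l V(3) by blast
  have mV: "m \<in> V'" "m \<in> polydisc l e" using m(2) e'(2) polydisc_mono[of "min e e'" e l] polydisc_mono[of "min e e'" e' l] by auto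
  obtain d' where d': "d' > 0" "polydisc m d' \<subseteq> V'" using polydisc_nhd[OF V(2) mV(1)] .
  have "polydisc m (min d d') \<subseteq> V'" "\<forall>x\<in>polydisc m (min d d'). Q x"
    using d'(2) m(5) polydisc_mono[of "min d d'" d m] polydisc_mono[of "min d d'" d' m] by auto
  then show "\<exists>m\<in>V'. m \<in> polydisc l e \<and> (\<exists>d>0. polydisc m d \<subseteq> V' \<and> (\<forall>x\<in>polydisc m d. Q x))"
    using mV d'(1) m(3) by (intro bexI[of _ m] conjI exI[of _ "min d d'"]) auto
qed

lemma generically_conj:
  assumes V: "hopen V" and Q: "generically h V Q" and R: "generically h V R"
  shows "generically h V (\<lambda>l. Q l \<and> R l)"
  unfolding generically_iff[OF V]
proof (intro ballI allI impI)
  fix l and e :: real assume l: "l \<in> V" and e: "e > 0"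
  obtain m d where m: "m \<in> V" "m \<in> polydisc l e" "d > 0" "polydisc m d \<subseteq> V" "\<forall>x\<in>polydisc m d. Q x"
    using Q[unfolded generically_iff[OF V]] l e by blast
  have "hopen (polydisc m d \<inter> polydisc l e)" by (intro openin_Int open_polydisc)
  then obtain d1 where d1: "d1 > 0" "polydisc m d1 \<subseteq> polydisc m d \<inter> polydisc l e"
    using polydisc_nhd[of "polydisc m d \<inter> polydisc l e" m] m polydisc_center[OF hopen_hdual[OF V m(1)] m(3)] by blast
  obtain m' d' where m': "m' \<in> V" "m' \<in> polydisc m d1" "d' > 0" "polydisc m' d' \<subseteq> V" "\<forall>x\<in>polydisc m' d'. R x"
    using R[unfolded generically_iff[OF V]] m(1) d1(1) by blast
  have "hopen (polydisc m d \<inter> polydisc m' d')" by (intro openin_Int open_polydisc)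
  moreover have "m' \<in> polydisc m d \<inter> polydisc m' d'" using m'(2) d1(2) polydisc_center[OF hopen_hdual[OF V m'(1)] m'(3)] by blast
  ultimately obtain d2 where d2: "d2 > 0" "polydisc m' d2 \<subseteq> polydisc m d \<inter> polydisc m' d'" by (rule polydisc_nhd)
  then show "\<exists>m\<in>V. m \<in> polydisc l e \<and> (\<exists>d>0. polydisc m d \<subseteq> V \<and> (\<forall>x\<in>polydisc m d. Q x \<and> R x))"
    using m' m d1(2) by (intro bexI[of _ m'] conjI exI[of _ d2]) blast+
qed

lemma generically_ball:
  assumes "hopen V" "finite A" "\<And>a. a \<in> A \<Longrightarrow> generically h V (Q a)"
  shows "generically h V (\<lambda>l. \<forall>a\<in>A. Q a l)"
  using assms(2,3)
proof (induction A rule: finite_induct)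
  case empty
  show ?case by (rule generically_all[OF assms(1)]) simp
next
  case (insert a A)
  have "generically h V (\<lambda>l. Q a l \<and> (\<forall>a\<in>A. Q a l))"
    by (rule generically_conj[OF assms(1)]) (use insert in blast)+
  then show ?case by simp
qed

lemma generically_local:
  assumes V: "hopen V" and loc: "\<And>l. l \<in> V \<Longrightarrow> \<exists>e>0. polydisc l e \<subseteq> V \<and> generically h (polydisc l e) Q"
  shows "generically h V Q"
  unfolding generically_iff[OF V]
proof (intro ballI allI impI)
  fix l and e :: real assume l: "l \<in> V" and e: "e > 0"
  obtain e' where e': "e' > 0" "polydisc l e' \<subseteq> V" "generically h (polydisc l e') Q" using loc[OF l] by blast
  obtain m d where "m \<in> polydisc l e'" "m \<in> polydisc l e" "d > 0" "polydisc m d \<subseteq> polydisc l e'" "\<forall>x\<in>polydisc m d. Q x"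
    using e'(3)[unfolded generically_iff[OF open_polydisc]] polydisc_center[OF hopen_hdual[OF V l] e'(1)] e by blast
  then show "\<exists>m\<in>V. m \<in> polydisc l e \<and> (\<exists>d>0. polydisc m d \<subseteq> V \<and> (\<forall>x\<in>polydisc m d. Q x))"
    using e'(2) by blast
qed

lemma generically_polydisc:
  assumes V: "hopen V" and Q: "generically h V Q" and l: "l \<in> V"
  obtains m d where "m \<in> V" "d > 0" "polydisc m d \<subseteq> V" "\<And>x. x \<in> polydisc m d \<Longrightarrow> Q x"
  using Q[unfolded generically_iff[OF V]] l zero_less_one by metis

lemma generically_point:
  assumes V: "hopen V" and Q: "generically h V Q" and l: "l \<in> V"
  obtains m where "m \<in> V" "Q m"
proof -
  obtain m d where "m \<in> V" "d > 0" "polydisc m d \<subseteq> V" "\<And>x. x \<in> polydisc m d \<Longrightarrow> Q x"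
    by (rule generically_polydisc[OF assms]) (rule that)
  then show thesis using that polydisc_center[OF hopen_hdual[OF V]] by blast
qed

subsection \<open>Functions holomorphic along lines\<close>

lemma hol_on_subset: "hol_on h V f \<Longrightarrow> V' \<subseteq> V \<Longrightarrow> hol_on h V' f"
  unfolding hol_on_def by (blast intro: continuous_on_subset holomorphic_on_subset)

lemma hol_on_const: "hol_on h V (\<lambda>_. c)"
  by (simp add: hol_on_def)

lemma hol_on_eval: "hol_on h V (\<lambda>l. l t)"
  unfolding hol_on_def
  by (intro conjI ballI continuous_on_subset[OF continuous_on_product_coordinates] holomorphic_intros subset_UNIV)

lemma hol_on_add: "hol_on h V f \<Longrightarrow> hol_on h V g \<Longrightarrow> hol_on h V (\<lambda>l. f l + g l)"
  and hol_on_diff: "hol_on h V f \<Longrightarrow> hol_on h V g \<Longrightarrow> hol_on h V (\<lambda>l. f l - g l)"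
  and hol_on_mult: "hol_on h V f \<Longrightarrow> hol_on h V g \<Longrightarrow> hol_on h V (\<lambda>l. f l * g l)"
  and hol_on_exp: "hol_on h V f \<Longrightarrow> hol_on h V (\<lambda>l. exp (f l))"
  unfolding hol_on_def by (auto intro!: continuous_intros holomorphic_intros)

lemma hol_on_sum: "(\<And>i. i \<in> A \<Longrightarrow> hol_on h V (f i)) \<Longrightarrow> hol_on h V (\<lambda>l. \<Sum>i\<in>A. f i l)"
  by (induction A rule: infinite_finite_induct) (auto intro: hol_on_const hol_on_add)

lemma hol_on_prod: "(\<And>i. i \<in> A \<Longrightarrow> hol_on h V (f i)) \<Longrightarrow> hol_on h V (\<lambda>l. \<Prod>i\<in>A. f i l)"
  by (induction A rule: infinite_finite_induct) (auto intro: hol_on_const hol_on_mult)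

lemmas hol_on_intros = hol_on_const hol_on_eval hol_on_add hol_on_diff hol_on_mult hol_on_exp hol_on_sum hol_on_prod

lemma polydisc_line_open_convex:
  assumes c: "c \<in> hdual h" and v: "v \<in> hdual h"
  shows "open {z. line c v z \<in> polydisc l e}" "convex {z. line c v z \<in> polydisc l e}"
proof -
  have eq: "{z. line c v z \<in> polydisc l e} = (\<Inter>\<gamma>\<in>P0. {z. norm (c (T \<gamma>) + z * v (T \<gamma>) - l (T \<gamma>)) < e})"
    using hdual_line[OF c v] by (auto simp: polydisc_def)
  show "open {z. line c v z \<in> polydisc l e}"
    unfolding eq using finite_P0 by (intro open_INT ballI open_Collect_less continuous_intros) auto
  have "convex {z. norm (a + z * b) < e}" for a b :: complex
  proof (rule convexI)
    fix x y and u w :: real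
    assume x: "x \<in> {z. norm (a + z * b) < e}" and y: "y \<in> {z. norm (a + z * b) < e}" and uw: "0 \<le> u" "0 \<le> w" "u + w = 1"
    have "a = u *\<^sub>R a + w *\<^sub>R a" using uw(3) by (metis scaleR_left_distrib scaleR_one)
    then have "a + (u *\<^sub>R x + w *\<^sub>R y) * b = u *\<^sub>R (a + x * b) + w *\<^sub>R (a + y * b)"
      by (simp add: algebra_simps)
    moreover have "u *\<^sub>R (a + x * b) + w *\<^sub>R (a + y * b) \<in> ball 0 e"
      by (rule convexD[OF convex_ball]) (use x y uw in auto)
    ultimately show "u *\<^sub>R x + w *\<^sub>R y \<in> {z. norm (a + z * b) < e}" by simp
  qed
  from this[of "c (T _) - l (T _)" "v (T _)"]
  show "convex {z. line c v z \<in> polydisc l e}"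
    unfolding eq by (intro convex_INT) (simp add: algebra_simps)
qed

text \<open>Reduction to one variable: the complex line from \<open>m\<close> to \<open>x\<close>
  meets the large polydisc in a convex, hence connected, open set, and \<open>f\<close> vanishes on
  it near \<open>m\<close>.\<close>

lemma hol_identity:
  assumes f: "hol_on h (polydisc l e) f" and d: "d > 0" "polydisc m d \<subseteq> polydisc l e" "m \<in> hdual h"
    and z: "\<And>x. x \<in> polydisc m d \<Longrightarrow> f x = 0" and x: "x \<in> polydisc l e"
  shows "f x = 0"
proof -
  define v where "v = x - m"
  have xh: "x \<in> hdual h" using x by (simp add: polydisc_def)
  have v: "v \<in> hdual h" unfolding v_def by (rule hdual_diff[OF xh d(3)])
  have m: "m \<in> polydisc m d" by (rule polydisc_center[OF d(3,1)])
  let ?S = "{z. line m v z \<in> polydisc l e}" and ?D = "{z. line m v z \<in> polydisc m d}"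
  have "f (line m v 1) = 0"
  proof (rule analytic_continuation_open[where f = "\<lambda>z. f (line m v z)" and g = "\<lambda>_. 0" and s = ?D and s' = ?S])
    show "open ?D" "open ?S" by (rule polydisc_line_open_convex[OF d(3) v])+
    show "?D \<noteq> {}" using m by (intro ex_in_conv[THEN iffD1] exI[of _ 0]) simp
    show "connected ?S" by (intro convex_connected polydisc_line_open_convex[OF d(3) v])
    show "?D \<subseteq> ?S" using d(2) by blast
    show "(\<lambda>z. f (line m v z)) holomorphic_on ?S"
      using f m d(2) v unfolding hol_on_def by blast
    show "1 \<in> ?S" using x by (simp add: v_def)
  qed (use z in auto)
  then show ?thesis by (simp add: v_def)
qed

lemma line_line: "line (line y v z) v w = line y v (z + w)"
  by (auto simp: algebra_simps)

text \<open>Only derivatives along the coordinate directions are given, so the coordinates of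
  \<open>m\<close> are changed into those of \<open>x\<close> one after another, each change being a
  one-variable problem on a convex set.\<close>

lemma constant_on_polydisc:
  fixes g :: "('g \<Rightarrow> complex) \<Rightarrow> complex"
  assumes m: "m \<in> hdual h" and d: "d > 0"
    and der: "\<And>x \<gamma>. x \<in> polydisc m d \<Longrightarrow> \<gamma> \<in> P0 \<Longrightarrow> ((\<lambda>z. g (line x (hs \<gamma>) z)) has_field_derivative 0) (at 0)"
    and x: "x \<in> polydisc m d"
  shows "g x = g m"
proof -
  have xh: "x \<in> hdual h" using x by (simp add: polydisc_def)
  define k where "k \<gamma> = x (T \<gamma>) - m (T \<gamma>)" for \<gamma>
  \<comment> \<open>The point with the coordinates of \<open>x\<close> at \<open>A\<close> and those
    of \<open>m\<close> elsewhere; it stays in the polydisc because each coordinate is bounded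
    separately.\<close>
  define y where "y A = (\<lambda>t. m t + (\<Sum>\<gamma>\<in>A. k \<gamma> * hs \<gamma> t))" for A
  have yh: "y A \<in> hdual h" if "A \<subseteq> P0" for A
  proof -
    have "(\<lambda>t. \<Sum>\<gamma>\<in>A. k \<gamma> * hs \<gamma> t) \<in> hdual h" using that hs_hdual by (intro hdual_sum) auto
    from hdual_line[OF m this, of 1] show ?thesis by (simp add: y_def)
  qed
  have yT: "y A (T \<beta>) - m (T \<beta>) = (if \<beta> \<in> A then k \<beta> else 0)" if "A \<subseteq> P0" "\<beta> \<in> P0" for A \<beta>
  proof -
    have "(\<Sum>\<gamma>\<in>A. k \<gamma> * hs \<gamma> (T \<beta>)) = (\<Sum>\<gamma>\<in>A. if \<beta> = \<gamma> then k \<beta> else 0)"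
      by (rule sum.cong) (use that hs_T in auto)
    also have "\<dots> = (if \<beta> \<in> A then k \<beta> else 0)"
      using finite_subset[OF that(1) finite_P0] by simp
    finally show ?thesis by (simp add: y_def)
  qed
  have ybox: "y A \<in> polydisc m d" if "A \<subseteq> P0" for A
    using yh[OF that] yT[OF that] x d by (auto simp: polydisc_def k_def)
  have "g (y A) = g m" if "finite A" "A \<subseteq> P0" for A
    using that
  proof (induction A rule: finite_induct)
    case empty
    show ?case by (simp add: y_def)
  next
    case (insert \<gamma> A)
    then have A: "A \<subseteq> P0" and \<gamma>: "\<gamma> \<in> P0" by auto
    let ?S = "{z. line (y A) (hs \<gamma>) z \<in> polydisc m d}"
    have yi: "y (insert \<gamma> A) = line (y A) (hs \<gamma>) (k \<gamma>)"
      using insert.hyps by (auto simp: y_def algebra_simps)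
    have "((\<lambda>z. g (line (y A) (hs \<gamma>) z)) has_field_derivative 0) (at z within ?S)" if "z \<in> ?S" for z
    proof -
      have "((\<lambda>w. g (line (line (y A) (hs \<gamma>) z) (hs \<gamma>) w)) has_field_derivative 0) (at 0)"
        by (rule der) (use that \<gamma> in auto)
      then have "((\<lambda>w. g (line (y A) (hs \<gamma>) (w + z))) has_field_derivative 0) (at 0)"
        unfolding line_line by (simp only: add.commute)
      then have "((\<lambda>z. g (line (y A) (hs \<gamma>) z)) has_field_derivative 0) (at (0 + z))"
        by (subst DERIV_shift)
      then show ?thesis by (simp add: has_field_derivative_at_within)
    qed
    then obtain c where c: "\<And>z. z \<in> ?S \<Longrightarrow> g (line (y A) (hs \<gamma>) z) = c"
      using has_field_derivative_zero_constant[OF polydisc_line_open_convex(2)[OF yh[OF A] hs_hdual[OF \<gamma>], of m d]]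
      by blast
    have S0: "0 \<in> ?S" using ybox[OF A] by simp
    have Sk: "k \<gamma> \<in> ?S" using ybox[OF insert.prems] unfolding yi by simp
    have "g (line (y A) (hs \<gamma>) (k \<gamma>)) = g (line (y A) (hs \<gamma>) 0)"
      by (rule trans[OF c[OF Sk] c[OF S0, symmetric]])
    then have "g (y (insert \<gamma> A)) = g (y A)" unfolding yi by simp
    then show ?case using insert.IH[OF A] by simp
  qed
  from this[OF finite_P0 subset_refl] have "g (y P0) = g m" .
  moreover have "y P0 = x"
  proof (rule hdual_eqI[OF yh[OF subset_refl] xh])
    fix t assume "t \<in> h"
    then show "y P0 t = x t"
      unfolding y_def k_def hdual_hs_expansion[OF xh \<open>t \<in> h\<close>] hdual_hs_expansion[OF m \<open>t \<in> h\<close>]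
      by (simp add: algebra_simps sum_subtractf)
  qed
  ultimately show ?thesis by simp
qed

text \<open>The solutions of \<open>c' = 1 - c\<^sup>2\<close>: one of \<open>(c + 1) e\<^sup>-\<^sup>u\<close> and \<open>(c - 1) e\<^sup>u\<close> is a constant multiple of the
  other, since they have the same logarithmic derivative \<open>- c\<close>.\<close>

lemma riccati_on_polydisc:
  fixes c :: "('g \<Rightarrow> complex) \<Rightarrow> complex"
  assumes m: "m \<in> hdual h" and d: "d > 0" and cont: "continuous_on (polydisc m d) c"
    and der: "\<And>x \<gamma>. x \<in> polydisc m d \<Longrightarrow> \<gamma> \<in> P0 \<Longrightarrow>
      ((\<lambda>z. c (line x (hs \<gamma>) z)) has_field_derivative (1 - (c x)\<^sup>2) * hs \<gamma> t) (at 0)"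
  obtains p d' where "d' > 0" "polydisc m d' \<subseteq> polydisc m d"
    "\<And>x. x \<in> polydisc m d' \<Longrightarrow> coordA p * (c x + 1) = coordB p * exp (2 * x t) * (c x - 1)"
proof -
  \<comment> \<open>Continuity keeps \<open>c\<close> away from the pole of the Cayley transform, or
    of its reciprocal, after shrinking the polydisc.\<close>
  have near: "\<exists>d'>0. polydisc m d' \<subseteq> polydisc m d \<and> (\<forall>x\<in>polydisc m d'. c x \<noteq> a)" if "c m \<noteq> a" for a
  proof -
    have "openin (top_of_set (polydisc m d)) (polydisc m d \<inter> c -` (- {a}))"
      by (rule continuous_openin_preimage_gen[OF cont]) auto
    then have "hopen (polydisc m d \<inter> c -` (- {a}))" using open_polydisc openin_trans by blast
    moreover have "m \<in> polydisc m d \<inter> c -` (- {a})" using polydisc_center[OF m d] that by simp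
    ultimately obtain d' where "d' > 0" "polydisc m d' \<subseteq> polydisc m d \<inter> c -` (- {a})" by (rule polydisc_nhd)
    then show ?thesis by blast
  qed
  have e0: "((\<lambda>z. exp (s * (x t + z * hs \<gamma> t))) has_field_derivative exp (s * x t) * (s * hs \<gamma> t)) (at 0)" for s x \<gamma>
    by (auto intro!: derivative_eq_intros)
  show thesis
  proof (cases "c m = 1")
    case False
    then obtain d' where d': "d' > 0" "polydisc m d' \<subseteq> polydisc m d" "\<And>x. x \<in> polydisc m d' \<Longrightarrow> c x \<noteq> 1" using near by blast
    define g where "g x = (c x + 1) / (c x - 1) * exp (- 2 * x t)" for x
    have "((\<lambda>z. g (line x (hs \<gamma>) z)) has_field_derivative 0) (at 0)" if x: "x \<in> polydisc m d'" and \<gamma>: "\<gamma> \<in> P0" for x \<gamma>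
    proof -
      have cx: "c x \<noteq> 1" by (rule d'(3)[OF x])
      have D: "((\<lambda>z. c (line x (hs \<gamma>) z)) has_field_derivative (1 - (c x)\<^sup>2) * hs \<gamma> t) (at 0)"
        by (rule der) (use x d'(2) \<gamma> in auto)
      have "((\<lambda>z. (c (line x (hs \<gamma>) z) + 1) / (c (line x (hs \<gamma>) z) - 1)) has_field_derivative
          ((1 - (c x)\<^sup>2) * hs \<gamma> t * (c x - 1) - (c x + 1) * ((1 - (c x)\<^sup>2) * hs \<gamma> t)) / ((c x - 1) * (c x - 1))) (at 0)"
        using cx by (auto intro!: derivative_eq_intros D)
      from DERIV_mult[OF this e0[of "- 2" x \<gamma>]] show ?thesis
        unfolding g_def
        by (rule DERIV_cong) (use cx in \<open>simp add: divide_simps, simp add: algebra_simps power2_eq_square\<close>)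
    qed
    then have const: "g x = g m" if "x \<in> polydisc m d'" for x by (rule constant_on_polydisc[OF m d'(1) _ that])
    show thesis
    proof (rule that[OF d'(1,2), of "Some (g m)"])
      fix x assume x: "x \<in> polydisc m d'"
      have "g m * exp (2 * x t) * (c x - 1) = (c x + 1) * (exp (- 2 * x t) * exp (2 * x t))"
        using d'(3)[OF x] unfolding const[OF x, symmetric] by (simp add: g_def)
      also have "exp (- 2 * x t) * exp (2 * x t) = 1" by (simp flip: exp_add)
      finally show "coordA (Some (g m)) * (c x + 1) = coordB (Some (g m)) * exp (2 * x t) * (c x - 1)" by simp
    qed
  next
    case True
    then obtain d' where d': "d' > 0" "polydisc m d' \<subseteq> polydisc m d" "\<And>x. x \<in> polydisc m d' \<Longrightarrow> c x \<noteq> - 1" using near[of "- 1"] by auto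
    \<comment> \<open>The reciprocal of the quantity in the other case. It vanishes at
      \<open>m\<close>, hence throughout, so \<open>c\<close> is the constant solution 1 and the
      point is \<open>None\<close>.\<close>
    define g where "g x = (c x - 1) / (c x + 1) * exp (2 * x t)" for x
    have "((\<lambda>z. g (line x (hs \<gamma>) z)) has_field_derivative 0) (at 0)" if x: "x \<in> polydisc m d'" and \<gamma>: "\<gamma> \<in> P0" for x \<gamma>
    proof -
      have cx: "c x + 1 \<noteq> 0" using d'(3)[OF x] by (simp add: add_eq_0_iff2)
      have D: "((\<lambda>z. c (line x (hs \<gamma>) z)) has_field_derivative (1 - (c x)\<^sup>2) * hs \<gamma> t) (at 0)"
        by (rule der) (use x d'(2) \<gamma> in auto)
      have "((\<lambda>z. (c (line x (hs \<gamma>) z) - 1) / (c (line x (hs \<gamma>) z) + 1)) has_field_derivative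
          ((1 - (c x)\<^sup>2) * hs \<gamma> t * (c x + 1) - (c x - 1) * ((1 - (c x)\<^sup>2) * hs \<gamma> t)) / ((c x + 1) * (c x + 1))) (at 0)"
        using cx by (auto intro!: derivative_eq_intros D)
      from DERIV_mult[OF this e0[of 2 x \<gamma>]] show ?thesis
        unfolding g_def
        by (rule DERIV_cong) (use cx in \<open>simp add: divide_simps, simp add: algebra_simps power2_eq_square\<close>)
    qed
    then have const: "g x = g m" if "x \<in> polydisc m d'" for x by (rule constant_on_polydisc[OF m d'(1) _ that])
    show thesis
    proof (rule that[OF d'(1,2), of None])
      fix x assume x: "x \<in> polydisc m d'"
      have "(c x - 1) / (c x + 1) * exp (2 * x t) = 0"
        using const[OF x] True by (simp add: g_def)
      then have "c x - 1 = 0" using d'(3)[OF x] by (auto simp: add_eq_0_iff2)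
      then show "coordA None * (c x + 1) = coordB None * exp (2 * x t) * (c x - 1)" by simp
    qed
  qed
qed

end

text \<open>The numbers c + 1 and c - 1 never vanish together, so the relation determines a point of
  the projective line.\<close>

lemma coord_rel_unique:
  fixes c x :: complex
  assumes "x \<noteq> 0" "coordA p * (c + 1) = coordB p * x * (c - 1)" "coordA q * (c + 1) = coordB q * x * (c - 1)"
  shows "p = q"
proof (rule ccontr)
  assume "p \<noteq> q"
  then have D: "coordA p * coordB q - coordA q * coordB p \<noteq> 0" using coord_proportional[of p q] by simp
  have "(coordA p * coordB q - coordA q * coordB p) * (c + 1) = coordB q * (coordA p * (c + 1)) - coordB p * (coordA q * (c + 1))"
    by (simp add: algebra_simps)
  also have "\<dots> = 0" unfolding assms(2,3) by (simp add: algebra_simps)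
  finally have 1: "c + 1 = 0" using D by simp
  have "(coordA p * coordB q - coordA q * coordB p) * (x * (c - 1)) = coordA p * (coordB q * x * (c - 1)) - coordA q * (coordB p * x * (c - 1))"
    by (simp add: algebra_simps)
  also have "\<dots> = 0" unfolding assms(2,3)[symmetric] by (simp add: algebra_simps)
  finally have "c - 1 = 0" using D assms(1) by simp
  with 1 have "(1::complex) + 1 = 0" by (metis add.commute diff_add_cancel add_0)
  then show False by simp
qed

context cartan
begin

subsection \<open>The r-matrix of an admissible system\<close>

definition rho_den :: "(('g \<Rightarrow> complex) \<Rightarrow> complex option) \<Rightarrow> ('g \<Rightarrow> complex) \<Rightarrow> ('g \<Rightarrow> complex) \<Rightarrow> complex"
  where "rho_den \<phi> l \<alpha> = coordB (\<phi> \<alpha>) * exp (2 * l (T \<alpha>)) - coordA (\<phi> \<alpha>)"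

text \<open>The inverse Cayley transform of (b / a) exp (2 \<langle>\<alpha>, \<lambda>\<rangle>):
  the constant 1 for \<open>None\<close>, the constant -1 for \<open>Some 0\<close>, and coth
  \<langle>\<alpha>, \<lambda> + \<lambda>_0\<rangle> if b / a = exp (2 \<langle>\<alpha>,
  \<lambda>_0\<rangle>).\<close>

definition rho :: "(('g \<Rightarrow> complex) \<Rightarrow> complex option) \<Rightarrow> ('g \<Rightarrow> complex) \<Rightarrow> ('g \<Rightarrow> complex) \<Rightarrow> complex"
  where "rho \<phi> l \<alpha> = (coordB (\<phi> \<alpha>) * exp (2 * l (T \<alpha>)) + coordA (\<phi> \<alpha>)) / rho_den \<phi> l \<alpha>"

lemma hdual_T_minus: "l \<in> hdual h \<Longrightarrow> \<alpha> \<in> \<Delta> \<Longrightarrow> l (T (- \<alpha>)) = - l (T \<alpha>)"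
  by (simp add: T_minus hdual_minus_arg T_h)

lemma hdual_T_add: "l \<in> hdual h \<Longrightarrow> \<alpha> \<in> \<Delta> \<Longrightarrow> \<beta> \<in> \<Delta> \<Longrightarrow> \<alpha> + \<beta> \<in> \<Delta> \<Longrightarrow> l (T (\<alpha> + \<beta>)) = l (T \<alpha>) + l (T \<beta>)"
  by (simp add: T_add hdual_add_arg T_h)

text \<open>This holds at the poles as well: the denominators at \<alpha> and -\<alpha> vanish
  together, and both quotients are then 0. So being a bivector and having zero gauge hold on all of
  \<open>U\<close>.\<close>

lemma rho_odd:
  assumes adm: "admissible \<phi>" and l: "l \<in> hdual h"
  shows "odd_on_roots (rho \<phi> l)"
  unfolding odd_on_roots_def
proof
  fix \<alpha> assume \<alpha>: "\<alpha> \<in> \<Delta>"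
  define e where "e = exp (2 * l (T \<alpha>))"
  have e: "e \<noteq> 0" "exp (2 * l (T (- \<alpha>))) = inverse e"
    by (simp_all add: e_def hdual_T_minus[OF l \<alpha>] exp_minus)
  have "rho \<phi> l (- \<alpha>) = (coordB (\<phi> (- \<alpha>)) * inverse e + coordA (\<phi> (- \<alpha>))) / (coordB (\<phi> (- \<alpha>)) * inverse e - coordA (\<phi> (- \<alpha>)))"
    unfolding rho_def rho_den_def e(2) ..
  moreover have "rho \<phi> l \<alpha> = (coordB (\<phi> \<alpha>) * e + coordA (\<phi> \<alpha>)) / (coordB (\<phi> \<alpha>) * e - coordA (\<phi> \<alpha>))"
    unfolding rho_def rho_den_def e_def ..
  moreover have "(coordB q * inverse e + coordA q) / (coordB q * inverse e - coordA q) = - ((coordB p * e + coordA p) / (coordB p * e - coordA p))"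
    if "coordA p * coordA q = coordB p * coordB q" for p q
  proof (cases p)
    case None
    then have "q = Some 0" using that by (cases q) auto
    then show ?thesis using None e by simp
  next
    case (Some c)
    show ?thesis
    proof (cases q)
      case None
      then show ?thesis using Some that e by simp
    next
      case q: (Some d)
      then have cd: "c * d = 1" using that Some by simp
      then have "c \<noteq> 0" by auto
      have "d = inverse c" by (rule inverse_unique[OF cd, symmetric])
      then have "(d * inverse e + 1) / (d * inverse e - 1) = (c * e * (d * inverse e + 1)) / (c * e * (d * inverse e - 1))"
        using e(1) \<open>c \<noteq> 0\<close> by (simp only: mult_divide_mult_cancel_left mult_eq_0_iff) simp
      also have "c * e * (d * inverse e + 1) = 1 + c * e"
        using \<open>c \<noteq> 0\<close> \<open>d = inverse c\<close> e(1) by (simp add: field_simps)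
      also have "c * e * (d * inverse e - 1) = 1 - c * e"
        using \<open>c \<noteq> 0\<close> \<open>d = inverse c\<close> e(1) by (simp add: field_simps)
      also have "(1 + c * e) / (1 - c * e) = - ((c * e + 1) / (c * e - 1))"
        by (metis add.commute minus_diff_eq minus_divide_right)
      finally show ?thesis using Some q by simp
    qed
  qed
  ultimately show "rho \<phi> l (- \<alpha>) = - rho \<phi> l \<alpha>"
    using admissible_minus[OF adm \<alpha>] by simp
qed

lemma rho_rel:
  assumes "rho_den \<phi> l \<alpha> \<noteq> 0"
  shows "coordA (\<phi> \<alpha>) * (rho \<phi> l \<alpha> + 1) = coordB (\<phi> \<alpha>) * exp (2 * l (T \<alpha>)) * (rho \<phi> l \<alpha> - 1)"
proof -
  define a u where "a = coordA (\<phi> \<alpha>)" and "u = coordB (\<phi> \<alpha>) * exp (2 * l (T \<alpha>))"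
  have "u - a \<noteq> 0" using assms by (simp add: rho_den_def a_def u_def)
  moreover have "rho \<phi> l \<alpha> = (u + a) / (u - a)" by (simp add: rho_def rho_den_def a_def u_def)
  ultimately have "a * (rho \<phi> l \<alpha> + 1) = u * (rho \<phi> l \<alpha> - 1)" by (simp add: field_simps)
  then show ?thesis by (simp add: a_def u_def)
qed

text \<open>If the denominator vanished, the relation would read a (c + 1) = a (c - 1), which forces
  both homogeneous coordinates to be 0.\<close>

lemma cayley_rel_rho:
  assumes "coordA (\<phi> \<alpha>) * (c + 1) = coordB (\<phi> \<alpha>) * exp (2 * l (T \<alpha>)) * (c - 1)"
  shows "rho_den \<phi> l \<alpha> \<noteq> 0" "c = rho \<phi> l \<alpha>"
proof -
  define a u where "a = coordA (\<phi> \<alpha>)" and "u = coordB (\<phi> \<alpha>) * exp (2 * l (T \<alpha>))"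
  have eq: "a * (c + 1) = u * (c - 1)" using assms by (simp add: a_def u_def)
  have "u \<noteq> a"
  proof
    assume "u = a"
    then have "a = 0" using eq by (simp add: algebra_simps)
    then have "\<phi> \<alpha> = None" "u = 0" using \<open>u = a\<close> by (simp_all add: a_def coordA_eq_0)
    then show False by (simp add: u_def)
  qed
  then show "rho_den \<phi> l \<alpha> \<noteq> 0" by (simp add: rho_den_def a_def u_def)
  have "c * (u - a) = u + a" using eq by (simp add: algebra_simps)
  then have "c = (u + a) / (u - a)" using \<open>u \<noteq> a\<close> by (simp add: field_simps)
  then show "c = rho \<phi> l \<alpha>" by (simp add: rho_def rho_den_def a_def u_def)
qed

text \<open>The addition theorem of coth, homogenized. Over the common denominator of the values at
  \<alpha> and \<beta>, it reduces to multiplicativity of the ratios u / a, which is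
  \<open>key\<close>.\<close>

lemma rho_algebraic:
  assumes adm: "admissible \<phi>" and l: "l \<in> hdual h" and den: "\<And>\<alpha>. \<alpha> \<in> \<Delta> \<Longrightarrow> rho_den \<phi> l \<alpha> \<noteq> 0"
    and ab: "\<alpha> \<in> \<Delta>" "\<beta> \<in> \<Delta>" "\<alpha> + \<beta> \<in> \<Delta>"
  shows "rho \<phi> l \<alpha> * rho \<phi> l \<beta> + 1 = rho \<phi> l (\<alpha> + \<beta>) * (rho \<phi> l \<alpha> + rho \<phi> l \<beta>)"
proof -
  define a1 a2 a3 where "a1 = coordA (\<phi> \<alpha>)" and "a2 = coordA (\<phi> \<beta>)" and "a3 = coordA (\<phi> (\<alpha> + \<beta>))"
  define u1 u2 u3 where "u1 = coordB (\<phi> \<alpha>) * exp (2 * l (T \<alpha>))" and "u2 = coordB (\<phi> \<beta>) * exp (2 * l (T \<beta>))"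
    and "u3 = coordB (\<phi> (\<alpha> + \<beta>)) * exp (2 * l (T (\<alpha> + \<beta>)))"
  have e: "exp (2 * l (T (\<alpha> + \<beta>))) = exp (2 * l (T \<alpha>)) * exp (2 * l (T \<beta>))"
    by (simp add: hdual_T_add[OF l ab] distrib_left exp_add)
  have key: "a1 * a2 * u3 = u1 * u2 * a3"
  proof -
    have "a1 * a2 * u3 = (a1 * a2 * coordB (\<phi> (\<alpha> + \<beta>))) * (exp (2 * l (T \<alpha>)) * exp (2 * l (T \<beta>)))"
      unfolding u3_def e by (simp add: mult_ac)
    also have "a1 * a2 * coordB (\<phi> (\<alpha> + \<beta>)) = coordB (\<phi> \<alpha>) * coordB (\<phi> \<beta>) * a3"
      unfolding a1_def a2_def a3_def by (rule admissible_add[OF adm ab])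
    finally show ?thesis by (simp add: u1_def u2_def mult_ac)
  qed
  have d: "u1 - a1 \<noteq> 0" "u2 - a2 \<noteq> 0" "u3 - a3 \<noteq> 0"
    using den[OF ab(1)] den[OF ab(2)] den[OF ab(3)]
    by (simp_all add: rho_den_def a1_def a2_def a3_def u1_def u2_def u3_def)
  have r: "rho \<phi> l \<alpha> = (u1 + a1) / (u1 - a1)" "rho \<phi> l \<beta> = (u2 + a2) / (u2 - a2)" "rho \<phi> l (\<alpha> + \<beta>) = (u3 + a3) / (u3 - a3)"
    by (simp_all add: rho_def rho_den_def a1_def a2_def a3_def u1_def u2_def u3_def)
  have "(u1 + a1) / (u1 - a1) * ((u2 + a2) / (u2 - a2)) + 1 = 2 * (u1 * u2 + a1 * a2) / ((u1 - a1) * (u2 - a2))"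
    using d(1,2) by (simp add: divide_simps) (simp add: algebra_simps)
  moreover have "(u1 + a1) / (u1 - a1) + (u2 + a2) / (u2 - a2) = 2 * (u1 * u2 - a1 * a2) / ((u1 - a1) * (u2 - a2))"
    using d(1,2) by (simp add: divide_simps) (simp add: algebra_simps)
  moreover have "2 * (u1 * u2 + a1 * a2) / ((u1 - a1) * (u2 - a2)) = (u3 + a3) / (u3 - a3) * (2 * (u1 * u2 - a1 * a2) / ((u1 - a1) * (u2 - a2)))"
  proof -
    have "(u1 * u2 + a1 * a2) * (u3 - a3) = (u3 + a3) * (u1 * u2 - a1 * a2)"
      using key by (simp add: algebra_simps)
    then have "u1 * u2 + a1 * a2 = (u3 + a3) / (u3 - a3) * (u1 * u2 - a1 * a2)"
      using d(3) by (simp add: field_simps)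
    then show ?thesis by simp
  qed
  ultimately show ?thesis unfolding r by simp
qed

lemma rho_derivative:
  assumes "rho_den \<phi> l \<alpha> \<noteq> 0"
  shows "((\<lambda>z. rho \<phi> (line l m z) \<alpha>) has_field_derivative (1 - (rho \<phi> l \<alpha>)\<^sup>2) * m (T \<alpha>)) (at 0)"
proof -
  define a b u v where "a = coordA (\<phi> \<alpha>)" and "b = coordB (\<phi> \<alpha>)" and "u = exp (2 * l (T \<alpha>))" and "v = m (T \<alpha>)"
  have d: "b * u - a \<noteq> 0" using assms by (simp add: rho_den_def a_def b_def u_def)
  have e: "((\<lambda>z. exp (2 * (l (T \<alpha>) + z * m (T \<alpha>)))) has_field_derivative u * (2 * v)) (at 0)"
    unfolding u_def v_def by (auto intro!: derivative_eq_intros)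
  have "((\<lambda>z. (b * exp (2 * (l (T \<alpha>) + z * m (T \<alpha>))) + a) / (b * exp (2 * (l (T \<alpha>) + z * m (T \<alpha>))) - a))
      has_field_derivative (b * (u * (2 * v)) * (b * u - a) - (b * u + a) * (b * (u * (2 * v)))) / ((b * u - a) * (b * u - a))) (at 0)"
    using d by (auto intro!: derivative_eq_intros e simp: u_def v_def algebra_simps)
  moreover have "(b * (u * (2 * v)) * (b * u - a) - (b * u + a) * (b * (u * (2 * v)))) / ((b * u - a) * (b * u - a))
      = (1 - ((b * u + a) / (b * u - a))\<^sup>2) * v"
    using d by (simp add: divide_simps) (simp add: algebra_simps power2_eq_square)
  ultimately show ?thesis
    by (simp add: rho_def rho_den_def a_def b_def u_def v_def)
qed

lemma alt_d_rmat:
  assumes D: "\<And>\<gamma>. \<gamma> \<in> P0 \<Longrightarrow> dir_deriv (hs \<gamma>) r l = rmat (\<delta> \<gamma>)"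
  shows "alt_d h E P0 r l i j k = (\<Sum>\<gamma>\<in>P0. wedge12 (T \<gamma>) (rmat (\<delta> \<gamma>)) i j k)"
  unfolding alt_d_def sum_fun_apply3 by (rule sum.cong) (simp_all add: D)

lemma rho_equation:
  assumes adm: "admissible \<phi>" and l: "l \<in> hdual h" and den: "\<And>\<alpha>. \<alpha> \<in> \<Delta> \<Longrightarrow> rho_den \<phi> l \<alpha> \<noteq> 0"
  shows "alt_d h E P0 (\<lambda>l. rmat (rho \<phi> l)) l i j k + 1 / 2 * schouten (rmat (rho \<phi> l)) (rmat (rho \<phi> l)) i j k
    = comm12_23 casimir casimir i j k"
proof -
  define \<delta> where "\<delta> \<gamma> \<alpha> = (1 - (rho \<phi> l \<alpha>)\<^sup>2) * hs \<gamma> (T \<alpha>)" for \<gamma> \<alpha>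
  have dd: "dir_deriv (hs \<gamma>) (\<lambda>l. rmat (rho \<phi> l)) l = rmat (\<delta> \<gamma>)" for \<gamma>
  proof (intro ext)
    fix a b
    have "((\<lambda>z. rmat (rho \<phi> (line l (hs \<gamma>) z)) a b) has_field_derivative rmat (\<delta> \<gamma>) a b) (at 0)"
      unfolding rmat_def \<delta>_def
      by (intro DERIV_sum DERIV_cmult_right rho_derivative den)
    then show "dir_deriv (hs \<gamma>) (\<lambda>l. rmat (rho \<phi> l)) l a b = rmat (\<delta> \<gamma>) a b"
      unfolding dir_deriv_def by (rule DERIV_imp_deriv)
  qed
  have odd: "odd_on_roots (rho \<phi> l)" by (rule rho_odd[OF adm l])
  have oddD: "odd_on_roots (\<delta> \<gamma>)" if "\<gamma> \<in> P0" for \<gamma>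
    using odd hdual_T_minus[OF hs_hdual[OF that]] by (simp add: odd_on_roots_def \<delta>_def)
  have P0: "P0 \<subseteq> \<Delta>" using P0_root by blast
  have ode: "(\<Sum>\<gamma>\<in>P0. \<gamma> t * \<delta> \<gamma> \<alpha>) = (1 - (rho \<phi> l \<alpha>)\<^sup>2) * \<alpha> t" if "\<alpha> \<in> \<Delta>" "t \<in> h" for \<alpha> t
  proof -
    \<comment> \<open>Expanding \<open>T \<alpha>\<close> in the basis of the
      \<open>T \<gamma>\<close> reassembles \<alpha> from the derivatives of \<langle>\<alpha>,
      \<lambda>\<rangle> along the coordinates.\<close>
    have "\<alpha> t = killing (\<Sum>\<gamma>\<in>P0. hs \<gamma> (T \<alpha>) *\<^sub>C T \<gamma>) t"
      unfolding hs_expansion[OF T_h[OF that(1)]] using killing_T that by simp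
    also have "\<dots> = (\<Sum>\<gamma>\<in>P0. hs \<gamma> (T \<alpha>) * \<gamma> t)"
      using P0 that(2) by (auto simp: killing_linear killing_T subset_iff intro!: sum.cong)
    finally show ?thesis by (simp add: \<delta>_def sum_distrib_left mult_ac)
  qed
  have "\<forall>i j k. (\<Sum>\<gamma>\<in>P0. wedge12 (T \<gamma>) (rmat (\<delta> \<gamma>)) i j k) + 1 / 2 * schouten (rmat (rho \<phi> l)) (rmat (rho \<phi> l)) i j k
        = comm12_23 casimir casimir i j k"
  proof (rule iffD2[OF cdybe_rmat[OF odd _ P0]])
    show "(\<forall>\<alpha>\<in>\<Delta>. \<forall>t\<in>h. (\<Sum>\<gamma>\<in>P0. \<gamma> t * \<delta> \<gamma> \<alpha>) = (1 - (rho \<phi> l \<alpha>)\<^sup>2) * \<alpha> t) \<and>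
      (\<forall>\<alpha>\<in>\<Delta>. \<forall>\<beta>\<in>\<Delta>. \<alpha> + \<beta> \<in> \<Delta> \<longrightarrow> rho \<phi> l \<alpha> * rho \<phi> l \<beta> + 1 = rho \<phi> l (\<alpha> + \<beta>) * (rho \<phi> l \<alpha> + rho \<phi> l \<beta>))"
      using ode rho_algebraic[OF adm l den] by blast
  qed (rule oddD)
  then show ?thesis unfolding alt_d_rmat[OF dd] by blast
qed

text \<open>Move from \<open>l\<close> by real multiples of a functional \<open>m\<close> that is
  real and nonzero at every \<open>T \<alpha>\<close>. Along this path the modulus of exp (2
  \<langle>\<alpha>, \<lambda>\<rangle>) is strictly monotone, so each denominator has at most one
  zero, and finitely many roots exclude finitely many parameters.\<close>

lemma generically_den:
  assumes V: "hopen V"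
  shows "generically h V (\<lambda>l. \<forall>\<alpha>\<in>\<Delta>. rho_den \<phi> l \<alpha> \<noteq> 0)"
  unfolding generically_iff[OF V]
proof (intro ballI allI impI)
  fix l and e :: real assume l: "l \<in> V" and e: "e > 0"
  have lh: "l \<in> hdual h" by (rule hopen_hdual[OF V l])
  obtain \<sigma> :: "('g \<Rightarrow> complex) \<Rightarrow> real" and m where m: "m \<in> hdual h" and ms: "\<And>\<alpha>. \<alpha> \<in> \<Delta> \<Longrightarrow> m (T \<alpha>) = of_real (\<sigma> \<alpha>)"
    and zero: "\<And>\<alpha>. \<alpha> \<in> \<Delta> \<Longrightarrow> \<sigma> \<alpha> = 0 \<longleftrightarrow> \<alpha> \<in> gen_roots h {} \<or> - \<alpha> \<in> gen_roots h {}"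
    by (rule sign_functional[OF root_base empty_subsetI]) (rule that)
  have "gen_roots h {} = {}" using root_nonzero by (auto simp: gen_roots_def zero_fun_def)
  then have \<sigma>: "\<sigma> \<alpha> \<noteq> 0" if "\<alpha> \<in> \<Delta>" for \<alpha> using zero[OF that] by simp
  have "hopen (V \<inter> polydisc l e)" using V open_polydisc by (rule openin_Int)
  moreover have "l \<in> V \<inter> polydisc l e" using l polydisc_center[OF lh e] by blast
  ultimately obtain e' where e': "e' > 0" "polydisc l e' \<subseteq> V \<inter> polydisc l e" by (rule polydisc_nhd)
  have "open {z. line l m z \<in> polydisc l e'}" by (rule polydisc_line_open_convex[OF lh m])
  moreover have "0 \<in> {z. line l m z \<in> polydisc l e'}" using polydisc_center[OF lh e'(1)] by simp
  ultimately obtain \<delta> where \<delta>: "\<delta> > 0" "ball 0 \<delta> \<subseteq> {z. line l m z \<in> polydisc l e'}"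
    using open_contains_ball by blast
  define B where "B \<alpha> = {z::real. rho_den \<phi> (line l m (of_real z)) \<alpha> = 0}" for \<alpha>
  have "finite (B \<alpha>)" if \<alpha>: "\<alpha> \<in> \<Delta>" for \<alpha>
  proof -
    have "z = w" if z: "z \<in> B \<alpha>" and w: "w \<in> B \<alpha>" for z w
    proof -
      have eq: "coordB (\<phi> \<alpha>) * exp (2 * (l (T \<alpha>) + of_real z * of_real (\<sigma> \<alpha>))) = coordA (\<phi> \<alpha>)"
        "coordB (\<phi> \<alpha>) * exp (2 * (l (T \<alpha>) + of_real w * of_real (\<sigma> \<alpha>))) = coordA (\<phi> \<alpha>)"
        using z w by (simp_all add: B_def rho_den_def ms[OF \<alpha>])
      have "coordB (\<phi> \<alpha>) \<noteq> 0"
      proof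
        assume "coordB (\<phi> \<alpha>) = 0"
        then show False using eq(1) coordB_eq_0[of "\<phi> \<alpha>"] by simp
      qed
      then have "exp (2 * (l (T \<alpha>) + of_real z * of_real (\<sigma> \<alpha>))) = exp (2 * (l (T \<alpha>) + of_real w * of_real (\<sigma> \<alpha>)))"
        using eq by (metis mult_left_cancel)
      then have "norm (exp (2 * (l (T \<alpha>) + of_real z * of_real (\<sigma> \<alpha>)))) = norm (exp (2 * (l (T \<alpha>) + of_real w * of_real (\<sigma> \<alpha>))))"
        by simp
      then have "z * \<sigma> \<alpha> = w * \<sigma> \<alpha>" by simp
      then show ?thesis using \<sigma>[OF \<alpha>] by simp
    qed
    then show ?thesis by (metis finite.emptyI finite.insertI finite_subset insertI1 is_singletonI' is_singleton_the_elem subsetI)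
  qed
  then have "finite (\<Union>\<alpha>\<in>\<Delta>. B \<alpha>)" using finite_roots by blast
  moreover have "infinite {0<..<\<delta>}" using \<delta>(1) by simp
  ultimately obtain z where z: "z \<in> {0<..<\<delta>}" "z \<notin> (\<Union>\<alpha>\<in>\<Delta>. B \<alpha>)"
    by (meson finite_subset subsetI)
  define y where "y = line l m (of_real z)"
  have y: "y \<in> polydisc l e'" "\<And>\<alpha>. \<alpha> \<in> \<Delta> \<Longrightarrow> rho_den \<phi> y \<alpha> \<noteq> 0"
  proof -
    have "complex_of_real z \<in> ball 0 \<delta>" using z(1) by simp
    then show "y \<in> polydisc l e'" using \<delta>(2) unfolding y_def by blast
    show "\<And>\<alpha>. \<alpha> \<in> \<Delta> \<Longrightarrow> rho_den \<phi> y \<alpha> \<noteq> 0" using z(2) by (simp add: B_def y_def)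
  qed
  have "open {x::'g \<Rightarrow> complex. rho_den \<phi> x \<alpha> \<noteq> 0}" for \<alpha>
    unfolding rho_den_def
    by (intro open_Collect_neq continuous_intros continuous_on_product_coordinates)
  then have "open (\<Inter>\<alpha>\<in>\<Delta>. {x::'g \<Rightarrow> complex. rho_den \<phi> x \<alpha> \<noteq> 0})"
    using finite_roots by (intro open_INT) auto
  then have "hopen (V \<inter> (hdual h \<inter> (\<Inter>\<alpha>\<in>\<Delta>. {x. rho_den \<phi> x \<alpha> \<noteq> 0})))"
    using V by (intro openin_Int openin_open_Int)
  moreover have "y \<in> V \<inter> (hdual h \<inter> (\<Inter>\<alpha>\<in>\<Delta>. {x. rho_den \<phi> x \<alpha> \<noteq> 0}))"
    using y e'(2) by (auto simp: polydisc_def)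
  ultimately obtain d where d: "d > 0" "polydisc y d \<subseteq> V \<inter> (hdual h \<inter> (\<Inter>\<alpha>\<in>\<Delta>. {x. rho_den \<phi> x \<alpha> \<noteq> 0}))"
    by (rule polydisc_nhd)
  then show "\<exists>m\<in>V. m \<in> polydisc l e \<and> (\<exists>d>0. polydisc m d \<subseteq> V \<and> (\<forall>x\<in>polydisc m d. \<forall>\<alpha>\<in>\<Delta>. rho_den \<phi> x \<alpha> \<noteq> 0))"
    using y(1) e'(2) by (intro bexI[of _ y] conjI exI[of _ d]) blast+
qed

lemma rho_meromorphic:
  assumes U: "hopen U"
  shows "meromorphic_tensor h U (\<lambda>l. rmat (rho \<phi> l))"
  unfolding meromorphic_tensor_def
proof
  fix l assume l: "l \<in> U"
  define q where "q x = (\<Prod>\<alpha>\<in>\<Delta>. rho_den \<phi> x \<alpha>)" for x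
  define p where "p x a b = (\<Sum>\<alpha>\<in>\<Delta>. (coordB (\<phi> \<alpha>) * exp (2 * x (T \<alpha>)) + coordA (\<phi> \<alpha>)) *
    (\<Prod>\<beta>\<in>\<Delta> - {\<alpha>}. rho_den \<phi> x \<beta>) * tens2 (E \<alpha>) (E (- \<alpha>)) a b)" for x a b
  have "hol_on h U q" unfolding q_def rho_den_def by (intro hol_on_intros)
  moreover have "\<forall>a b. hol_on h U (\<lambda>m. p m a b)" unfolding p_def rho_den_def by (intro allI hol_on_intros)
  moreover have "generically h U (\<lambda>m. q m \<noteq> 0 \<and> (\<forall>a b. rmat (rho \<phi> m) a b = p m a b / q m))"
  proof (rule generically_mono[OF generically_den[OF U, of \<phi>]])
    fix m assume den: "\<forall>\<alpha>\<in>\<Delta>. rho_den \<phi> m \<alpha> \<noteq> 0"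
    then have q: "q m \<noteq> 0" using finite_roots by (simp add: q_def)
    have "rmat (rho \<phi> m) a b = p m a b / q m" for a b
    proof -
      have "rho \<phi> m \<alpha> * tens2 (E \<alpha>) (E (- \<alpha>)) a b = (coordB (\<phi> \<alpha>) * exp (2 * m (T \<alpha>)) + coordA (\<phi> \<alpha>)) *
        (\<Prod>\<beta>\<in>\<Delta> - {\<alpha>}. rho_den \<phi> m \<beta>) * tens2 (E \<alpha>) (E (- \<alpha>)) a b / q m" if \<alpha>: "\<alpha> \<in> \<Delta>" for \<alpha>
      proof -
        have "q m = rho_den \<phi> m \<alpha> * (\<Prod>\<beta>\<in>\<Delta> - {\<alpha>}. rho_den \<phi> m \<beta>)"
          unfolding q_def by (rule prod.remove[OF finite_roots \<alpha>])
        then show ?thesis using q den \<alpha> by (simp add: rho_def)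
      qed
      then show ?thesis by (simp add: rmat_def p_def sum_divide_distrib)
    qed
    then show "q m \<noteq> 0 \<and> (\<forall>a b. rmat (rho \<phi> m) a b = p m a b / q m)" using q by blast
  qed
  ultimately show "\<exists>V p q. hopen V \<and> l \<in> V \<and> V \<subseteq> U \<and> hol_on h V q \<and> (\<forall>a b. hol_on h V (\<lambda>m. p m a b)) \<and>
      generically h V (\<lambda>m. q m \<noteq> 0 \<and> (\<forall>a b. rmat (rho \<phi> m) a b = p m a b / q m))"
    using U l by blast
qed

lemma rho_dynamical:
  assumes U: "hopen U" and adm: "admissible \<phi>"
  shows "dynamical_r_matrix h E P0 U (\<lambda>l. rmat (rho \<phi> l))" "zero_gauge h E P0 U (\<lambda>l. rmat (rho \<phi> l))"
proof -
  have Uh: "l \<in> hdual h" if "l \<in> U" for l by (rule hopen_hdual[OF U that])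
  show "dynamical_r_matrix h E P0 U (\<lambda>l. rmat (rho \<phi> l))"
    unfolding dynamical_r_matrix_def
  proof (intro conjI)
    show "meromorphic_tensor h U (\<lambda>l. rmat (rho \<phi> l))" by (rule rho_meromorphic[OF U])
    show "generically h U (\<lambda>l. rmat (rho \<phi> l) \<in> bivectors)"
      by (rule generically_all[OF U]) (use Uh rmat_bivector rho_odd[OF adm] in blast)
    show "generically h U (\<lambda>l. \<forall>x\<in>h. ad2 x (rmat (rho \<phi> l)) = 0)"
      by (rule generically_all[OF U]) (use ad2_rmat in blast)
    show "generically h U (\<lambda>l. \<forall>i j k. alt_d h E P0 (\<lambda>l. rmat (rho \<phi> l)) l i j k +
      1 / 2 * schouten (rmat (rho \<phi> l)) (rmat (rho \<phi> l)) i j k = comm12_23 casimir casimir i j k)"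
      by (rule generically_mono[OF generically_den[OF U, of \<phi>]]) (use rho_equation[OF adm] Uh in blast)
  qed
  show "zero_gauge h E P0 U (\<lambda>l. rmat (rho \<phi> l))"
    unfolding zero_gauge_def
  proof (rule generically_all[OF U])
    fix l assume "l \<in> U"
    then show "\<exists>c. \<forall>a b. rmat (rho \<phi> l) a b = (\<Sum>\<alpha>\<in>gen_roots h P0. c \<alpha> * wedge2 (E \<alpha>) (E (- \<alpha>)) a b)"
      using rmat_wedge[OF root_base rho_odd[OF adm Uh]] by blast
  qed
qed

subsection \<open>Every dynamical r-matrix with zero gauge term comes from an admissible system\<close>

lemma zero_gauge_rmat:
  assumes "\<forall>a b. r a b = (\<Sum>\<alpha>\<in>gen_roots h P0. c \<alpha> * wedge2 (E \<alpha>) (E (- \<alpha>)) a b)"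
  shows "odd_on_roots (rcoeff r)" "r = rmat (rcoeff r)"
proof -
  define \<rho> where "\<rho> \<alpha> = (if \<alpha> \<in> gen_roots h P0 then c \<alpha> else - c (- \<alpha>))" for \<alpha>
  have odd: "odd_on_roots \<rho>"
    unfolding odd_on_roots_def
  proof
    fix \<alpha> assume "\<alpha> \<in> \<Delta>"
    then show "\<rho> (- \<alpha>) = - \<rho> \<alpha>"
      using pos_or_neg[OF root_base, of \<alpha>] not_pos_and_neg[OF root_base, of \<alpha>] by (auto simp: \<rho>_def)
  qed
  have r: "r = rmat \<rho>"
    by (intro ext) (simp add: assms rmat_wedge[OF root_base odd] \<rho>_def)
  have eq: "rcoeff r \<alpha> = \<rho> \<alpha>" if "\<alpha> \<in> \<Delta>" for \<alpha> unfolding r by (rule rcoeff_rmat[OF that])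
  show "odd_on_roots (rcoeff r)" using odd root_minus by (simp add: odd_on_roots_def eq)
  show "r = rmat (rcoeff r)" by (subst r) (simp add: rmat_def eq)
qed

text \<open>\<open>p\<close> is the integration constant of the Riccati equation at \<alpha>, in
  homogeneous form so that the coefficients 1 and -1 are allowed.\<close>

definition cayley_rel :: "(('g \<Rightarrow> complex) \<Rightarrow> 'g tensor2) \<Rightarrow> ('g \<Rightarrow> complex) \<Rightarrow> complex option \<Rightarrow> ('g \<Rightarrow> complex) \<Rightarrow> bool"
  where "cayley_rel r \<alpha> p x \<longleftrightarrow> coordA p * (rcoeff (r x) \<alpha> + 1) = coordB p * exp (2 * x (T \<alpha>)) * (rcoeff (r x) \<alpha> - 1)"

lemma cayley_rel_unique: "cayley_rel r \<alpha> p x \<Longrightarrow> cayley_rel r \<alpha> q x \<Longrightarrow> p = q"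
  unfolding cayley_rel_def by (rule coord_rel_unique) simp_all

lemma rcoeff_has_derivative:
  assumes "\<And>a b. ((\<lambda>z. f z a b) has_field_derivative D a b) (at x within A)"
  shows "((\<lambda>z. rcoeff (f z) \<alpha>) has_field_derivative rcoeff D \<alpha>) (at x within A)"
  unfolding rcoeff_def by (intro DERIV_sum DERIV_cmult_right assms)

text \<open>Where \<open>r\<close> equals a quotient at every point of a polydisc, it is holomorphic
  along lines and \<open>dir_deriv\<close> is a true derivative. The identities that make
  \<open>r\<close> an \<open>rmat\<close> with odd coefficients hold near \<open>x\<close>, so they
  pass to the derivatives, and \<open>cdybe_rmat\<close> applies at \<open>x\<close>.\<close>

lemma equation_on_polydisc:
  assumes m: "m \<in> hdual h" and d: "d > 0"
    and q: "hol_on h (polydisc m d) q" and p: "\<And>a b. hol_on h (polydisc m d) (\<lambda>x. p x a b)"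
    and quot: "\<And>x. x \<in> polydisc m d \<Longrightarrow> q x \<noteq> 0 \<and> (\<forall>a b. r x a b = p x a b / q x)"
    and odd: "\<And>x. x \<in> polydisc m d \<Longrightarrow> odd_on_roots (rcoeff (r x))"
    and rm: "\<And>x. x \<in> polydisc m d \<Longrightarrow> r x = rmat (rcoeff (r x))"
    and eq: "\<And>x i j k. x \<in> polydisc m d \<Longrightarrow>
      alt_d h E P0 r x i j k + 1 / 2 * schouten (r x) (r x) i j k = comm12_23 casimir casimir i j k"
    and x: "x \<in> polydisc m d"
  shows "\<And>\<alpha> \<gamma>. \<alpha> \<in> \<Delta> \<Longrightarrow> \<gamma> \<in> P0 \<Longrightarrow>
      ((\<lambda>z. rcoeff (r (line x (hs \<gamma>) z)) \<alpha>) has_field_derivative (1 - (rcoeff (r x) \<alpha>)\<^sup>2) * hs \<gamma> (T \<alpha>)) (at 0)"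
    and "\<And>\<alpha> \<beta>. \<alpha> \<in> \<Delta> \<Longrightarrow> \<beta> \<in> \<Delta> \<Longrightarrow> \<alpha> + \<beta> \<in> \<Delta> \<Longrightarrow>
      rcoeff (r x) \<alpha> * rcoeff (r x) \<beta> + 1 = rcoeff (r x) (\<alpha> + \<beta>) * (rcoeff (r x) \<alpha> + rcoeff (r x) \<beta>)"
proof -
  have xh: "x \<in> hdual h" using x by (simp add: polydisc_def)
  define \<delta> where "\<delta> \<gamma> = rcoeff (dir_deriv (hs \<gamma>) r x)" for \<gamma>
  have der: "((\<lambda>z. r (line x (hs \<gamma>) z) a b) has_field_derivative dir_deriv (hs \<gamma>) r x a b) (at 0)"
    if \<gamma>: "\<gamma> \<in> P0" for \<gamma> a b
  proof -
    let ?S = "{z. line x (hs \<gamma>) z \<in> polydisc m d}"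
    have S: "open ?S" "0 \<in> ?S" using polydisc_line_open_convex(1)[OF xh hs_hdual[OF \<gamma>]] x by auto
    have "(\<lambda>z. p (line x (hs \<gamma>) z) a b / q (line x (hs \<gamma>) z)) holomorphic_on ?S"
    proof (rule holomorphic_on_divide)
      show "(\<lambda>z. p (line x (hs \<gamma>) z) a b) holomorphic_on ?S" "(\<lambda>z. q (line x (hs \<gamma>) z)) holomorphic_on ?S"
        using p[of a b] q x hs_hdual[OF \<gamma>] unfolding hol_on_def by blast+
    qed (use quot in blast)
    then have "(\<lambda>z. r (line x (hs \<gamma>) z) a b) holomorphic_on ?S"
    proof (rule holomorphic_transform)
      fix z assume "z \<in> ?S"
      then have "line x (hs \<gamma>) z \<in> polydisc m d" by simp
      from quot[OF this] show "p (line x (hs \<gamma>) z) a b / q (line x (hs \<gamma>) z) = r (line x (hs \<gamma>) z) a b" by simp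
    qed
    then show ?thesis
      unfolding dir_deriv_def by (rule holomorphic_derivI[OF _ S])
  qed
  have cder: "((\<lambda>z. rcoeff (r (line x (hs \<gamma>) z)) \<alpha>) has_field_derivative \<delta> \<gamma> \<alpha>) (at 0)" if \<gamma>: "\<gamma> \<in> P0" for \<gamma> \<alpha>
    unfolding \<delta>_def by (rule rcoeff_has_derivative[OF der[OF \<gamma>]])
  have near: "\<forall>\<^sub>F z in nhds 0. line x (hs \<gamma>) z \<in> polydisc m d" if \<gamma>: "\<gamma> \<in> P0" for \<gamma>
    using eventually_nhds_in_open[OF polydisc_line_open_convex(1)[OF xh hs_hdual[OF \<gamma>], of m d], of 0] x by simp
  have oddD: "odd_on_roots (\<delta> \<gamma>)" if \<gamma>: "\<gamma> \<in> P0" for \<gamma>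
    unfolding odd_on_roots_def
  proof
    fix \<alpha> assume \<alpha>: "\<alpha> \<in> \<Delta>"
    have "\<forall>\<^sub>F z in nhds 0. rcoeff (r (line x (hs \<gamma>) z)) (- \<alpha>) = - rcoeff (r (line x (hs \<gamma>) z)) \<alpha>"
      using near[OF \<gamma>] by eventually_elim (use odd \<alpha> in \<open>auto simp: odd_on_roots_def\<close>)
    then have "((\<lambda>z. rcoeff (r (line x (hs \<gamma>) z)) (- \<alpha>)) has_field_derivative - \<delta> \<gamma> \<alpha>) (at 0)"
      using DERIV_minus[OF cder[OF \<gamma>, of \<alpha>]] by (subst DERIV_cong_ev[OF refl _ refl])
    then show "\<delta> \<gamma> (- \<alpha>) = - \<delta> \<gamma> \<alpha>" by (rule DERIV_unique[OF cder[OF \<gamma>]])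
  qed
  have dd: "dir_deriv (hs \<gamma>) r x = rmat (\<delta> \<gamma>)" if \<gamma>: "\<gamma> \<in> P0" for \<gamma>
  proof (intro ext)
    fix a b
    have "((\<lambda>z. rmat (rcoeff (r (line x (hs \<gamma>) z))) a b) has_field_derivative rmat (\<delta> \<gamma>) a b) (at 0)"
      unfolding rmat_def by (intro DERIV_sum DERIV_cmult_right cder[OF \<gamma>])
    moreover have "\<forall>\<^sub>F z in nhds 0. r (line x (hs \<gamma>) z) a b = rmat (rcoeff (r (line x (hs \<gamma>) z))) a b"
      using near[OF \<gamma>] by eventually_elim (use rm in metis)
    ultimately have "((\<lambda>z. r (line x (hs \<gamma>) z) a b) has_field_derivative rmat (\<delta> \<gamma>) a b) (at 0)"
      by (subst DERIV_cong_ev[OF refl _ refl])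
    then show "dir_deriv (hs \<gamma>) r x a b = rmat (\<delta> \<gamma>) a b" by (rule DERIV_unique[OF der[OF \<gamma>]])
  qed
  have P0: "P0 \<subseteq> \<Delta>" using P0_root by blast
  have ad: "alt_d h E P0 r x i j k = (\<Sum>\<gamma>\<in>P0. wedge12 (T \<gamma>) (rmat (\<delta> \<gamma>)) i j k)" for i j k
    by (rule alt_d_rmat) (rule dd)
  have "\<forall>i j k. (\<Sum>\<gamma>\<in>P0. wedge12 (T \<gamma>) (rmat (\<delta> \<gamma>)) i j k) +
      1 / 2 * schouten (rmat (rcoeff (r x))) (rmat (rcoeff (r x))) i j k = comm12_23 casimir casimir i j k"
    using eq[OF x] unfolding ad rm[OF x, symmetric] by blast
  from iffD1[OF cdybe_rmat[OF odd[OF x] _ P0] this, OF oddD]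
  have ode: "\<And>\<alpha> t. \<alpha> \<in> \<Delta> \<Longrightarrow> t \<in> h \<Longrightarrow> (\<Sum>\<gamma>\<in>P0. \<gamma> t * \<delta> \<gamma> \<alpha>) = (1 - (rcoeff (r x) \<alpha>)\<^sup>2) * \<alpha> t"
    and alg: "\<And>\<alpha> \<beta>. \<alpha> \<in> \<Delta> \<Longrightarrow> \<beta> \<in> \<Delta> \<Longrightarrow> \<alpha> + \<beta> \<in> \<Delta> \<Longrightarrow>
      rcoeff (r x) \<alpha> * rcoeff (r x) \<beta> + 1 = rcoeff (r x) (\<alpha> + \<beta>) * (rcoeff (r x) \<alpha> + rcoeff (r x) \<beta>)"
    by blast+
  show "\<And>\<alpha> \<beta>. \<alpha> \<in> \<Delta> \<Longrightarrow> \<beta> \<in> \<Delta> \<Longrightarrow> \<alpha> + \<beta> \<in> \<Delta> \<Longrightarrow>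
      rcoeff (r x) \<alpha> * rcoeff (r x) \<beta> + 1 = rcoeff (r x) (\<alpha> + \<beta>) * (rcoeff (r x) \<alpha> + rcoeff (r x) \<beta>)"
    by (rule alg)
  fix \<alpha> \<gamma> assume \<alpha>: "\<alpha> \<in> \<Delta>" and \<gamma>: "\<gamma> \<in> P0"
  have "\<delta> \<gamma> \<alpha> = (\<Sum>\<beta>\<in>P0. if \<beta> = \<gamma> then \<delta> \<gamma> \<alpha> else 0)" using \<gamma> finite_P0 by simp
  \<comment> \<open>The element of \<open>h\<close> identified with \<open>hs \<gamma>\<close> is
    the one at which the simple root \<gamma> is 1 and the others are 0; evaluating there isolates
    the derivative along \<open>hs \<gamma>\<close>.\<close>
  also have "\<dots> = (\<Sum>\<beta>\<in>P0. \<beta> (hvec h (hs \<gamma>)) * \<delta> \<beta> \<alpha>)"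
    by (rule sum.cong) (use \<gamma> P0_root hs_T hs_hdual in \<open>auto simp: root_hvec\<close>)
  also have "\<dots> = (1 - (rcoeff (r x) \<alpha>)\<^sup>2) * \<alpha> (hvec h (hs \<gamma>))"
    by (rule ode[OF \<alpha> hvec_h[OF hs_hdual[OF \<gamma>]]])
  finally have "\<delta> \<gamma> \<alpha> = (1 - (rcoeff (r x) \<alpha>)\<^sup>2) * hs \<gamma> (T \<alpha>)"
    by (simp add: root_hvec[OF \<alpha> hs_hdual[OF \<gamma>]])
  then show "((\<lambda>z. rcoeff (r (line x (hs \<gamma>) z)) \<alpha>) has_field_derivative (1 - (rcoeff (r x) \<alpha>)\<^sup>2) * hs \<gamma> (T \<alpha>)) (at 0)"
    using cder[OF \<gamma>, of \<alpha>] by simp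
qed

definition solution_at :: "(('g \<Rightarrow> complex) \<Rightarrow> 'g tensor2) \<Rightarrow> ('g \<Rightarrow> complex) \<Rightarrow> bool"
  where "solution_at r x \<longleftrightarrow> odd_on_roots (rcoeff (r x)) \<and> r x = rmat (rcoeff (r x)) \<and>
    (\<forall>i j k. alt_d h E P0 r x i j k + 1 / 2 * schouten (r x) (r x) i j k = comm12_23 casimir casimir i j k)"

lemma dynamical_solution:
  assumes U: "hopen U" and r: "dynamical_r_matrix h E P0 U r" "zero_gauge h E P0 U r"
  shows "generically h U (solution_at r)"
proof -
  have "generically h U (\<lambda>l. \<forall>i j k. alt_d h E P0 r l i j k + 1 / 2 * schouten (r l) (r l) i j k = comm12_23 casimir casimir i j k)"
    using r(1) unfolding dynamical_r_matrix_def by blast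
  from generically_conj[OF U this r(2)[unfolded zero_gauge_def]] show ?thesis
  proof (rule generically_mono)
    fix l assume *: "(\<forall>i j k. alt_d h E P0 r l i j k + 1 / 2 * schouten (r l) (r l) i j k = comm12_23 casimir casimir i j k) \<and>
       (\<exists>c. \<forall>a b. r l a b = (\<Sum>\<alpha>\<in>gen_roots h P0. c \<alpha> * wedge2 (E \<alpha>) (E (- \<alpha>)) a b))"
    then obtain c where c: "\<forall>a b. r l a b = (\<Sum>\<alpha>\<in>gen_roots h P0. c \<alpha> * wedge2 (E \<alpha>) (E (- \<alpha>)) a b)" by blast
    show "solution_at r l"
      unfolding solution_at_def using zero_gauge_rmat[OF c] * by blast
  qed
qed

lemma local_quotient:
  assumes U: "hopen U" and r: "dynamical_r_matrix h E P0 U r" "zero_gauge h E P0 U r" and l: "l \<in> U"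
  obtains e p q where "e > 0" "polydisc l e \<subseteq> U" "hol_on h (polydisc l e) q" "\<And>a b. hol_on h (polydisc l e) (\<lambda>x. p x a b)"
    "generically h (polydisc l e) (\<lambda>x. (q x \<noteq> 0 \<and> (\<forall>a b. r x a b = p x a b / q x)) \<and> solution_at r x)"
proof -
  have "meromorphic_tensor h U r" using r(1) unfolding dynamical_r_matrix_def by blast
  from bspec[OF this[unfolded meromorphic_tensor_def] l]
  obtain V p q where V: "hopen V" "l \<in> V" "V \<subseteq> U" and q: "hol_on h V q" and p: "\<And>a b. hol_on h V (\<lambda>x. p x a b)"
    and g: "generically h V (\<lambda>m. q m \<noteq> 0 \<and> (\<forall>a b. r m a b = p m a b / q m))"
    by blast
  obtain e where e: "e > 0" "polydisc l e \<subseteq> V" using polydisc_nhd[OF V(1,2)] .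
  have "polydisc l e \<subseteq> U" using e V by blast
  show thesis
  proof (rule that[OF e(1) \<open>polydisc l e \<subseteq> U\<close> hol_on_subset[OF q e(2)] hol_on_subset[OF p e(2)]])
    show "generically h (polydisc l e) (\<lambda>x. (q x \<noteq> 0 \<and> (\<forall>a b. r x a b = p x a b / q x)) \<and> solution_at r x)"
      by (intro generically_conj[OF open_polydisc] generically_subset[OF V(1) open_polydisc e(2) g]
          generically_subset[OF U open_polydisc \<open>polydisc l e \<subseteq> U\<close> dynamical_solution[OF U r]])
  qed
qed

text \<open>The integration constant is found on a small polydisc inside the given one. It is then
  valid at all generic points of the large polydisc, although poles may lie in between.\<close>

lemma local_rel:
  assumes U: "hopen U" and r: "dynamical_r_matrix h E P0 U r" "zero_gauge h E P0 U r" and l: "l \<in> U" and \<alpha>: "\<alpha> \<in> \<Delta>"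
  shows "\<exists>p e. e > 0 \<and> polydisc l e \<subseteq> U \<and> generically h (polydisc l e) (cayley_rel r \<alpha> p)"
proof -
  obtain e p q where e: "e > 0" "polydisc l e \<subseteq> U" and q: "hol_on h (polydisc l e) q"
    and p: "\<And>a b. hol_on h (polydisc l e) (\<lambda>x. p x a b)" and
    g: "generically h (polydisc l e) (\<lambda>x. (q x \<noteq> 0 \<and> (\<forall>a b. r x a b = p x a b / q x)) \<and> solution_at r x)"
    by (rule local_quotient[OF U r l]) (rule that)
  obtain m d where m: "m \<in> polydisc l e" "d > 0" "polydisc m d \<subseteq> polydisc l e" and
    good: "\<And>x. x \<in> polydisc m d \<Longrightarrow> (q x \<noteq> 0 \<and> (\<forall>a b. r x a b = p x a b / q x)) \<and> solution_at r x"
    by (rule generically_polydisc[OF open_polydisc g polydisc_center[OF hopen_hdual[OF U l] e(1)]]) (rule that)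
  have mh: "m \<in> hdual h" using m(1) by (simp add: polydisc_def)
  have pm: "hol_on h (polydisc m d) (\<lambda>x. p x a b)" for a b by (rule hol_on_subset[OF p m(3)])
  have quot: "rcoeff (r x) \<alpha> = rcoeff (p x) \<alpha> / q x" if "\<forall>a b. r x a b = p x a b / q x" for x
    using that by (simp add: rcoeff_def sum_divide_distrib)
  have pc: "hol_on h (polydisc l e) (\<lambda>x. rcoeff (p x) \<alpha>)"
    unfolding rcoeff_def by (intro hol_on_intros p)
  have "continuous_on (polydisc m d) (\<lambda>x. rcoeff (p x) \<alpha> / q x)"
    using pc q m(3) good by (intro continuous_on_divide) (auto simp: hol_on_def intro: continuous_on_subset)
  then have cont: "continuous_on (polydisc m d) (\<lambda>x. rcoeff (r x) \<alpha>)"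
    by (rule continuous_on_eq) (use good quot in metis)
  have der: "((\<lambda>z. rcoeff (r (line x (hs \<gamma>) z)) \<alpha>) has_field_derivative (1 - (rcoeff (r x) \<alpha>)\<^sup>2) * hs \<gamma> (T \<alpha>)) (at 0)"
    if "x \<in> polydisc m d" "\<gamma> \<in> P0" for x \<gamma>
    by (rule equation_on_polydisc(1)[where p = p, OF mh m(2) hol_on_subset[OF q m(3)] pm _ _ _ _ that(1) \<alpha> that(2)])
       (use good in \<open>unfold solution_at_def, blast\<close>)+
  obtain s d' where d': "d' > 0" "polydisc m d' \<subseteq> polydisc m d" and
    cayley_rel: "\<And>x. x \<in> polydisc m d' \<Longrightarrow> coordA s * (rcoeff (r x) \<alpha> + 1) = coordB s * exp (2 * x (T \<alpha>)) * (rcoeff (r x) \<alpha> - 1)"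
    by (rule riccati_on_polydisc[OF mh m(2) cont der]) (assumption | rule that)+
  \<comment> \<open>The relation multiplied by the denominator \<open>q\<close>, which is
    holomorphic on the whole polydisc around \<open>l\<close>.\<close>
  define f where "f x = coordA s * (rcoeff (p x) \<alpha> + q x) - coordB s * exp (2 * x (T \<alpha>)) * (rcoeff (p x) \<alpha> - q x)" for x
  have fr: "f x = q x * (coordA s * (rcoeff (r x) \<alpha> + 1) - coordB s * exp (2 * x (T \<alpha>)) * (rcoeff (r x) \<alpha> - 1))"
    if "q x \<noteq> 0 \<and> (\<forall>a b. r x a b = p x a b / q x)" for x
  proof -
    have "rcoeff (p x) \<alpha> = q x * rcoeff (r x) \<alpha>" using quot[of x] that by simp
    then show ?thesis by (simp add: f_def algebra_simps)
  qed
  have fhol: "hol_on h (polydisc l e) f" unfolding f_def by (intro hol_on_intros pc q)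
  have f0: "f x = 0" if "x \<in> polydisc l e" for x
  proof (rule hol_identity[OF fhol d'(1) _ mh _ that])
    show "polydisc m d' \<subseteq> polydisc l e" using d'(2) m(3) by blast
    show "f x = 0" if "x \<in> polydisc m d'" for x
      using fr[of x] good[of x] cayley_rel[OF that] that d'(2) by auto
  qed
  have "generically h (polydisc l e) (cayley_rel r \<alpha> s)"
  proof (rule generically_mono[OF g])
    fix x assume "x \<in> polydisc l e" and x: "(q x \<noteq> 0 \<and> (\<forall>a b. r x a b = p x a b / q x)) \<and> solution_at r x"
    then show "cayley_rel r \<alpha> s x" using f0[of x] fr[OF conjunct1[OF x]] by (simp add: cayley_rel_def)
  qed
  then show ?thesis using e by blast
qed

text \<open>Two overlapping polydiscs share a generic point, and there the coefficient determines
  the constant; so the constant is locally constant on the connected set \<open>U\<close>.\<close>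

lemma global_rel:
  assumes U: "hopen U" "connected U" "U \<noteq> {}" and r: "dynamical_r_matrix h E P0 U r" "zero_gauge h E P0 U r" and \<alpha>: "\<alpha> \<in> \<Delta>"
  shows "\<exists>p. generically h U (cayley_rel r \<alpha> p)"
proof -
  have "\<forall>l\<in>U. \<exists>p e. e > 0 \<and> polydisc l e \<subseteq> U \<and> generically h (polydisc l e) (cayley_rel r \<alpha> p)"
    using local_rel[OF U(1) r _ \<alpha>] by blast
  then obtain s e where s: "\<And>l. l \<in> U \<Longrightarrow> e l > 0 \<and> polydisc l (e l) \<subseteq> U \<and> generically h (polydisc l (e l)) (cayley_rel r \<alpha> (s l))"
    by metis
  have near: "s l' = s l" if l: "l \<in> U" and l': "l' \<in> polydisc l (e l)" for l l'
  proof -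
    have U': "l' \<in> U" using s[OF l] l' by blast
    let ?W = "polydisc l (e l) \<inter> polydisc l' (e l')"
    have W: "hopen ?W" by (intro openin_Int open_polydisc)
    have "l' \<in> ?W" using l' polydisc_center[OF hopen_hdual[OF U(1) U']] s[OF U'] by blast
    moreover have "generically h ?W (\<lambda>x. cayley_rel r \<alpha> (s l) x \<and> cayley_rel r \<alpha> (s l') x)"
      by (rule generically_conj[OF W generically_subset[OF open_polydisc W Int_lower1] generically_subset[OF open_polydisc W Int_lower2]])
         (use s[OF l] s[OF U'] in blast)+
    ultimately obtain x where "cayley_rel r \<alpha> (s l) x \<and> cayley_rel r \<alpha> (s l') x"
      using generically_point[OF W] by blast
    then show ?thesis using cayley_rel_unique by blast
  qed
  obtain l0 where l0: "l0 \<in> U" using U(3) by blast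
  have const: "s l = s l0" if "l \<in> U" for l
  proof (rule connected_equivalence_relation[OF U(2) that l0, of "\<lambda>a b. s a = s b"])
    fix a assume a: "a \<in> U"
    have "openin (top_of_set U) (polydisc a (e a))"
    proof (rule openin_subset_trans[OF open_polydisc])
      show "polydisc a (e a) \<subseteq> U" using s[OF a] by blast
      show "U \<subseteq> hdual h" using hopen_hdual[OF U(1)] by blast
    qed
    moreover have "a \<in> polydisc a (e a)" using polydisc_center[OF hopen_hdual[OF U(1) a]] s[OF a] by blast
    ultimately show "\<exists>T. openin (top_of_set U) T \<and> a \<in> T \<and> (\<forall>x\<in>T. s a = s x)" using near[OF a] by metis
  qed auto
  have "generically h U (cayley_rel r \<alpha> (s l0))"
    by (rule generically_local[OF U(1)]) (use s const in metis)
  then show ?thesis by blast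
qed

text \<open>Multiplying the two relations gives the claim times (c + 1) (1 - c). If this factor
  vanishes, one of the points is 0 and the other is infinity.\<close>

lemma cayley_rel_odd:
  assumes "coordA p * (c + 1) = coordB p * e * (c - 1)" "coordA q * (- c + 1) = coordB q * inverse e * (- c - 1)" "e \<noteq> (0::complex)"
  shows "coordA p * coordA q = coordB p * coordB q"
proof -
  have "coordA p * coordA q * (c + 1) * (1 - c) = (coordA p * (c + 1)) * (coordA q * (- c + 1))" by (simp add: algebra_simps)
  also have "\<dots> = coordB p * coordB q * (c + 1) * (1 - c)" unfolding assms(1,2) using assms(3) by (simp add: field_simps)
  finally have *: "coordA p * coordA q * (c + 1) * (1 - c) = coordB p * coordB q * (c + 1) * (1 - c)" .
  consider "c = 1" | "c = - 1" | "(c + 1) * (1 - c) \<noteq> 0" by (auto simp: add_eq_0_iff2)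
  then show ?thesis
  proof cases
    case 1
    then have "coordA p = 0" "coordB q = 0" using assms by auto
    then show ?thesis by simp
  next
    case 2
    then have "coordB p = 0" "coordA q = 0" using assms by auto
    then show ?thesis by simp
  next
    case 3
    then show ?thesis using * by (simp only: mult.assoc mult_right_cancel mult_cancel_right) (auto simp flip: mult.assoc)
  qed
qed

text \<open>By the algebraic condition, (c1 + 1) (c2 + 1) and (c1 - 1) (c2 - 1) are c3 + 1 and c3 -
  1 times c1 + c2, so Cayley transforms multiply. If c1 + c2 = 0, the condition forces c1 to be 1 or
  -1: one of \<open>p1\<close>, \<open>p2\<close> is 0, the other infinity, and \<open>p3\<close> is
  unrestricted.\<close>

lemma cayley_rel_add:
  fixes c1 c2 c3 e1 e2 :: complex
  assumes r1: "coordA p1 * (c1 + 1) = coordB p1 * e1 * (c1 - 1)" and r2: "coordA p2 * (c2 + 1) = coordB p2 * e2 * (c2 - 1)"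
    and r3: "coordA p3 * (c3 + 1) = coordB p3 * (e1 * e2) * (c3 - 1)" and e: "e1 \<noteq> 0" "e2 \<noteq> 0"
    and alg: "c1 * c2 + 1 = c3 * (c1 + c2)"
  shows "coordA p1 * coordA p2 * coordB p3 = coordB p1 * coordB p2 * coordA p3"
proof (cases "c1 + c2 = 0")
  case True
  then have "c2 = - c1" by (simp add: add_eq_0_iff)
  then have "c1 * c1 = 1" using alg by simp
  then have "c1 = 1 \<or> c1 = - 1" by (simp add: square_eq_1_iff)
  then show ?thesis
  proof
    assume "c1 = 1"
    then have "coordA p1 = 0" "coordB p2 = 0" using r1 r2 \<open>c2 = - c1\<close> e by auto
    then show ?thesis by simp
  next
    assume "c1 = - 1"
    then have "coordB p1 = 0" "coordA p2 = 0" using r1 r2 \<open>c2 = - c1\<close> e by auto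
    then show ?thesis by simp
  qed
next
  case False
  define X Y where "X = c3 + 1" and "Y = e1 * e2 * (c3 - 1)"
  have "(c1 + 1) * (c2 + 1) = X * (c1 + c2)" "(c1 - 1) * (c2 - 1) = (c3 - 1) * (c1 + c2)"
    using alg by (simp_all add: X_def algebra_simps)
  moreover have "coordA p1 * coordA p2 * ((c1 + 1) * (c2 + 1)) = coordB p1 * coordB p2 * (e1 * e2) * ((c1 - 1) * (c2 - 1))"
  proof -
    have "coordA p1 * coordA p2 * ((c1 + 1) * (c2 + 1)) = (coordA p1 * (c1 + 1)) * (coordA p2 * (c2 + 1))" by (simp only: mult_ac)
    also have "\<dots> = coordB p1 * coordB p2 * (e1 * e2) * ((c1 - 1) * (c2 - 1))" unfolding r1 r2 by (simp only: mult_ac)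
    finally show ?thesis .
  qed
  ultimately have "(coordA p1 * coordA p2 * X) * (c1 + c2) = (coordB p1 * coordB p2 * Y) * (c1 + c2)"
    by (simp only: Y_def mult_ac)
  then have q: "coordA p1 * coordA p2 * X = coordB p1 * coordB p2 * Y" using False by simp
  have q3: "coordA p3 * X = coordB p3 * Y" using r3 by (simp add: X_def Y_def mult_ac)
  have "(coordA p1 * coordA p2 * coordB p3 - coordB p1 * coordB p2 * coordA p3) * X =
      coordB p3 * (coordA p1 * coordA p2 * X) - coordB p1 * coordB p2 * (coordA p3 * X)" by (simp add: algebra_simps)
  also have "\<dots> = 0" unfolding q q3 by (simp add: algebra_simps)
  finally have 1: "(coordA p1 * coordA p2 * coordB p3 - coordB p1 * coordB p2 * coordA p3) * X = 0" .
  have "(coordA p1 * coordA p2 * coordB p3 - coordB p1 * coordB p2 * coordA p3) * Y =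
      coordA p1 * coordA p2 * (coordB p3 * Y) - coordA p3 * (coordB p1 * coordB p2 * Y)" by (simp add: algebra_simps)
  also have "\<dots> = 0" unfolding q[symmetric] q3[symmetric] by (simp add: algebra_simps)
  finally have 2: "(coordA p1 * coordA p2 * coordB p3 - coordB p1 * coordB p2 * coordA p3) * Y = 0" .
  \<comment> \<open>c3 + 1 and c3 - 1 differ by 2, so one of the two vanishing products can be
    cancelled.\<close>
  have "X \<noteq> 0 \<or> Y \<noteq> 0"
  proof (rule ccontr)
    assume "\<not> (X \<noteq> 0 \<or> Y \<noteq> 0)"
    then have "c3 + 1 = 0" "c3 - 1 = 0" using e by (auto simp: X_def Y_def)
    then have "(1::complex) + 1 = 0" by (metis add.commute diff_add_cancel add_0)
    then show False by simp
  qed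
  then show ?thesis using 1 2 by auto
qed

text \<open>Admissibility concerns constants only. So it is verified at a single point
  \<open>m\<close>, chosen where \<open>r\<close> is a quotient, solves the equation and satisfies
  the relation for every root.\<close>

lemma dynamical_admissible:
  assumes U: "hopen U" "connected U" "U \<noteq> {}" and r: "dynamical_r_matrix h E P0 U r" "zero_gauge h E P0 U r"
  obtains \<phi> where "admissible \<phi>" "generically h U (\<lambda>l. r l = rmat (rho \<phi> l))"
proof -
  have "\<forall>\<alpha>\<in>\<Delta>. \<exists>p. generically h U (cayley_rel r \<alpha> p)" using global_rel[OF U r] by blast
  then obtain \<phi> where \<phi>: "\<And>\<alpha>. \<alpha> \<in> \<Delta> \<Longrightarrow> generically h U (cayley_rel r \<alpha> (\<phi> \<alpha>))" by metis
  have all: "generically h U (\<lambda>l. \<forall>\<alpha>\<in>\<Delta>. cayley_rel r \<alpha> (\<phi> \<alpha>) l)"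
    by (rule generically_ball[OF U(1) finite_roots \<phi>])
  have eq: "generically h U (\<lambda>l. r l = rmat (rho \<phi> l))"
  proof (rule generically_mono[OF generically_conj[OF U(1) all dynamical_solution[OF U(1) r]]])
    fix l assume l: "(\<forall>\<alpha>\<in>\<Delta>. cayley_rel r \<alpha> (\<phi> \<alpha>) l) \<and> solution_at r l"
    then have "rcoeff (r l) \<alpha> = rho \<phi> l \<alpha>" if "\<alpha> \<in> \<Delta>" for \<alpha>
      using cayley_rel_rho(2)[of \<phi> \<alpha>] that unfolding cayley_rel_def by blast
    then have "rmat (rcoeff (r l)) = rmat (rho \<phi> l)" by (simp add: rmat_def)
    then show "r l = rmat (rho \<phi> l)" using l unfolding solution_at_def by metis
  qed
  obtain l where l: "l \<in> U" using U(3) by blast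
  obtain e p q where e: "e > 0" "polydisc l e \<subseteq> U" and q: "hol_on h (polydisc l e) q"
    and p: "\<And>a b. hol_on h (polydisc l e) (\<lambda>x. p x a b)" and
    g: "generically h (polydisc l e) (\<lambda>x. (q x \<noteq> 0 \<and> (\<forall>a b. r x a b = p x a b / q x)) \<and> solution_at r x)"
    by (rule local_quotient[OF U(1) r l]) (rule that)
  have g': "generically h (polydisc l e) (\<lambda>x. ((q x \<noteq> 0 \<and> (\<forall>a b. r x a b = p x a b / q x)) \<and> solution_at r x) \<and> (\<forall>\<alpha>\<in>\<Delta>. cayley_rel r \<alpha> (\<phi> \<alpha>) x))"
    by (rule generically_conj[OF open_polydisc g generically_subset[OF U(1) open_polydisc e(2) all]])
  obtain m d where m: "m \<in> polydisc l e" "d > 0" "polydisc m d \<subseteq> polydisc l e" and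
    good: "\<And>x. x \<in> polydisc m d \<Longrightarrow> ((q x \<noteq> 0 \<and> (\<forall>a b. r x a b = p x a b / q x)) \<and> solution_at r x) \<and> (\<forall>\<alpha>\<in>\<Delta>. cayley_rel r \<alpha> (\<phi> \<alpha>) x)"
    by (rule generically_polydisc[OF open_polydisc g' polydisc_center[OF hopen_hdual[OF U(1) l] e(1)]]) (rule that)
  have mh: "m \<in> hdual h" using m(1) by (simp add: polydisc_def)
  have mm: "m \<in> polydisc m d" by (rule polydisc_center[OF mh m(2)])
  have pm: "hol_on h (polydisc m d) (\<lambda>x. p x a b)" for a b by (rule hol_on_subset[OF p m(3)])
  define c where "c = rcoeff (r m)"
  have alg: "c \<alpha> * c \<beta> + 1 = c (\<alpha> + \<beta>) * (c \<alpha> + c \<beta>)" if "\<alpha> \<in> \<Delta>" "\<beta> \<in> \<Delta>" "\<alpha> + \<beta> \<in> \<Delta>" for \<alpha> \<beta>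
    unfolding c_def
    by (rule equation_on_polydisc(2)[where p = p, OF mh m(2) hol_on_subset[OF q m(3)] pm _ _ _ _ mm that])
       (use good in \<open>unfold solution_at_def, blast\<close>)+
  have odd: "c (- \<alpha>) = - c \<alpha>" if "\<alpha> \<in> \<Delta>" for \<alpha>
    using good[OF mm] that unfolding c_def solution_at_def odd_on_roots_def by blast
  have cayley_rel: "coordA (\<phi> \<alpha>) * (c \<alpha> + 1) = coordB (\<phi> \<alpha>) * exp (2 * m (T \<alpha>)) * (c \<alpha> - 1)" if "\<alpha> \<in> \<Delta>" for \<alpha>
    using good[OF mm] that unfolding c_def cayley_rel_def by blast
  have "admissible \<phi>"
    unfolding admissible_def
  proof (intro conjI ballI impI)
    fix \<alpha> assume \<alpha>: "\<alpha> \<in> \<Delta>"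
    show "coordA (\<phi> \<alpha>) * coordA (\<phi> (- \<alpha>)) = coordB (\<phi> \<alpha>) * coordB (\<phi> (- \<alpha>))"
    proof (rule cayley_rel_odd[OF cayley_rel[OF \<alpha>]])
      have "exp (2 * m (T (- \<alpha>))) = inverse (exp (2 * m (T \<alpha>)))"
        by (simp add: hdual_T_minus[OF mh \<alpha>] exp_minus)
      then show "coordA (\<phi> (- \<alpha>)) * (- c \<alpha> + 1) = coordB (\<phi> (- \<alpha>)) * inverse (exp (2 * m (T \<alpha>))) * (- c \<alpha> - 1)"
        using cayley_rel[OF root_minus[OF \<alpha>]] unfolding odd[OF \<alpha>] by simp
    qed simp
    fix \<beta> assume \<beta>: "\<beta> \<in> \<Delta>" and ab: "\<alpha> + \<beta> \<in> \<Delta>"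
    show "coordA (\<phi> \<alpha>) * coordA (\<phi> \<beta>) * coordB (\<phi> (\<alpha> + \<beta>)) = coordB (\<phi> \<alpha>) * coordB (\<phi> \<beta>) * coordA (\<phi> (\<alpha> + \<beta>))"
    proof (rule cayley_rel_add[OF cayley_rel[OF \<alpha>] cayley_rel[OF \<beta>] _ _ _ alg[OF \<alpha> \<beta> ab]])
      have "exp (2 * m (T (\<alpha> + \<beta>))) = exp (2 * m (T \<alpha>)) * exp (2 * m (T \<beta>))"
        by (simp add: hdual_T_add[OF mh \<alpha> \<beta> ab] distrib_left exp_add)
      then show "coordA (\<phi> (\<alpha> + \<beta>)) * (c (\<alpha> + \<beta>) + 1) = coordB (\<phi> (\<alpha> + \<beta>)) * (exp (2 * m (T \<alpha>)) * exp (2 * m (T \<beta>))) * (c (\<alpha> + \<beta>) - 1)"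
        using cayley_rel[OF ab] by simp
    qed simp_all
  qed
  then show thesis using that eq by blast
qed

lemma rho_system_unique:
  assumes U: "hopen U" "U \<noteq> {}" and eq: "generically h U (\<lambda>l. rmat (rho \<phi> l) = rmat (rho \<psi> l))" and \<alpha>: "\<alpha> \<in> \<Delta>"
  shows "\<phi> \<alpha> = \<psi> \<alpha>"
proof -
  obtain l where l: "l \<in> U" using U(2) by blast
  have "generically h U (\<lambda>l. rmat (rho \<phi> l) = rmat (rho \<psi> l) \<and> (\<forall>\<alpha>\<in>\<Delta>. rho_den \<phi> l \<alpha> \<noteq> 0) \<and> (\<forall>\<alpha>\<in>\<Delta>. rho_den \<psi> l \<alpha> \<noteq> 0))"
    by (intro generically_conj[OF U(1)] eq generically_den[OF U(1)])
  then obtain m where m: "rmat (rho \<phi> m) = rmat (rho \<psi> m)" "rho_den \<phi> m \<alpha> \<noteq> 0" "rho_den \<psi> m \<alpha> \<noteq> 0"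
    using generically_point[OF U(1) _ l] \<alpha> by blast
  have "rho \<phi> m \<alpha> = rho \<psi> m \<alpha>" using m(1) rcoeff_rmat[OF \<alpha>] by metis
  then show ?thesis
    using coord_rel_unique[OF _ rho_rel[OF m(2)]] rho_rel[OF m(3)] by simp
qed

end

subsection \<open>The correspondence\<close>

lemma coth_exp: "coth z = (exp (2 * z) + 1) / (exp (2 * z) - 1)"
proof -
  have *: "cosh z = exp (- z) / 2 * (exp (2 * z) + 1)" "sinh z = exp (- z) / 2 * (exp (2 * z) - 1)"
    by (simp_all add: cosh_def sinh_def scaleR_conv_of_real algebra_simps flip: exp_add)
  show ?thesis unfolding coth_def * by simp
qed

lemma sinh_eq_0_iff: "sinh z = 0 \<longleftrightarrow> exp (2 * z) = (1::complex)"
proof -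
  have *: "sinh z = exp (- z) / 2 * (exp (2 * z) - 1)"
    by (simp add: sinh_def scaleR_conv_of_real algebra_simps flip: exp_add)
  show ?thesis unfolding * by simp
qed

context cartan
begin

lemma paramsD:
  assumes "(P, S, l) \<in> params h"
  shows "root_base h P" "S \<subseteq> P" "l \<in> hdual h" "l + l \<in> hdual h"
proof -
  show "root_base h P" "S \<subseteq> P" and l: "l \<in> hdual h" using assms by (auto simp: params_def)
  show "l + l \<in> hdual h" by (rule hdual_add[OF l l])
qed

text \<open>The functional is doubled because coth z depends on exp (2 z). The equality holds at
  every \<open>l\<close>, since at a pole both coefficients are 0.\<close>

lemma coth_r_matrix_rho:
  assumes p: "(P, S, l0) \<in> params h" and l: "l \<in> hdual h"
  shows "coth_r_matrix h E P S l0 l = rmat (rho (param_system P S (l0 + l0)) l)"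
proof (intro ext)
  fix a b
  note P = paramsD(1)[OF p] and S = paramsD(2)[OF p] and l0 = paramsD(3)[OF p]
  let ?\<phi> = "param_system P S (l0 + l0)"
  have fin: "finite (gen_roots h P)"
    using finite_subset[OF _ finite_roots, of "gen_roots h P"] gen_roots_root by blast
  have sub: "gen_roots h S \<subseteq> gen_roots h P" by (rule gen_roots_mono[OF S base_finite[OF P]])
  have odd: "odd_on_roots (rho ?\<phi> l)"
    by (rule rho_odd[OF param_system_admissible[OF P S paramsD(4)[OF p]] l])
  have 1: "rho ?\<phi> l \<alpha> = coth (dform h \<alpha> (l + l0))" if "\<alpha> \<in> gen_roots h S" for \<alpha>
  proof -
    have \<alpha>: "\<alpha> \<in> \<Delta>" by (rule gen_roots_root[OF that])
    have "dform h \<alpha> (l + l0) = l (T \<alpha>) + l0 (T \<alpha>)"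
      using dform_root[OF \<alpha> hdual_add[OF l l0]] by simp
    moreover have "exp (2 * (l (T \<alpha>) + l0 (T \<alpha>))) = exp (l0 (T \<alpha>) + l0 (T \<alpha>)) * exp (2 * l (T \<alpha>))"
      by (simp add: algebra_simps flip: exp_add)
    ultimately show ?thesis
      using that by (simp add: rho_def rho_den_def param_system_def coth_exp)
  qed
  have 2: "rho ?\<phi> l \<alpha> = 1" if "\<alpha> \<in> gen_roots h P - gen_roots h S" for \<alpha>
  proof -
    have "- \<alpha> \<notin> gen_roots h S" using not_pos_and_neg[OF P] that sub by blast
    then show ?thesis using that by (simp add: rho_def rho_den_def param_system_def)
  qed
  have "coth_r_matrix h E P S l0 l a b = (\<Sum>\<alpha>\<in>gen_roots h S. rho ?\<phi> l \<alpha> * wedge2 (E \<alpha>) (E (- \<alpha>)) a b) +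
      (\<Sum>\<alpha>\<in>gen_roots h P - gen_roots h S. rho ?\<phi> l \<alpha> * wedge2 (E \<alpha>) (E (- \<alpha>)) a b)"
    unfolding coth_r_matrix_def
  proof (rule arg_cong2[of _ _ _ _ "(+)"])
    show "(\<Sum>\<alpha>\<in>gen_roots h S. coth (dform h \<alpha> (l + l0)) * wedge2 (E \<alpha>) (E (- \<alpha>)) a b) =
        (\<Sum>\<alpha>\<in>gen_roots h S. rho ?\<phi> l \<alpha> * wedge2 (E \<alpha>) (E (- \<alpha>)) a b)"
      by (rule sum.cong[OF refl]) (simp only: 1)
    show "(\<Sum>\<alpha>\<in>gen_roots h P - gen_roots h S. wedge2 (E \<alpha>) (E (- \<alpha>)) a b) =
        (\<Sum>\<alpha>\<in>gen_roots h P - gen_roots h S. rho ?\<phi> l \<alpha> * wedge2 (E \<alpha>) (E (- \<alpha>)) a b)"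
      by (rule sum.cong[OF refl]) (simp only: 2 mult_1_left)
  qed
  also have "\<dots> = (\<Sum>\<alpha>\<in>gen_roots h P. rho ?\<phi> l \<alpha> * wedge2 (E \<alpha>) (E (- \<alpha>)) a b)"
    unfolding sum.subset_diff[OF sub fin] by (rule add.commute)
  finally show "coth_r_matrix h E P S l0 l a b = rmat (rho ?\<phi> l) a b"
    unfolding rmat_wedge[OF P odd] .
qed

section \<open>Classes of r-matrices, and the passage between parameters and admissible
  systems\<close>

lemma gen_eq_equiv:
  assumes U: "hopen U"
  shows "equiv UNIV (gen_eq h U)"
proof (rule equivI)
  show "refl (gen_eq h U)" by (rule refl_onI) (auto simp: gen_eq_def intro: generically_all[OF U])
  show "sym (gen_eq h U)" by (rule symI) (auto simp: gen_eq_def elim: generically_mono)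
  show "trans (gen_eq h U)"
  proof (rule transI)
    fix r s t assume "(r, s) \<in> gen_eq h U" "(s, t) \<in> gen_eq h U"
    then have "generically h U (\<lambda>l. r l = s l \<and> s l = t l)"
      by (auto simp: gen_eq_def intro: generically_conj[OF U])
    then show "(r, t) \<in> gen_eq h U" by (auto simp: gen_eq_def elim: generically_mono)
  qed
qed auto

definition rho_class :: "('g \<Rightarrow> complex) set \<Rightarrow> (('g \<Rightarrow> complex) \<Rightarrow> complex option) \<Rightarrow> (('g \<Rightarrow> complex) \<Rightarrow> 'g tensor2) set"
  where "rho_class U \<phi> = gen_eq h U `` {\<lambda>l. rmat (rho \<phi> l)}"

lemma gen_eq_class:
  assumes "hopen U" "generically h U (\<lambda>l. r l = s l)"
  shows "gen_eq h U `` {r} = gen_eq h U `` {s}"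
  using assms by (intro equiv_class_eq[OF gen_eq_equiv]) (auto simp: gen_eq_def)

lemma r_class_rho_class:
  assumes U: "hopen U" and p: "(P, S, l0) \<in> params h"
  shows "r_class h E U P S l0 = rho_class U (param_system P S (l0 + l0))"
  unfolding r_class_def rho_class_def
  by (intro gen_eq_class[OF U] generically_all[OF U] coth_r_matrix_rho[OF p] hopen_hdual[OF U])

lemma rho_class_eq_iff:
  assumes U: "hopen U" "U \<noteq> {}"
  shows "rho_class U \<phi> = rho_class U \<psi> \<longleftrightarrow> (\<forall>\<alpha>\<in>\<Delta>. \<phi> \<alpha> = \<psi> \<alpha>)"
proof
  assume "rho_class U \<phi> = rho_class U \<psi>"
  from eq_equiv_class[OF this[unfolded rho_class_def] gen_eq_equiv[OF U(1)] UNIV_I]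
  have "generically h U (\<lambda>l. rmat (rho \<phi> l) = rmat (rho \<psi> l))" by (simp add: gen_eq_def)
  then show "\<forall>\<alpha>\<in>\<Delta>. \<phi> \<alpha> = \<psi> \<alpha>" using rho_system_unique[OF U] by blast
next
  assume "\<forall>\<alpha>\<in>\<Delta>. \<phi> \<alpha> = \<psi> \<alpha>"
  then have "rmat (rho \<phi> l) = rmat (rho \<psi> l)" for l by (simp add: rmat_def rho_def rho_den_def)
  then show "rho_class U \<phi> = rho_class U \<psi>" by (simp add: rho_class_def)
qed

lemma dyn_r_matrices_eq:
  assumes U: "hopen U" "connected U" "U \<noteq> {}"
  shows "dyn_r_matrices h E P0 U = rho_class U ` {\<phi>. admissible \<phi>}"
proof
  show "dyn_r_matrices h E P0 U \<subseteq> rho_class U ` {\<phi>. admissible \<phi>}"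
  proof
    fix C assume "C \<in> dyn_r_matrices h E P0 U"
    then obtain r where r: "dynamical_r_matrix h E P0 U r" "zero_gauge h E P0 U r" "C = gen_eq h U `` {r}"
      unfolding dyn_r_matrices_def by (auto elim: quotientE)
    obtain \<phi> where \<phi>: "admissible \<phi>" "generically h U (\<lambda>l. r l = rmat (rho \<phi> l))"
      using dynamical_admissible[OF U r(1,2)] .
    have "C = rho_class U \<phi>" unfolding r(3) rho_class_def by (rule gen_eq_class[OF U(1) \<phi>(2)])
    then show "C \<in> rho_class U ` {\<phi>. admissible \<phi>}" using \<phi>(1) by blast
  qed
  show "rho_class U ` {\<phi>. admissible \<phi>} \<subseteq> dyn_r_matrices h E P0 U"
    unfolding dyn_r_matrices_def rho_class_def using rho_dynamical[OF U(1)] by (auto intro!: quotientI)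
qed

lemma admissible_iff_params:
  "admissible \<phi> \<longleftrightarrow> (\<exists>P S l. (P, S, l) \<in> params h \<and> (\<forall>\<alpha>\<in>\<Delta>. \<phi> \<alpha> = param_system P S l \<alpha>))"
proof
  assume "admissible \<phi>"
  then obtain P S l where "root_base h P" "S \<subseteq> P" "l \<in> hdual h" "\<And>\<alpha>. \<alpha> \<in> \<Delta> \<Longrightarrow> \<phi> \<alpha> = param_system P S l \<alpha>"
    by (rule admissible_param_system) (rule that)
  then show "\<exists>P S l. (P, S, l) \<in> params h \<and> (\<forall>\<alpha>\<in>\<Delta>. \<phi> \<alpha> = param_system P S l \<alpha>)"
    unfolding params_def by blast
next
  assume "\<exists>P S l. (P, S, l) \<in> params h \<and> (\<forall>\<alpha>\<in>\<Delta>. \<phi> \<alpha> = param_system P S l \<alpha>)"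
  then obtain P S l where p: "(P, S, l) \<in> params h" and eq: "\<And>\<alpha>. \<alpha> \<in> \<Delta> \<Longrightarrow> \<phi> \<alpha> = param_system P S l \<alpha>" by blast
  have "admissible (param_system P S l)" by (rule param_system_admissible[OF paramsD(1,2,3)[OF p]])
  then show "admissible \<phi>" by (simp add: admissible_def eq root_minus)
qed

text \<open>Needed for surjectivity onto the r-matrices, whose systems are given by doubled
  functionals.\<close>

lemma params_halve:
  assumes p: "(P, S, l) \<in> params h"
  obtains l0 where "(P, S, l0) \<in> params h" "l0 + l0 = l"
proof
  show "(P, S, \<lambda>x. 1 / 2 * l x) \<in> params h"
    using p hdual_scale[of l "1 / 2"] unfolding params_def by blast
  show "(\<lambda>x. 1 / 2 * l x) + (\<lambda>x. 1 / 2 * l x) = l" by (simp add: fun_eq_iff)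
qed

lemma params_double: "(P, S, l) \<in> params h \<Longrightarrow> (P, S, l + l) \<in> params h"
  unfolding params_def using hdual_add by blast

lemma pair_subalgebra_params:
  "(P, S, l) \<in> params h \<Longrightarrow> pair_subalgebra h E P S l = lag (param_system P S l)"
  by (rule pair_subalgebra_lag) (rule paramsD, assumption)+

lemma param_admissible: "(P, S, l) \<in> params h \<Longrightarrow> admissible (param_system P S l)"
  by (rule param_system_admissible) (rule paramsD, assumption)+

text \<open>\<open>Q\<close> is taken to be trivial for the full correspondence, and to be the
  exclusion of the value 1 for the subalgebras that meet the diagonal in \<open>h\<close>. The
  assumption says that it sees a system only through its values at roots.\<close>

lemma lag_image_params: "lag ` {\<phi>. admissible \<phi> \<and> Q \<phi>} = {pair_subalgebra h E P S l | P S l. (P, S, l) \<in> params h \<and> Q (param_system P S l)}"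
  if Q: "\<And>\<phi> \<psi>. (\<And>\<alpha>. \<alpha> \<in> \<Delta> \<Longrightarrow> \<phi> \<alpha> = \<psi> \<alpha>) \<Longrightarrow> Q \<phi> \<longleftrightarrow> Q \<psi>" for Q
proof (intro equalityI subsetI)
  fix W assume "W \<in> lag ` {\<phi>. admissible \<phi> \<and> Q \<phi>}"
  then obtain \<phi> where \<phi>: "admissible \<phi>" "Q \<phi>" "W = lag \<phi>" by blast
  then obtain P S l where p: "(P, S, l) \<in> params h" and eq: "\<And>\<alpha>. \<alpha> \<in> \<Delta> \<Longrightarrow> \<phi> \<alpha> = param_system P S l \<alpha>"
    unfolding admissible_iff_params by blast
  have "W = pair_subalgebra h E P S l" "Q (param_system P S l)"
    using \<phi>(2,3) lag_cong[of \<phi> "param_system P S l", OF eq] Q[of \<phi> "param_system P S l", OF eq] pair_subalgebra_params[OF p] by simp_all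
  then show "W \<in> {pair_subalgebra h E P S l | P S l. (P, S, l) \<in> params h \<and> Q (param_system P S l)}" using p by blast
next
  fix W assume "W \<in> {pair_subalgebra h E P S l | P S l. (P, S, l) \<in> params h \<and> Q (param_system P S l)}"
  then show "W \<in> lag ` {\<phi>. admissible \<phi> \<and> Q \<phi>}" using pair_subalgebra_params param_admissible by blast
qed

lemma rho_class_image_params:
  assumes U: "hopen U" "U \<noteq> {}" and Q: "\<And>\<phi> \<psi>. (\<And>\<alpha>. \<alpha> \<in> \<Delta> \<Longrightarrow> \<phi> \<alpha> = \<psi> \<alpha>) \<Longrightarrow> Q \<phi> \<longleftrightarrow> Q \<psi>"
  shows "rho_class U ` {\<phi>. admissible \<phi> \<and> Q \<phi>} =
    {r_class h E U P S l0 | P S l0. (P, S, l0) \<in> params h \<and> Q (param_system P S (l0 + l0))}"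
proof (intro equalityI subsetI)
  fix C assume "C \<in> rho_class U ` {\<phi>. admissible \<phi> \<and> Q \<phi>}"
  then obtain \<phi> where \<phi>: "admissible \<phi>" "Q \<phi>" "C = rho_class U \<phi>" by blast
  then obtain P S l where p: "(P, S, l) \<in> params h" and eq: "\<And>\<alpha>. \<alpha> \<in> \<Delta> \<Longrightarrow> \<phi> \<alpha> = param_system P S l \<alpha>"
    unfolding admissible_iff_params by blast
  obtain l0 where l0: "(P, S, l0) \<in> params h" "l0 + l0 = l" using params_halve[OF p] .
  have "C = r_class h E U P S l0"
    unfolding \<phi>(3) r_class_rho_class[OF U(1) l0(1)] rho_class_eq_iff[OF U] l0(2) using eq by blast
  moreover have "Q (param_system P S (l0 + l0))" using Q[of \<phi> "param_system P S l", OF eq] \<phi>(2) l0(2) by simp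
  ultimately show "C \<in> {r_class h E U P S l0 | P S l0. (P, S, l0) \<in> params h \<and> Q (param_system P S (l0 + l0))}" using l0(1) by blast
next
  fix C assume "C \<in> {r_class h E U P S l0 | P S l0. (P, S, l0) \<in> params h \<and> Q (param_system P S (l0 + l0))}"
  then show "C \<in> rho_class U ` {\<phi>. admissible \<phi> \<and> Q \<phi>}"
    using r_class_rho_class[OF U(1)] param_admissible[OF params_double] by blast
qed

lemma param_system_ne_1:
  assumes p: "(P, S, l) \<in> params h"
  shows "(\<forall>\<alpha>\<in>\<Delta>. param_system P S l \<alpha> \<noteq> Some 1) \<longleftrightarrow> (\<forall>\<alpha>\<in>gen_roots h S. exp (l (T \<alpha>)) \<noteq> 1)"
proof
  assume *: "\<forall>\<alpha>\<in>\<Delta>. param_system P S l \<alpha> \<noteq> Some 1"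
  show "\<forall>\<alpha>\<in>gen_roots h S. exp (l (T \<alpha>)) \<noteq> 1"
  proof
    fix \<alpha> assume "\<alpha> \<in> gen_roots h S"
    then show "exp (l (T \<alpha>)) \<noteq> 1" using *[rule_format, OF gen_roots_root[OF \<open>\<alpha> \<in> gen_roots h S\<close>]] by (simp add: param_system_def)
  qed
next
  assume *: "\<forall>\<alpha>\<in>gen_roots h S. exp (l (T \<alpha>)) \<noteq> 1"
  show "\<forall>\<alpha>\<in>\<Delta>. param_system P S l \<alpha> \<noteq> Some 1"
  proof
    fix \<alpha> assume \<alpha>: "\<alpha> \<in> \<Delta>"
    have "exp (l (T \<alpha>)) \<noteq> 1" if "- \<alpha> \<in> gen_roots h S"
    proof -
      have "exp (l (T (- \<alpha>))) \<noteq> 1" using * that by blast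
      then show ?thesis unfolding hdual_T_minus[OF paramsD(3)[OF p] \<alpha>] exp_minus by simp
    qed
    then show "param_system P S l \<alpha> \<noteq> Some 1" using * by (auto simp: param_system_def)
  qed
qed

text \<open>The first part has the period of exp and serves the subalgebras; the second has the
  period of coth, because the functional is doubled, and serves the r-matrices.\<close>

lemma exp_eq_on_simple:
  assumes P: "root_base h P" and S: "S \<subseteq> P" and l: "l \<in> hdual h" "l' \<in> hdual h"
  shows "(\<forall>\<alpha>\<in>S. exp (l (T \<alpha>)) = exp (l' (T \<alpha>))) \<longleftrightarrow>
      (\<forall>\<alpha>\<in>S. \<exists>k::int. dform h \<alpha> l - dform h \<alpha> l' = of_int k * of_real (2 * pi) * \<i>)" (is ?th1)
    and "(\<forall>\<alpha>\<in>S. exp ((l + l) (T \<alpha>)) = exp ((l' + l') (T \<alpha>))) \<longleftrightarrow>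
      (\<forall>\<alpha>\<in>S. \<exists>k::int. dform h \<alpha> l - dform h \<alpha> l' = of_int k * of_real pi * \<i>)" (is ?th2)
proof -
  have r: "dform h \<alpha> m = m (T \<alpha>)" if "\<alpha> \<in> S" "m \<in> hdual h" for \<alpha> m
    using that S base_roots[OF P] by (intro dform_root) auto
  have "exp x = exp y \<longleftrightarrow> (\<exists>k::int. x - y = of_int k * of_real (2 * pi) * \<i>)" for x y :: complex
    unfolding exp_eq by (simp add: algebra_simps)
  then show ?th1 using r l by simp
  have "exp (x + x) = exp (y + y) \<longleftrightarrow> (\<exists>k::int. x - y = of_int k * of_real pi * \<i>)" for x y :: complex
  proof -
    have "x + x = y + y + of_int (2 * k) * of_real pi * \<i> \<longleftrightarrow> x - y = of_int k * of_real pi * \<i>" for k :: int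
    proof -
      have "x + x = y + y + of_int (2 * k) * of_real pi * \<i> \<longleftrightarrow> 2 * (x - y) = 2 * (of_int k * of_real pi * \<i>)"
        by (simp add: algebra_simps)
      then show ?thesis by (simp only: mult_left_cancel mult_cancel_left) simp
    qed
    then show ?thesis unfolding exp_eq by simp
  qed
  then show ?th2 using r l by simp
qed

end

theorem theorem5p2:
  fixes h :: "'g::simple_complex_lie_algebra set"
    and E :: "('g \<Rightarrow> complex) \<Rightarrow> 'g"
    and P0 U :: "('g \<Rightarrow> complex) set"
  assumes "cartan_subalgebra h"
    and "root_vectors h E"
    and "root_base h P0"
    and "openin (top_of_set (hdual h)) U" and "connected U" and "U \<noteq> {}"
  shows
    "dyn_r_matrices h E P0 U = {r_class h E U P S l0 | P S l0. (P, S, l0) \<in> params h} \<and>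
     (\<forall>P S l0 S' l0'. (P, S, l0) \<in> params h \<and> (P, S', l0') \<in> params h \<longrightarrow>
        (r_class h E U P S l0 = r_class h E U P S' l0' \<longleftrightarrow>
          S = S' \<and> (\<forall>\<alpha>\<in>S. \<exists>k::int. dform h \<alpha> l0 - dform h \<alpha> l0' = of_int k * of_real pi * \<i>))) \<and>
     (\<forall>P S l0. (P, S, l0) \<in> params h \<longrightarrow> lagrangian_subalgebra (pair_subalgebra h E P S l0)) \<and>
     {W. lagrangian_subalgebra W \<and> W \<inter> diag UNIV = diag h} =
       {pair_subalgebra h E P S l0 | P S l0. (P, S, l0) \<in> params h \<and>
          (\<forall>\<alpha>\<in>gen_roots h S. exp (dform h \<alpha> l0) \<noteq> 1)} \<and>
     (\<forall>P S l0 S' l0'. (P, S, l0) \<in> params h \<and> (P, S', l0') \<in> params h \<longrightarrow>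
        (pair_subalgebra h E P S l0 = pair_subalgebra h E P S' l0' \<longleftrightarrow>
          S = S' \<and> (\<forall>\<alpha>\<in>S. \<exists>k::int. dform h \<alpha> l0 - dform h \<alpha> l0' = of_int k * of_real (2 * pi) * \<i>))) \<and>
     (\<exists>\<Psi>. bij_betw \<Psi> {pair_subalgebra h E P S l0 | P S l0. (P, S, l0) \<in> params h}
              (dyn_r_matrices h E P0 U) \<and>
        (\<forall>P S l0. (P, S, l0) \<in> params h \<longrightarrow>
          \<Psi> (pair_subalgebra h E P S (l0 + l0)) = r_class h E U P S l0) \<and>
        \<Psi> ` {W. lagrangian_subalgebra W \<and> W \<inter> diag UNIV = diag h} =
          {r_class h E U P S l0 | P S l0. (P, S, l0) \<in> params h \<and>
             (\<forall>\<alpha>\<in>gen_roots h S. sinh (dform h \<alpha> l0) \<noteq> 0)})"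
proof -
  interpret cartan h E P0 by unfold_locales (rule assms)+
  note U = assms(4-6)
  show ?thesis
    (is "?dyn \<and> ?r_eq \<and> ?lagr \<and> ?diag \<and> ?pair_eq \<and> ?bij")
  proof (intro conjI)
    let ?Q = "\<lambda>\<phi>. \<forall>\<alpha>\<in>\<Delta>. \<phi> \<alpha> \<noteq> Some (1::complex)"
    have Q: "?Q \<phi> \<longleftrightarrow> ?Q \<psi>" if "\<And>\<alpha>. \<alpha> \<in> \<Delta> \<Longrightarrow> \<phi> \<alpha> = \<psi> \<alpha>" for \<phi> \<psi> using that by simp
    have lag_all: "{pair_subalgebra h E P S l | P S l. (P, S, l) \<in> params h} = lag ` {\<phi>. admissible \<phi>}"
      using lag_image_params[of "\<lambda>_. True"] by simp
    have class_all: "{r_class h E U P S l0 | P S l0. (P, S, l0) \<in> params h} = rho_class U ` {\<phi>. admissible \<phi>}"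
      using rho_class_image_params[OF U(1,3), of "\<lambda>_. True"] by simp
    have dform_gen: "dform h \<alpha> l = l (T \<alpha>)" if "\<alpha> \<in> gen_roots h S" "(P, S, l) \<in> params h" for \<alpha> P S l
      using that gen_roots_root paramsD(3) by (intro dform_root) blast+
    have lagr_diag: "{W. lagrangian_subalgebra W \<and> W \<inter> diag UNIV = diag h} = lag ` {\<phi>. admissible \<phi> \<and> ?Q \<phi>}"
    proof (intro equalityI subsetI)
      fix W assume "W \<in> {W. lagrangian_subalgebra W \<and> W \<inter> diag UNIV = diag h}"
      then have W: "lagrangian_subalgebra W" "W \<inter> diag UNIV = diag h" by auto
      obtain \<phi> where \<phi>: "admissible \<phi>" "W = lag \<phi>" using lagrangian_is_lag[OF W] .
      have "?Q \<phi>" using W(2) unfolding \<phi>(2) lag_diag .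
      then show "W \<in> lag ` {\<phi>. admissible \<phi> \<and> ?Q \<phi>}" using \<phi> by blast
    next
      fix W assume "W \<in> lag ` {\<phi>. admissible \<phi> \<and> ?Q \<phi>}"
      then show "W \<in> {W. lagrangian_subalgebra W \<and> W \<inter> diag UNIV = diag h}"
        using lag_lagrangian lag_diag by auto
    qed
    show dyn: ?dyn unfolding class_all by (rule dyn_r_matrices_eq[OF U])
    show ?r_eq
    proof (intro allI impI)
      fix P S l0 S' l0' assume p: "(P, S, l0) \<in> params h \<and> (P, S', l0') \<in> params h"
      then have p1: "(P, S, l0) \<in> params h" and p2: "(P, S', l0') \<in> params h" by auto
      show "r_class h E U P S l0 = r_class h E U P S' l0' \<longleftrightarrow>
            S = S' \<and> (\<forall>\<alpha>\<in>S. \<exists>k::int. dform h \<alpha> l0 - dform h \<alpha> l0' = of_int k * of_real pi * \<i>)"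
        unfolding r_class_rho_class[OF U(1) p1] r_class_rho_class[OF U(1) p2] rho_class_eq_iff[OF U(1,3)]
          param_system_eq_iff[OF paramsD(1,2)[OF p1] paramsD(2)[OF p2] paramsD(4)[OF p1] paramsD(4)[OF p2]]
          exp_eq_on_simple(2)[OF paramsD(1,2,3)[OF p1] paramsD(3)[OF p2]] ..
    qed
    show ?lagr using lag_lagrangian param_admissible pair_subalgebra_params by simp
    have "{pair_subalgebra h E P S l | P S l. (P, S, l) \<in> params h \<and> ?Q (param_system P S l)} =
        {pair_subalgebra h E P S l | P S l. (P, S, l) \<in> params h \<and> (\<forall>\<alpha>\<in>gen_roots h S. exp (dform h \<alpha> l) \<noteq> 1)}"
    proof -
      have "(P, S, l) \<in> params h \<and> ?Q (param_system P S l) \<longleftrightarrow>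
          (P, S, l) \<in> params h \<and> (\<forall>\<alpha>\<in>gen_roots h S. exp (dform h \<alpha> l) \<noteq> 1)" for P S l
        using param_system_ne_1[of P S l] dform_gen by auto
      then show ?thesis by simp
    qed
    with lag_image_params[of ?Q, OF Q] show ?diag unfolding lagr_diag by (rule trans)
    show ?pair_eq
    proof (intro allI impI)
      fix P S l0 S' l0' assume p: "(P, S, l0) \<in> params h \<and> (P, S', l0') \<in> params h"
      then have p1: "(P, S, l0) \<in> params h" and p2: "(P, S', l0') \<in> params h" by auto
      have "lag \<phi> = lag \<psi> \<longleftrightarrow> (\<forall>\<alpha>\<in>\<Delta>. \<phi> \<alpha> = \<psi> \<alpha>)" for \<phi> \<psi> using lag_inj lag_cong by blast
      then show "pair_subalgebra h E P S l0 = pair_subalgebra h E P S' l0' \<longleftrightarrow>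
            S = S' \<and> (\<forall>\<alpha>\<in>S. \<exists>k::int. dform h \<alpha> l0 - dform h \<alpha> l0' = of_int k * of_real (2 * pi) * \<i>)"
        unfolding pair_subalgebra_params[OF p1] pair_subalgebra_params[OF p2]
          exp_eq_on_simple(1)[OF paramsD(1,2,3)[OF p1] paramsD(3)[OF p2], symmetric]
          param_system_eq_iff[OF paramsD(1,2)[OF p1] paramsD(2)[OF p2] paramsD(3)[OF p1] paramsD(3)[OF p2], symmetric]
        by blast
    qed
    \<comment> \<open>\<open>lag \<phi>\<close> determines \<phi> only at the roots, so a
      representative is chosen; \<open>rho_class\<close> depends on the same values only, which
      makes the choice harmless.\<close>
    define \<Psi> where "\<Psi> W = rho_class U (SOME \<phi>. admissible \<phi> \<and> W = lag \<phi>)" for W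
    have \<Psi>: "\<Psi> (lag \<phi>) = rho_class U \<phi>" if "admissible \<phi>" for \<phi>
    proof -
      have "\<exists>\<psi>. admissible \<psi> \<and> lag \<phi> = lag \<psi>" using that by blast
      from someI_ex[OF this] have "lag \<phi> = lag (SOME \<psi>. admissible \<psi> \<and> lag \<phi> = lag \<psi>)" by blast
      then have "\<forall>\<alpha>\<in>\<Delta>. (SOME \<psi>. admissible \<psi> \<and> lag \<phi> = lag \<psi>) \<alpha> = \<phi> \<alpha>" using lag_inj by metis
      then show ?thesis unfolding \<Psi>_def rho_class_eq_iff[OF U(1,3)] .
    qed
    have img: "\<Psi> ` (lag ` X) = rho_class U ` X" if "X \<subseteq> {\<phi>. admissible \<phi>}" for X
      using that \<Psi> by (auto simp: image_image subset_iff intro!: image_cong)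
    show ?bij
    proof (intro exI[of _ \<Psi>] conjI allI impI)
      show "bij_betw \<Psi> {pair_subalgebra h E P S l0 | P S l0. (P, S, l0) \<in> params h} (dyn_r_matrices h E P0 U)"
        unfolding lag_all dyn_r_matrices_eq[OF U] bij_betw_def
      proof
        show "inj_on \<Psi> (lag ` {\<phi>. admissible \<phi>})"
        proof (rule inj_onI)
          fix W W' assume "W \<in> lag ` {\<phi>. admissible \<phi>}" "W' \<in> lag ` {\<phi>. admissible \<phi>}" and eq: "\<Psi> W = \<Psi> W'"
          then obtain \<phi> \<psi> where a: "admissible \<phi>" "W = lag \<phi>" "admissible \<psi>" "W' = lag \<psi>" by blast
          then have "\<forall>\<alpha>\<in>\<Delta>. \<phi> \<alpha> = \<psi> \<alpha>"
            using eq unfolding a(2,4) \<Psi>[OF a(1)] \<Psi>[OF a(3)] rho_class_eq_iff[OF U(1,3)] by blast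
          then show "W = W'" unfolding a(2,4) by (intro lag_cong) blast
        qed
        show "\<Psi> ` (lag ` {\<phi>. admissible \<phi>}) = rho_class U ` {\<phi>. admissible \<phi>}" by (rule img) simp
      qed
      show "\<Psi> (pair_subalgebra h E P S (l0 + l0)) = r_class h E U P S l0" if p: "(P, S, l0) \<in> params h" for P S l0
        unfolding pair_subalgebra_params[OF params_double[OF p]] r_class_rho_class[OF U(1) p]
        by (rule \<Psi>[OF param_admissible[OF params_double[OF p]]])
      have "\<Psi> ` {W. lagrangian_subalgebra W \<and> W \<inter> diag UNIV = diag h} = rho_class U ` {\<phi>. admissible \<phi> \<and> ?Q \<phi>}"
        unfolding lagr_diag by (rule img) blast
      also have "\<dots> = {r_class h E U P S l0 | P S l0. (P, S, l0) \<in> params h \<and> ?Q (param_system P S (l0 + l0))}"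
        by (rule rho_class_image_params[OF U(1,3), of ?Q, OF Q])
      also have "\<dots> = {r_class h E U P S l0 | P S l0. (P, S, l0) \<in> params h \<and> (\<forall>\<alpha>\<in>gen_roots h S. sinh (dform h \<alpha> l0) \<noteq> 0)}"
      proof -
        have "(P, S, l) \<in> params h \<and> ?Q (param_system P S (l + l)) \<longleftrightarrow>
            (P, S, l) \<in> params h \<and> (\<forall>\<alpha>\<in>gen_roots h S. sinh (dform h \<alpha> l) \<noteq> 0)" for P S l
        proof (rule conj_cong[OF refl])
          assume p: "(P, S, l) \<in> params h"
          have "exp ((l + l) (T \<alpha>)) \<noteq> 1 \<longleftrightarrow> sinh (dform h \<alpha> l) \<noteq> 0" if "\<alpha> \<in> gen_roots h S" for \<alpha>
            unfolding plus_fun_def sinh_eq_0_iff mult_2 dform_gen[OF that p] ..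
          then show "?Q (param_system P S (l + l)) \<longleftrightarrow> (\<forall>\<alpha>\<in>gen_roots h S. sinh (dform h \<alpha> l) \<noteq> 0)"
            unfolding param_system_ne_1[OF params_double[OF p]] by blast
        qed
        then show ?thesis by simp
      qed
      finally show "\<Psi> ` {W. lagrangian_subalgebra W \<and> W \<inter> diag UNIV = diag h} =
        {r_class h E U P S l0 | P S l0. (P, S, l0) \<in> params h \<and> (\<forall>\<alpha>\<in>gen_roots h S. sinh (dform h \<alpha> l0) \<noteq> 0)}" .
    qed
  qed
qed

end
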